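(* Let $d\in\{2,3\}$, and let $\mathbf{T}_\varepsilon(\tau)=\mathbf{A}_\varepsilon^{-1}\mathbf{B}_\varepsilon+\frac1\tau\mathbf{A}_\varepsilon^{-1}\mathbf{C}:X(D)\to X(D)$ for $\varepsilon\ge0$, with the operators defined in the context. Let $U\subset\mathbb{C}\setminus\{0\}$ be any bounded set not having $0$ as a limit point, and let $\tau\in U$. Then $$\|\mathbf{T}_\varepsilon(\tau)-\mathbf{T}_0(\tau)\|\to0\quad\text{as }\varepsilon\to0$$ in the operator norm. Moreover, if $n_\varepsilon=n$ for all $\varepsilon\ge0$, then $$\|\mathbf{T}_\varepsilon(\tau)-\mathbf{T}_0(\tau)\|=\mathcal{O}(\varepsilon^{d/2}).$$
   Context: $D\subset\mathbb{R}^d$ is a bounded domain with piecewise smooth boundary. $A\in C^2(D,\mathbb{R}^{d\times d})$ is symmetric-matrix valued and $n\in C^1(D)$ is real-valued, bounded, with $\inf_D n>0$. The points $z_1,\dots,z_M\in D$ satisfy $|z_i-z_j|\ge c_0>0$ for $i\neq j$ and $\mathrm{dist}(z_m,\partial D)\ge c_0>0$; each $B_m$ is a smooth deformation of a ball centered at the origin (a bounded smooth domain). $A_m$ is a constant real symmetric matrix and $n_m>0$ a constant. For small $\varepsilon>0$ let $D_\varepsilon=\bigcup_{m=1}^M(z_m+\varepsilon B_m)$ and $A_\varepsilon=A_m$, $n_\varepsilon=n_m$ in $z_m+\varepsilon B_m$, $A_\varepsilon=A$, $n_\varepsilon=n$ in $D\setminus\overline{D_\varepsilon}$; $A_0=A$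 and, for $\varepsilon=0$, the lower-order coefficient is $n$. $A_{min}=\inf_{x\in D}\inf_{|\xi|=1}\overline\xi\cdot A(x)\xi>0$, $A_{max}=\sup_{x\in D}\sup_{|\xi|=1}\overline\xi\cdot A(x)\xi<\infty$, $a_{min}=\min_m\inf_{|\xi|=1}\overline\xi\cdot A_m\xi>0$, $a_{max}=\max_m\sup_{|\xi|=1}\overline\xi\cdot A_m\xi<\infty$. It is assumed that either (i) $A_{min}>1$ and $a_{min}>1$, or (ii) $A_{max}<1$ and $a_{max}<1$. $X(D)=\{(w,v)\in H^1(D)\times H^1(D): w-v\in H^1_0(D)\}$ (complex-valued) with the $H^1(D)\times H^1(D)$ inner product. For $(w,v),(\varphi_1,\varphi_2)\in X(D)$, $$\mathcal{A}_\varepsilon((w,v);(\varphi_1,\varphi_2))=\int_D A_\varepsilon\nabla w\cdot\nabla\overline{\varphi}_1+A_{min}w\overline{\varphi}_1\,dx-\int_D\nabla v\cdot\nabla\overline{\varphi}_2+v\overline{\varphi}_2\,dx,$$ $$\mathcal{B}_\varepsilon((w,v);(\varphi_1,\varphi_2))=\int_D n_\varepsilon w\overline{\varphi}_1-v\overline{\varphi}_2\,dx,\qquad \mathcal{C}((w,v);(\varphi_1,\varphi_2))=\int_D A_{min}w\overline{\varphi}_1-v\overline{\varphi}_2\,dx;$$ in case (ii), $A_{min}$ is replaced by $A_{max}$ in $\mathcal{A}_\varepsilon$ and $\mathcal{C}$. $\mathbf{A}_\varepsilon,\mathbf{B}_\varepsilon,\mathbf{C}:X(D)\to X(D)$ are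 the bounded operators representing these forms via the Riesz theorem, e.g. $(\mathbf{B}_\varepsilon(w,v);(\varphi_1,\varphi_2))_{X(D)}=\mathcal{B}_\varepsilon((w,v);(\varphi_1,\varphi_2))$. $\mathbf{A}_\varepsilon$ is boundedly invertible for all $\varepsilon\ge0$, with inverse bounded uniformly in $\varepsilon$. *)

theory Defs
  imports "HOL-Analysis.Analysis" "HOL-Library.Function_Algebras"
begin

section \<open>Regularity of functions and domains\<close>

text \<open>\<open>k\<close>-fold continuous differentiability; only meant for open \<open>S\<close>.\<close>

primrec Ck_on :: "nat \<Rightarrow> 'a::euclidean_space set \<Rightarrow> ('a \<Rightarrow> 'b::real_normed_vector) \<Rightarrow> bool" where
  "Ck_on 0 S f \<longleftrightarrow> continuous_on S f"
| "Ck_on (Suc k) S f \<longleftrightarrow>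
     f differentiable_on S \<and> (\<forall>b\<in>Basis. Ck_on k S (\<lambda>x. frechet_derivative f (at x) b))"

definition smooth_on :: "'a::euclidean_space set \<Rightarrow> ('a \<Rightarrow> 'b::real_normed_vector) \<Rightarrow> bool" where
  "smooth_on S f \<longleftrightarrow> (\<forall>k. Ck_on k S f)"

text \<open>
  A piece \<open>S\<close> of the boundary of \<open>D\<close> that is smooth up to its own edges: \<open>closure S\<close> lies on a
  smooth hypersurface \<open>\<rho> = 0\<close> extending past the edges of \<open>S\<close>, and near each point of \<open>S\<close> itself
  \<open>D\<close> is one side of that hypersurface. The boundary is piecewise smooth if it is the union of the
  closures of finitely many such pieces; edges, corners and vertices are the points of
  \<open>closure S - S\<close>.
\<close>

definition smooth_boundary_piece :: "'a::euclidean_space set \<Rightarrow> 'a set \<Rightarrow> bool" where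
  "smooth_boundary_piece D S \<longleftrightarrow> S \<subseteq> frontier D \<and>
     (\<exists>V (\<rho>::'a \<Rightarrow> real). open V \<and> closure S \<subseteq> V \<and> smooth_on V \<rho> \<and>
        (\<forall>x\<in>V. frechet_derivative \<rho> (at x) \<noteq> (\<lambda>_. 0)) \<and>
        (\<forall>x\<in>S. \<exists>r>0. ball x r \<subseteq> V \<and> D \<inter> ball x r = {y \<in> ball x r. \<rho> y < 0}))"

definition piecewise_smooth_boundary :: "'a::euclidean_space set \<Rightarrow> bool" where
  "piecewise_smooth_boundary D \<longleftrightarrow>
     (\<exists>\<S>. finite \<S> \<and> (\<forall>S\<in>\<S>. smooth_boundary_piece D S) \<and> frontier D = (\<Union>S\<in>\<S>. closure S))"

text \<open>
  Image of a ball centred at the origin under a diffeomorphism defined on a neighbourhood of the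
  closed ball; such a set is a bounded domain with smooth boundary.
\<close>

definition smooth_ball_deformation :: "'a::euclidean_space set \<Rightarrow> bool" where
  "smooth_ball_deformation B \<longleftrightarrow>
     (\<exists>r>0. \<exists>U V \<Phi> \<Psi>. open U \<and> open V \<and> cball 0 r \<subseteq> U \<and> homeomorphism U V \<Phi> \<Psi> \<and>
        smooth_on U (\<Phi>::'a \<Rightarrow> 'a) \<and> smooth_on V \<Psi> \<and> B = \<Phi> ` ball 0 r)"


section \<open>Hermitian algebra\<close>

text \<open>\<open>a \<cdot> cnj b\<close> for complex vectors.\<close>

definition hdot :: "complex^'d \<Rightarrow> complex^'d \<Rightarrow> complex" where
  "hdot a b = (\<Sum>i\<in>UNIV. a $ i * cnj (b $ i))"

definition cmat :: "real^'d^'d \<Rightarrow> complex^'d^'d" where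
  "cmat M = (\<chi> i j. complex_of_real (M $ i $ j))"

text \<open>Infimum and supremum of \<open>cnj \<xi> \<cdot> M \<xi>\<close> over complex unit vectors. The value is real for
  symmetric \<open>M\<close>, hence \<open>Re\<close>. Extended reals keep unbounded coefficients from producing
  unspecified values.\<close>

definition qform_inf :: "real^'d^'d \<Rightarrow> ereal" where
  "qform_inf M = (INF \<xi>\<in>{\<xi>. norm \<xi> = 1}. ereal (Re (hdot (cmat M *v \<xi>) \<xi>)))"

definition qform_sup :: "real^'d^'d \<Rightarrow> ereal" where
  "qform_sup M = (SUP \<xi>\<in>{\<xi>. norm \<xi> = 1}. ereal (Re (hdot (cmat M *v \<xi>) \<xi>)))"


section \<open>Sobolev spaces\<close>

text \<open>
  Elements of \<open>H\<^sup>1(D)\<close> are represented by functions, where representatives that agree almost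
  everywhere on \<open>D\<close> stand for the same element (values outside \<open>D\<close> are irrelevant). All inner
  products, norms and forms below depend only on the classes, and operators are determined up to
  this identification.
\<close>

definition L2 :: "(real^'d) set \<Rightarrow> (real^'d \<Rightarrow> complex) set" where
  "L2 D = {f \<in> borel_measurable (lebesgue_on D). integrable (lebesgue_on D) (\<lambda>x. (norm (f x))\<^sup>2)}"

definition test_function :: "(real^'d) set \<Rightarrow> (real^'d \<Rightarrow> complex) \<Rightarrow> bool" where
  "test_function D \<phi> \<longleftrightarrow> smooth_on UNIV \<phi> \<and> compact (closure {x. \<phi> x \<noteq> 0}) \<and>
     closure {x. \<phi> x \<noteq> 0} \<subseteq> D"

definition is_weak_gradient ::
    "(real^'d) set \<Rightarrow> (real^'d \<Rightarrow> complex) \<Rightarrow> (real^'d \<Rightarrow> complex^'d) \<Rightarrow> bool" where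
  "is_weak_gradient D w g \<longleftrightarrow> (\<forall>i. (\<lambda>x. g x $ i) \<in> L2 D) \<and>
     (\<forall>\<phi>. test_function D \<phi> \<longrightarrow> (\<forall>i.
        (LINT x|lebesgue_on D. w x * frechet_derivative \<phi> (at x) (axis i 1)) =
        - (LINT x|lebesgue_on D. g x $ i * \<phi> x)))"

definition H1 :: "(real^'d) set \<Rightarrow> (real^'d \<Rightarrow> complex) set" where
  "H1 D = {w \<in> L2 D. \<exists>g. is_weak_gradient D w g}"

text \<open>The weak gradient of an \<open>H\<^sup>1\<close> function, unique up to a null set.\<close>

definition wgrad :: "(real^'d) set \<Rightarrow> (real^'d \<Rightarrow> complex) \<Rightarrow> (real^'d \<Rightarrow> complex^'d)" where
  "wgrad D w = (SOME g. is_weak_gradient D w g)"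

definition H1_inner :: "(real^'d) set \<Rightarrow> (real^'d \<Rightarrow> complex) \<Rightarrow> (real^'d \<Rightarrow> complex) \<Rightarrow> complex" where
  "H1_inner D w \<phi> = (LINT x|lebesgue_on D. hdot (wgrad D w x) (wgrad D \<phi> x) + w x * cnj (\<phi> x))"

definition H1_norm :: "(real^'d) set \<Rightarrow> (real^'d \<Rightarrow> complex) \<Rightarrow> real" where
  "H1_norm D w = sqrt (Re (H1_inner D w w))"

text \<open>The closure of the test functions in \<open>H\<^sup>1(D)\<close>.\<close>

definition H10 :: "(real^'d) set \<Rightarrow> (real^'d \<Rightarrow> complex) set" where
  "H10 D = {w \<in> H1 D. \<forall>e>0. \<exists>\<phi>. test_function D \<phi> \<and> H1_norm D (w - \<phi>) < e}"


section \<open>The space \<open>X(D)\<close> and its operators\<close>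

type_synonym 'd fpair = "(real^'d \<Rightarrow> complex) \<times> (real^'d \<Rightarrow> complex)"

definition X :: "(real^'d) set \<Rightarrow> 'd fpair set" where
  "X D = {(w, v). w \<in> H1 D \<and> v \<in> H1 D \<and> w - v \<in> H10 D}"

definition X_inner :: "(real^'d) set \<Rightarrow> 'd fpair \<Rightarrow> 'd fpair \<Rightarrow> complex" where
  "X_inner D = (\<lambda>(w, v) (\<phi>\<^sub>1, \<phi>\<^sub>2). H1_inner D w \<phi>\<^sub>1 + H1_inner D v \<phi>\<^sub>2)"

definition X_norm :: "(real^'d) set \<Rightarrow> 'd fpair \<Rightarrow> real" where
  "X_norm D u = sqrt (Re (X_inner D u u))"

text \<open>Equality of elements of \<open>X(D)\<close>.\<close>

definition X_eq :: "(real^'d) set \<Rightarrow> 'd fpair \<Rightarrow> 'd fpair \<Rightarrow> bool" where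
  "X_eq D u u' \<longleftrightarrow> (AE x in lebesgue_on D. fst u x = fst u' x \<and> snd u x = snd u' x)"

definition X_scale :: "complex \<Rightarrow> 'd fpair \<Rightarrow> 'd fpair" where
  "X_scale c = (\<lambda>(w, v). (\<lambda>x. c * w x, \<lambda>x. c * v x))"

text \<open>The operator \<open>L\<close> on \<open>X(D)\<close> with \<open>(L u; \<phi>) = F u \<phi>\<close> given by the Riesz theorem.\<close>

definition riesz_op ::
    "(real^'d) set \<Rightarrow> ('d fpair \<Rightarrow> 'd fpair \<Rightarrow> complex) \<Rightarrow> 'd fpair \<Rightarrow> 'd fpair" where
  "riesz_op D F u = (SOME g. g \<in> X D \<and> (\<forall>\<phi>\<in>X D. X_inner D g \<phi> = F u \<phi>))"

definition X_inv :: "(real^'d) set \<Rightarrow> ('d fpair \<Rightarrow> 'd fpair) \<Rightarrow> 'd fpair \<Rightarrow> 'd fpair" where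
  "X_inv D L g = (SOME u. u \<in> X D \<and> X_eq D (L u) g)"

text \<open>Operator norm on \<open>X(D)\<close>; it is \<open>\<infinity>\<close> for unbounded operators.\<close>

definition X_opnorm :: "(real^'d) set \<Rightarrow> ('d fpair \<Rightarrow> 'd fpair) \<Rightarrow> ereal" where
  "X_opnorm D L = (SUP u\<in>{u \<in> X D. X_norm D u \<le> 1}. ereal (X_norm D (L u)))"

text \<open>In the following \<open>a\<close> and \<open>b\<close> are the coefficients \<open>A\<^sub>\<epsilon>\<close> and \<open>n\<^sub>\<epsilon>\<close>, and \<open>\<kappa>\<close> is the constant
  \<open>A\<^sub>m\<^sub>i\<^sub>n\<close> or \<open>A\<^sub>m\<^sub>a\<^sub>x\<close>, according to the case.\<close>

definition form_A :: "(real^'d) set \<Rightarrow> (real^'d \<Rightarrow> real^'d^'d) \<Rightarrow> real \<Rightarrow> 'd fpair \<Rightarrow> 'd fpair \<Rightarrow> complex" where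
  "form_A D a \<kappa> = (\<lambda>(w, v) (\<phi>\<^sub>1, \<phi>\<^sub>2).
     (LINT x|lebesgue_on D. hdot (cmat (a x) *v wgrad D w x) (wgrad D \<phi>\<^sub>1 x)
                              + complex_of_real \<kappa> * w x * cnj (\<phi>\<^sub>1 x))
     - (LINT x|lebesgue_on D. hdot (wgrad D v x) (wgrad D \<phi>\<^sub>2 x) + v x * cnj (\<phi>\<^sub>2 x)))"

definition form_B :: "(real^'d) set \<Rightarrow> (real^'d \<Rightarrow> real) \<Rightarrow> 'd fpair \<Rightarrow> 'd fpair \<Rightarrow> complex" where
  "form_B D b = (\<lambda>(w, v) (\<phi>\<^sub>1, \<phi>\<^sub>2).
     (LINT x|lebesgue_on D. complex_of_real (b x) * w x * cnj (\<phi>\<^sub>1 x) - v x * cnj (\<phi>\<^sub>2 x)))"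

definition form_C :: "(real^'d) set \<Rightarrow> real \<Rightarrow> 'd fpair \<Rightarrow> 'd fpair \<Rightarrow> complex" where
  "form_C D \<kappa> = (\<lambda>(w, v) (\<phi>\<^sub>1, \<phi>\<^sub>2).
     (LINT x|lebesgue_on D. complex_of_real \<kappa> * w x * cnj (\<phi>\<^sub>1 x) - v x * cnj (\<phi>\<^sub>2 x)))"

definition A_inv_op :: "(real^'d) set \<Rightarrow> (real^'d \<Rightarrow> real^'d^'d) \<Rightarrow> real \<Rightarrow> 'd fpair \<Rightarrow> 'd fpair" where
  "A_inv_op D a \<kappa> = X_inv D (riesz_op D (form_A D a \<kappa>))"

definition T_op :: "(real^'d) set \<Rightarrow> (real^'d \<Rightarrow> real^'d^'d) \<Rightarrow> (real^'d \<Rightarrow> real) \<Rightarrow> real \<Rightarrow> complex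
    \<Rightarrow> 'd fpair \<Rightarrow> 'd fpair" where
  "T_op D a b \<kappa> \<tau> u = A_inv_op D a \<kappa> (riesz_op D (form_B D b) u)
     + X_scale (1 / \<tau>) (A_inv_op D a \<kappa> (riesz_op D (form_C D \<kappa>) u))"


section \<open>Small inclusions\<close>

definition inclusion :: "(nat \<Rightarrow> real^'d) \<Rightarrow> (nat \<Rightarrow> (real^'d) set) \<Rightarrow> real \<Rightarrow> nat \<Rightarrow> (real^'d) set" where
  "inclusion z B \<epsilon> m = (\<lambda>y. z m + \<epsilon> *\<^sub>R y) ` B m"

text \<open>
  The background coefficient \<open>c\<close>, replaced by the constant \<open>k m\<close> in the \<open>m\<close>-th inclusion; used for
  both \<open>A\<^sub>\<epsilon>\<close> and \<open>n\<^sub>\<epsilon>\<close>. For small \<open>\<epsilon> > 0\<close> the inclusions are disjoint, so \<open>m\<close> is unique. On the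
  boundary of the inclusions, a null set, the value is that of \<open>c\<close>. For \<open>\<epsilon> = 0\<close> it is \<open>c\<close>.
\<close>

definition perturbed :: "nat \<Rightarrow> (nat \<Rightarrow> real^'d) \<Rightarrow> (nat \<Rightarrow> (real^'d) set) \<Rightarrow> (nat \<Rightarrow> 'c)
    \<Rightarrow> (real^'d \<Rightarrow> 'c) \<Rightarrow> real \<Rightarrow> real^'d \<Rightarrow> 'c" where
  "perturbed M z B k c \<epsilon> x =
     (if \<epsilon> > 0 \<and> (\<exists>m\<in>{1..M}. x \<in> inclusion z B \<epsilon> m)
      then k (SOME m. m \<in> {1..M} \<and> x \<in> inclusion z B \<epsilon> m) else c x)"

end

theory Submission
 imports Defs
begin

text \<open>
 The difference of the two solutions is estimated by testing the perturbed problem against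
 \<open>T d\<close>, where \<open>d\<close> is the difference and \<open>T\<close> is the flip \<open>(w, v) \<mapsto> (w, 2 w - v)\<close> or
 \<open>(w - 2 v, - v)\<close> that makes the sign-indefinite form coercive. The right-hand side then only involves
 the background solution on the inclusions. Interior regularity (difference quotients, twice) together with a
 dyadic Poincare argument replaces the Sobolev embedding: the gradient of the background solution has the
 \<open>L\<^sup>2\<close> mass of a bounded function on small balls, which gives \<open>\<epsilon> powr (d/2)\<close>, while the plain \<open>H\<^sup>1\<close>
 bound on \<open>w\<close> gives \<open>sqrt \<epsilon>\<close> for the perturbation of \<open>n\<close>.
\<close>

text \<open>The perturbed coefficient jumps, so no regularity is asked of the solution belonging to
  it: that solution enters through a stability constant alone, which depends only on bounds shared
  by \<open>A\<close> and all \<open>Am\<close> and hence not on the size of the inclusions. The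
  rate then needs the background gradient to behave on small balls like a bounded function. Second
  weak derivatives are never formed; bounds of the type
  \<open>l2on S (%x. g (x + h) - g x) \<le> K * norm h\<close> take their place and need
  translations only. The restriction to dimensions 2 and 3 enters in the dyadic summation: its terms
  grow by the ratio \<open>sqrt (2 ^ d) / 2\<close>, at most \<open>sqrt 2\<close> for
  \<open>d \<le> 3\<close>, and the growth left by a first summation is still beaten by the factor
  1/2 gained in a second one. This analysis is carried out for real Borel functions on the whole
  space, where shifts and convolutions are total; complex Sobolev functions on \<open>D\<close>
  reach it through Borel representatives of their real and imaginary parts, which solve equations of
  the same form because the coefficients are real.\<close>

section \<open>Calculus of k-fold continuously differentiable functions\<close>

lemma Ck_on_cong:
 assumes "open S" "!!x. x \<in> S ==> f x = g x" "Ck_on k S f"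
 shows "Ck_on k S g"
 using assms(2,3)
proof (induction k arbitrary: f g)
 case 0
 then show ?case using continuous_on_cong by fastforce
next
 case (Suc k)
 have fd: "frechet_derivative f (at x) = frechet_derivative g (at x)" if "x \<in> S" for x
 proof -
  have "(f has_derivative F) (at x) \<longleftrightarrow> (g has_derivative F) (at x)" for F
   using has_derivative_transform_within_open[OF _ \<open>open S\<close> that]  Suc.prems(1) by metis
  then show ?thesis unfolding frechet_derivative_def by simp
 qed
 have "g differentiable_on S" unfolding differentiable_on_def
 proof
  fix x assume x: "x \<in> S"
  have "(f has_derivative frechet_derivative f (at x)) (at x)"
   using Suc.prems(2) x \<open>open S\<close> by (auto simp: differentiable_on_eq_differentiable_at frechet_derivative_works)
  then have "(g has_derivative frechet_derivative f (at x)) (at x)"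
   by (rule has_derivative_transform_within_open[OF _ \<open>open S\<close> x]) (use Suc.prems in auto)
  then show "g differentiable at x within S"
   by (meson differentiable_def has_derivative_at_withinI)
 qed
 moreover have "Ck_on k S (%x. frechet_derivative g (at x) b)" if "b \<in> Basis" for b
  using Suc.IH[of "%x. frechet_derivative f (at x) b" "%x. frechet_derivative g (at x) b"] fd Suc.prems that by auto
 ultimately show ?case by simp
qed

text \<open>Serves all closure proofs below: any explicit derivative may be used, and its
  identification with \<open>frechet_derivative\<close> is done here once.\<close>

lemma Ck_on_SucI:
 assumes S: "open S" and d: "!!x. x \<in> S ==> (f has_derivative f' x) (at x)"
  and c: "!!b. b \<in> Basis ==> Ck_on k S (%x. f' x b)"
 shows "Ck_on (Suc k) S f"
proof -
 have "f differentiable_on S"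
  using d S by (meson differentiable_on_def differentiable_def has_derivative_at_withinI)
 moreover have "Ck_on k S (%x. frechet_derivative f (at x) b)" if "b \<in> Basis" for b
  by (rule Ck_on_cong[OF S _ c[OF that]]) (use d frechet_derivative_at in metis)
 ultimately show ?thesis by simp
qed

lemma Ck_on_SucD:
 assumes "open S" "Ck_on (Suc k) S f" "x \<in> S"
 shows "(f has_derivative frechet_derivative f (at x)) (at x)"
 using assms by (metis Ck_on.simps(2) differentiable_on_eq_differentiable_at frechet_derivative_works)

lemma Ck_on_Suc_le: "open S ==> Ck_on (Suc k) S f ==> Ck_on k S f"
proof (induction k arbitrary: f)
 case 0 then show ?case by (simp add: differentiable_imp_continuous_on)
next
 case (Suc k) then show ?case by simp
qed

lemma Ck_on_continuous: "open S ==> Ck_on k S f ==> continuous_on S f"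
 by (induction k) (auto simp: differentiable_imp_continuous_on)

lemma Ck_on_const: "open S ==> Ck_on k S (%x. c)"
proof (induction k arbitrary: c)
 case (Suc k)
 show ?case by (rule Ck_on_SucI[OF Suc.prems, of _ "%_ _. 0"]) (auto simp: Suc)
qed auto

lemma Ck_on_linear: "open S ==> bounded_linear L ==> Ck_on k S L"
proof (induction k)
 case 0 then show ?case by (simp add: linear_continuous_on)
next
 case (Suc k)
 show ?case by (rule Ck_on_SucI[OF Suc.prems(1), of _ "%_. L"]) (auto simp: Suc bounded_linear_imp_has_derivative Ck_on_const)
qed

lemma Ck_on_add: "open S ==> Ck_on k S f ==> Ck_on k S g ==> Ck_on k S (%x. f x + g x)"
proof (induction k arbitrary: f g)
 case 0 then show ?case by (auto intro: continuous_intros)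
next
 case (Suc k)
 show ?case
  by (rule Ck_on_SucI[OF Suc.prems(1), of _ "%x h. frechet_derivative f (at x) h + frechet_derivative g (at x) h"])
   (use Suc in \<open>auto intro!: has_derivative_add Ck_on_SucD[OF Suc.prems(1,2)] Ck_on_SucD[OF Suc.prems(1,3)]\<close>)
qed

lemma Ck_on_bilinear:
 assumes "open S" "bounded_bilinear B" "Ck_on k S f" "Ck_on k S g"
 shows "Ck_on k S (%x. B (f x) (g x))"
 using assms(3,4)
proof (induction k arbitrary: f g)
 case 0 then show ?case using bounded_bilinear.continuous_on[OF assms(2)] by auto
next
 case (Suc k)
 show ?case
 proof (rule Ck_on_SucI[OF assms(1), of _ "%x h. B (f x) (frechet_derivative g (at x) h) + B (frechet_derivative f (at x) h) (g x)"])
  fix x assume "x \<in> S"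
  then show "((%x. B (f x) (g x)) has_derivative (%h. B (f x) (frechet_derivative g (at x) h) + B (frechet_derivative f (at x) h) (g x))) (at x)"
   using bounded_bilinear.FDERIV[OF assms(2) Ck_on_SucD[OF assms(1) Suc.prems(1)] Ck_on_SucD[OF assms(1) Suc.prems(2)]] by blast
 next
  fix b :: 'a assume "b \<in> Basis"
  then show "Ck_on k S (%x. B (f x) (frechet_derivative g (at x) b) + B (frechet_derivative f (at x) b) (g x))"
   using Suc.prems Ck_on_Suc_le[OF assms(1) Suc.prems(1)] Ck_on_Suc_le[OF assms(1) Suc.prems(2)]
   by (intro Ck_on_add assms(1) Suc.IH) auto
 qed
qed

lemma Ck_on_mult:
 fixes f g :: "'a::euclidean_space => real"
 shows "open S ==> Ck_on k S f ==> Ck_on k S g ==> Ck_on k S (%x. f x * g x)"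
 by (rule Ck_on_bilinear[OF _ bounded_bilinear_mult])

lemma Ck_on_bounded_linear:
 assumes "open S" "bounded_linear L" "Ck_on k S f"
 shows "Ck_on k S (%x. L (f x))"
 using assms(3)
proof (induction k arbitrary: f)
 case 0 then show ?case using assms(2) by (simp add: bounded_linear.continuous_on)
next
 case (Suc k)
 show ?case
  by (rule Ck_on_SucI[OF assms(1), of _ "%x h. L (frechet_derivative f (at x) h)"])
   (use Suc in \<open>auto intro!: bounded_linear.has_derivative[OF assms(2)] Ck_on_SucD[OF assms(1) Suc.prems]\<close>)
qed

lemma Ck_on_affine:
 fixes f :: "'a::euclidean_space => 'b::real_normed_vector"
 assumes "Ck_on k UNIV f"
 shows "Ck_on k UNIV (%x. f (a + r *\<^sub>R x))"
 using assms
proof (induction k arbitrary: f)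
 case 0 then show ?case by (auto intro!: continuous_on_compose2[of UNIV f] continuous_intros)
next
 case (Suc k)
 let ?F = "%x h. r *\<^sub>R frechet_derivative f (at (a + r *\<^sub>R x)) h"
 have "((%x. f (a + r *\<^sub>R x)) has_derivative ?F x) (at x)" for x
 proof -
  have D: "(f has_derivative frechet_derivative f (at y)) (at y)" for y
   using Ck_on_SucD[OF open_UNIV Suc.prems] by simp
  have "((%x. f (a + r *\<^sub>R x)) has_derivative (%h. frechet_derivative f (at (a + r *\<^sub>R x)) (r *\<^sub>R h))) (at x)"
   by (rule has_derivative_compose[OF _ D]) (auto intro!: derivative_eq_intros)
  then show ?thesis
   using linear_scale[OF has_derivative_linear[OF D]] by simp
 qed
 moreover have "Ck_on k UNIV (%x. ?F x b)" if "b \<in> Basis" for b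
  using Suc that by (intro Ck_on_bounded_linear[OF open_UNIV bounded_linear_scaleR_right]) auto
 ultimately show ?case by (intro Ck_on_SucI) auto
qed

section \<open>A smooth bump function\<close>

text \<open>The classical flat function exp(-1/t), multiplied by powers of 1/t. The powers make the
  family closed under differentiation up to linear combinations, so one induction over the order
  gives smoothness at 0 as well.\<close>

definition flat_exp :: "nat => real => real" where
 "flat_exp m t = (if t > 0 then (1/t)^m * exp (- (1/t)) else 0)"

lemma flat_exp_tendsto_0: "(flat_exp m \<longlongrightarrow> 0) (at 0)"
proof (rule filterlim_split_at)
 have "\<forall>\<^sub>F t in at_left 0. flat_exp m t = 0"
  unfolding flat_exp_def by (auto simp: eventually_at_filter)
 then show "(flat_exp m \<longlongrightarrow> 0) (at_left 0)" using tendsto_eventually by blast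
next
 have "((%t::real. inverse t ^ m / exp (inverse t)) \<longlongrightarrow> 0) (at_right 0)"
  using filterlim_compose[OF tendsto_power_div_exp_0[of m] filterlim_inverse_at_top_right] by (simp add: o_def)
 moreover have "\<forall>\<^sub>F t in at_right 0. inverse t ^ m / exp (inverse t) = flat_exp m t"
  unfolding flat_exp_def eventually_at_filter by (auto simp: exp_minus field_simps)
 ultimately show "(flat_exp m \<longlongrightarrow> 0) (at_right 0)" by (rule Lim_transform_eventually)
qed

lemma flat_exp_deriv:
 "(flat_exp m has_real_derivative (flat_exp (m+2) t - real m * flat_exp (m+1) t)) (at t)"
proof (cases t "0::real" rule: linorder_cases)
 case less
 have "(flat_exp m has_real_derivative 0) (at t)"
  by (rule has_field_derivative_transform_within_open[of "%_. 0" _ _ "{..<0}"]) (use less in \<open>auto simp: flat_exp_def\<close>)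
 then show ?thesis using less by (simp add: flat_exp_def)
next
 case equal
 have "((%h. flat_exp (m+1) h) \<longlongrightarrow> 0) (at 0)" by (rule flat_exp_tendsto_0)
 \<comment> \<open>Away from 0 the difference quotient of one member at 0 is the next member of the
   family, so its limit is already known.\<close>
 then have "((%h. flat_exp m h / h) \<longlongrightarrow> 0) (at 0)"
  by (rule Lim_transform_eventually) (auto simp: flat_exp_def eventually_at_filter)
 then show ?thesis using equal by (simp add: DERIV_def flat_exp_def)
next
 case greater
 have "((%t. (1/t)^m * exp (- (1/t))) has_real_derivative (flat_exp (m+2) t - real m * flat_exp (m+1) t)) (at t)"
 proof -
  define s where "s = 1/t"
  have D: "((%t. 1/t) has_real_derivative (- (s^2))) (at t)"
   using greater by (auto intro!: derivative_eq_intros simp: s_def power2_eq_square field_simps)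
  have "((%t. (1/t)^m * exp (- (1/t))) has_real_derivative
    ((real m * (- (s^2)) * s^(m - 1)) * exp (- s) + (exp (- s) * s^2) * s^m)) (at t)"
   using D greater by (auto intro!: derivative_eq_intros simp: s_def power2_eq_square)
  moreover have "(real m * (- (s^2)) * s^(m - 1)) * exp (- s) + (exp (- s) * s^2) * s^m
    = s^(m+2) * exp (- s) - real m * (s^(m+1) * exp (- s))"
   by (cases m) (auto simp: algebra_simps power2_eq_square)
  ultimately show ?thesis using greater by (simp add: flat_exp_def s_def)
 qed
 then show ?thesis
  by (rule has_field_derivative_transform_within_open[of _ _ _ "{0<..}"]) (use greater in \<open>auto simp: flat_exp_def\<close>)
qed

text \<open>The index \<open>m\<close> is generalised in the induction because differentiating
  raises it by 1 and by 2.\<close>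

lemma Ck_on_flat_exp:
 fixes p :: "'a::euclidean_space => real"
 assumes p: "smooth_on UNIV p"
 shows "Ck_on k UNIV (%x. flat_exp m (p x))"
proof (induction k arbitrary: m)
 case 0
 have "continuous_on UNIV p" using p Ck_on_continuous[OF open_UNIV] by (auto simp: smooth_on_def)
 moreover have "continuous_on UNIV (flat_exp m)"
  using flat_exp_deriv DERIV_isCont by (meson continuous_at_imp_continuous_on)
 ultimately show ?case by (auto intro: continuous_on_compose2)
next
 case (Suc k)
 have sm: "Ck_on (Suc k) UNIV p" using p by (simp add: smooth_on_def)
 note D = Ck_on_SucD[OF open_UNIV sm]
 let ?F = "%x h. (flat_exp (m+2) (p x) - real m * flat_exp (m+1) (p x)) * frechet_derivative p (at x) h"
 have "((%x. flat_exp m (p x)) has_derivative ?F x) (at x)" for x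
  using has_derivative_compose[OF D flat_exp_deriv[unfolded has_field_derivative_def]] by auto
 moreover have "Ck_on k UNIV (%x. ?F x b)" if "b \<in> Basis" for b
 proof -
  have "Ck_on k UNIV (%x. flat_exp (m+2) (p x) + (- real m) * flat_exp (m+1) (p x))"
   by (intro Ck_on_add Ck_on_mult Suc Ck_on_const) auto
  then show ?thesis using sm that by (intro Ck_on_mult) auto
 qed
 ultimately show ?case by (intro Ck_on_SucI) auto
qed

lemma smooth_bump:
 obtains \<rho> :: "'a::euclidean_space => real"
 where "smooth_on UNIV \<rho>" "!!x. \<rho> x \<ge> 0" "!!x. \<rho> x > 0 \<longleftrightarrow> norm x < 1" "!!x. \<rho> x \<le> 1"
proof
 \<comment> \<open>Positive exactly in the open unit ball. It is written as a sum of products to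
   match \<open>Ck_on_add\<close> and \<open>Ck_on_mult\<close>. The bound by 1 comes from exp(-1/t)
   being at most 1.\<close>
 let ?p = "%x::'a. 1 + (-1) * (x \<bullet> x)"
 let ?r = "%x. flat_exp 0 (?p x)"
 have "smooth_on UNIV ?p" unfolding smooth_on_def
  by (intro allI Ck_on_add Ck_on_mult Ck_on_const Ck_on_bilinear[OF _ bounded_bilinear_inner] Ck_on_linear bounded_linear_ident) auto
 then show "smooth_on UNIV ?r" unfolding smooth_on_def[of _ ?r] using Ck_on_flat_exp by blast
 show "?r x \<ge> 0" "?r x \<le> 1" for x by (auto simp: flat_exp_def)
 show "?r x > 0 \<longleftrightarrow> norm x < 1" for x
  by (auto simp: flat_exp_def dot_square_norm power_less_one_iff)
qed

section \<open>Square-integrable functions and their seminorm\<close>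

definition sqi :: "'a measure => ('a => 'b::euclidean_space) => bool" where
 "sqi M f \<longleftrightarrow> f \<in> borel_measurable M \<and> integrable M (%x. (norm (f x))\<^sup>2)"

text \<open>A real number rather than an extended one: the Bochner integral of a non-integrable
  function is 0, so the value says something only together with \<open>sqi\<close>. The codomain is
  any Euclidean space, which covers real, complex and vector-valued functions at once.\<close>

definition l2 :: "'a measure => ('a => 'b::euclidean_space) => real" where
 "l2 M f = sqrt (\<integral>x. (norm (f x))\<^sup>2 \<partial>M)"

lemma sqi_measurable[measurable_dest]: "sqi M f ==> f \<in> borel_measurable M"
 by (simp add: sqi_def)

lemma l2_nonneg[simp]: "l2 M f \<ge> 0" by (simp add: l2_def)

lemma l2_sq: "(l2 M f)\<^sup>2 = (\<integral>x. (norm (f x))\<^sup>2 \<partial>M)"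
 by (simp add: l2_def)

lemma l2_nn: "sqi M f ==> (\<integral>\<^sup>+x. ennreal ((norm (f x))\<^sup>2) \<partial>M) = ennreal ((l2 M f)\<^sup>2)"
 unfolding l2_sq by (rule nn_integral_eq_integral) (auto simp: sqi_def)

text \<open>The entry point for every estimate obtained by Fubini or Fatou: the nonnegative integral
  needs no integrability beforehand, and finiteness delivers membership and bound together.\<close>

lemma sqi_l2_nnI:
 assumes [measurable]: "f \<in> borel_measurable M" and le: "(\<integral>\<^sup>+x. ennreal ((norm (f x))\<^sup>2) \<partial>M) \<le> ennreal (C\<^sup>2)" and "C \<ge> 0"
 shows "sqi M f" "l2 M f \<le> C"
proof -
 have "integrable M (%x. (norm (f x))\<^sup>2)"
  using le_less_trans[OF le ennreal_less_top] by (intro integrableI_bounded) simp_all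
 then show s: "sqi M f" by (simp add: sqi_def)
 have "(l2 M f)\<^sup>2 \<le> C\<^sup>2" using le unfolding l2_nn[OF s] by simp
 then show "l2 M f \<le> C" using \<open>C \<ge> 0\<close> by (rule power2_le_imp_le)
qed

lemma sqi_bound:
 assumes m[measurable]: "f \<in> borel_measurable M" and g: "sqi M g" and le: "AE x in M. norm (f x) \<le> c * norm (g x)" and c: "c \<ge> 0"
 shows "sqi M f" "l2 M f \<le> c * l2 M g"
proof -
 have [measurable]: "g \<in> borel_measurable M" using g by (simp add: sqi_def)
 have le2: "AE x in M. (norm (f x))\<^sup>2 \<le> c\<^sup>2 * (norm (g x))\<^sup>2"
  using le by eventually_elim (metis norm_ge_zero power_mono power_mult_distrib)
 have "(\<integral>\<^sup>+x. ennreal ((norm (f x))\<^sup>2) \<partial>M) \<le> (\<integral>\<^sup>+x. ennreal (c\<^sup>2 * (norm (g x))\<^sup>2) \<partial>M)"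
  by (rule nn_integral_mono_AE) (use le2 in \<open>auto elim!: eventually_mono intro: ennreal_leI\<close>)
 also have "\<dots> = ennreal ((c * l2 M g)\<^sup>2)"
  using l2_nn[OF g] by (simp add: ennreal_mult nn_integral_cmult power_mult_distrib)
 finally show "sqi M f" "l2 M f \<le> c * l2 M g" using sqi_l2_nnI[OF m] c by auto
qed

lemma sqi_zero[simp]: "sqi M (%x. 0)" "l2 M (%x. 0) = 0" by (auto simp: sqi_def l2_def)

lemma sqi_scaleR: "sqi M f ==> sqi M (%x. c *\<^sub>R f x)" and l2_scaleR: "l2 M (%x. c *\<^sub>R f x) = \<bar>c\<bar> * l2 M f"
 by (auto simp: sqi_def l2_def power_mult_distrib real_sqrt_mult)

lemma sqi_uminus: "sqi M f ==> sqi M (%x. - f x)" and l2_uminus: "l2 M (%x. - f x) = l2 M f"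
 by (auto simp: sqi_def l2_def)

lemma sqi_norm: "sqi M f ==> sqi M (%x. norm (f x))" and l2_norm: "l2 M (%x. norm (f x)) = l2 M f"
 by (auto simp: sqi_def l2_def)

lemma sqi_add:
 assumes f: "sqi M f" and g: "sqi M g"
 shows "sqi M (%x. f x + g x)"
proof -
 have [measurable]: "f \<in> borel_measurable M" "g \<in> borel_measurable M" using assms by (auto simp: sqi_def)
 have "integrable M (%x. (norm (f x + g x))\<^sup>2)"
 proof (rule Bochner_Integration.integrable_bound)
  show "integrable M (%x. 2 * (norm (f x))\<^sup>2 + 2 * (norm (g x))\<^sup>2)" using assms by (auto simp: sqi_def)
  have "(norm (f x + g x))\<^sup>2 \<le> 2 * (norm (f x))\<^sup>2 + 2 * (norm (g x))\<^sup>2" for x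
  proof -
   have "(norm (f x + g x))\<^sup>2 \<le> (norm (f x) + norm (g x))\<^sup>2" by (simp add: norm_triangle_ineq power_mono)
   then show ?thesis using sum_squares_ge_zero[of "norm (f x) - norm (g x)" 0] by (simp add: power2_eq_square algebra_simps)
  qed
  then show "AE x in M. norm ((norm (f x + g x))\<^sup>2) \<le> norm (2 * (norm (f x))\<^sup>2 + 2 * (norm (g x))\<^sup>2)" by auto
 qed auto
 then show ?thesis by (simp add: sqi_def)
qed

lemma sqi_diff: "sqi M f ==> sqi M g ==> sqi M (%x. f x - g x)"
 using sqi_add[of M f "%x. - g x"] sqi_uminus by auto

lemma sqi_sum: "(!!i. i \<in> I ==> sqi M (f i)) ==> sqi M (%x. \<Sum>i\<in>I. f i x)"
 by (induction I rule: infinite_finite_induct) (auto intro: sqi_add)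

lemma l2_prod:
 fixes f :: "'a => 'b::euclidean_space" and g :: "'a => 'c::euclidean_space"
 assumes f: "sqi M f" and g: "sqi M g"
 shows "integrable M (%x. norm (f x) * norm (g x))" "(\<integral>x. norm (f x) * norm (g x) \<partial>M) \<le> l2 M f * l2 M g"
proof -
 have [measurable]: "f \<in> borel_measurable M" "g \<in> borel_measurable M" using assms by (auto simp: sqi_def)
 have "(\<integral>\<^sup>+x. ennreal (norm (f x) * norm (g x)) \<partial>M)\<^sup>2 \<le> ennreal ((l2 M f * l2 M g)\<^sup>2)"
  using Cauchy_Schwarz_nn_integral[of "%x. ennreal (norm (f x))" M "%x. ennreal (norm (g x))"]
  by (simp add: ennreal_mult ennreal_power l2_nn[OF f] l2_nn[OF g] power_mult_distrib)
 then have le: "(\<integral>\<^sup>+x. ennreal (norm (f x) * norm (g x)) \<partial>M) \<le> ennreal (l2 M f * l2 M g)"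
  (is "?I \<le> _")
 \<comment> \<open>The square root of the squared inequality is taken among the reals, so an
   infinite integral has to be excluded separately.\<close>
 proof (cases ?I)
  case (real r)
  then have "r\<^sup>2 \<le> (l2 M f * l2 M g)\<^sup>2"
   using \<open>?I\<^sup>2 \<le> _\<close> by (simp add: ennreal_power)
  then have "r \<le> l2 M f * l2 M g" by (rule power2_le_imp_le) simp
  then show ?thesis using real by (simp add: ennreal_leI)
 next
  case top
  then show ?thesis using \<open>?I\<^sup>2 \<le> _\<close> by (simp add: top_unique)
 qed
 show i: "integrable M (%x. norm (f x) * norm (g x))"
  using le_less_trans[OF le ennreal_less_top] by (intro integrableI_bounded) simp_all
 show "(\<integral>x. norm (f x) * norm (g x) \<partial>M) \<le> l2 M f * l2 M g"
  using le nn_integral_eq_integral[OF i] by simp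
qed

text \<open>The common source of all pairing estimates: inner products, scalar multiples, complex
  products and \<open>hdot\<close> only have to supply the pointwise bound.\<close>

lemma l2_bilinear:
 fixes f :: "'a => 'b::euclidean_space" and g :: "'a => 'c::euclidean_space" and F :: "'a => 'd::euclidean_space"
 assumes f: "sqi M f" and g: "sqi M g" and F: "F \<in> borel_measurable M"
  and le: "AE x in M. norm (F x) \<le> c * (norm (f x) * norm (g x))"
  and c: "c \<ge> 0"
 shows "integrable M F" "norm (\<integral>x. F x \<partial>M) \<le> c * (l2 M f * l2 M g)"
proof -
 show i: "integrable M F"
  by (rule Bochner_Integration.integrable_bound[OF integrable_mult_right[OF l2_prod(1)[OF f g], of c] F])
   (use le c in \<open>auto simp: abs_mult\<close>)
 have "norm (\<integral>x. F x \<partial>M) \<le> (\<integral>x. norm (F x) \<partial>M)" by (rule integral_norm_bound)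
 also have "\<dots> \<le> (\<integral>x. c * (norm (f x) * norm (g x)) \<partial>M)"
  by (rule integral_mono_AE) (use i l2_prod(1)[OF f g] le in auto)
 also have "\<dots> \<le> c * (l2 M f * l2 M g)" using l2_prod(2)[OF f g] c by (simp add: mult_left_mono)
 finally show "norm (\<integral>x. F x \<partial>M) \<le> c * (l2 M f * l2 M g)" .
qed

lemma l2_inner:
 assumes f: "sqi M f" and g: "sqi M g"
 shows "integrable M (%x. f x \<bullet> g x)" "\<bar>\<integral>x. f x \<bullet> g x \<partial>M\<bar> \<le> l2 M f * l2 M g"
proof -
 have [measurable]: "f \<in> borel_measurable M" "g \<in> borel_measurable M" using assms by (auto simp: sqi_def)
 show "integrable M (%x. f x \<bullet> g x)" "\<bar>\<integral>x. f x \<bullet> g x \<partial>M\<bar> \<le> l2 M f * l2 M g"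
  using l2_bilinear[OF f g, of "%x. f x \<bullet> g x" 1] Cauchy_Schwarz_ineq2[of "f _" "g _"] by simp_all
qed

lemma l2_mult:
 fixes f g :: "'a => real"
 assumes f: "sqi M f" and g: "sqi M g"
 shows "integrable M (%x. f x * g x)" "\<bar>\<integral>x. f x * g x \<partial>M\<bar> \<le> l2 M f * l2 M g"
 using l2_inner[OF assms] by simp_all

lemma l2_scaleR_int:
 fixes f :: "'a => real" and g :: "'a => 'b::euclidean_space"
 assumes f: "sqi M f" and g: "sqi M g"
 shows "integrable M (%x. f x *\<^sub>R g x)" "norm (\<integral>x. f x *\<^sub>R g x \<partial>M) \<le> l2 M f * l2 M g"
proof -
 have [measurable]: "f \<in> borel_measurable M" "g \<in> borel_measurable M" using assms by (auto simp: sqi_def)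
 show "integrable M (%x. f x *\<^sub>R g x)" "norm (\<integral>x. f x *\<^sub>R g x \<partial>M) \<le> l2 M f * l2 M g"
  using l2_bilinear[OF f g, of "%x. f x *\<^sub>R g x" 1] by simp_all
qed

lemma l2_triangle:
 assumes f: "sqi M f" and g: "sqi M g"
 shows "l2 M (%x. f x + g x) \<le> l2 M f + l2 M g"
proof -
 have i: "integrable M (%x. (norm (f x))\<^sup>2)" "integrable M (%x. (norm (g x))\<^sup>2)" using assms by (auto simp: sqi_def)
 have "(l2 M (%x. f x + g x))\<^sup>2 \<le> (\<integral>x. (norm (f x))\<^sup>2 + 2 * (norm (f x) * norm (g x)) + (norm (g x))\<^sup>2 \<partial>M)"
  unfolding l2_sq
 proof (rule integral_mono)
  show "integrable M (%x. (norm (f x + g x))\<^sup>2)" using sqi_add[OF f g] by (simp add: sqi_def)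
  show "integrable M (%x. (norm (f x))\<^sup>2 + 2 * (norm (f x) * norm (g x)) + (norm (g x))\<^sup>2)"
   using l2_prod(1)[OF f g] i by auto
  show "(norm (f x + g x))\<^sup>2 \<le> (norm (f x))\<^sup>2 + 2 * (norm (f x) * norm (g x)) + (norm (g x))\<^sup>2" for x
   using power_mono[OF norm_triangle_ineq[of "f x" "g x"], of 2] by (simp add: power2_sum)
 qed
 also have "\<dots> = (l2 M f)\<^sup>2 + 2 * (\<integral>x. norm (f x) * norm (g x) \<partial>M) + (l2 M g)\<^sup>2"
  using l2_prod(1)[OF f g] i by (simp add: l2_sq)
 also have "\<dots> \<le> (l2 M f + l2 M g)\<^sup>2" using l2_prod(2)[OF f g] by (simp add: power2_sum)
 finally show ?thesis by (rule power2_le_imp_le) simp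
qed

lemma l2_diff_le:
 assumes f: "sqi M f" and g: "sqi M g"
 shows "l2 M (%x. f x - g x) \<le> l2 M f + l2 M g" "l2 M f \<le> l2 M g + l2 M (%x. f x - g x)"
 using l2_triangle[OF f sqi_uminus[OF g]] l2_triangle[OF g sqi_diff[OF f g]] by (auto simp: l2_uminus)

lemma l2_diff_commute: "l2 M (%x. f x - g x) = l2 M (%x. g x - f x)"
 by (simp add: l2_def norm_minus_commute)

lemma l2_sum:
 assumes "finite I" "!!i. i \<in> I ==> sqi M (f i)"
 shows "l2 M (%x. \<Sum>i\<in>I. f i x) \<le> (\<Sum>i\<in>I. l2 M (f i))"
 using assms
proof (induction I rule: finite_induct)
 case (insert i I)
 then show ?case using l2_triangle[of M "f i" "%x. \<Sum>i\<in>I. f i x"] sqi_sum[of I M f] by force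
qed auto

lemma l2_cong_AE:
 assumes "AE x in M. f x = g x" "f \<in> borel_measurable M" "g \<in> borel_measurable M"
 shows "l2 M f = l2 M g"
proof -
 have "(\<integral>x. (norm (f x))\<^sup>2 \<partial>M) = (\<integral>x. (norm (g x))\<^sup>2 \<partial>M)"
  by (rule integral_cong_AE) (use assms in auto)
 then show ?thesis by (simp add: l2_def)
qed

lemma sqi_cong_AE:
 assumes "AE x in M. f x = g x" "g \<in> borel_measurable M" "sqi M f"
 shows "sqi M g"
 by (rule sqi_bound(1)[OF assms(2,3), of 1]) (use assms(1) in auto)

lemma l2_zero_AE:
 assumes f: "sqi M f" and "l2 M f = 0"
 shows "AE x in M. f x = 0"
proof -
 have "(\<integral>x. (norm (f x))\<^sup>2 \<partial>M) = 0" using l2_sq[of M f] assms(2) by simp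
 then have "AE x in M. (norm (f x))\<^sup>2 = 0"
  using integral_nonneg_eq_0_iff_AE[of M "%x. (norm (f x))\<^sup>2"] f by (simp add: sqi_def)
 then show ?thesis by simp
qed

lemma sqi_mult_bounded:
 fixes c :: "'a => real"
 assumes [measurable]: "c \<in> borel_measurable M" and f: "sqi M f" and c: "!!x. \<bar>c x\<bar> \<le> K"
 shows "sqi M (%x. c x *\<^sub>R f x)" "l2 M (%x. c x *\<^sub>R f x) \<le> K * l2 M f"
proof -
 have [measurable]: "f \<in> borel_measurable M" using f by (simp add: sqi_def)
 have "K \<ge> 0" using c[of undefined] by linarith
 moreover have "norm (c x *\<^sub>R f x) \<le> K * norm (f x)" for x using c[of x] by (simp add: mult_right_mono)
 ultimately show "sqi M (%x. c x *\<^sub>R f x)" "l2 M (%x. c x *\<^sub>R f x) \<le> K * l2 M f"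
  by (auto intro!: sqi_bound[OF _ f, of "%x. c x *\<^sub>R f x" K])
qed

text \<open>The norm over a subset of the whole space.\<close>

abbreviation restr :: "'a set => ('a => 'b::euclidean_space) => 'a => 'b" where
 "restr S f \<equiv> (%x. indicat_real S x *\<^sub>R f x)"

definition l2on :: "'a::euclidean_space set => ('a => 'b::euclidean_space) => real" where
 "l2on S f = l2 lborel (restr S f)"

lemma l2on_nonneg[simp]: "l2on S f \<ge> 0" by (simp add: l2on_def)

lemma sqi_restr: "S \<in> sets M ==> sqi M f ==> sqi M (restr S f)"
 by (rule sqi_mult_bounded(1)[of _ _ _ 1]) (auto simp: indicator_def)

lemma l2on_UNIV[simp]: "l2on UNIV f = l2 lborel f" by (simp add: l2on_def)

lemma l2on_mono:
 assumes "S \<in> sets borel" "T \<in> sets borel" "S \<subseteq> T" "f \<in> borel_measurable borel" "sqi lborel (restr T f)"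
 shows "l2on S f \<le> l2on T f" "sqi lborel (restr S f)"
proof -
 have [measurable]: "S \<in> sets borel" "T \<in> sets borel" "f \<in> borel_measurable borel" by fact+
 have le: "norm (restr S f x) \<le> 1 * norm (restr T f x)" for x using assms(3) by (auto simp: indicator_def)
 show "l2on S f \<le> l2on T f" "sqi lborel (restr S f)"
  unfolding l2on_def using sqi_bound[OF _ assms(5), of "restr S f" 1] le by auto
qed

lemma l2on_le: "S \<in> sets borel ==> sqi lborel f ==> l2on S f \<le> l2 lborel f"
 unfolding l2on_def using sqi_mult_bounded(2)[of "indicat_real S" lborel f 1] by (auto simp: indicator_def)

section \<open>Invariance of Lebesgue measure under shifts and reflections\<close>

lemma nn_integral_lborel_shift:
 fixes h :: "'a::euclidean_space"
 assumes [measurable]: "f \<in> borel_measurable borel"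
 shows "(\<integral>\<^sup>+x. f (x + h) \<partial>lborel) = (\<integral>\<^sup>+x. f x \<partial>lborel)"
proof -
 have "(\<integral>\<^sup>+x. f x \<partial>lborel) = (\<integral>\<^sup>+x. f x \<partial>distr lborel borel ((+) h))" by (simp add: lborel_distr_plus)
 also have "\<dots> = (\<integral>\<^sup>+x. f (h + x) \<partial>lborel)" by (rule nn_integral_distr) auto
 finally show ?thesis by (simp add: add.commute)
qed

lemma integral_lborel_shift:
 fixes f :: "'a::euclidean_space => 'b::euclidean_space"
 assumes [measurable]: "f \<in> borel_measurable borel"
 shows "(\<integral>x. f (x + h) \<partial>lborel) = (\<integral>x. f x \<partial>lborel)"
proof -
 have "(\<integral>x. f x \<partial>lborel) = (\<integral>x. f x \<partial>distr lborel borel ((+) h))" by (simp add: lborel_distr_plus)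
 also have "\<dots> = (\<integral>x. f (h + x) \<partial>lborel)" by (rule integral_distr) auto
 finally show ?thesis by (simp add: add.commute)
qed

lemma integral_lborel_reflect:
 fixes f :: "'a::euclidean_space => 'b::euclidean_space"
 assumes [measurable]: "f \<in> borel_measurable borel"
 shows "(\<integral>x. f (a - x) \<partial>lborel) = (\<integral>x. f x \<partial>lborel)"
proof -
 have eq: "lborel = distr lborel borel (%x. a - x)"
  using lborel_affine[of "-1" a] by (simp add: density_1)
 have "(\<integral>x. f x \<partial>lborel) = (\<integral>x. f x \<partial>distr lborel borel (%x. a - x))" using eq by simp
 also have "\<dots> = (\<integral>x. f (a - x) \<partial>lborel)" by (rule integral_distr) auto
 finally show ?thesis by simp
qed

lemma sqi_shift:
 fixes f :: "'a::euclidean_space => 'b::euclidean_space"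
 assumes f: "sqi lborel f"
 shows "sqi lborel (%x. f (x + h))" "l2 lborel (%x. f (x + h)) = l2 lborel f"
proof -
 have m[measurable]: "f \<in> borel_measurable borel" using f by (simp add: sqi_def)
 have "(\<integral>\<^sup>+x. ennreal ((norm (f (x + h)))\<^sup>2) \<partial>lborel) = ennreal ((l2 lborel f)\<^sup>2)"
  using nn_integral_lborel_shift[of "%x. ennreal ((norm (f x))\<^sup>2)" h] l2_nn[OF f] by simp
 then show "sqi lborel (%x. f (x + h))" using sqi_l2_nnI(1)[of "%x. f (x + h)" lborel "l2 lborel f"] by auto
 show "l2 lborel (%x. f (x + h)) = l2 lborel f"
  unfolding l2_def using integral_lborel_shift[of "%x. (norm (f x))\<^sup>2" h] by simp
qed

lemma sqi_reflect:
 fixes f :: "'a::euclidean_space => 'b::euclidean_space"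
 assumes f: "sqi lborel f"
 shows "sqi lborel (%x. f (a - x))" "l2 lborel (%x. f (a - x)) = l2 lborel f"
proof -
 have m[measurable]: "f \<in> borel_measurable borel" using f by (simp add: sqi_def)
 have eq: "lborel = distr lborel borel (%x::'a. a - x)"
  using lborel_affine[of "-1" a] by (simp add: density_1)
 have "(\<integral>\<^sup>+x. ennreal ((norm (f x))\<^sup>2) \<partial>lborel) = (\<integral>\<^sup>+x. ennreal ((norm (f x))\<^sup>2) \<partial>distr lborel borel (%x. a - x))" using eq by simp
 also have "\<dots> = (\<integral>\<^sup>+x. ennreal ((norm (f (a - x)))\<^sup>2) \<partial>lborel)" by (rule nn_integral_distr) auto
 finally have "(\<integral>\<^sup>+x. ennreal ((norm (f (a - x)))\<^sup>2) \<partial>lborel) \<le> ennreal ((l2 lborel f)\<^sup>2)" using l2_nn[OF f] by simp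
 from sqi_l2_nnI(1)[OF _ this] show "sqi lborel (%x. f (a - x))" by simp
 show "l2 lborel (%x. f (a - x)) = l2 lborel f"
  unfolding l2_def using integral_lborel_reflect[of "%x. (norm (f x))\<^sup>2" a] by simp
qed

lemma sqi_bounded_support:
 fixes g :: "'a::euclidean_space => 'b::euclidean_space"
 assumes m: "g \<in> borel_measurable borel" and K: "!!x. norm (g x) \<le> K" and s: "!!x. x \<notin> cball a r ==> g x = 0" and r: "r \<ge> 0"
 shows "sqi lborel g" "l2 lborel g \<le> K * sqrt (unit_ball_vol DIM('a) * r ^ DIM('a))"
proof -
 let ?i = "indicat_real (cball a r)"
 have K0: "K \<ge> 0" using K[of a] norm_ge_zero order_trans by blast
 have i: "integrable lborel ?i"
  using emeasure_bounded_finite[of "cball a r"] by (auto simp: integrable_indicator_iff)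
 have si: "sqi lborel ?i" using i by (auto simp: sqi_def power2_eq_square simp flip: indicator_inter_arith)
 have "(l2 lborel ?i)\<^sup>2 = (\<integral>x. ?i x \<partial>lborel)"
  unfolding l2_sq by (rule Bochner_Integration.integral_cong) (auto simp: indicator_def)
 also have "\<dots> = unit_ball_vol DIM('a) * r ^ DIM('a)" using content_cball[OF r, of a] by simp
 finally have l: "l2 lborel ?i = sqrt (unit_ball_vol DIM('a) * r ^ DIM('a))"
  using real_sqrt_unique l2_nonneg by metis
 have "norm (g x) \<le> K * norm (?i x)" for x using K[of x] s[of x] by (auto simp: indicator_def)
 then show "sqi lborel g" "l2 lborel g \<le> K * sqrt (unit_ball_vol DIM('a) * r ^ DIM('a))"
  using sqi_bound[OF _ si, of g K] m K0 l by auto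
qed

section \<open>Compactly supported kernels and convolution\<close>

definition ckern :: "real => ('a::euclidean_space => 'b::euclidean_space) => bool" where
 "ckern r \<rho> \<longleftrightarrow> r > 0 \<and> continuous_on UNIV \<rho> \<and> (\<forall>x. norm x > r --> \<rho> x = 0)"

lemma ckern_measurable[measurable_dest]: "ckern r \<rho> ==> \<rho> \<in> borel_measurable borel"
 by (auto simp: ckern_def borel_measurable_continuous_onI)

lemma ckern_bounded:
 assumes "ckern r \<rho>"
 obtains K where "K > 0" "!!x. norm (\<rho> x) \<le> K"
proof -
 have "compact (\<rho> ` cball 0 r)"
  using assms by (intro compact_continuous_image) (auto simp: ckern_def intro: continuous_on_subset)
 then obtain K where K: "K > 0" "!!x. x \<in> cball 0 r ==> norm (\<rho> x) \<le> K"
  using compact_imp_bounded bounded_pos by (metis imageI)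
 show ?thesis
 proof (rule that[OF K(1)])
  show "norm (\<rho> x) \<le> K" for x using K assms by (cases "norm x > r") (auto simp: ckern_def)
 qed
qed

lemma ckern_sqi: "ckern r \<rho> ==> sqi lborel \<rho>"
proof -
 assume a: "ckern r \<rho>"
 then obtain K where K: "K > 0" "!!x. norm (\<rho> x) \<le> K" using ckern_bounded by blast
 show ?thesis
  by (rule sqi_bounded_support(1)[of _ K 0 r]) (use a K in \<open>auto simp: ckern_def borel_measurable_continuous_onI\<close>)
qed

lemma ckern_uniform:
 assumes a: "ckern r \<rho>" and e: "e > 0"
 obtains d where "d > 0" "d < 1" "!!x y. norm (x - y) < d ==> norm (\<rho> x - \<rho> y) \<le> e"
proof -
 have "uniformly_continuous_on (cball 0 (r+1)) \<rho>"
  using a by (intro compact_uniformly_continuous) (auto simp: ckern_def intro: continuous_on_subset)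
 then obtain d where d: "d > 0" "!!x y. x \<in> cball 0 (r+1) ==> y \<in> cball 0 (r+1) ==> dist y x < d ==> dist (\<rho> y) (\<rho> x) < e"
  unfolding uniformly_continuous_on_def using e by metis
 show ?thesis
 \<comment> \<open>The cap 1/2 settles points outside the ball of radius \<open>r + 1\<close>: if
   one of two such close points lies there, both are outside the support.\<close>
 proof (rule that[of "min d (1/2)"])
  fix x y :: 'a assume xy: "norm (x - y) < min d (1/2)"
  show "norm (\<rho> x - \<rho> y) \<le> e"
  proof (cases "norm x \<le> r + 1 \<and> norm y \<le> r + 1")
   case True then show ?thesis using d(2)[of y x] xy by (simp add: dist_norm)
  next
   case False
   then have "norm x > r" "norm y > r" using xy norm_triangle_ineq2[of x y] norm_triangle_ineq2[of y x] by (auto simp: norm_minus_commute)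
   then show ?thesis using a e by (simp add: ckern_def)
  qed
 qed (use d in auto)
qed

definition conv :: "('a::euclidean_space => real) => ('a => 'b::euclidean_space) => 'a => 'b" where
 "conv \<rho> f x = (\<integral>y. \<rho> (x - y) *\<^sub>R f y \<partial>lborel)"

lemma conv_integrable:
 assumes "ckern r \<rho>" "sqi lborel f"
 shows "integrable lborel (%y. \<rho> (x - y) *\<^sub>R f y)"
 by (rule l2_scaleR_int(1)[OF sqi_reflect(1)[OF ckern_sqi[OF assms(1)]] assms(2)])

lemma conv_alt:
 assumes "ckern r \<rho>" "sqi lborel f"
 shows "conv \<rho> f x = (\<integral>s. \<rho> s *\<^sub>R f (x - s) \<partial>lborel)" "integrable lborel (%s. \<rho> s *\<^sub>R f (x - s))"
proof -
 have [measurable]: "\<rho> \<in> borel_measurable borel" "f \<in> borel_measurable borel"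
  using assms by (auto simp: ckern_measurable sqi_def)
 show "conv \<rho> f x = (\<integral>s. \<rho> s *\<^sub>R f (x - s) \<partial>lborel)"
  unfolding conv_def using integral_lborel_reflect[of "%y. \<rho> (x - y) *\<^sub>R f y" x] by simp
 show "integrable lborel (%s. \<rho> s *\<^sub>R f (x - s))"
  by (rule l2_scaleR_int(1)[OF ckern_sqi[OF assms(1)] sqi_reflect(1)[OF assms(2)]])
qed

text \<open>Turns uniform smallness of a kernel supported in a fixed ball into smallness of its
  integral against an L2 function. Continuity and differentiability of convolutions both reduce to
  it, applied to kernel differences.\<close>

lemma kernel_bound:
 fixes k :: "'a::euclidean_space => real"
 assumes m: "k \<in> borel_measurable borel" and K: "!!x. norm (k x) \<le> K" and s: "!!x. x \<notin> cball a r ==> k x = 0" and r: "r \<ge> 0"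
  and f: "sqi lborel f"
 shows "norm (\<integral>y. k y *\<^sub>R f y \<partial>lborel) \<le> K * sqrt (unit_ball_vol DIM('a) * r ^ DIM('a)) * l2 lborel f"
 using l2_scaleR_int(2)[OF sqi_bounded_support(1)[OF m K s r] f] sqi_bounded_support(2)[OF m K s r]
 by (meson l2_nonneg mult_right_mono order_trans)

lemma conv_continuous:
 fixes \<rho> :: "'a::euclidean_space => real"
 assumes \<rho>: "ckern r \<rho>" and f: "sqi lborel f"
 shows "continuous_on UNIV (conv \<rho> f)"
 unfolding continuous_on_iff
proof (intro ballI allI impI)
 fix x :: 'a and e :: real assume e: "e > 0"
 have [measurable]: "\<rho> \<in> borel_measurable borel" using \<rho> by (rule ckern_measurable)
 have r: "r > 0" using \<rho> by (simp add: ckern_def)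
 \<comment> \<open>The summand 1 only keeps \<open>C\<close> positive as a divisor. The radius
   \<open>r + 1\<close> covers the supports of both kernels, whose centres are less than 1
   apart.\<close>
 define C where "C = sqrt (unit_ball_vol DIM('a) * (r+1) ^ DIM('a)) * l2 lborel f + 1"
 have C: "C > 0" unfolding C_def using r by (simp add: add_nonneg_pos)
 obtain d where d: "d > 0" "d < 1" "!!x y. norm (x - y) < d ==> norm (\<rho> x - \<rho> y) \<le> e/(2*C)"
  using ckern_uniform[OF \<rho>, of "e/(2*C)"] e C by auto
 show "\<exists>d>0. \<forall>x'\<in>UNIV. dist x' x < d --> dist (conv \<rho> f x') (conv \<rho> f x) < e"
 proof (intro exI[of _ d] conjI ballI impI d(1))
  fix x' assume "dist x' x < d"
  then have xx: "norm (x' - x) < d" by (simp add: dist_norm)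
  have "conv \<rho> f x' - conv \<rho> f x = (\<integral>y. (\<rho> (x' - y) - \<rho> (x - y)) *\<^sub>R f y \<partial>lborel)"
   unfolding conv_def using conv_integrable[OF \<rho> f] by (simp add: scaleR_diff_left)
  also have "norm \<dots> \<le> e/(2*C) * sqrt (unit_ball_vol DIM('a) * (r+1) ^ DIM('a)) * l2 lborel f"
  proof (rule kernel_bound[of _ _ x])
   show "norm (\<rho> (x' - y) - \<rho> (x - y)) \<le> e/(2*C)" for y using d(3)[of "x' - y" "x - y"] xx by simp
   fix y assume "y \<notin> cball x (r+1)"
   then have "norm (x - y) > r + 1" by (simp add: dist_norm)
   moreover then have "norm (x' - y) > r" using xx d(2) norm_triangle_ineq[of "x' - y" "x - x'"] by (simp add: norm_minus_commute)
   ultimately show "\<rho> (x' - y) - \<rho> (x - y) = 0" using \<rho> by (simp add: ckern_def)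
  qed (use r f in auto)
  also have "\<dots> \<le> e/(2*C) * C"
   using mult_left_mono[of "sqrt (unit_ball_vol DIM('a) * (r+1) ^ DIM('a)) * l2 lborel f" C "e/(2*C)"] e C
   by (simp add: C_def mult.assoc)
  also have "\<dots> < e" using e C by simp
  finally show "dist (conv \<rho> f x') (conv \<rho> f x) < e" by (simp add: dist_norm)
 qed
qed

lemma linear_Basis_sum:
 fixes F :: "'a::euclidean_space => real"
 assumes "linear F"
 shows "F h = (\<Sum>b\<in>Basis. (h \<bullet> b) * F b)"
 using linear_sum[OF assms, of "%b. (h \<bullet> b) *\<^sub>R b" Basis] linear_scale[OF assms]
 by (simp add: euclidean_representation)

text \<open>The mean value inequality is applied to the remainder as a function of the increment;
  its derivative is small by uniform continuity of the partial derivatives. Independence of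
  \<open>z\<close> is what permits differentiation under the integral sign.\<close>

lemma taylor_uniform:
 fixes \<rho> :: "'a::euclidean_space => real"
 assumes D: "!!z. (\<rho> has_derivative \<rho>' z) (at z)" and k: "!!b. b \<in> Basis ==> ckern r (%z. \<rho>' z b)" and e: "e > 0"
 obtains d where "d > 0" "d < 1" "!!z h. norm h < d ==> norm (\<rho> (z + h) - \<rho> z - \<rho>' z h) \<le> e * norm h"
proof -
 have "\<exists>d. d > 0 \<and> d < 1 \<and> (\<forall>x y. norm (x - y) < d --> norm (\<rho>' x b - \<rho>' y b) \<le> e / DIM('a))" if "b \<in> Basis" for b
  using ckern_uniform[OF k[OF that], of "e / DIM('a)"] e by (metis DIM_positive divide_pos_pos of_nat_0_less_iff)
 then obtain \<delta> where \<delta>: "!!b. b \<in> Basis ==> \<delta> b > 0 \<and> \<delta> b < 1 \<and> (\<forall>x y. norm (x - y) < \<delta> b --> norm (\<rho>' x b - \<rho>' y b) \<le> e / DIM('a))"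
  by metis
 define d where "d = Min (\<delta> ` Basis)"
 have d: "d > 0" "d \<le> \<delta> b" if "b \<in> Basis" for b using that \<delta> by (auto simp: d_def)
 have d0: "d > 0" "d < 1" using d[OF SOME_Basis] \<delta>[OF SOME_Basis] by auto
 show ?thesis
 proof (rule that[OF d0])
  fix z h :: 'a assume h: "norm h < d"
  have bl: "linear (\<rho>' y)" for y using D has_derivative_linear by blast
  have on: "onorm (%v. \<rho>' (z + k) v - \<rho>' z v) \<le> e" if "norm k < d" for k
  proof (rule onorm_le)
   fix v :: 'a
   have "\<rho>' (z + k) v - \<rho>' z v = (\<Sum>b\<in>Basis. (v \<bullet> b) * (\<rho>' (z + k) b - \<rho>' z b))"
    unfolding linear_Basis_sum[OF bl, of _ v] by (simp add: sum_subtractf algebra_simps)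
   also have "norm \<dots> \<le> (\<Sum>b\<in>(Basis :: 'a set). norm v * (e / DIM('a)))"
   proof (rule order_trans[OF norm_sum sum_mono])
    fix b :: 'a assume b: "b \<in> Basis"
    then have "norm (\<rho>' (z + k) b - \<rho>' z b) \<le> e / DIM('a)" using \<delta>[OF b] d(2)[OF b] that by (simp add: )
    then show "norm ((v \<bullet> b) * (\<rho>' (z + k) b - \<rho>' z b)) \<le> norm v * (e / DIM('a))"
     using mult_mono[OF Basis_le_norm[OF b, of v], of "norm (\<rho>' (z + k) b - \<rho>' z b)" "e / DIM('a)"] by (simp add: abs_mult)
   qed
   finally show "norm (\<rho>' (z + k) v - \<rho>' z v) \<le> e * norm v" by (simp add: mult.commute)
  qed
  let ?g = "%k. \<rho> (z + k) - \<rho>' z k"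
  have blz: "bounded_linear (\<rho>' z)" using D has_derivative_bounded_linear by blast
  have "norm (?g h - ?g 0) \<le> e * norm (h - 0)"
  proof (rule differentiable_bound[of "ball 0 d" ?g "%k v. \<rho>' (z + k) v - \<rho>' z v"])
   fix k :: 'a assume "k \<in> ball 0 d"
   then show "onorm (%v. \<rho>' (z + k) v - \<rho>' z v) \<le> e" by (intro on) simp
   have "((%k. \<rho> (z + k)) has_derivative \<rho>' (z + k)) (at k)"
    by (rule has_derivative_compose[of "%k. z + k" "%v. v", OF _ D, simplified]) (auto intro!: derivative_eq_intros)
   then have "(?g has_derivative (%v. \<rho>' (z + k) v - \<rho>' z v)) (at k)"
    by (intro has_derivative_diff bounded_linear_imp_has_derivative[OF blz])
   then show "(?g has_derivative (%v. \<rho>' (z + k) v - \<rho>' z v)) (at k within ball 0 d)" by (rule has_derivative_at_withinI)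
  qed (use h d0 in auto)
  then show "norm (\<rho> (z + h) - \<rho> z - \<rho>' z h) \<le> e * norm h" using linear_0[OF bl] by (simp add: algebra_simps)
 qed
qed

text \<open>All differentiation falls on the kernel, so \<open>f\<close> need only be square
  integrable: the Taylor remainder of the kernel is integrated against \<open>f\<close> by
  \<open>kernel_bound\<close>.\<close>

lemma conv_has_derivative:
 fixes \<rho> :: "'a::euclidean_space => real" and f :: "'a => 'b::euclidean_space"
 assumes D: "!!z. (\<rho> has_derivative \<rho>' z) (at z)" and \<rho>: "ckern r \<rho>" and k: "!!b. b \<in> Basis ==> ckern r (%z. \<rho>' z b)" and f: "sqi lborel f"
 shows "(conv \<rho> f has_derivative (%h. \<Sum>b\<in>Basis. (h \<bullet> b) *\<^sub>R conv (%z. \<rho>' z b) f x)) (at x)"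
 unfolding has_derivative_at_alt
proof (intro conjI allI impI)
 let ?F = "%h. \<Sum>b\<in>Basis. (h \<bullet> b) *\<^sub>R conv (%z. \<rho>' z b) f x"
 show "bounded_linear ?F"
  by (intro bounded_linear_sum bounded_linear_scaleR_const bounded_linear_inner_left)
 fix e :: real assume e: "e > 0"
 have m[measurable]: "\<rho> \<in> borel_measurable borel" using \<rho> by (rule ckern_measurable)
 have r: "r > 0" using \<rho> by (simp add: ckern_def)
 have bl: "linear (\<rho>' y)" for y using D has_derivative_linear by blast
 have rep: "\<rho>' z h = (\<Sum>b\<in>Basis. (h \<bullet> b) * \<rho>' z b)" for z h
  by (rule linear_Basis_sum[OF bl])
 define C where "C = sqrt (unit_ball_vol DIM('a) * (r+1) ^ DIM('a)) * l2 lborel f + 1"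
 have C: "C > 0" unfolding C_def using r by (simp add: add_nonneg_pos)
 obtain d where d: "d > 0" "d < 1" "!!z h. norm h < d ==> norm (\<rho> (z + h) - \<rho> z - \<rho>' z h) \<le> e/C * norm h"
  using taylor_uniform[OF D k, of "e/C"] e C by auto
 show "\<exists>d>0. \<forall>y. norm (y - x) < d --> norm (conv \<rho> f y - conv \<rho> f x - ?F (y - x)) \<le> e * norm (y - x)"
 proof (intro exI[of _ d] conjI allI impI d(1))
  fix y assume xy: "norm (y - x) < d"
  let ?k = "%u. \<rho> (y - u) - \<rho> (x - u) - \<rho>' (x - u) (y - x)"
  have Fi: "integrable lborel (%u. \<rho>' (x - u) (y - x) *\<^sub>R f u)" and
   F: "?F (y - x) = (\<integral>u. \<rho>' (x - u) (y - x) *\<^sub>R f u \<partial>lborel)"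
   unfolding conv_def rep[of _ "y - x"] using conv_integrable[OF k f]
   by (simp_all add: scaleR_sum_left flip: scaleR_scaleR)
  have "conv \<rho> f y - conv \<rho> f x - ?F (y - x) = (\<integral>u. ?k u *\<^sub>R f u \<partial>lborel)"
   unfolding F using conv_integrable[OF \<rho> f] Fi by (simp add: conv_def scaleR_diff_left)
  also have "norm \<dots> \<le> (e/C * norm (y - x)) * sqrt (unit_ball_vol DIM('a) * (r+1) ^ DIM('a)) * l2 lborel f"
  proof (rule kernel_bound[of _ _ x])
   show "norm (?k u) \<le> e/C * norm (y - x)" for u using d(3)[of "y - x" "x - u"] xy by simp
   have [measurable]: "(%z. \<rho>' z b) \<in> borel_measurable borel" if "b \<in> Basis" for b using k[OF that] by (rule ckern_measurable)
   show "?k \<in> borel_measurable borel" unfolding rep[of _ "y - x"] by measurable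
   fix u assume "u \<notin> cball x (r+1)"
   then have 1: "norm (x - u) > r + 1" by (simp add: dist_norm)
   then have 2: "norm (y - u) > r" using xy d(2) norm_triangle_ineq[of "y - u" "x - y"] by (simp add: norm_minus_commute)
   have "\<rho>' (x - u) b = 0" if "b \<in> Basis" for b using k[OF that] 1 by (simp add: ckern_def)
   then show "?k u = 0" unfolding rep[of _ "y - x"] using \<rho> 1 2 by (simp add: ckern_def)
  qed (use r f in auto)
  also have "\<dots> \<le> (e/C * norm (y - x)) * C"
   using mult_left_mono[of "sqrt (unit_ball_vol DIM('a) * (r+1) ^ DIM('a)) * l2 lborel f" C "e/C * norm (y - x)"] e C
   by (simp add: C_def mult.assoc)
  also have "\<dots> = e * norm (y - x)" using C by simp
  finally show "norm (conv \<rho> f y - conv \<rho> f x - ?F (y - x)) \<le> e * norm (y - x)" .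
 qed
qed

lemma smooth_deriv:
 assumes "smooth_on UNIV \<rho>"
 shows "(\<rho> has_derivative frechet_derivative \<rho> (at z)) (at z)"
  and "b \<in> Basis ==> smooth_on UNIV (%z. frechet_derivative \<rho> (at z) b)"
proof -
 have S: "Ck_on (Suc k) UNIV \<rho>" for k using assms by (simp add: smooth_on_def)
 show "(\<rho> has_derivative frechet_derivative \<rho> (at z)) (at z)" using Ck_on_SucD[OF open_UNIV S] by simp
 show "smooth_on UNIV (%z. frechet_derivative \<rho> (at z) b)" if "b \<in> Basis"
  using S that by (simp add: smooth_on_def)
qed

lemma smooth_continuous: "smooth_on UNIV \<rho> ==> continuous_on UNIV \<rho>"
 by (metis Ck_on.simps(1) smooth_on_def)

lemma frechet_derivative_zero:
 assumes "open S" "x \<in> S" "!!y. y \<in> S ==> f y = 0"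
 shows "frechet_derivative f (at x) = (%_. 0)"
proof -
 have "(f has_derivative (%_. 0)) (at x)"
  by (rule has_derivative_transform_within_open[of "%_. 0", OF _ assms(1,2)]) (use assms(3) in auto)
 then show ?thesis using frechet_derivative_at by metis
qed

lemma ckern_deriv:
 assumes "smooth_on UNIV \<rho>" "ckern r \<rho>" "b \<in> Basis"
 shows "ckern r (%z. frechet_derivative \<rho> (at z) b)"
proof -
 have "open {x::'a. norm x > r}" by (intro open_Collect_less continuous_intros)
 then have "frechet_derivative \<rho> (at x) = (%_. 0)" if "norm x > r" for x
  by (rule frechet_derivative_zero) (use assms that in \<open>auto simp: ckern_def\<close>)
 then show ?thesis using assms smooth_continuous[OF smooth_deriv(2)[OF assms(1,3)]] by (simp add: ckern_def)
qed

text \<open>The induction runs over kernels, since each partial derivative of the convolution is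
  again a convolution with a smooth kernel of the same support radius.\<close>

lemma conv_smooth:
 fixes \<rho> :: "'a::euclidean_space => real" and f :: "'a => 'b::euclidean_space"
 assumes "smooth_on UNIV \<rho>" "ckern r \<rho>" and f: "sqi lborel f"
 shows "smooth_on UNIV (conv \<rho> f)"
proof -
 have "Ck_on k UNIV (conv \<rho> f)" for k using assms(1,2)
 proof (induction k arbitrary: \<rho>)
  case 0 then show ?case using conv_continuous[OF _ f] by simp
 next
  case (Suc k)
  note D = conv_has_derivative[OF smooth_deriv(1)[OF Suc.prems(1)] Suc.prems(2) ckern_deriv[OF Suc.prems] f]
  show ?case
  proof (rule Ck_on_SucI[OF open_UNIV D])
   fix b :: 'a assume b: "b \<in> Basis"
   have "Ck_on k UNIV (conv (%z. frechet_derivative \<rho> (at z) b) f)"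
    by (rule Suc.IH) (use smooth_deriv(2) ckern_deriv Suc.prems b in auto)
   then show "Ck_on k UNIV (%x. \<Sum>b'\<in>Basis. (b \<bullet> b') *\<^sub>R conv (%z. frechet_derivative \<rho> (at z) b') f x)"
    using b by (simp add: inner_Basis if_distrib[of "%c. c *\<^sub>R _"] cong: if_cong)
  qed
 qed
 then show ?thesis by (simp add: smooth_on_def)
qed

text \<open>Writing the kernel as the square of its root, Cauchy-Schwarz bounds the pointwise error
  by a kernel average of squared translation errors; integrating in \<open>x\<close> first then
  leaves only the L2 modulus of continuity of \<open>f\<close>.\<close>

lemma conv_approx:
 fixes \<rho> :: "'a::euclidean_space => real" and f :: "'a => 'b::euclidean_space"
 assumes \<rho>: "ckern r \<rho>" and nn: "!!x. \<rho> x \<ge> 0" and one: "(\<integral>x. \<rho> x \<partial>lborel) = 1" and f: "sqi lborel f"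
  and tr: "!!s. norm s \<le> r ==> l2 lborel (%x. f (x + s) - f x) \<le> e" and e: "e \<ge> 0"
 shows "sqi lborel (conv \<rho> f)" "l2 lborel (%x. conv \<rho> f x - f x) \<le> e"
proof -
 have [measurable]: "\<rho> \<in> borel_measurable borel" "f \<in> borel_measurable borel"
  using \<rho> f by (auto simp: ckern_measurable sqi_def)
 have [measurable]: "conv \<rho> f \<in> borel_measurable borel"
  by (rule borel_measurable_continuous_onI[OF conv_continuous[OF \<rho> f]])
 have i\<rho>: "integrable lborel \<rho>" using one not_integrable_integral_eq by fastforce
 let ?q = "%s. sqrt (\<rho> s)"
 have q: "sqi lborel ?q" and q1: "l2 lborel ?q = 1" using i\<rho> nn one by (auto simp: sqi_def l2_def)
 have key: "ennreal ((norm (conv \<rho> f x - f x))\<^sup>2) \<le> (\<integral>\<^sup>+s. ennreal (\<rho> s) * ennreal ((norm (f (x - s) - f x))\<^sup>2) \<partial>lborel)" for x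
 proof -
  let ?g = "%s. ?q s *\<^sub>R (f (x - s) - f x)"
  obtain K where K: "!!x. norm (\<rho> x) \<le> K" using ckern_bounded[OF \<rho>] by blast
  have "sqi lborel (%s. ?q s *\<^sub>R f (x - s))"
   by (rule sqi_mult_bounded(1)[OF _ sqi_reflect(1)[OF f], of _ "sqrt K"]) (use K nn in auto)
  moreover have "sqi lborel (%s. ?q s *\<^sub>R f x)"
   by (rule sqi_bound(1)[OF _ q, of _ "norm (f x)"]) auto
  ultimately have g: "sqi lborel ?g" using sqi_diff by (fastforce simp: scaleR_diff_right)
  have "conv \<rho> f x - f x = (\<integral>s. \<rho> s *\<^sub>R f (x - s) \<partial>lborel) - (\<integral>s. \<rho> s *\<^sub>R f x \<partial>lborel)"
   using one i\<rho> by (simp add: conv_alt[OF \<rho> f])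
  also have "\<dots> = (\<integral>s. ?q s *\<^sub>R ?g s \<partial>lborel)"
   using conv_alt(2)[OF \<rho> f, of x] i\<rho> nn by (simp add: scaleR_diff_right)
  finally have "norm (conv \<rho> f x - f x) \<le> l2 lborel ?g"
   using l2_scaleR_int(2)[OF q g] q1 by simp
  then have "ennreal ((norm (conv \<rho> f x - f x))\<^sup>2) \<le> ennreal ((l2 lborel ?g)\<^sup>2)"
   by (intro ennreal_leI power_mono) auto
  also have "\<dots> = (\<integral>\<^sup>+s. ennreal (\<rho> s) * ennreal ((norm (f (x - s) - f x))\<^sup>2) \<partial>lborel)"
   unfolding l2_nn[OF g, symmetric] using nn by (simp add: power_mult_distrib ennreal_mult)
  finally show ?thesis .
 qed
 have "(\<integral>\<^sup>+x. ennreal ((norm (conv \<rho> f x - f x))\<^sup>2) \<partial>lborel)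
   \<le> (\<integral>\<^sup>+x. (\<integral>\<^sup>+s. ennreal (\<rho> s) * ennreal ((norm (f (x - s) - f x))\<^sup>2) \<partial>lborel) \<partial>lborel)"
  by (rule nn_integral_mono) (use key in auto)
 also have "\<dots> = (\<integral>\<^sup>+s. (\<integral>\<^sup>+x. ennreal (\<rho> s) * ennreal ((norm (f (x - s) - f x))\<^sup>2) \<partial>lborel) \<partial>lborel)"
  by (rule lborel_pair.Fubini') measurable
 also have "\<dots> \<le> (\<integral>\<^sup>+s. ennreal (\<rho> s) * ennreal (e\<^sup>2) \<partial>lborel)"
 proof (rule nn_integral_mono)
  fix s :: 'a
  have "(\<integral>\<^sup>+x. ennreal ((norm (f (x - s) - f x))\<^sup>2) \<partial>lborel) \<le> ennreal (e\<^sup>2)" if "norm s \<le> r"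
  proof -
   have "sqi lborel (%x. f (x + (- s)) - f x)" by (intro sqi_diff sqi_shift f)
   from l2_nn[OF this] show ?thesis using tr[of "- s"] that e by (simp add: power_mono ennreal_leI)
  qed
  then show "(\<integral>\<^sup>+x. ennreal (\<rho> s) * ennreal ((norm (f (x - s) - f x))\<^sup>2) \<partial>lborel) \<le> ennreal (\<rho> s) * ennreal (e\<^sup>2)"
   using \<rho> by (cases "norm s \<le> r") (auto simp: nn_integral_cmult ckern_def mult_left_mono)
 qed
 also have "\<dots> = ennreal (e\<^sup>2)"
  using nn_integral_eq_integral[OF i\<rho>] nn one by (simp add: nn_integral_multc)
 finally have le: "(\<integral>\<^sup>+x. ennreal ((norm (conv \<rho> f x - f x))\<^sup>2) \<partial>lborel) \<le> ennreal (e\<^sup>2)" .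
 show "l2 lborel (%x. conv \<rho> f x - f x) \<le> e" using sqi_l2_nnI(2)[OF _ le e] by simp
 have "sqi lborel (%x. conv \<rho> f x - f x)" using sqi_l2_nnI(1)[OF _ le e] by simp
 from sqi_add[OF this f] show "sqi lborel (conv \<rho> f)" by simp
qed

section \<open>Continuous approximation and L2-continuity of translations\<close>

lemma dominated_l2:
 fixes f :: "'a => 'b::euclidean_space"
 assumes [measurable]: "!!i. g i \<in> borel_measurable M" "f \<in> borel_measurable M" and w: "sqi M w"
  and bound: "!!i. AE x in M. norm (f x - g i x) \<le> norm (w x)"
  and lim: "AE x in M. (%i. g i x) \<longlonglongrightarrow> f x"
 shows "(%i. l2 M (%x. f x - g i x)) \<longlonglongrightarrow> 0"
proof -
 have "(%i. \<integral>x. (norm (f x - g i x))\<^sup>2 \<partial>M) \<longlonglongrightarrow> (\<integral>x. 0 \<partial>M)"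
 proof (rule integral_dominated_convergence[where w="%x. (norm (w x))\<^sup>2"])
  show "integrable M (%x. (norm (w x))\<^sup>2)" using w by (simp add: sqi_def)
  show "AE x in M. (%i. (norm (f x - g i x))\<^sup>2) \<longlonglongrightarrow> 0"
   using lim
  proof eventually_elim
   case (elim x)
   have "(%i. (norm (f x - g i x))\<^sup>2) \<longlonglongrightarrow> (norm (f x - f x))\<^sup>2" by (intro tendsto_intros elim)
   then show ?case by simp
  qed
  show "AE x in M. norm ((norm (f x - g i x))\<^sup>2) \<le> (norm (w x))\<^sup>2" for i
   using bound[of i] by eventually_elim (simp add: power_mono)
 qed auto
 then have "(%i. sqrt (\<integral>x. (norm (f x - g i x))\<^sup>2 \<partial>M)) \<longlonglongrightarrow> sqrt 0" by (intro tendsto_intros) simp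
 then show ?thesis by (simp add: l2_def)
qed

text \<open>Truncating both the argument and the value of \<open>f\<close> first makes dominated
  convergence available for the almost everywhere convergent continuous functions that measurability
  provides.\<close>

lemma l2_dense_ckern:
 fixes f :: "'a::euclidean_space => 'b::euclidean_space"
 assumes f: "sqi lborel f" and e: "e > 0"
 obtains g r where "ckern r g" "l2 lborel (%x. f x - g x) < e"
proof -
 have fm[measurable]: "f \<in> borel_measurable borel" using f by (simp add: sqi_def)
 define S where "S N = {x. norm x \<le> real N \<and> norm (f x) \<le> real N}" for N :: nat
 have Sm[measurable]: "S N \<in> sets borel" for N unfolding S_def by measurable
 have "(%N. l2 lborel (%x. f x - restr (S N) f x)) \<longlonglongrightarrow> 0"
 proof (rule dominated_l2[OF _ _ f])
  show "AE x in lborel. (%N. restr (S N) f x) \<longlonglongrightarrow> f x"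
  proof (rule AE_I2)
   fix x :: 'a
   obtain N0 where N0: "norm x \<le> real N0" "norm (f x) \<le> real N0"
    using real_arch_simple[of "max (norm x) (norm (f x))"] by auto
   have "\<forall>\<^sub>F N in sequentially. restr (S N) f x = f x"
    using eventually_ge_at_top[of N0] by eventually_elim (use N0 in \<open>auto simp: S_def\<close>)
   then show "(%N. restr (S N) f x) \<longlonglongrightarrow> f x" by (rule tendsto_eventually)
  qed
 qed (auto simp: indicator_def)
 then have "\<forall>\<^sub>F N in sequentially. l2 lborel (%x. f x - restr (S N) f x) < e/2"
  using e by (intro order_tendstoD) auto
 then obtain N where N: "l2 lborel (%x. f x - restr (S N) f x) < e/2" by (auto simp: eventually_sequentially)
 let ?F = "restr (S N) f"
 have Fm: "?F \<in> borel_measurable borel" by measurable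
 then have "?F \<in> borel_measurable lebesgue" by (intro measurable_completion) simp
 \<comment> \<open>The gauge-integral notion \<open>measurable_on\<close> is by definition an almost
   everywhere limit of continuous functions.\<close>
 then have "?F measurable_on UNIV" using measurable_on_iff_borel_measurable[of UNIV ?F] by (simp add: lebesgue_on_UNIV_eq)
 then obtain Z g where Z: "negligible Z" and g: "!!n. continuous_on UNIV (g n)" "!!x. x \<notin> Z ==> (%n. g n x) \<longlonglongrightarrow> ?F x"
  unfolding measurable_on_def by auto
 define cut where "cut x = max 0 (min 1 (real N + 1 - norm x))" for x :: 'a
 \<comment> \<open>Projecting onto the ball of radius \<open>N\<close> and cutting off beyond radius
   \<open>N\<close> keep continuity, give a common bound and a common support, and change nothing in
   the limit.\<close>
 define h where "h n x = cut x *\<^sub>R closest_point (cball 0 (real N)) (g n x)" for n x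
 have cc: "continuous_on T (closest_point (cball (0::'b) (real N)))" for T
  by (rule continuous_on_closest_point) auto
 have hc: "continuous_on UNIV (h n)" for n
  unfolding h_def cut_def by (intro continuous_intros continuous_on_compose2[OF cc[of UNIV] g(1)]) auto
 have hk: "ckern (real N + 1) (h n)" for n
  using hc by (auto simp: ckern_def h_def cut_def)
 have clb: "norm (closest_point (cball (0::'b) (real N)) y) \<le> real N" for y
  using closest_point_in_set[of "cball (0::'b) (real N)" y] by simp
 have Fb: "norm (?F x) \<le> real N" for x by (auto simp: S_def indicator_def)
 have "(%n. l2 lborel (%x. ?F x - h n x)) \<longlonglongrightarrow> 0"
 proof (rule dominated_l2)
  let ?w = "%x::'a. indicat_real (cball 0 (real N + 1)) x * (2 * real N)"
  show "sqi lborel ?w" by (rule sqi_bounded_support(1)[of _ "2 * real N" 0 "real N + 1"]) (auto simp: indicator_def)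
  show "AE x in lborel. norm (?F x - h n x) \<le> norm (?w x)" for n
  proof (rule AE_I2)
   fix x :: 'a
   have "norm (h n x) \<le> 1 * real N" unfolding h_def norm_scaleR using clb by (intro mult_mono) (auto simp: cut_def)
   then have "norm (?F x - h n x) \<le> 2 * real N" using Fb[of x] norm_triangle_ineq4[of "?F x" "h n x"] by linarith
   moreover have "?F x = 0 \<and> h n x = 0" if "x \<notin> cball 0 (real N + 1)" using that by (auto simp: h_def cut_def S_def indicator_def)
   ultimately show "norm (?F x - h n x) \<le> norm (?w x)" by (cases "x \<in> cball 0 (real N + 1)") auto
  qed
  have "AE x in lebesgue. x \<notin> Z" using Z by (simp add: AE_not_in negligible_iff_null_sets)
  then have "AE x in lborel. x \<notin> Z" by (simp add: AE_completion_iff)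
  then show "AE x in lborel. (%n. h n x) \<longlonglongrightarrow> ?F x"
  proof eventually_elim
   case (elim x)
   have "isCont (closest_point (cball (0::'b) (real N))) (?F x)" using cc[of UNIV] by (simp add: continuous_on_eq_continuous_at)
   then have "(%n. closest_point (cball 0 (real N)) (g n x)) \<longlonglongrightarrow> closest_point (cball 0 (real N)) (?F x)"
    using g(2)[OF elim] by (rule isCont_tendsto_compose)
   then have "(%n. h n x) \<longlonglongrightarrow> cut x *\<^sub>R closest_point (cball 0 (real N)) (?F x)"
    unfolding h_def by (intro tendsto_intros)
   moreover have "closest_point (cball 0 (real N)) (?F x) = ?F x"
    using Fb by (intro closest_point_self) auto
   moreover have "cut x *\<^sub>R ?F x = ?F x" by (auto simp: cut_def S_def indicator_def)
   ultimately show ?case by (simp only:)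
  qed
 qed (use hc in \<open>auto intro: borel_measurable_continuous_onI\<close>)
 then have "\<forall>\<^sub>F n in sequentially. l2 lborel (%x. ?F x - h n x) < e/2"
  using e by (intro order_tendstoD) auto
 then obtain n where n: "l2 lborel (%x. ?F x - h n x) < e/2" by (auto simp: eventually_sequentially)
 have Fs: "sqi lborel ?F" by (rule sqi_restr) (use f in auto)
 have "l2 lborel (%x. (f x - ?F x) + (?F x - h n x)) \<le> l2 lborel (%x. f x - ?F x) + l2 lborel (%x. ?F x - h n x)"
  by (intro l2_triangle sqi_diff f Fs ckern_sqi[OF hk])
 then have "l2 lborel (%x. f x - h n x) < e" using N n by simp
 then show ?thesis using that hk by blast
qed

text \<open>Three thirds of \<open>e\<close>: two for replacing \<open>f\<close> by a continuous
  compactly supported function at both places, one for the uniform continuity of that function on a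
  bounded set.\<close>

lemma l2_translation_continuous:
 fixes f :: "'a::euclidean_space => 'b::euclidean_space"
 assumes f: "sqi lborel f" and e: "e > 0"
 obtains d where "d > 0" "!!h. norm h \<le> d ==> l2 lborel (%x. f (x + h) - f x) \<le> e"
proof -
 obtain g r where g: "ckern r g" "l2 lborel (%x. f x - g x) < e/3" using l2_dense_ckern[OF f, of "e/3"] e by (metis divide_pos_pos zero_less_numeral)
 have r: "r > 0" and [measurable]: "g \<in> borel_measurable borel" using g ckern_measurable by (auto simp: ckern_def)
 define C where "C = sqrt (unit_ball_vol DIM('a) * (r+1) ^ DIM('a)) + 1"
 have C: "C > 0" unfolding C_def using r by (simp add: add_nonneg_pos)
 obtain d where d: "d > 0" "d < 1" "!!x y. norm (x - y) < d ==> norm (g x - g y) \<le> e/(3*C)"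
  using ckern_uniform[OF g(1), of "e/(3*C)"] e C by auto
 show ?thesis
 proof (rule that[of "d/2"])
  fix h :: 'a assume h: "norm h \<le> d/2"
  note gs = ckern_sqi[OF g(1)]
  have "l2 lborel (%x. g (x + h) - g x) \<le> e/(3*C) * sqrt (unit_ball_vol DIM('a) * (r+1) ^ DIM('a))"
  proof (rule sqi_bounded_support(2)[of _ _ 0])
   show "norm (g (x + h) - g x) \<le> e/(3*C)" for x using d h by simp
   fix x :: 'a assume "x \<notin> cball 0 (r+1)"
   then have "norm x > r + 1" by simp
   moreover then have "norm (x + h) > r" using h d norm_triangle_ineq[of "x + h" "- h"] by simp
   ultimately show "g (x + h) - g x = 0" using g(1) by (simp add: ckern_def)
  qed (use r in auto)
  also have "\<dots> \<le> e/(3*C) * C" using e C by (intro mult_left_mono) (auto simp: C_def)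
  finally have 1: "l2 lborel (%x. g (x + h) - g x) \<le> e/3" using C by simp
  have "l2 lborel (%x. (f (x + h) - g (x + h)) + ((g (x + h) - g x) - (f x - g x)))
    \<le> l2 lborel (%x. f (x + h) - g (x + h)) + (l2 lborel (%x. g (x + h) - g x) + l2 lborel (%x. f x - g x))"
   by (intro order_trans[OF l2_triangle] add_left_mono l2_diff_le(1) sqi_diff sqi_shift f gs)
  also have "l2 lborel (%x. f (x + h) - g (x + h)) = l2 lborel (%x. f x - g x)"
   using sqi_shift(2)[OF sqi_diff[OF f gs]] .
  finally show "l2 lborel (%x. f (x + h) - f x) \<le> e" using 1 g(2) by simp
 qed (use d in auto)
qed

text \<open>A smooth mollifier at scale \<open>d\<close>.\<close>

definition mollifier :: "real => ('a::euclidean_space => real) => bool" where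
 "mollifier d \<rho> \<longleftrightarrow> smooth_on UNIV \<rho> \<and> ckern d \<rho> \<and> (\<forall>x. \<rho> x \<ge> 0) \<and> (\<integral>x. \<rho> x \<partial>lborel) = 1"

lemma mollifier_exists:
 assumes d: "d > 0"
 obtains \<rho> :: "'a::euclidean_space => real" where "mollifier d \<rho>"
proof -
 obtain \<beta> :: "'a => real" where b: "smooth_on UNIV \<beta>" "!!x. \<beta> x \<ge> 0" "!!x. \<beta> x > 0 \<longleftrightarrow> norm x < 1" "!!x. \<beta> x \<le> 1"
  using smooth_bump by blast
 let ?g = "%x. \<beta> (0 + (1/d) *\<^sub>R x)"
 have gs: "smooth_on UNIV ?g" using b(1) Ck_on_affine unfolding smooth_on_def by blast
 have gpos: "?g x > 0 \<longleftrightarrow> norm x < d" for x using b(3)[of "(1/d) *\<^sub>R x"] d by (simp add: field_simps)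
 then have g0: "?g x = 0" if "norm x \<ge> d" for x using that b(2) by (metis less_eq_real_def linorder_not_le)
 have gk: "ckern d ?g" using d smooth_continuous[OF gs] g0 by (auto simp: ckern_def)
 have gm[measurable]: "?g \<in> borel_measurable borel" using gk by (rule ckern_measurable)
 have gi: "integrable lborel ?g"
 proof (rule Bochner_Integration.integrable_bound)
  show "integrable lborel (indicat_real (cball (0::'a) d))"
   using emeasure_bounded_finite[of "cball (0::'a) d"] by (auto simp: integrable_indicator_iff)
  show "AE x in lborel. norm (?g x) \<le> norm (indicat_real (cball 0 d) x)"
  proof (rule AE_I2)
   fix x :: 'a
   show "norm (?g x) \<le> norm (indicat_real (cball 0 d) x)"
    using b(2)[of "0 + (1/d) *\<^sub>R x"] b(4)[of "0 + (1/d) *\<^sub>R x"] g0[of x] by (cases "norm x \<le> d") (simp_all del: add_0)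
  qed
 qed measurable
 define c where "c = (\<integral>x. ?g x \<partial>lborel)"
 have "c \<noteq> 0"
 proof
  assume "c = 0"
  then have "AE x in lborel. ?g x = 0" using integral_nonneg_eq_0_iff_AE[OF gi] b(2) by (simp add: c_def)
  then have "AE x::'a in lborel. x \<notin> ball 0 d"
  proof (rule AE_mp, intro AE_I2 impI)
   fix x assume "?g x = 0"
   then show "x \<notin> ball 0 d" using gpos[of x] by auto
  qed
  then have "emeasure lborel (ball (0::'a) d) = 0" using AE_iff_null_sets[of "ball (0::'a) d" lborel] by (auto simp: null_sets_def)
  then show False using emeasure_ball[of d "0::'a"] d unit_ball_vol_pos[of "real DIM('a)"] by simp
 qed
 moreover have "c \<ge> 0" unfolding c_def by (rule integral_nonneg_AE) (use b(2) in auto)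
 ultimately have c: "c > 0" by simp
 let ?r = "%x. (1/c) * ?g x"
 have "smooth_on UNIV ?r" using gs unfolding smooth_on_def by (intro allI Ck_on_mult Ck_on_const) auto
 moreover have "ckern d ?r" using gk c by (auto simp: ckern_def intro!: continuous_intros)
 moreover have "(\<integral>x. ?r x \<partial>lborel) = 1" using c by (simp only: integral_mult_right_zero c_def[symmetric]) simp
 ultimately have "mollifier d ?r" using b(2) c by (simp add: mollifier_def)
 then show ?thesis by (rule that)
qed

text \<open>The threshold serves every mollifier of smaller scale, so that one and the same
  mollifier can later approximate a function and its weak gradient
  (\<open>mollifier_approx2\<close>).\<close>

lemma mollify_l2:
 fixes f :: "'a::euclidean_space => 'b::euclidean_space"
 assumes f: "sqi lborel f" and e: "e > 0"
 obtains d where "d > 0" "!!\<delta> \<rho>. \<delta> \<le> d ==> mollifier \<delta> \<rho> ==> l2 lborel (%x. conv \<rho> f x - f x) \<le> e"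
proof -
 obtain d where d: "d > 0" "!!h. norm h \<le> d ==> l2 lborel (%x. f (x + h) - f x) \<le> e"
  using l2_translation_continuous[OF f e] by blast
 show ?thesis
 proof (rule that[OF d(1)])
  fix \<delta> and \<rho> :: "'a => real" assume "\<delta> \<le> d" "mollifier \<delta> \<rho>"
  then show "l2 lborel (%x. conv \<rho> f x - f x) \<le> e"
   using conv_approx(2)[of \<delta> \<rho> f e] f e d(2) by (auto simp: mollifier_def)
 qed
qed

lemma mollify_sqi:
 assumes f: "sqi lborel f" and \<rho>: "mollifier \<delta> \<rho>"
 shows "sqi lborel (conv \<rho> f)"
 by (rule conv_approx(1)[of \<delta> \<rho> f "2 * l2 lborel f"])
  (use f \<rho> order_trans[OF l2_diff_le(1)[OF sqi_shift(1)[OF f] f]] sqi_shift(2)[OF f] in \<open>auto simp: mollifier_def\<close>)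

section \<open>Real test functions and weak gradients on the whole space\<close>

text \<open>The support is confined by some compact superset instead of a closure, so products,
  shifts and reflections need no computation of closures.\<close>

definition rtest :: "'a::euclidean_space set => ('a => real) => bool" where
 "rtest \<Omega> \<phi> \<longleftrightarrow> smooth_on UNIV \<phi> \<and> (\<exists>K. compact K \<and> K \<subseteq> \<Omega> \<and> (\<forall>x. x \<notin> K --> \<phi> x = 0))"

definition grad :: "('a::euclidean_space => real) => 'a => 'a" where
 "grad \<phi> x = (\<Sum>b\<in>Basis. frechet_derivative \<phi> (at x) b *\<^sub>R b)"

lemma grad_inner_Basis: "b \<in> Basis ==> grad \<phi> x \<bullet> b = frechet_derivative \<phi> (at x) b"
 unfolding grad_def by (simp add: inner_sum_left inner_Basis if_distrib cong: if_cong)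

lemma grad_eqI:
 assumes "(\<phi> has_derivative F) (at x)" "!!b. b \<in> Basis ==> F b = g \<bullet> b"
 shows "grad \<phi> x = g"
proof (rule euclidean_eqI)
 fix b :: 'a assume b: "b \<in> Basis"
 have "frechet_derivative \<phi> (at x) = F" using frechet_derivative_at[OF assms(1)] by simp
 then show "grad \<phi> x \<bullet> b = g \<bullet> b" using assms(2)[OF b] by (simp add: grad_inner_Basis[OF b])
qed

lemma has_derivative_grad:
 assumes "(\<phi> has_derivative F) (at x)"
 shows "(\<phi> has_derivative (%h. grad \<phi> x \<bullet> h)) (at x)"
proof -
 have F: "frechet_derivative \<phi> (at x) = F" using frechet_derivative_at[OF assms] by simp
 have "grad \<phi> x \<bullet> h = F h" for h
  unfolding linear_Basis_sum[OF has_derivative_linear[OF assms], of h] grad_def F inner_sum_left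
  by (rule sum.cong) (auto simp: inner_commute mult.commute)
 then show ?thesis using assms by simp
qed

lemma rtest_ckern:
 assumes "rtest \<Omega> \<phi>"
 obtains r where "ckern r \<phi>"
proof -
 obtain K where K: "compact K" "!!x. x \<notin> K ==> \<phi> x = 0" using assms by (auto simp: rtest_def)
 then obtain B where B: "!!x. x \<in> K ==> norm x \<le> B" using compact_imp_bounded bounded_iff by metis
 have "ckern (max B 1) \<phi>" using smooth_continuous[of \<phi>] assms K B by (fastforce simp: ckern_def rtest_def)
 then show ?thesis by (rule that)
qed

lemma rtest_sqi: "rtest \<Omega> \<phi> ==> sqi lborel \<phi>"
 using rtest_ckern ckern_sqi by metis

lemma rtest_bounded:
 assumes "rtest \<Omega> \<phi>"
 obtains K where "K > 0" "!!x. norm (\<phi> x) \<le> K"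
 using rtest_ckern[OF assms] ckern_bounded by metis

lemma rtest_grad_ckern:
 assumes "rtest \<Omega> \<phi>"
 obtains r where "ckern r (grad \<phi>)"
proof -
 obtain r where r: "ckern r \<phi>" using rtest_ckern[OF assms] by blast
 have s: "smooth_on UNIV \<phi>" using assms by (simp add: rtest_def)
 note k = ckern_deriv[OF s r]
 have "ckern r (grad \<phi>)" unfolding grad_def using k r by (auto simp: ckern_def intro!: continuous_intros)
 then show ?thesis by (rule that)
qed

lemma rtest_grad_sqi: "rtest \<Omega> \<phi> ==> sqi lborel (grad \<phi>)"
 using rtest_grad_ckern ckern_sqi by metis

lemma rtest_grad_support:
 assumes "rtest \<Omega> \<phi>" "compact K" "!!x. x \<notin> K ==> \<phi> x = 0" "x \<notin> K"
 shows "grad \<phi> x = 0"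
proof -
 have "open (- K)" using assms(2) compact_imp_closed by blast
 then have "frechet_derivative \<phi> (at x) = (%_. 0)"
  by (rule frechet_derivative_zero) (use assms in auto)
 then show ?thesis by (simp add: grad_def)
qed

lemma rtest_mono: "rtest \<Omega> \<phi> ==> \<Omega> \<subseteq> \<Omega>' ==> rtest \<Omega>' \<phi>"
 by (auto simp: rtest_def)

lemma rtest_mult:
 assumes "rtest \<Omega> \<eta>" "smooth_on UNIV \<phi>"
 shows "rtest \<Omega> (%x. \<eta> x * \<phi> x)" "grad (%x. \<eta> x * \<phi> x) x = \<eta> x *\<^sub>R grad \<phi> x + \<phi> x *\<^sub>R grad \<eta> x"
proof -
 have s: "smooth_on UNIV \<eta>" using assms by (simp add: rtest_def)
 have sm: "smooth_on UNIV (%x. \<eta> x * \<phi> x)"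
  unfolding smooth_on_def by (intro allI Ck_on_mult) (use s assms(2) in \<open>auto simp: smooth_on_def\<close>)
 obtain K where K: "compact K" "K \<subseteq> \<Omega>" "\<forall>x. x \<notin> K --> \<eta> x = 0" using assms(1) by (auto simp: rtest_def)
 then have "\<forall>x. x \<notin> K --> \<eta> x * \<phi> x = 0" by simp
 with sm K show "rtest \<Omega> (%x. \<eta> x * \<phi> x)" unfolding rtest_def by blast
 have "((%x. \<eta> x * \<phi> x) has_derivative (%h. \<eta> x * frechet_derivative \<phi> (at x) h + frechet_derivative \<eta> (at x) h * \<phi> x)) (at x)"
  by (rule has_derivative_mult[OF smooth_deriv(1)[OF s] smooth_deriv(1)[OF assms(2)]])
 then show "grad (%x. \<eta> x * \<phi> x) x = \<eta> x *\<^sub>R grad \<phi> x + \<phi> x *\<^sub>R grad \<eta> x"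
  by (rule grad_eqI) (simp add: inner_add_left grad_inner_Basis)
qed

text \<open>The factor 1 gives the translations needed for differences of equations, the factor -1
  the reflection that puts a mollifier into the weak identity.\<close>

lemma rtest_affine:
 assumes "rtest \<Omega> \<phi>" and r: "r = 1 \<or> r = -1"
 shows "rtest {x. a + r *\<^sub>R x \<in> \<Omega>} (%x. \<phi> (a + r *\<^sub>R x))" "grad (%x. \<phi> (a + r *\<^sub>R x)) x = r *\<^sub>R grad \<phi> (a + r *\<^sub>R x)"
proof -
 obtain K where K: "compact K" "K \<subseteq> \<Omega>" "!!x. x \<notin> K ==> \<phi> x = 0" and s: "smooth_on UNIV \<phi>" using assms by (auto simp: rtest_def)
 let ?f = "%y. r *\<^sub>R y - r *\<^sub>R a"
 have rr: "a + r *\<^sub>R x \<in> K \<longleftrightarrow> x \<in> ?f ` K" for x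
  using r by (auto intro!: image_eqI[of _ _ "a + r *\<^sub>R x"])
 have "compact (?f ` K)" by (intro compact_continuous_image continuous_intros K)
 moreover have "?f ` K \<subseteq> {x. a + r *\<^sub>R x \<in> \<Omega>}" using K(2) r by auto
 moreover have "\<phi> (a + r *\<^sub>R x) = 0" if "x \<notin> ?f ` K" for x using K(3) rr that by blast
 moreover have "smooth_on UNIV (%x. \<phi> (a + r *\<^sub>R x))"
  unfolding smooth_on_def by (intro allI Ck_on_affine) (use s in \<open>simp add: smooth_on_def\<close>)
 ultimately show "rtest {x. a + r *\<^sub>R x \<in> \<Omega>} (%x. \<phi> (a + r *\<^sub>R x))" unfolding rtest_def by blast
 have "((%x. \<phi> (a + r *\<^sub>R x)) has_derivative (%h. grad \<phi> (a + r *\<^sub>R x) \<bullet> (r *\<^sub>R h))) (at x)"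
  by (rule has_derivative_compose[OF _ has_derivative_grad[OF smooth_deriv(1)[OF s]]]) (auto intro!: derivative_eq_intros)
 then show "grad (%x. \<phi> (a + r *\<^sub>R x)) x = r *\<^sub>R grad \<phi> (a + r *\<^sub>R x)"
  by (rule grad_eqI) simp
qed

text \<open>Both functions live on the whole space and only the identity is local, so they can be
  shifted and mollified freely; the domain merely decides where the result is meaningful. The
  identity is vector-valued, all partial derivatives at once.\<close>

definition weakg :: "'a::euclidean_space set => ('a => real) => ('a => 'a) => bool" where
 "weakg \<Omega> w G \<longleftrightarrow> sqi lborel w \<and> sqi lborel G \<and>
  (\<forall>\<phi>. rtest \<Omega> \<phi> --> (\<integral>x. w x *\<^sub>R grad \<phi> x \<partial>lborel) = - (\<integral>x. \<phi> x *\<^sub>R G x \<partial>lborel))"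

lemma weakgD: "weakg \<Omega> w G ==> rtest \<Omega> \<phi> ==> (\<integral>x. w x *\<^sub>R grad \<phi> x \<partial>lborel) = - (\<integral>x. \<phi> x *\<^sub>R G x \<partial>lborel)"
 by (simp add: weakg_def)

lemma weakg_mono: "weakg \<Omega> w G ==> \<Omega>' \<subseteq> \<Omega> ==> weakg \<Omega>' w G"
 unfolding weakg_def by (meson rtest_mono)

lemma weakg_diff:
 assumes "weakg \<Omega> w G" "weakg \<Omega> w' G'"
 shows "weakg \<Omega> (%x. w x - w' x) (%x. G x - G' x)"
proof -
 have s: "sqi lborel w" "sqi lborel w'" "sqi lborel G" "sqi lborel G'" using assms by (auto simp: weakg_def)
 show ?thesis unfolding weakg_def
 proof (intro conjI allI impI sqi_diff s)
  fix \<phi> :: "'a => real" assume \<phi>: "rtest \<Omega> \<phi>"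
  note f = rtest_sqi[OF \<phi>] and g = rtest_grad_sqi[OF \<phi>]
  show "(\<integral>x. (w x - w' x) *\<^sub>R grad \<phi> x \<partial>lborel) = - (\<integral>x. \<phi> x *\<^sub>R (G x - G' x) \<partial>lborel)"
   using l2_scaleR_int(1)[OF s(1) g] l2_scaleR_int(1)[OF s(2) g] l2_scaleR_int(1)[OF f s(3)] l2_scaleR_int(1)[OF f s(4)] assms \<phi>
   by (simp add: scaleR_diff_left scaleR_diff_right weakg_def)
 qed
qed

lemma weakg_shift:
 fixes w :: "'a::euclidean_space => real"
 assumes "weakg \<Omega> w G"
 shows "weakg {x. x + h \<in> \<Omega>} (%x. w (x + h)) (%x. G (x + h))"
 unfolding weakg_def
proof (intro conjI allI impI)
 show "sqi lborel (%x. w (x + h))" "sqi lborel (%x. G (x + h))" using assms sqi_shift by (auto simp: weakg_def)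
 fix \<phi> :: "'a => real" assume \<phi>: "rtest {x. x + h \<in> \<Omega>} \<phi>"
 let ?\<psi> = "%x. \<phi> (- h + 1 *\<^sub>R x)"
 have \<psi>: "rtest \<Omega> ?\<psi>" "grad ?\<psi> x = grad \<phi> (x - h)" for x
  using rtest_affine[OF \<phi>, of 1 "- h"] by auto
 have [measurable]: "w \<in> borel_measurable borel" "G \<in> borel_measurable borel" "\<phi> \<in> borel_measurable borel" "grad \<phi> \<in> borel_measurable borel"
  using assms rtest_sqi[OF \<phi>] rtest_grad_sqi[OF \<phi>] by (auto simp: weakg_def sqi_def)
 have "(\<integral>x. w x *\<^sub>R grad \<phi> (x - h) \<partial>lborel) = - (\<integral>x. \<phi> (x - h) *\<^sub>R G x \<partial>lborel)"
  using assms \<psi> by (auto simp: weakg_def)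
 moreover have "(\<integral>x. w (x + h) *\<^sub>R grad \<phi> x \<partial>lborel) = (\<integral>x. w x *\<^sub>R grad \<phi> (x - h) \<partial>lborel)"
  using integral_lborel_shift[of "%x. w x *\<^sub>R grad \<phi> (x - h)" h] by simp
 moreover have "(\<integral>x. \<phi> x *\<^sub>R G (x + h) \<partial>lborel) = (\<integral>x. \<phi> (x - h) *\<^sub>R G x \<partial>lborel)"
  using integral_lborel_shift[of "%x. \<phi> (x - h) *\<^sub>R G x" h] by simp
 ultimately show "(\<integral>x. w (x + h) *\<^sub>R grad \<phi> x \<partial>lborel) = - (\<integral>x. \<phi> x *\<^sub>R G (x + h) \<partial>lborel)" by simp
qed

text \<open>A cutoff supported in the domain turns a local weak gradient into a global one, because
  the cutoff times any test function is admissible for the local identity.\<close>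

lemma weakg_mult:
 assumes w: "weakg \<Omega> w G" and \<eta>: "rtest \<Omega> \<eta>"
 shows "weakg UNIV (%x. \<eta> x * w x) (%x. \<eta> x *\<^sub>R G x + w x *\<^sub>R grad \<eta> x)"
 unfolding weakg_def
proof (intro conjI allI impI)
 have sw: "sqi lborel w" and sG: "sqi lborel G" using w by (auto simp: weakg_def)
 obtain K where K: "!!x. norm (\<eta> x) \<le> K" using rtest_bounded[OF \<eta>] by blast
 obtain r where "ckern r (grad \<eta>)" using rtest_grad_ckern[OF \<eta>] by blast
 then obtain K' where K': "K' > 0" "!!x. norm (grad \<eta> x) \<le> K'" using ckern_bounded by blast
 have [measurable]: "w \<in> borel_measurable borel" "G \<in> borel_measurable borel" "\<eta> \<in> borel_measurable borel" "grad \<eta> \<in> borel_measurable borel"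
  using sw sG rtest_sqi[OF \<eta>] rtest_grad_sqi[OF \<eta>] by (auto simp: sqi_def)
 have s1: "sqi lborel (%x. \<eta> x * w x)"
  using sqi_mult_bounded(1)[OF _ sw, of \<eta> K] K by auto
 have s2: "sqi lborel (%x. \<eta> x *\<^sub>R G x)"
  using sqi_mult_bounded(1)[OF _ sG, of \<eta> K] K by auto
 have s3: "sqi lborel (%x. w x *\<^sub>R grad \<eta> x)"
 proof (rule sqi_bound(1)[OF _ sw, of _ K'])
  show "AE x in lborel. norm (w x *\<^sub>R grad \<eta> x) \<le> K' * norm (w x)"
   using mult_left_mono[OF K'(2) abs_ge_zero] by (intro AE_I2) (simp add: mult.commute)
 qed (use K' in auto)
 show "sqi lborel (%x. \<eta> x * w x)" "sqi lborel (%x. \<eta> x *\<^sub>R G x + w x *\<^sub>R grad \<eta> x)"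
  using s1 sqi_add[OF s2 s3] by auto
 fix \<phi> :: "'a => real" assume \<phi>: "rtest UNIV \<phi>"
 note f = rtest_sqi[OF \<phi>] and g = rtest_grad_sqi[OF \<phi>]
 have p: "rtest \<Omega> (%x. \<eta> x * \<phi> x)" "!!x. grad (%x. \<eta> x * \<phi> x) x = \<eta> x *\<^sub>R grad \<phi> x + \<phi> x *\<^sub>R grad \<eta> x"
  using rtest_mult[OF \<eta>] \<phi> by (auto simp: rtest_def)
 have "(\<integral>x. w x *\<^sub>R (\<eta> x *\<^sub>R grad \<phi> x + \<phi> x *\<^sub>R grad \<eta> x) \<partial>lborel) = - (\<integral>x. (\<eta> x * \<phi> x) *\<^sub>R G x \<partial>lborel)"
  using weakgD[OF w p(1)] by (simp only: p(2))
 moreover have "(\<integral>x. w x *\<^sub>R (\<eta> x *\<^sub>R grad \<phi> x + \<phi> x *\<^sub>R grad \<eta> x) \<partial>lborel)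
   = (\<integral>x. (\<eta> x * w x) *\<^sub>R grad \<phi> x \<partial>lborel) + (\<integral>x. \<phi> x *\<^sub>R w x *\<^sub>R grad \<eta> x \<partial>lborel)"
  using l2_scaleR_int(1)[OF s1 g] l2_scaleR_int(1)[OF f s3]
  by (subst Bochner_Integration.integral_add[symmetric]) (auto simp: scaleR_add_right mult_ac)
 moreover have "(\<integral>x. \<phi> x *\<^sub>R (\<eta> x *\<^sub>R G x + w x *\<^sub>R grad \<eta> x) \<partial>lborel)
   = (\<integral>x. (\<eta> x * \<phi> x) *\<^sub>R G x \<partial>lborel) + (\<integral>x. \<phi> x *\<^sub>R w x *\<^sub>R grad \<eta> x \<partial>lborel)"
  using l2_scaleR_int(1)[OF f s2] l2_scaleR_int(1)[OF f s3]
  by (simp add: scaleR_add_right mult_ac)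
 ultimately show "(\<integral>x. (\<eta> x * w x) *\<^sub>R grad \<phi> x \<partial>lborel) = - (\<integral>x. \<phi> x *\<^sub>R (\<eta> x *\<^sub>R G x + w x *\<^sub>R grad \<eta> x) \<partial>lborel)"
  by (simp add: eq_diff_eq)
qed

text \<open>The reflected kernel at \<open>x\<close> is itself a test function as long as its closed
  ball of radius \<open>\<delta>\<close> stays in the domain; the weak identity then moves the
  derivative from the kernel to \<open>G\<close>.\<close>

lemma conv_weakg:
 fixes w :: "'a::euclidean_space => real"
 assumes w: "weakg \<Omega> w G" and s: "smooth_on UNIV \<rho>" and k: "ckern \<delta> \<rho>" and sub: "cball x \<delta> \<subseteq> \<Omega>"
 shows "(conv \<rho> w has_derivative (%h. conv \<rho> G x \<bullet> h)) (at x)"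
proof -
 have sw: "sqi lborel w" and sG: "sqi lborel G" using w by (auto simp: weakg_def)
 have r: "rtest UNIV \<rho>" unfolding rtest_def
  using s k by (intro conjI exI[of _ "cball 0 \<delta>"]) (auto simp: ckern_def)
 note D = conv_has_derivative[OF smooth_deriv(1)[OF s] k ckern_deriv[OF s k] sw, of x]
 have "rtest (cball 0 \<delta>) \<rho>" unfolding rtest_def
  using s k by (intro conjI exI[of _ "cball 0 \<delta>"]) (auto simp: ckern_def)
 from rtest_affine[OF this, of "-1" x]
 have t: "rtest {y. x - y \<in> cball 0 \<delta>} (%y. \<rho> (x - y))" "!!y. grad (%y. \<rho> (x - y)) y = - grad \<rho> (x - y)" by simp_all
 have "{y. x - y \<in> cball 0 \<delta>} \<subseteq> \<Omega>" using sub by (auto simp: dist_norm subset_iff norm_minus_commute)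
 then have e: "(\<integral>y. w y *\<^sub>R (- grad \<rho> (x - y)) \<partial>lborel) = - conv \<rho> G x"
  using weakgD[OF w rtest_mono[OF t(1)]] by (simp only: t(2) conv_def)
 have i: "integrable lborel (%y. w y *\<^sub>R (- grad \<rho> (x - y)))"
  by (intro l2_scaleR_int(1) sw sqi_uminus sqi_reflect rtest_grad_sqi[OF r])
 have "conv (%z. frechet_derivative \<rho> (at z) b) w x = conv \<rho> G x \<bullet> b" if b: "b \<in> Basis" for b
 proof -
  have "- (conv \<rho> G x \<bullet> b) = (\<integral>y. w y *\<^sub>R (- grad \<rho> (x - y)) \<bullet> b \<partial>lborel)"
   using integral_inner_left[of b, OF i] e by simp
  also have "\<dots> = - conv (%z. frechet_derivative \<rho> (at z) b) w x"
   unfolding conv_def using b by (simp add: grad_inner_Basis mult.commute)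
  finally show ?thesis by simp
 qed
 then have "(\<Sum>b\<in>Basis. (h \<bullet> b) *\<^sub>R conv (%z. frechet_derivative \<rho> (at z) b) w x) = conv \<rho> G x \<bullet> h" for h
  by (simp add: euclidean_inner[of "conv \<rho> G x" h] mult.commute)
 then show ?thesis using D by simp
qed

lemma l2on_triangle:
 assumes "S \<in> sets borel" "sqi lborel f" "sqi lborel g"
 shows "l2on S (%x. f x + g x) \<le> l2on S f + l2on S g"
 unfolding l2on_def using l2_triangle[OF sqi_restr[OF _ assms(2), of S] sqi_restr[OF _ assms(3), of S]] assms(1)
 by (simp add: scaleR_add_right)

section \<open>Difference estimates for functions with a weak gradient\<close>

text \<open>Fundamental theorem of calculus plus Cauchy-Schwarz on an interval of length 1, put in
  terms of nonnegative integrals so that the order of integration can be exchanged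
  afterwards.\<close>

lemma unit_interval_bound:
 fixes F :: "real => real"
 assumes D: "!!s. s \<in> {0..1} ==> (F has_real_derivative F' s) (at s)" and c: "continuous_on UNIV F'"
 shows "ennreal ((F 1 - F 0)\<^sup>2) \<le> (\<integral>\<^sup>+s. ennreal (indicator {0..1} s * (F' s)\<^sup>2) \<partial>lborel)"
proof -
 let ?i = "indicat_real {0..1::real}"
 have [measurable]: "F' \<in> borel_measurable borel" using c by (rule borel_measurable_continuous_onI)
 have "bounded (F' ` {0..1})" using c by (intro compact_imp_bounded compact_continuous_image) (auto intro: continuous_on_subset)
 then obtain B where "\<forall>y\<in>F' ` {0..1}. norm y \<le> B" unfolding bounded_iff by blast
 then have B: "!!s. s \<in> {0..1} ==> \<bar>F' s\<bar> \<le> B" by simp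
 have B0: "B \<ge> 0" using B[of 0] by simp
 have i: "sqi lborel ?i" "l2 lborel ?i = 1"
 proof -
  have e: "(%s. (norm (?i s))\<^sup>2) = ?i" by (auto simp: indicator_def fun_eq_iff)
  have "integrable lborel ?i" by (simp add: integrable_indicator_iff)
  then show "sqi lborel ?i" unfolding sqi_def e by simp
  show "l2 lborel ?i = 1" unfolding l2_def e by simp
 qed
 have iF: "sqi lborel (%s. ?i s * F' s)"
  by (rule sqi_bound(1)[OF _ i(1), of _ B]) (use B B0 in \<open>auto simp: indicator_def\<close>)
 have "has_bochner_integral lborel (%x. ?i x *\<^sub>R F' x) (F 1 - F 0)"
  by (rule has_bochner_integral_FTC_Icc)
   (use D c in \<open>auto intro: continuous_on_subset has_field_derivative_at_within simp: has_real_derivative_iff_has_vector_derivative[symmetric]\<close>)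
 then have "F 1 - F 0 = (\<integral>x. ?i x *\<^sub>R F' x \<partial>lborel)" by (simp add: has_bochner_integral_integral_eq)
 also have "\<dots> = (\<integral>x. ?i x * (?i x * F' x) \<partial>lborel)" by (rule Bochner_Integration.integral_cong) (auto simp: indicator_def)
 finally have "\<bar>F 1 - F 0\<bar> \<le> l2 lborel (%s. ?i s * F' s)" using l2_mult(2)[OF i(1) iF] i(2) by simp
 then have "ennreal (\<bar>F 1 - F 0\<bar>\<^sup>2) \<le> ennreal ((l2 lborel (%s. ?i s * F' s))\<^sup>2)" by (intro ennreal_leI power_mono) auto
 also have "\<dots> = (\<integral>\<^sup>+s. ennreal (?i s * (F' s)\<^sup>2) \<partial>lborel)"
  unfolding l2_nn[OF iF, symmetric] by (rule nn_integral_cong) (auto simp: indicator_def)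
 finally show ?thesis by simp
qed

text \<open>Pointwise, the increment is bounded by the gradient along the segment from
  \<open>x\<close> to \<open>x + h\<close>; after exchanging integrals each translate of the
  gradient has the same norm.\<close>

lemma shift_estimate_mollified:
 fixes w :: "'a::euclidean_space => real"
 assumes w: "weakg \<Omega> w G" and [measurable]: "S \<in> sets borel"
  and sub: "!!x s. x \<in> S ==> s \<in> {0..1} ==> cball (x + s *\<^sub>R h) \<delta> \<subseteq> \<Omega>"
  and \<rho>: "mollifier \<delta> \<rho>"
 shows "l2on S (%x. conv \<rho> w (x + h) - conv \<rho> w x) \<le> norm h * l2 lborel (conv \<rho> G)"
proof -
 have sw: "sqi lborel w" and sG: "sqi lborel G" using w by (auto simp: weakg_def)
 have s\<rho>: "smooth_on UNIV \<rho>" "ckern \<delta> \<rho>" using \<rho> by (auto simp: mollifier_def)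
 have gc: "continuous_on UNIV (conv \<rho> G)" by (rule conv_continuous[OF s\<rho>(2) sG])
 have [measurable]: "conv \<rho> G \<in> borel_measurable borel" "conv \<rho> w \<in> borel_measurable borel"
  using gc conv_continuous[OF s\<rho>(2) sw] by (auto intro: borel_measurable_continuous_onI)
 have Gs: "sqi lborel (conv \<rho> G)" by (rule mollify_sqi[OF sG \<rho>])
 have pt: "ennreal ((norm (indicator S x *\<^sub>R (conv \<rho> w (x + h) - conv \<rho> w x)))\<^sup>2)
   \<le> (\<integral>\<^sup>+s. indicator {0..1} s * ennreal ((norm h)\<^sup>2 * (norm (conv \<rho> G (x + s *\<^sub>R h)))\<^sup>2) \<partial>lborel)" for x
 proof (cases "x \<in> S")
  case True
  have "ennreal ((conv \<rho> w (x + 1 *\<^sub>R h) - conv \<rho> w (x + 0 *\<^sub>R h))\<^sup>2) \<le>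
   (\<integral>\<^sup>+s. ennreal (indicator {0..1} s * (conv \<rho> G (x + s *\<^sub>R h) \<bullet> h)\<^sup>2) \<partial>lborel)"
  proof (rule unit_interval_bound)
   fix s :: real assume "s \<in> {0..1}"
   then have 1: "(conv \<rho> w has_derivative (%h'. conv \<rho> G (x + s *\<^sub>R h) \<bullet> h')) (at (x + s *\<^sub>R h))"
    by (intro conv_weakg[OF w s\<rho> sub[OF True]])
   have "((%s. x + s *\<^sub>R h) has_derivative (%t. t *\<^sub>R h)) (at s)"
    by (auto intro!: derivative_eq_intros)
   from has_derivative_compose[where g="conv \<rho> w" and f="%s. x + s *\<^sub>R h", OF this 1]
   have "((%s. conv \<rho> w (x + s *\<^sub>R h)) has_derivative (%t. conv \<rho> G (x + s *\<^sub>R h) \<bullet> (t *\<^sub>R h))) (at s)" .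
   then show "((%s. conv \<rho> w (x + s *\<^sub>R h)) has_real_derivative conv \<rho> G (x + s *\<^sub>R h) \<bullet> h) (at s)"
    by (simp add: has_field_derivative_def mult_commute_abs)
  next
   show "continuous_on UNIV (%s. conv \<rho> G (x + s *\<^sub>R h) \<bullet> h)"
    by (intro continuous_intros continuous_on_compose2[OF gc]) auto
  qed
  also have "\<dots> \<le> (\<integral>\<^sup>+s. indicator {0..1} s * ennreal ((norm h)\<^sup>2 * (norm (conv \<rho> G (x + s *\<^sub>R h)))\<^sup>2) \<partial>lborel)"
  proof (rule nn_integral_mono)
   fix s :: real
   have "(conv \<rho> G (x + s *\<^sub>R h) \<bullet> h)\<^sup>2 \<le> (norm h)\<^sup>2 * (norm (conv \<rho> G (x + s *\<^sub>R h)))\<^sup>2"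
    using power_mono[OF Cauchy_Schwarz_ineq2[of "conv \<rho> G (x + s *\<^sub>R h)" h] abs_ge_zero, of 2]
    by (simp add: power_mult_distrib mult.commute)
   then show "ennreal (indicator {0..1} s * (conv \<rho> G (x + s *\<^sub>R h) \<bullet> h)\<^sup>2)
    \<le> indicator {0..1} s * ennreal ((norm h)\<^sup>2 * (norm (conv \<rho> G (x + s *\<^sub>R h)))\<^sup>2)"
    by (cases "s \<in> {0..1}") (auto intro: ennreal_leI)
  qed
  finally show ?thesis using True by simp
 qed simp
 have "(\<integral>\<^sup>+x. ennreal ((norm (restr S (%x. conv \<rho> w (x + h) - conv \<rho> w x) x))\<^sup>2) \<partial>lborel)
  \<le> (\<integral>\<^sup>+x. (\<integral>\<^sup>+s. indicator {0..1} s * ennreal ((norm h)\<^sup>2 * (norm (conv \<rho> G (x + s *\<^sub>R h)))\<^sup>2) \<partial>lborel) \<partial>lborel)"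
  by (rule nn_integral_mono) (rule pt)
 also have "\<dots> = (\<integral>\<^sup>+s. (\<integral>\<^sup>+x. indicator {0..1} s * ennreal ((norm h)\<^sup>2 * (norm (conv \<rho> G (x + s *\<^sub>R h)))\<^sup>2) \<partial>lborel) \<partial>(lborel :: real measure))"
  by (rule lborel_pair.Fubini') measurable
 also have "\<dots> = (\<integral>\<^sup>+s. indicator {0..1::real} s * ennreal ((norm h * l2 lborel (conv \<rho> G))\<^sup>2) \<partial>lborel)"
 proof (rule nn_integral_cong)
  fix s :: real
  have "(\<integral>\<^sup>+x. ennreal ((norm (conv \<rho> G (x + s *\<^sub>R h)))\<^sup>2) \<partial>lborel) = ennreal ((l2 lborel (conv \<rho> G))\<^sup>2)"
   using l2_nn[OF sqi_shift(1)[OF Gs, of "s *\<^sub>R h"]] sqi_shift(2)[OF Gs, of "s *\<^sub>R h"] by simp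
  then show "(\<integral>\<^sup>+x. indicator {0..1} s * ennreal ((norm h)\<^sup>2 * (norm (conv \<rho> G (x + s *\<^sub>R h)))\<^sup>2) \<partial>lborel)
    = indicator {0..1} s * ennreal ((norm h * l2 lborel (conv \<rho> G))\<^sup>2)"
   by (simp add: ennreal_mult nn_integral_cmult power_mult_distrib)
 qed
 also have "\<dots> = ennreal ((norm h * l2 lborel (conv \<rho> G))\<^sup>2)" by (simp add: nn_integral_multc)
 finally show ?thesis unfolding l2on_def by (rule sqi_l2_nnI(2)[rotated]) auto
qed

lemma mollifier_approx2:
 assumes f: "sqi lborel (f :: 'a::euclidean_space => 'b::euclidean_space)" and g: "sqi lborel (g :: 'a => 'c::euclidean_space)"
  and e: "e > 0" and d: "d > 0"
 obtains \<delta> \<rho> where "0 < \<delta>" "\<delta> \<le> d" "mollifier \<delta> \<rho>" "l2 lborel (%x. conv \<rho> f x - f x) \<le> e" "l2 lborel (%x. conv \<rho> g x - g x) \<le> e"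
proof -
 obtain d1 where d1: "d1 > 0" "!!\<delta> \<rho>. \<delta> \<le> d1 ==> mollifier \<delta> \<rho> ==> l2 lborel (%x. conv \<rho> f x - f x) \<le> e"
  using mollify_l2[OF f e] by blast
 obtain d2 where d2: "d2 > 0" "!!\<delta> \<rho>. \<delta> \<le> d2 ==> mollifier \<delta> \<rho> ==> l2 lborel (%x. conv \<rho> g x - g x) \<le> e"
  using mollify_l2[OF g e] by blast
 let ?d = "min d (min d1 d2)"
 have "?d > 0" using d d1 d2 by simp
 then obtain \<rho> :: "'a => real" where "mollifier ?d \<rho>" using mollifier_exists by blast
 then show ?thesis using that[of ?d \<rho>] d1(2)[of ?d \<rho>] d2(2)[of ?d \<rho>] \<open>?d > 0\<close> by simp
qed

lemma shift_estimate:
 fixes w :: "'a::euclidean_space => real"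
 assumes w: "weakg \<Omega> w G" and S[measurable]: "S \<in> sets borel" and d: "d > 0"
  and sub: "!!x s. x \<in> S ==> s \<in> {0..1} ==> cball (x + s *\<^sub>R h) d \<subseteq> \<Omega>"
 shows "l2on S (%x. w (x + h) - w x) \<le> norm h * l2 lborel G"
proof (rule field_le_epsilon)
 fix e' :: real assume e': "e' > 0"
 \<comment> \<open>The error budget: \<open>norm h * e\<close> from mollifying the gradient and
   \<open>e\<close> twice from mollifying \<open>w\<close> at the two ends of the shift.\<close>
 define e where "e = e' / (norm h + 2)"
 have e: "e > 0" using e' by (simp add: e_def add_nonneg_pos)
 have sw: "sqi lborel w" and sG: "sqi lborel G" using w by (auto simp: weakg_def)
 obtain \<delta> \<rho> where m: "0 < \<delta>" "\<delta> \<le> d" "mollifier \<delta> \<rho>" "l2 lborel (%x. conv \<rho> w x - w x) \<le> e" "l2 lborel (%x. conv \<rho> G x - G x) \<le> e"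
  using mollifier_approx2[OF sw sG e d] by blast
 have 1: "l2on S (%x. conv \<rho> w (x + h) - conv \<rho> w x) \<le> norm h * l2 lborel (conv \<rho> G)"
  by (rule shift_estimate_mollified[OF w S _ m(3)]) (use sub m(2) in \<open>meson order_trans subset_cball\<close>)
 note s = mollify_sqi[OF sw m(3)] mollify_sqi[OF sG m(3)]
 have "l2 lborel (conv \<rho> G) \<le> l2 lborel G + e" using l2_diff_le(2)[OF s(2) sG] m(5) by simp
 then have 2: "norm h * l2 lborel (conv \<rho> G) \<le> norm h * l2 lborel G + norm h * e"
  using mult_left_mono[of _ _ "norm h"] by (fastforce simp: distrib_left)
 note sd = sqi_diff[OF sw s(1)]
 have "l2on S (%x. (conv \<rho> w (x + h) - conv \<rho> w x) + ((w (x + h) - conv \<rho> w (x + h)) - (w x - conv \<rho> w x)))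
  \<le> l2on S (%x. conv \<rho> w (x + h) - conv \<rho> w x) + l2on S (%x. (w (x + h) - conv \<rho> w (x + h)) - (w x - conv \<rho> w x))"
  by (intro l2on_triangle S sqi_diff sqi_shift sw s)
 also have "l2on S (%x. (w (x + h) - conv \<rho> w (x + h)) - (w x - conv \<rho> w x)) \<le>
   l2 lborel (%x. (w (x + h) - conv \<rho> w (x + h)) - (w x - conv \<rho> w x))"
  by (intro l2on_le S sqi_diff sqi_shift sw s)
 also have "\<dots> \<le> l2 lborel (%x. w (x + h) - conv \<rho> w (x + h)) + l2 lborel (%x. w x - conv \<rho> w x)"
  by (intro l2_diff_le sqi_diff sqi_shift sw s)
 also have "l2 lborel (%x. w (x + h) - conv \<rho> w (x + h)) = l2 lborel (%x. w x - conv \<rho> w x)"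
  by (rule sqi_shift(2)[OF sd])
 finally have 3: "l2on S (%x. w (x + h) - w x) \<le> norm h * l2 lborel G + norm h * e + 2 * e"
  using 1 2 m(4) l2_diff_commute[of lborel w "conv \<rho> w"] by simp
 have "norm h + 2 > 0" using norm_ge_zero[of h] by linarith
 then have "(norm h + 2) * e = e'" by (simp add: e_def)
 then have "norm h * e + 2 * e = e'" by (simp add: distrib_right)
 with 3 show "l2on S (%x. w (x + h) - w x) \<le> norm h * l2 lborel G + e'" by linarith
qed

lemma shift_estimate_global:
 assumes "weakg UNIV w G"
 shows "l2 lborel (%x. w (x + h) - w x) \<le> norm h * l2 lborel G"
 using shift_estimate[OF assms, of UNIV 1 h] by simp

lemma weakg_approx_test:
 fixes \<phi> :: "'a::euclidean_space => real"
 assumes w: "weakg UNIV \<phi> \<Phi>" and K: "compact K" "K \<subseteq> \<Omega>" "open \<Omega>" "!!x. x \<notin> K ==> \<phi> x = 0" and e: "e > 0"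
 obtains \<psi> where "rtest \<Omega> \<psi>" "l2 lborel (%x. \<psi> x - \<phi> x) \<le> e" "l2 lborel (%x. grad \<psi> x - \<Phi> x) \<le> e"
proof -
 have sw: "sqi lborel \<phi>" and sG: "sqi lborel \<Phi>" using w by (auto simp: weakg_def)
 obtain d where d: "d > 0" "(\<Union>x\<in>K. ball x d) \<subseteq> \<Omega>"
  using compact_subset_open_imp_ball_epsilon_subset[OF K(1,3,2)] by blast
 obtain \<delta> \<rho> where m: "0 < \<delta>" "\<delta> \<le> d/2" "mollifier \<delta> \<rho>" "l2 lborel (%x. conv \<rho> \<phi> x - \<phi> x) \<le> e" "l2 lborel (%x. conv \<rho> \<Phi> x - \<Phi> x) \<le> e"
  using mollifier_approx2[OF sw sG e half_gt_zero[OF d(1)]] by blast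
 have s\<rho>: "smooth_on UNIV \<rho>" "ckern \<delta> \<rho>" using m(3) by (auto simp: mollifier_def)
 let ?K = "{x + y |x y. x \<in> K \<and> y \<in> cball 0 \<delta>}"
 have "compact ?K" by (intro compact_sums K compact_cball)
 moreover have "?K \<subseteq> \<Omega>"
 proof clarsimp
  fix x y :: 'a assume "x \<in> K" "norm y \<le> \<delta>"
  then have "x + y \<in> ball x d" using m(1,2) d(1) by (simp add: dist_norm)
  then show "x + y \<in> \<Omega>" using d(2) \<open>x \<in> K\<close> by (meson UN_I subsetD)
 qed
 moreover have "conv \<rho> \<phi> x = 0" if x: "x \<notin> ?K" for x
 proof -
  have "\<rho> (x - y) *\<^sub>R \<phi> y = 0" for y
  proof (cases "y \<in> K")
   case True
   have "x - y \<notin> cball 0 \<delta>"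
   proof
    assume "x - y \<in> cball 0 \<delta>"
    moreover have "x = y + (x - y)" by simp
    ultimately show False using x True by blast
   qed
   then show ?thesis using s\<rho>(2) by (simp add: ckern_def)
  qed (use K in simp)
  then show ?thesis by (simp only: conv_def Bochner_Integration.integral_zero)
 qed
 ultimately have "rtest \<Omega> (conv \<rho> \<phi>)" unfolding rtest_def using conv_smooth[OF s\<rho> sw] by blast
 moreover have "grad (conv \<rho> \<phi>) x = conv \<rho> \<Phi> x" for x
  by (rule grad_eqI[OF conv_weakg[OF w s\<rho>]]) auto
 ultimately show ?thesis using that[of "conv \<rho> \<phi>"] m(4,5) by simp
qed

text \<open>The test functions of the regularity proof are cutoffs times differences of the solution
  and hence not smooth. Mollifying them keeps their support inside the open set and converges in the
  function and its gradient, which is all both sides of the equation see.\<close>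

lemma weak_equation_extend:
 fixes P \<Phi> :: "'a::euclidean_space => 'a"
 assumes P: "sqi lborel P" and f: "sqi lborel f"
  and eq: "!!\<psi>. rtest \<Omega> \<psi> ==> (\<integral>x. P x \<bullet> grad \<psi> x \<partial>lborel) = (\<integral>x. f x * \<psi> x \<partial>lborel)"
  and w: "weakg UNIV \<phi> \<Phi>" and K: "compact K" "K \<subseteq> \<Omega>" "open \<Omega>" "!!x. x \<notin> K ==> \<phi> x = 0"
 shows "(\<integral>x. P x \<bullet> \<Phi> x \<partial>lborel) = (\<integral>x. f x * \<phi> x \<partial>lborel)"
proof -
 have sw: "sqi lborel \<phi>" and sG: "sqi lborel \<Phi>" using w by (auto simp: weakg_def)
 let ?d = "(\<integral>x. P x \<bullet> \<Phi> x \<partial>lborel) - (\<integral>x. f x * \<phi> x \<partial>lborel)"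
 have "\<bar>?d\<bar> \<le> 0"
 proof (rule field_le_epsilon)
  fix e' :: real assume e': "e' > 0"
  define e where "e = e' / (l2 lborel P + l2 lborel f + 1)"
  have c: "l2 lborel P + l2 lborel f + 1 > 0" by (simp add: add_nonneg_pos)
  have e: "e > 0" using e' c by (simp add: e_def)
  obtain \<psi> where \<psi>: "rtest \<Omega> \<psi>" "l2 lborel (%x. \<psi> x - \<phi> x) \<le> e" "l2 lborel (%x. grad \<psi> x - \<Phi> x) \<le> e"
   using weakg_approx_test[OF w K e] by blast
  note s = rtest_sqi[OF \<psi>(1)] rtest_grad_sqi[OF \<psi>(1)]
  have 1: "(\<integral>x. P x \<bullet> (grad \<psi> x - \<Phi> x) \<partial>lborel) = (\<integral>x. P x \<bullet> grad \<psi> x \<partial>lborel) - (\<integral>x. P x \<bullet> \<Phi> x \<partial>lborel)"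
   using l2_inner(1)[OF P s(2)] l2_inner(1)[OF P sG] by (simp add: inner_diff_right)
  have 2: "(\<integral>x. f x * (\<psi> x - \<phi> x) \<partial>lborel) = (\<integral>x. f x * \<psi> x \<partial>lborel) - (\<integral>x. f x * \<phi> x \<partial>lborel)"
   using l2_mult(1)[OF f s(1)] l2_mult(1)[OF f sw] by (simp add: right_diff_distrib)
  have "\<bar>?d\<bar> \<le> \<bar>\<integral>x. P x \<bullet> (grad \<psi> x - \<Phi> x) \<partial>lborel\<bar> + \<bar>\<integral>x. f x * (\<psi> x - \<phi> x) \<partial>lborel\<bar>"
   unfolding 1 2 using eq[OF \<psi>(1)] by linarith
  also have "\<dots> \<le> l2 lborel P * e + l2 lborel f * e"
   using l2_inner(2)[OF P sqi_diff[OF s(2) sG]] l2_mult(2)[OF f sqi_diff[OF s(1) sw]]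
    mult_left_mono[OF \<psi>(2) l2_nonneg[of lborel f]] mult_left_mono[OF \<psi>(3) l2_nonneg[of lborel P]] by linarith
  also have "\<dots> \<le> (l2 lborel P + l2 lborel f + 1) * e" using e by (simp add: algebra_simps)
  also have "\<dots> = e'" using c by (simp add: e_def)
  finally show "\<bar>?d\<bar> \<le> 0 + e'" by simp
 qed
 then show ?thesis by simp
qed

section \<open>Caccioppoli estimate for differences\<close>

lemma matrix_vector_measurable[measurable (raw)]:
 fixes a :: "'a => real^'n^'m" and G :: "'a => real^'n"
 assumes "a \<in> borel_measurable M" "G \<in> borel_measurable M"
 shows "(%x. a x *v G x) \<in> borel_measurable M"
proof -
 have "continuous_on UNIV (%p :: (real^'n^'m) \<times> (real^'n). fst p *v snd p)"
  unfolding matrix_vector_mult_def by (intro continuous_on_vec_lambda continuous_intros)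
 from borel_measurable_continuous_Pair[OF assms this] show ?thesis by simp
qed

lemma restr_measurable: "S \<in> sets borel ==> f \<in> borel_measurable borel ==> restr S f \<in> borel_measurable borel"
 by (intro borel_measurable_scaleR borel_measurable_indicator)

lemma inner_mono_support:
 fixes f g :: "'a::euclidean_space => 'b::euclidean_space"
 assumes S[measurable]: "S \<in> sets borel" and f: "f \<in> borel_measurable borel" "sqi lborel (restr S f)" and g: "sqi lborel g"
  and s: "!!x. x \<notin> S ==> g x = 0"
 shows "\<bar>\<integral>x. f x \<bullet> g x \<partial>lborel\<bar> \<le> l2on S f * l2 lborel g" "integrable lborel (%x. f x \<bullet> g x)"
proof -
 have e: "f x \<bullet> g x = restr S f x \<bullet> g x" for x using s[of x] by (auto simp: indicator_def)
 show "\<bar>\<integral>x. f x \<bullet> g x \<partial>lborel\<bar> \<le> l2on S f * l2 lborel g" "integrable lborel (%x. f x \<bullet> g x)"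
  unfolding e l2on_def using l2_inner[OF f(2) g] by auto
qed

text \<open>Boundedness of the coefficient is global, so that products with it are square integrable
  everywhere; ellipticity and the Lipschitz bound are local. The radii leave a margin
  \<open>R - r2\<close>, half of which is available for shifts.\<close>

locale cacc =
 fixes z :: "real^'n" and R r2 \<Lambda> \<mu> L K1 :: real and \<eta> :: "real^'n => real"
  and a :: "real^'n => real^'n^'n"
 assumes r2: "0 < r2" "r2 < R" and lam: "\<mu> > 0" and Lam: "\<Lambda> \<ge> 0" and L: "L \<ge> 0"
  and eta: "smooth_on UNIV \<eta>" "!!x. 0 \<le> \<eta> x" "!!x. \<eta> x \<le> 1" "!!x. norm (grad \<eta> x) \<le> K1" "!!x. x \<notin> cball z r2 ==> \<eta> x = 0"
  and am[measurable]: "a \<in> borel_measurable borel"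
  and bnd: "!!x \<xi>. norm (a x *v \<xi>) \<le> \<Lambda> * norm \<xi>"
  and ell: "!!x \<xi>. x \<in> ball z R ==> \<mu> * (norm \<xi>)\<^sup>2 \<le> (a x *v \<xi>) \<bullet> \<xi>"
  and lip: "!!x y \<xi>. x \<in> ball z R ==> y \<in> ball z R ==> norm ((a x - a y) *v \<xi>) \<le> L * norm (x - y) * norm \<xi>"
begin

text \<open>Nirenberg's method of differences: the equation is tested with the backward difference
  of the cutoff squared times the forward difference of \<open>w\<close>. \<open>Y\<close> collects
  all data, already of order \<open>norm h\<close>, and the outcome is a quadratic inequality for
  the localised gradient difference \<open>N\<close>. The field \<open>H\<close> is a flux on the
  right-hand side, present for the second application of the method.\<close>

lemma core:
 assumes w: "weakg (ball z R) w G" and f: "sqi lborel f" and H: "sqi lborel H"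
  and eq: "!!\<psi>. rtest (ball z R) \<psi> ==> (\<integral>x. (a x *v G x - H x) \<bullet> grad \<psi> x \<partial>lborel) = (\<integral>x. f x * \<psi> x \<partial>lborel)"
  and h: "norm h < (R - r2)/2" and K: "l2on (cball z r2) (%x. H (x + h) - H x) \<le> K * norm h" "K \<ge> 0"
  and N: "N = l2 lborel (%x. \<eta> x *\<^sub>R (G (x + h) - G x))" and Y: "Y = norm h * (l2 lborel G + l2 lborel f + K)"
 shows "\<mu> * N\<^sup>2 \<le> 2 * \<Lambda> * K1 * Y * N + (L + 1) * Y * (N + 2 * K1 * Y)"
proof -
 have sw: "sqi lborel w" and sG: "sqi lborel G" using w by (auto simp: weakg_def)
 have [measurable]: "w \<in> borel_measurable borel" "G \<in> borel_measurable borel" "f \<in> borel_measurable borel" "H \<in> borel_measurable borel"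
  using sw sG f H by (auto simp: sqi_def)
 define v where "v x = w (x + h) - w x" for x
 define g where "g x = G (x + h) - G x" for x
 have sv: "sqi lborel v" unfolding v_def by (intro sqi_diff sqi_shift sw)
 have sg: "sqi lborel g" unfolding g_def by (intro sqi_diff sqi_shift sG)
 have K10: "K1 \<ge> 0" using eta(4)[of z] norm_ge_zero order_trans by blast
 let ?C = "cball z r2"
 have rt: "rtest (ball z (R - norm h)) \<eta>" unfolding rtest_def
  using eta r2 h by (intro conjI exI[of _ ?C]) (auto simp: dist_norm)
 have ge: "grad \<eta> x = 0" if "x \<notin> ?C" for x
  by (rule rtest_grad_support[OF rt _ _ that]) (use eta in auto)
 have [measurable]: "\<eta> \<in> borel_measurable borel" "grad \<eta> \<in> borel_measurable borel" "v \<in> borel_measurable borel" "g \<in> borel_measurable borel"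
  using rtest_sqi[OF rt] rtest_grad_sqi[OF rt] sv sg by (auto simp: sqi_def)
 have wv: "weakg (ball z (R - norm h)) v g"
  unfolding v_def g_def
 proof (rule weakg_diff)
  show "weakg (ball z (R - norm h)) w G" by (rule weakg_mono[OF w subset_ball]) simp
  show "weakg (ball z (R - norm h)) (%x. w (x + h)) (%x. G (x + h))"
  proof (rule weakg_mono[OF weakg_shift[OF w]], safe)
   fix x assume "x \<in> ball z (R - norm h)"
   then show "x + h \<in> ball z R" using norm_triangle_ineq4[of "z - x" h] by (simp add: dist_norm algebra_simps)
  qed
 qed
 let ?\<eta>2 = "%x. \<eta> x * \<eta> x"
 define u where "u x = ?\<eta>2 x * v x" for x
 define \<Psi> where "\<Psi> x = ?\<eta>2 x *\<^sub>R g x + (2 * \<eta> x * v x) *\<^sub>R grad \<eta> x" for x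
 have wu: "weakg UNIV u \<Psi>"
 proof -
  have "grad ?\<eta>2 x = (2 * \<eta> x) *\<^sub>R grad \<eta> x" for x
   using rtest_mult(2)[OF rt eta(1)] by (simp flip: scaleR_left.add)
  then show ?thesis using weakg_mult[OF wv rtest_mult(1)[OF rt eta(1)]] unfolding u_def[abs_def] \<Psi>_def[abs_def] by (simp add: mult_ac)
 qed
 have su: "sqi lborel u" and s\<Psi>: "sqi lborel \<Psi>" using wu by (auto simp: weakg_def)
 have [measurable]: "\<Psi> \<in> borel_measurable borel" "u \<in> borel_measurable borel" using su s\<Psi> by (auto simp: sqi_def)
 have u0: "u x = 0" "\<Psi> x = 0" if "x \<notin> ?C" for x using that eta(5)[OF that] by (auto simp: u_def \<Psi>_def)
 \<comment> \<open>The shift by \<open>- h\<close> is the adjoint of the shift by \<open>h\<close>: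
   summation by parts moves the difference onto the flux \<open>P\<close>.\<close>
 define \<phi> where "\<phi> x = u (x + (- h)) - u x" for x
 define \<Phi> where "\<Phi> x = \<Psi> (x + (- h)) - \<Psi> x" for x
 have w\<phi>: "weakg UNIV \<phi> \<Phi>" unfolding \<phi>_def \<Phi>_def
  by (rule weakg_diff[OF weakg_mono[OF weakg_shift[OF wu]] wu]) auto
 have s\<phi>: "sqi lborel \<phi>" and s\<Phi>: "sqi lborel \<Phi>" using w\<phi> by (auto simp: weakg_def)
 have saG: "sqi lborel (%x. a x *v G x)"
  by (rule sqi_bound(1)[OF _ sG, of _ \<Lambda>]) (use bnd Lam in auto)
 define P where "P x = a x *v G x - H x" for x
 have sP: "sqi lborel P" unfolding P_def by (rule sqi_diff[OF saG H])
 have [measurable]: "P \<in> borel_measurable borel" using sP by (auto simp: sqi_def)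
 have "(\<integral>x. P x \<bullet> \<Phi> x \<partial>lborel) = (\<integral>x. f x * \<phi> x \<partial>lborel)"
 proof (rule weak_equation_extend[OF sP f _ w\<phi>])
  show "compact (cball z (r2 + norm h))" "open (ball z R)" by auto
  have "r2 + norm h < R" using h r2 by (simp add: field_simps)
  then show "cball z (r2 + norm h) \<subseteq> ball z R" by (auto simp: dist_norm)
  fix x assume x: "x \<notin> cball z (r2 + norm h)"
  then have "x \<notin> ?C" "x + (- h) \<notin> ?C"
   using norm_triangle_ineq[of "z - (x - h)" "- h"] norm_ge_zero[of h]
   by (auto simp: dist_norm algebra_simps simp del: norm_ge_zero)
  then show "\<phi> x = 0" using u0 by (simp add: \<phi>_def)
 next
  fix \<psi> assume "rtest (ball z R) \<psi>"
  then show "(\<integral>x. P x \<bullet> grad \<psi> x \<partial>lborel) = (\<integral>x. f x * \<psi> x \<partial>lborel)" using eq by (simp add: P_def)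
 qed
 moreover have "(\<integral>x. P x \<bullet> \<Phi> x \<partial>lborel) = (\<integral>x. (P (x + h) - P x) \<bullet> \<Psi> x \<partial>lborel)"
 proof -
  have "(\<integral>x. P x \<bullet> \<Psi> (x + (- h)) \<partial>lborel) = (\<integral>x. P (x + h) \<bullet> \<Psi> x \<partial>lborel)"
   using integral_lborel_shift[of "%x. P x \<bullet> \<Psi> (x + (- h))" h] by simp
  then show ?thesis unfolding \<Phi>_def
   using l2_inner(1)[OF sP s\<Psi>] l2_inner(1)[OF sP sqi_shift(1)[OF s\<Psi>, of "- h"]] l2_inner(1)[OF sqi_shift(1)[OF sP, of h] s\<Psi>]
   by (simp add: inner_diff_right inner_diff_left)
 qed
 ultimately have main: "(\<integral>x. (P (x + h) - P x) \<bullet> \<Psi> x \<partial>lborel) = (\<integral>x. f x * \<phi> x \<partial>lborel)" by simp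
 define q where "q x = (a (x + h) - a x) *v G x" for x
 define H' where "H' x = H (x + h) - H x" for x
 have qm[measurable]: "q \<in> borel_measurable borel" unfolding q_def by measurable
 have sH': "sqi lborel H'" unfolding H'_def by (intro sqi_diff sqi_shift H)
 \<comment> \<open>Discrete product rule. The first term is elliptic, \<open>q\<close> uses the
   Lipschitz bound of the coefficient, and \<open>H'\<close> is controlled by
   \<open>K\<close>.\<close>
 have dP: "P (x + h) - P x = a (x + h) *v g x + q x - H' x" for x
  by (simp add: P_def g_def q_def H'_def matrix_vector_mult_diff_distrib matrix_vector_mult_diff_rdistrib)
 have xh: "x \<in> ball z R" "x + h \<in> ball z R" if "x \<in> ?C" for x
 proof -
  have "norm (z - x) \<le> r2" using that by (simp add: dist_norm)
  moreover have "norm (z - (x + h)) \<le> norm (z - x) + norm h" using norm_triangle_ineq4[of "z - x" h] by (simp add: algebra_simps)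
  ultimately show "x \<in> ball z R" "x + h \<in> ball z R" using h r2 by (auto simp: dist_norm)
 qed
 have qb: "norm (restr ?C q x) \<le> (L * norm h) * norm (G x)" for x
  using lip[of "x + h" x "G x"] xh[of x] L by (cases "x \<in> ?C") (auto simp: q_def)
 have [measurable]: "restr ?C q \<in> borel_measurable borel"
  by (intro restr_measurable qm) simp
 have sq: "sqi lborel (restr ?C q)" and lq: "l2on ?C q \<le> (L * norm h) * l2 lborel G"
  unfolding l2on_def using sqi_bound[OF _ sG, of "restr ?C q" "L * norm h"] qb L by auto
 have sag: "sqi lborel (%x. a (x + h) *v g x)"
  by (rule sqi_bound(1)[OF _ sg, of _ \<Lambda>]) (use bnd Lam in auto)
 define V where "V = l2 lborel (%x. v x *\<^sub>R grad \<eta> x)"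
 have rv: "sqi lborel (restr ?C v)" by (rule sqi_restr[OF _ sv]) simp
 have Vb: "norm (v x *\<^sub>R grad \<eta> x) \<le> K1 * norm (restr ?C v x)" for x
  using mult_right_mono[OF eta(4)[of x] abs_ge_zero[of "v x"]] ge[of x] by (cases "x \<in> ?C") (simp_all add: mult.commute)
 have sV: "sqi lborel (%x. v x *\<^sub>R grad \<eta> x)" and V1: "V \<le> K1 * l2on ?C v"
  unfolding V_def l2on_def using sqi_bound[OF _ rv, of "%x. v x *\<^sub>R grad \<eta> x" K1] Vb K10 by auto
 have "l2on ?C v \<le> norm h * l2 lborel G" unfolding v_def
 proof (rule shift_estimate[OF w])
  show "(R - r2)/2 - norm h > 0" using h by simp
  fix x and s :: real assume x: "x \<in> ?C" and s: "s \<in> {0..1}"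
  show "cball (x + s *\<^sub>R h) ((R - r2)/2 - norm h) \<subseteq> ball z R"
  proof
   fix y assume "y \<in> cball (x + s *\<^sub>R h) ((R - r2)/2 - norm h)"
   then have y: "norm (x + s *\<^sub>R h - y) \<le> (R - r2)/2 - norm h" by (simp add: dist_norm)
   have "norm (s *\<^sub>R h) \<le> norm h" using s by (simp add: mult_left_le_one_le)
   moreover have "z - y = (z - x) - s *\<^sub>R h + (x + s *\<^sub>R h - y)" by simp
   ultimately have "norm (z - y) \<le> norm (z - x) + norm h + norm (x + s *\<^sub>R h - y)"
    by (smt (verit) norm_triangle_ineq norm_triangle_ineq4)
   then have "norm (z - y) \<le> r2 + (R - r2)/2" using x y by (simp add: dist_norm)
   also have "\<dots> < R" using r2 by (simp add: field_simps)
   finally show "y \<in> ball z R" by (simp add: dist_norm)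
  qed
 qed simp
 also have "\<dots> \<le> Y" unfolding Y using K by (intro mult_left_mono) auto
 finally have V2: "V \<le> K1 * Y" using V1 K10 by (meson mult_left_mono order_trans)
 have sN: "sqi lborel (%x. \<eta> x *\<^sub>R g x)"
  by (rule sqi_bound(1)[OF _ sg, of _ 1]) (use eta in \<open>auto simp: mult_left_le_one_le\<close>)
 have N': "N = l2 lborel (%x. \<eta> x *\<^sub>R g x)" using N by (simp add: g_def)
 have Y0: "Y \<ge> 0" unfolding Y using K by (intro mult_nonneg_nonneg add_nonneg_nonneg) auto
 have \<Psi>l: "l2 lborel \<Psi> \<le> N + 2 * V"
 proof -
  have e1: "sqi lborel (%x. ?\<eta>2 x *\<^sub>R g x)" "l2 lborel (%x. ?\<eta>2 x *\<^sub>R g x) \<le> 1 * N"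
   using sqi_bound[OF _ sN, of "%x. ?\<eta>2 x *\<^sub>R g x" 1] eta by (auto simp: N' mult.assoc mult_left_le_one_le)
  have e2: "sqi lborel (%x. (2 * \<eta> x * v x) *\<^sub>R grad \<eta> x)" "l2 lborel (%x. (2 * \<eta> x * v x) *\<^sub>R grad \<eta> x) \<le> 2 * V"
   using sqi_bound[OF _ sV, of "%x. (2 * \<eta> x * v x) *\<^sub>R grad \<eta> x" 2] eta by (auto simp: V_def abs_mult mult.assoc mult_left_le_one_le)
  show ?thesis unfolding \<Psi>_def using l2_triangle[OF e1(1) e2(1)] e1(2) e2(2) by simp
 qed
 define E where "E = N + 2 * K1 * Y"
 have \<Psi>E: "l2 lborel \<Psi> \<le> E" using \<Psi>l V2 by (simp add: E_def)
 have E0: "E \<ge> 0" using \<Psi>E l2_nonneg order_trans by blast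
 have i1: "integrable lborel (%x. (a (x + h) *v g x) \<bullet> \<Psi> x)" by (rule l2_inner(1)[OF sag s\<Psi>])
 have i2: "integrable lborel (%x. q x \<bullet> \<Psi> x)" and b2: "\<bar>\<integral>x. q x \<bullet> \<Psi> x \<partial>lborel\<bar> \<le> (L * norm h * l2 lborel G) * E"
 proof -
  show "integrable lborel (%x. q x \<bullet> \<Psi> x)" by (rule inner_mono_support(2)[of ?C]) (use sq s\<Psi> u0 in auto)
  have "\<bar>\<integral>x. q x \<bullet> \<Psi> x \<partial>lborel\<bar> \<le> l2on ?C q * l2 lborel \<Psi>" by (rule inner_mono_support(1)) (use sq s\<Psi> u0 in auto)
  also have "\<dots> \<le> (L * norm h * l2 lborel G) * E" using lq \<Psi>E L by (intro mult_mono) auto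
  finally show "\<bar>\<integral>x. q x \<bullet> \<Psi> x \<partial>lborel\<bar> \<le> (L * norm h * l2 lborel G) * E" .
 qed
 have i3: "integrable lborel (%x. H' x \<bullet> \<Psi> x)" and b3: "\<bar>\<integral>x. H' x \<bullet> \<Psi> x \<partial>lborel\<bar> \<le> (K * norm h) * E"
 proof -
  have [measurable]: "H' \<in> borel_measurable borel" using sH' by (simp add: sqi_def)
  show "integrable lborel (%x. H' x \<bullet> \<Psi> x)" by (rule l2_inner(1)[OF sH' s\<Psi>])
  have "\<bar>\<integral>x. H' x \<bullet> \<Psi> x \<partial>lborel\<bar> \<le> l2on ?C H' * l2 lborel \<Psi>" by (rule inner_mono_support(1)) (use sqi_restr[OF _ sH'] s\<Psi> u0 in auto)
  also have "\<dots> \<le> (K * norm h) * E"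
  proof (intro mult_mono \<Psi>E)
   show "l2on ?C H' \<le> K * norm h" using K(1) unfolding H'_def[abs_def] .
  qed (use K(2) in auto)
  finally show "\<bar>\<integral>x. H' x \<bullet> \<Psi> x \<partial>lborel\<bar> \<le> (K * norm h) * E" .
 qed
 \<comment> \<open>Here \<open>f\<close> is not shifted: the factor \<open>norm h\<close> comes from
   the difference in the test function, so plain square integrability of \<open>f\<close>
   suffices.\<close>
 have b4: "\<bar>\<integral>x. f x * \<phi> x \<partial>lborel\<bar> \<le> (norm h * l2 lborel f) * E"
 proof -
  have "l2 lborel \<phi> \<le> norm h * l2 lborel \<Psi>" using shift_estimate_global[OF wu, of "- h"] by (simp add: \<phi>_def[abs_def])
  also have "\<dots> \<le> norm h * E" using \<Psi>E by (simp add: mult_left_mono)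
  finally have "l2 lborel f * l2 lborel \<phi> \<le> l2 lborel f * (norm h * E)" by (simp add: mult_left_mono)
  then show ?thesis using l2_mult(2)[OF f s\<phi>] by (simp add: mult_ac)
 qed
 have split: "(\<integral>x. (P (x + h) - P x) \<bullet> \<Psi> x \<partial>lborel)
   = (\<integral>x. (a (x + h) *v g x) \<bullet> \<Psi> x \<partial>lborel) + (\<integral>x. q x \<bullet> \<Psi> x \<partial>lborel) - (\<integral>x. H' x \<bullet> \<Psi> x \<partial>lborel)"
  unfolding dP using i1 i2 i3 by (simp add: inner_add_left inner_diff_left)
 \<comment> \<open>The gradient of the squared cutoff produces the cross term; the second factor of
   the cutoff stays with \<open>g\<close>, so this term is linear in \<open>N\<close>.\<close>
 have low: "\<mu> * N\<^sup>2 - 2 * \<Lambda> * (N * V) \<le> (\<integral>x. (a (x + h) *v g x) \<bullet> \<Psi> x \<partial>lborel)"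
 proof -
  let ?l = "%x. \<mu> * (norm (\<eta> x *\<^sub>R g x))\<^sup>2 - 2 * \<Lambda> * (norm (\<eta> x *\<^sub>R g x) * norm (v x *\<^sub>R grad \<eta> x))"
  have j1: "integrable lborel (%x. (norm (\<eta> x *\<^sub>R g x))\<^sup>2)" using sN by (simp add: sqi_def)
  have j2: "integrable lborel (%x. norm (\<eta> x *\<^sub>R g x) * norm (v x *\<^sub>R grad \<eta> x))" by (rule l2_prod(1)[OF sN sV])
  have "\<mu> * N\<^sup>2 - 2 * \<Lambda> * (N * V) \<le> \<mu> * N\<^sup>2 - 2 * \<Lambda> * (\<integral>x. norm (\<eta> x *\<^sub>R g x) * norm (v x *\<^sub>R grad \<eta> x) \<partial>lborel)"
   using mult_left_mono[OF l2_prod(2)[OF sN sV], of "2 * \<Lambda>"] Lam by (simp add: N' V_def)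
  also have "\<dots> = (\<integral>x. ?l x \<partial>lborel)"
   unfolding N' l2_sq using j1 j2 by (simp del: norm_scaleR)
  also have "\<dots> \<le> (\<integral>x. (a (x + h) *v g x) \<bullet> \<Psi> x \<partial>lborel)"
  proof (rule integral_mono)
   show "integrable lborel ?l" using j1 j2 by (simp del: norm_scaleR)
   fix x
   show "?l x \<le> (a (x + h) *v g x) \<bullet> \<Psi> x"
   proof (cases "x \<in> ?C")
    case True
    let ?b = "a (x + h) *v g x"
    have "\<mu> * (norm (g x))\<^sup>2 \<le> ?b \<bullet> g x" by (rule ell[OF xh(2)[OF True]])
    then have 1: "\<mu> * (norm (\<eta> x *\<^sub>R g x))\<^sup>2 \<le> ?\<eta>2 x * (?b \<bullet> g x)"
     using mult_left_mono[of "\<mu> * (norm (g x))\<^sup>2" "?b \<bullet> g x" "?\<eta>2 x"] by (simp add: power_mult_distrib power2_eq_square mult_ac)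
    have "\<bar>?b \<bullet> grad \<eta> x\<bar> \<le> \<Lambda> * norm (g x) * norm (grad \<eta> x)"
     using Cauchy_Schwarz_ineq2[of ?b "grad \<eta> x"] mult_right_mono[OF bnd[of "x + h" "g x"] norm_ge_zero[of "grad \<eta> x"]] by linarith
    then have "(2 * \<eta> x * \<bar>v x\<bar>) * \<bar>?b \<bullet> grad \<eta> x\<bar> \<le> (2 * \<eta> x * \<bar>v x\<bar>) * (\<Lambda> * norm (g x) * norm (grad \<eta> x))"
     using eta(2)[of x] by (intro mult_left_mono) auto
    moreover have "\<bar>(2 * \<eta> x * v x) * (?b \<bullet> grad \<eta> x)\<bar> = (2 * \<eta> x * \<bar>v x\<bar>) * \<bar>?b \<bullet> grad \<eta> x\<bar>"
     using eta(2)[of x] by (simp add: abs_mult)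
    ultimately have 2: "- (2 * \<Lambda> * (norm (\<eta> x *\<^sub>R g x) * norm (v x *\<^sub>R grad \<eta> x))) \<le> (2 * \<eta> x * v x) * (?b \<bullet> grad \<eta> x)"
     using eta(2)[of x] by (simp add: mult_ac)
    show ?thesis unfolding \<Psi>_def inner_add_right inner_scaleR_right using 1 2 by linarith
   next
    case False then show ?thesis using u0[OF False] eta(5)[OF False] by simp
   qed
  qed (rule i1)
  finally show ?thesis .
 qed
 have "N * V \<le> N * (K1 * Y)" using V2 by (intro mult_left_mono) (simp_all add: N')
 then have "2 * \<Lambda> * (N * V) \<le> 2 * \<Lambda> * (N * (K1 * Y))" by (rule mult_left_mono) (use Lam in simp)
 then have "\<mu> * N\<^sup>2 \<le> 2 * \<Lambda> * (N * (K1 * Y)) + (L * norm h * l2 lborel G) * E + (K * norm h) * E + (norm h * l2 lborel f) * E"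
  using low split main b2 b3 b4 by linarith
 moreover have "(L * norm h * l2 lborel G) * E + (K * norm h) * E + (norm h * l2 lborel f) * E \<le> (L + 1) * Y * E"
 proof -
  have "L * norm h * l2 lborel G + K * norm h + norm h * l2 lborel f \<le> (L + 1) * Y"
  proof -
   have "L * (norm h * (l2 lborel G)) \<le> L * Y" unfolding Y using L K by (intro mult_left_mono) auto
   moreover have "K * norm h + norm h * l2 lborel f \<le> Y" unfolding Y by (simp add: algebra_simps)
   ultimately show ?thesis by (simp add: algebra_simps)
  qed
  from mult_right_mono[OF this E0] show ?thesis by (simp add: algebra_simps)
 qed
 moreover have "2 * \<Lambda> * (N * (K1 * Y)) = 2 * \<Lambda> * K1 * Y * N" by simp
 ultimately show ?thesis unfolding E_def by linarith
qed

lemma estimate: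
 assumes w: "weakg (ball z R) w G" and f: "sqi lborel f" and H: "sqi lborel H"
  and eq: "!!\<psi>. rtest (ball z R) \<psi> ==> (\<integral>x. (a x *v G x - H x) \<bullet> grad \<psi> x \<partial>lborel) = (\<integral>x. f x * \<psi> x \<partial>lborel)"
  and h: "norm h < (R - r2)/2" and K: "l2on (cball z r2) (%x. H (x + h) - H x) \<le> K * norm h" "K \<ge> 0"
  and c: "c > 0" "!!x. x \<in> ball z r1 ==> c \<le> \<eta> x"
 shows "l2on (ball z r1) (%x. G (x + h) - G x)
  \<le> ((2 * \<Lambda> * K1 + (L + 1) * (1 + 2 * K1)) / \<mu> + 1) / c * (norm h * (l2 lborel G + l2 lborel f + K))"
proof -
 define N where "N = l2 lborel (%x. \<eta> x *\<^sub>R (G (x + h) - G x))"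
 define Y where "Y = norm h * (l2 lborel G + l2 lborel f + K)"
 define B where "B = 2 * \<Lambda> * K1 + (L + 1) * (1 + 2 * K1)"
 have main: "\<mu> * N\<^sup>2 \<le> 2 * \<Lambda> * K1 * Y * N + (L + 1) * Y * (N + 2 * K1 * Y)"
  by (rule core[OF w f H eq h K N_def Y_def])
 have Y0: "Y \<ge> 0" unfolding Y_def using K by (intro mult_nonneg_nonneg add_nonneg_nonneg) auto
 have K10: "K1 \<ge> 0" using eta(4)[of z] norm_ge_zero order_trans by blast
 have B0: "B \<ge> 0" using Lam L K10 by (simp add: B_def)
 \<comment> \<open>If this failed, \<open>Y\<close> would be below \<open>N\<close>; replacing the
   quadratic occurrence of \<open>Y\<close> by \<open>N\<close> and dividing by \<open>N\<close>
   gives the bound it was supposed to violate.\<close>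
 have NY: "N \<le> (B / \<mu> + 1) * Y"
 proof (rule ccontr)
  assume "\<not> ?thesis"
  then have less: "(B / \<mu> + 1) * Y < N" by simp
  have "1 * Y \<le> (B / \<mu> + 1) * Y" using B0 lam Y0 by (intro mult_right_mono) auto
  then have YN: "Y \<le> N" using less by simp
  have N0: "N > 0" using less Y0 B0 lam by (smt (verit) divide_nonneg_pos mult_nonneg_nonneg)
  have "\<mu> * N\<^sup>2 \<le> 2 * \<Lambda> * K1 * Y * N + (L + 1) * Y * (N + 2 * K1 * N)"
  proof -
   have "2 * K1 * Y \<le> 2 * K1 * N" using YN K10 by (intro mult_left_mono) auto
   then have "(L + 1) * Y * (N + 2 * K1 * Y) \<le> (L + 1) * Y * (N + 2 * K1 * N)" using L Y0 by (intro mult_left_mono) auto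
   then show ?thesis using main by linarith
  qed
  also have "\<dots> = (B * Y) * N" by (simp add: B_def algebra_simps)
  finally have "\<mu> * N \<le> B * Y" using N0 by (simp add: power2_eq_square)
  then have "N \<le> (B / \<mu>) * Y" using lam by (simp add: field_simps)
  then show False using less Y0 by (simp add: algebra_simps)
 qed
 have sG: "sqi lborel G" using w by (auto simp: weakg_def)
 have sg: "sqi lborel (%x. G (x + h) - G x)" by (intro sqi_diff sqi_shift sG)
 have [measurable]: "G \<in> borel_measurable borel" using sG by (auto simp: sqi_def)
 have em: "\<eta> \<in> borel_measurable borel" using smooth_continuous[OF eta(1)] by (rule borel_measurable_continuous_onI)
 have sN: "sqi lborel (%x. \<eta> x *\<^sub>R (G (x + h) - G x))"
  by (rule sqi_mult_bounded(1)[OF _ sg, of _ 1]) (use eta em in auto)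
 have "l2on (ball z r1) (%x. G (x + h) - G x) \<le> (1/c) * N"
  unfolding l2on_def N_def
 proof (rule sqi_bound(2)[OF _ sN])
  show "AE x in lborel. norm (restr (ball z r1) (%x. G (x + h) - G x) x) \<le> 1/c * norm (\<eta> x *\<^sub>R (G (x + h) - G x))"
  proof (rule AE_I2)
   fix x
   show "norm (restr (ball z r1) (%x. G (x + h) - G x) x) \<le> 1/c * norm (\<eta> x *\<^sub>R (G (x + h) - G x))"
    using mult_right_mono[OF c(2)[of x] norm_ge_zero[of "G (x + h) - G x"]] c(1) eta(2)[of x]
    by (cases "x \<in> ball z r1") (simp_all add: pos_le_divide_eq mult.commute del: scaleR_diff_right)
  qed
  show "restr (ball z r1) (%x. G (x + h) - G x) \<in> borel_measurable lborel"
   using restr_measurable[of "ball z r1" "%x. G (x + h) - G x"] sg by (simp add: sqi_def)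
 qed (use c in auto)
 also have "\<dots> \<le> (1/c) * ((B / \<mu> + 1) * Y)" using NY c by (intro mult_left_mono) auto
 finally show ?thesis by (simp add: B_def Y_def)
qed

end

text \<open>The coefficient assumptions of the locale \<open>cacc\<close>, detached from the cutoff
  so that a constant can be fixed before the coefficient is.\<close>

definition good_coeff :: "real^'n => real => real => real => real => (real^'n => real^'n^'n) => bool" where
 "good_coeff z R \<Lambda> \<mu> L a \<longleftrightarrow> a \<in> borel_measurable borel \<and> (\<forall>x \<xi>. norm (a x *v \<xi>) \<le> \<Lambda> * norm \<xi>)
  \<and> (\<forall>x\<in>ball z R. \<forall>\<xi>. \<mu> * (norm \<xi>)\<^sup>2 \<le> (a x *v \<xi>) \<bullet> \<xi>)
  \<and> (\<forall>x\<in>ball z R. \<forall>y\<in>ball z R. \<forall>\<xi>. norm ((a x - a y) *v \<xi>) \<le> L * norm (x - y) * norm \<xi>)"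

text \<open>The constant depends on the radii and the bounds only, the cutoff being chosen first.
  This uniformity is used when the method is applied again to a shifted coefficient.\<close>

lemma caccioppoli_difference:
 fixes z :: "real^'n"
 assumes r: "0 < r1" "r1 < r2" "r2 < R" and lam: "\<mu> > 0" "\<Lambda> \<ge> 0" "L \<ge> 0"
 obtains C where "C \<ge> 0"
  "!!a w G f H K h. good_coeff z R \<Lambda> \<mu> L a ==> weakg (ball z R) w G ==> sqi lborel f ==> sqi lborel H ==>
    (!!\<psi>. rtest (ball z R) \<psi> ==> (\<integral>x. (a x *v G x - H x) \<bullet> grad \<psi> x \<partial>lborel) = (\<integral>x. f x * \<psi> x \<partial>lborel)) ==>
    norm h < (R - r2)/2 ==> l2on (cball z r2) (%x. H (x + h) - H x) \<le> K * norm h ==> K \<ge> 0 ==>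
    l2on (ball z r1) (%x. G (x + h) - G x) \<le> C * (norm h * (l2 lborel G + l2 lborel f + K))"
proof -
 obtain \<beta> :: "real^'n => real" where b: "smooth_on UNIV \<beta>" "!!x. \<beta> x \<ge> 0" "!!x. \<beta> x > 0 \<longleftrightarrow> norm x < 1" "!!x. \<beta> x \<le> 1"
  using smooth_bump by blast
 have r20: "r2 > 0" using r by simp
 define \<eta> where "\<eta> x = \<beta> ((- (1/r2)) *\<^sub>R z + (1/r2) *\<^sub>R x)" for x
 have \<eta>s: "smooth_on UNIV \<eta>" unfolding \<eta>_def smooth_on_def by (intro allI Ck_on_affine) (use b(1) in \<open>simp add: smooth_on_def\<close>)
 have "norm ((- (1/r2)) *\<^sub>R z + (1/r2) *\<^sub>R x) = norm (x - z) / r2" for x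
 proof -
  have "(- (1/r2)) *\<^sub>R z + (1/r2) *\<^sub>R x = (1/r2) *\<^sub>R (x - z)" by (simp add: algebra_simps)
  then show ?thesis using r20 by (simp only: norm_scaleR) simp
 qed
 then have pos: "\<eta> x > 0 \<longleftrightarrow> norm (x - z) < r2" for x unfolding \<eta>_def b(3) using r20 by simp
 have \<eta>0: "\<eta> x = 0" if "x \<notin> cball z r2" for x
 proof -
  have "\<eta> x \<ge> 0" unfolding \<eta>_def by (rule b(2))
  then show ?thesis using pos[of x] that by (simp add: dist_norm norm_minus_commute)
 qed
 have rt: "rtest UNIV \<eta>" unfolding rtest_def using \<eta>s \<eta>0 by (intro conjI exI[of _ "cball z r2"]) auto
 obtain r' where "ckern r' (grad \<eta>)" using rtest_grad_ckern[OF rt] by blast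
 then obtain K1 where K1: "K1 > 0" "!!x. norm (grad \<eta> x) \<le> K1" using ckern_bounded by blast
 have "continuous_on (cball z r1) \<eta>" using smooth_continuous[OF \<eta>s] continuous_on_subset by blast
 from continuous_attains_inf[OF compact_cball _ this] obtain x0 where x0: "x0 \<in> cball z r1" "!!y. y \<in> cball z r1 ==> \<eta> x0 \<le> \<eta> y"
  using r by auto
 \<comment> \<open>The bump is not 1 on the inner ball; its positive minimum there is enough and
   enters the constant as a divisor.\<close>
 define c where "c = \<eta> x0"
 have c: "c > 0" using pos[of x0] x0(1) r by (simp add: c_def dist_norm norm_minus_commute)
 define C where "C = ((2 * \<Lambda> * K1 + (L + 1) * (1 + 2 * K1)) / \<mu> + 1) / c"
 show ?thesis
 proof (rule that[of C])
  show "C \<ge> 0" using lam K1 c by (simp add: C_def)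
  fix a w G f H K h
  assume a: "good_coeff z R \<Lambda> \<mu> L a"
   and "weakg (ball z R) w G" "sqi lborel f" "sqi lborel H"
    "!!\<psi>. rtest (ball z R) \<psi> ==> (\<integral>x. (a x *v G x - H x) \<bullet> grad \<psi> x \<partial>lborel) = (\<integral>x. f x * \<psi> x \<partial>lborel)"
    "norm h < (R - r2)/2" "l2on (cball z r2) (%x. H (x + h) - H x) \<le> K * norm h" "K \<ge> 0"
  note asm = this(2-)
  interpret cacc z R r2 \<Lambda> \<mu> L K1 \<eta> a
   by unfold_locales (use r lam K1 \<eta>s \<eta>0 b a in \<open>auto simp: good_coeff_def \<eta>_def\<close>)
  show "l2on (ball z r1) (%x. G (x + h) - G x) \<le> C * (norm h * (l2 lborel G + l2 lborel f + K))"
   unfolding C_def by (rule estimate[OF asm c]) (use x0 in \<open>auto simp: c_def\<close>)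
 qed
qed

text \<open>Integrating \<open>g x = (g x - g y) + g y\<close> over \<open>x\<close> in the half ball and \<open>y\<close> in the ball; differences \<open>g (x + h) - g x\<close>
 then suffice to compare the means of \<open>\<bar>g\<bar>\<^sup>2\<close> at the two scales.\<close>

lemma dyadic_step:
 fixes g :: "'a::euclidean_space => 'b::euclidean_space"
 assumes g: "sqi lborel g" and t: "t > 0" and K: "K \<ge> 0"
  and diff: "!!h. norm h < 2 * t ==> l2on (ball z t) (%x. g (x + h) - g x) \<le> K * norm h"
 shows "sqrt (2 ^ DIM('a)) * l2on (ball z (t/2)) g \<le> 2 ^ DIM('a) * (2 * t * K) + l2on (ball z t) g"
proof -
 have [measurable]: "g \<in> borel_measurable borel" using g by (simp add: sqi_def)
 let ?M = "lborel \<Otimes>\<^sub>M (lborel :: 'a measure) :: ('a \<times> 'a) measure"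
 let ?A = "ball z (t/2)" and ?B = "ball z t"
 have bs[measurable, simp]: "?A \<in> sets borel" "?B \<in> sets borel" "ball (0::'a) (2 * t) \<in> sets borel" by (auto intro: borel_open)
 let ?i = "%x y. indicat_real ?A x * indicat_real ?B y"
 define V where "V = unit_ball_vol (real DIM('a)) * t ^ DIM('a)"
 have Vpos: "V > 0" using t by (simp add: V_def)
 have eB: "emeasure lborel ?B = ennreal V" using t by (simp add: V_def emeasure_ball)
 have eA: "emeasure lborel ?A = ennreal (V / 2 ^ DIM('a))" using t by (simp add: V_def emeasure_ball power_divide)
 have e2: "emeasure lborel (ball (0::'a) (2 * t)) = ennreal (2 ^ DIM('a) * V)" using t by (simp add: V_def emeasure_ball power_mult_distrib mult_ac)
 define q where "q p = ?i (fst p) (snd p) *\<^sub>R g (snd p)" for p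
 define u where "u p = ?i (fst p) (snd p) *\<^sub>R g (fst p)" for p
 define d where "d p = ?i (fst p) (snd p) *\<^sub>R (g (fst p) - g (snd p))" for p
 have [measurable]: "fst \<in> borel_measurable ?M" "snd \<in> borel_measurable ?M"
  using measurable_fst[of "lborel :: 'a measure" "lborel :: 'a measure"] measurable_snd[of "lborel :: 'a measure" "lborel :: 'a measure"] by simp_all
 have [measurable]: "(%p. g (snd p)) \<in> borel_measurable ?M" using measurable_compose[of snd ?M borel g] by simp
 have [measurable]: "(%p. g (fst p)) \<in> borel_measurable ?M" using measurable_compose[of fst ?M borel g] by simp
 have [measurable]: "(%p. indicat_real ?A (fst p)) \<in> borel_measurable ?M" by (rule measurable_compose[of fst ?M borel "indicat_real ?A"]) (auto intro!: borel_measurable_indicator)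
 have [measurable]: "(%p. indicat_real ?B (snd p)) \<in> borel_measurable ?M" by (rule measurable_compose[of snd ?M borel "indicat_real ?B"]) (auto intro!: borel_measurable_indicator)
 have [measurable]: "q \<in> borel_measurable ?M" "u \<in> borel_measurable ?M" "d \<in> borel_measurable ?M"
  unfolding q_def u_def d_def by (intro borel_measurable_scaleR borel_measurable_times borel_measurable_diff; measurable)+
 have sA: "sqi lborel (restr ?A g)" and sB: "sqi lborel (restr ?B g)" by (auto intro!: sqi_restr g)
 have [measurable]: "restr ?A g \<in> borel_measurable borel" "restr ?B g \<in> borel_measurable borel" using sA sB by (auto simp: sqi_def)
 have nq: "(\<integral>\<^sup>+p. ennreal ((norm (q p))\<^sup>2) \<partial>?M) = ennreal ((sqrt (V / 2 ^ DIM('a)) * l2on ?B g)\<^sup>2)"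
 proof -
  have "(\<integral>\<^sup>+p. ennreal ((norm (q p))\<^sup>2) \<partial>?M) = (\<integral>\<^sup>+x. (\<integral>\<^sup>+y. ennreal ((norm (q (x, y)))\<^sup>2) \<partial>lborel) \<partial>lborel)"
   by (subst lborel.nn_integral_fst[symmetric]) auto
  also have "\<dots> = (\<integral>\<^sup>+x. indicator ?A x * ennreal ((l2on ?B g)\<^sup>2) \<partial>lborel)"
  proof (rule nn_integral_cong)
   fix x
   have "(\<integral>\<^sup>+y. ennreal ((norm (q (x, y)))\<^sup>2) \<partial>lborel) = (\<integral>\<^sup>+y. indicator ?A x * ennreal ((norm (restr ?B g y))\<^sup>2) \<partial>lborel)"
    by (rule nn_integral_cong) (auto simp: q_def indicator_def)
   also have "\<dots> = indicator ?A x * ennreal ((l2on ?B g)\<^sup>2)"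
    using l2_nn[OF sB] by (cases "x \<in> ?A") (simp_all add: l2on_def)
   finally show "(\<integral>\<^sup>+y. ennreal ((norm (q (x, y)))\<^sup>2) \<partial>lborel) = indicator ?A x * ennreal ((l2on ?B g)\<^sup>2)" .
  qed
  also have "\<dots> = ennreal (V / 2 ^ DIM('a)) * ennreal ((l2on ?B g)\<^sup>2)" using eA by (simp add: nn_integral_multc)
  also have "\<dots> = ennreal ((sqrt (V / 2 ^ DIM('a)) * l2on ?B g)\<^sup>2)"
   using Vpos by (simp add: ennreal_mult'[symmetric] power_mult_distrib)
  finally show ?thesis .
 qed
 have nu: "(\<integral>\<^sup>+p. ennreal ((norm (u p))\<^sup>2) \<partial>?M) = ennreal ((sqrt V * l2on ?A g)\<^sup>2)"
 proof -
  have "(\<integral>\<^sup>+p. ennreal ((norm (u p))\<^sup>2) \<partial>?M) = (\<integral>\<^sup>+x. (\<integral>\<^sup>+y. ennreal ((norm (u (x, y)))\<^sup>2) \<partial>lborel) \<partial>lborel)"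
   by (subst lborel.nn_integral_fst[symmetric]) auto
  also have "\<dots> = (\<integral>\<^sup>+x. ennreal V * ennreal ((norm (restr ?A g x))\<^sup>2) \<partial>lborel)"
  proof (rule nn_integral_cong)
   fix x
   have "(\<integral>\<^sup>+y. ennreal ((norm (u (x, y)))\<^sup>2) \<partial>lborel) = (\<integral>\<^sup>+y. indicator ?B y * ennreal ((norm (restr ?A g x))\<^sup>2) \<partial>lborel)"
    by (rule nn_integral_cong) (auto simp: u_def indicator_def)
   also have "\<dots> = ennreal V * ennreal ((norm (restr ?A g x))\<^sup>2)"
    using eB by (simp add: nn_integral_multc)
   finally show "(\<integral>\<^sup>+y. ennreal ((norm (u (x, y)))\<^sup>2) \<partial>lborel) = ennreal V * ennreal ((norm (restr ?A g x))\<^sup>2)" .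
  qed
  also have "\<dots> = ennreal V * ennreal ((l2on ?A g)\<^sup>2)" using l2_nn[OF sA] by (simp add: nn_integral_cmult l2on_def)
  also have "\<dots> = ennreal ((sqrt V * l2on ?A g)\<^sup>2)"
   using Vpos by (simp add: ennreal_mult'[symmetric] power_mult_distrib)
  finally show ?thesis .
 qed
 have nd: "(\<integral>\<^sup>+p. ennreal ((norm (d p))\<^sup>2) \<partial>?M) \<le> ennreal ((sqrt (2 ^ DIM('a) * V) * (2 * t * K))\<^sup>2)"
 proof -
  have "(\<integral>\<^sup>+p. ennreal ((norm (d p))\<^sup>2) \<partial>?M) = (\<integral>\<^sup>+x. (\<integral>\<^sup>+y. ennreal ((norm (d (x, y)))\<^sup>2) \<partial>lborel) \<partial>lborel)"
   by (subst lborel.nn_integral_fst[symmetric]) auto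
  also have "\<dots> \<le> (\<integral>\<^sup>+x. (\<integral>\<^sup>+h. indicator (ball 0 (2 * t)) h * ennreal ((norm (restr ?B (%x. g (x + h) - g x) x))\<^sup>2) \<partial>lborel) \<partial>lborel)"
  proof (rule nn_integral_mono)
   fix x
   \<comment> \<open>Substituting \<open>h + x\<close> for \<open>y\<close> turns pairs of points
     into shifts; a point of the half ball and one of the ball are less than \<open>2 * t\<close>
     apart.\<close>
   have "(\<integral>\<^sup>+y. ennreal ((norm (d (x, y)))\<^sup>2) \<partial>lborel) = (\<integral>\<^sup>+h. ennreal ((norm (d (x, h + x)))\<^sup>2) \<partial>lborel)"
    by (subst nn_integral_lborel_shift) auto
   also have "\<dots> \<le> (\<integral>\<^sup>+h. indicator (ball 0 (2 * t)) h * ennreal ((norm (restr ?B (%x. g (x + h) - g x) x))\<^sup>2) \<partial>lborel)"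
   proof (rule nn_integral_mono)
    fix h
    show "ennreal ((norm (d (x, h + x)))\<^sup>2) \<le> indicator (ball 0 (2 * t)) h * ennreal ((norm (restr ?B (%x. g (x + h) - g x) x))\<^sup>2)"
    proof (cases "x \<in> ?A \<and> h + x \<in> ?B")
     case True
     then have "norm (z - x) < t" "norm (z - (h + x)) < t" using t by (auto simp: dist_norm)
     then have "norm h < 2 * t" using norm_triangle_ineq4[of "z - x" "z - (h + x)"] by simp
     then show ?thesis using True t by (auto simp: d_def norm_minus_commute add.commute indicator_def)
    next
     case False then show ?thesis by (auto simp: d_def indicator_def)
    qed
   qed
   finally show "(\<integral>\<^sup>+y. ennreal ((norm (d (x, y)))\<^sup>2) \<partial>lborel) \<le> (\<integral>\<^sup>+h. indicator (ball 0 (2 * t)) h * ennreal ((norm (restr ?B (%x. g (x + h) - g x) x))\<^sup>2) \<partial>lborel)" .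
  qed
  also have "\<dots> = (\<integral>\<^sup>+h. (\<integral>\<^sup>+x. indicator (ball 0 (2 * t)) h * ennreal ((norm (restr ?B (%x. g (x + h) - g x) x))\<^sup>2) \<partial>lborel) \<partial>lborel)"
   by (rule lborel_pair.Fubini') measurable
  also have "\<dots> \<le> (\<integral>\<^sup>+h. indicator (ball (0::'a) (2 * t)) h * ennreal ((2 * t * K)\<^sup>2) \<partial>lborel)"
  proof (rule nn_integral_mono)
   fix h
   have s: "sqi lborel (restr ?B (%x. g (x + h) - g x))" by (intro sqi_restr sqi_diff sqi_shift g) auto
   have "l2on ?B (%x. g (x + h) - g x) \<le> 2 * t * K" if "norm h < 2 * t"
    using diff[OF that] mult_left_mono[OF less_imp_le[OF that] K] by (simp add: mult_ac)
   then show "(\<integral>\<^sup>+x. indicator (ball 0 (2 * t)) h * ennreal ((norm (restr ?B (%x. g (x + h) - g x) x))\<^sup>2) \<partial>lborel)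
     \<le> indicator (ball 0 (2 * t)) h * ennreal ((2 * t * K)\<^sup>2)"
    using l2_nn[OF s] by (cases "norm h < 2 * t") (auto simp: nn_integral_cmult l2on_def intro!: ennreal_leI power_mono)
  qed
  also have "\<dots> = ennreal (2 ^ DIM('a) * V) * ennreal ((2 * t * K)\<^sup>2)" using e2 by (simp add: nn_integral_multc)
  also have "\<dots> = ennreal ((sqrt (2 ^ DIM('a) * V) * (2 * t * K))\<^sup>2)"
   using Vpos by (simp add: ennreal_mult'[symmetric] power_mult_distrib)
  finally show ?thesis .
 qed
 have c1: "0 \<le> sqrt (V / 2 ^ DIM('a)) * l2on ?B g" and c2: "0 \<le> sqrt V * l2on ?A g"
  and c3: "0 \<le> sqrt (2 ^ DIM('a) * V) * (2 * t * K)"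
  using Vpos t K by (auto intro!: mult_nonneg_nonneg)
 have qm: "q \<in> borel_measurable ?M" and um: "u \<in> borel_measurable ?M" and dm: "d \<in> borel_measurable ?M" by fact+
 note sq = sqi_l2_nnI[OF qm eq_refl[OF nq] c1] and su = sqi_l2_nnI(1)[OF um eq_refl[OF nu] c2]
  and sd = sqi_l2_nnI[OF dm nd c3]
 have "ennreal ((sqrt V * l2on ?A g)\<^sup>2) = ennreal ((l2 ?M u)\<^sup>2)" using l2_nn[OF su] nu by simp
 then have "(sqrt V * l2on ?A g)\<^sup>2 = (l2 ?M u)\<^sup>2" by (simp only: ennreal_inj zero_le_power2)
 then have lu: "sqrt V * l2on ?A g = l2 ?M u" by (rule power2_eq_imp_eq[OF _ c2 l2_nonneg])
 \<comment> \<open>The triangle inequality is used in L2 of the product space, where the norms of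
   \<open>u\<close> and \<open>q\<close> are the norms of \<open>g\<close> on the two balls times
   the root of the volume of the other ball.\<close>
 have "u = (%p. d p + q p)" by (auto simp: u_def d_def q_def fun_eq_iff algebra_simps)
 then have "sqrt V * l2on ?A g \<le> sqrt (2 ^ DIM('a) * V) * (2 * t * K) + sqrt (V / 2 ^ DIM('a)) * l2on ?B g"
  using lu l2_triangle[OF sd(1) sq(1)] sd(2) sq(2) by simp
 then have "sqrt V * l2on ?A g \<le> sqrt V * (sqrt (2 ^ DIM('a)) * (2 * t * K) + l2on ?B g / sqrt (2 ^ DIM('a)))"
  by (simp add: real_sqrt_mult real_sqrt_divide algebra_simps)
 then have "l2on ?A g \<le> sqrt (2 ^ DIM('a)) * (2 * t * K) + l2on ?B g / sqrt (2 ^ DIM('a))" using Vpos by simp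
 then have "sqrt (2 ^ DIM('a)) * l2on ?A g \<le> sqrt (2 ^ DIM('a)) * (sqrt (2 ^ DIM('a)) * (2 * t * K) + l2on ?B g / sqrt (2 ^ DIM('a)))"
  by (intro mult_left_mono) auto
 also have "\<dots> = (sqrt (2 ^ DIM('a)) * sqrt (2 ^ DIM('a))) * (2 * t * K) + l2on ?B g" by (simp only: distrib_left mult.assoc) simp
 finally show ?thesis by simp
qed

section \<open>Second differences of the gradient\<close>

text \<open>The estimates carry the global norm of the weak gradient. Truncating it to a set around
  the domain makes that norm local, which is essential when it is a difference known to be small
  only on a ball.\<close>

lemma weakg_restr:
 assumes w: "weakg \<Omega> w G" and S: "\<Omega> \<subseteq> S" "S \<in> sets borel"
 shows "weakg \<Omega> w (restr S G)"
 unfolding weakg_def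
proof (intro conjI allI impI)
 have sG: "sqi lborel G" using w by (simp add: weakg_def)
 show "sqi lborel w" using w by (simp add: weakg_def)
 show "sqi lborel (restr S G)" by (rule sqi_restr[OF _ sG]) (use S in simp)
 fix \<phi> :: "'a => real" assume \<phi>: "rtest \<Omega> \<phi>"
 have "\<phi> x *\<^sub>R restr S G x = \<phi> x *\<^sub>R G x" for x
  using \<phi> S by (cases "x \<in> S") (auto simp: rtest_def)
 then show "(\<integral>x. w x *\<^sub>R grad \<phi> x \<partial>lborel) = - (\<integral>x. \<phi> x *\<^sub>R restr S G x \<partial>lborel)"
  using weakgD[OF w \<phi>] by presburger
qed

lemma weak_equation_difference:
 fixes P :: "'a::euclidean_space => 'a"
 assumes P: "sqi lborel P" and f: "sqi lborel f"
  and eq: "!!\<psi>. rtest (ball z R) \<psi> ==> (\<integral>x. P x \<bullet> grad \<psi> x \<partial>lborel) = (\<integral>x. f x * \<psi> x \<partial>lborel)"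
  and \<psi>: "rtest (ball z r) \<psi>" and r: "r + norm k \<le> R"
 shows "(\<integral>x. (P (x + k) - P x) \<bullet> grad \<psi> x \<partial>lborel) = (\<integral>x. (f (x + k) - f x) * \<psi> x \<partial>lborel)"
proof -
 note s1 = rtest_sqi[OF \<psi>] and s2 = rtest_grad_sqi[OF \<psi>]
 have [measurable]: "P \<in> borel_measurable borel" "f \<in> borel_measurable borel" "\<psi> \<in> borel_measurable borel" "grad \<psi> \<in> borel_measurable borel"
  using P f s1 s2 by (auto simp: sqi_def)
 let ?\<psi> = "%x. \<psi> (- k + 1 *\<^sub>R x)"
 have a: "rtest {x. - k + 1 *\<^sub>R x \<in> ball z r} ?\<psi>" "!!x. grad ?\<psi> x = grad \<psi> (x - k)"
  using rtest_affine[OF \<psi>, of 1 "- k"] by simp_all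
 have "{x. - k + 1 *\<^sub>R x \<in> ball z r} \<subseteq> ball z R"
 proof clarsimp
  fix x assume "dist z (x - k) < r"
  then show "dist z x < R" using norm_triangle_ineq4[of "z - (x - k)" k] r by (simp add: dist_norm)
 qed
 from eq[OF rtest_mono[OF a(1) this], unfolded a(2)]
 have "(\<integral>x. P x \<bullet> grad \<psi> (x - k) \<partial>lborel) = (\<integral>x. f x * \<psi> (x - k) \<partial>lborel)" by simp
 moreover have "(\<integral>x. P x \<bullet> grad \<psi> (x - k) \<partial>lborel) = (\<integral>x. P (x + k) \<bullet> grad \<psi> x \<partial>lborel)"
  using integral_lborel_shift[of "%x. P x \<bullet> grad \<psi> (x - k)" k] by simp
 moreover have "(\<integral>x. f x * \<psi> (x - k) \<partial>lborel) = (\<integral>x. f (x + k) * \<psi> x \<partial>lborel)"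
  using integral_lborel_shift[of "%x. f x * \<psi> (x - k)" k] by simp
 moreover have "rtest (ball z R) \<psi>"
 proof (rule rtest_mono[OF \<psi> subset_ball])
  show "r \<le> R" using r norm_ge_zero[of k] by linarith
 qed
 ultimately show ?thesis
  using eq[of \<psi>] l2_inner(1)[OF P s2] l2_inner(1)[OF sqi_shift(1)[OF P, of k] s2] l2_mult(1)[OF f s1] l2_mult(1)[OF sqi_shift(1)[OF f, of k] s1]
  by (simp add: inner_diff_left left_diff_distrib)
qed

text \<open>The difference of the solution under a shift by \<open>k\<close> solves an equation with
  the shifted coefficient and an extra flux from the increment of the coefficient, so the
  Caccioppoli estimate applies a second time. The radii run through R, 3R/4, R/2, 3R/8, R/4; the
  bound R/16 on shifts is the margin \<open>(R/2 - 3*R/8)/2\<close> of the second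
  application.\<close>

lemma second_difference:
 fixes z :: "real^'n"
 assumes R: "0 < R" and lam: "\<mu> > 0" "\<Lambda> \<ge> 0" "L \<ge> 0" "Lq \<ge> 0"
 obtains C where "C \<ge> 0"
  "!!a w G f Kf h k. good_coeff z R \<Lambda> \<mu> L a ==>
    (!!x h k \<xi>. {x, x + h, x + k, x + h + k} \<subseteq> ball z R ==> norm ((a (x + h + k) - a (x + h) - (a (x + k) - a x)) *v \<xi>) \<le> Lq * norm h * norm k * norm \<xi>) ==>
    weakg (ball z R) w G ==> sqi lborel f ==>
    (!!\<psi>. rtest (ball z R) \<psi> ==> (\<integral>x. (a x *v G x) \<bullet> grad \<psi> x \<partial>lborel) = (\<integral>x. f x * \<psi> x \<partial>lborel)) ==>
    l2on (ball z (R/2)) (%x. f (x + k) - f x) \<le> Kf * norm k ==> Kf \<ge> 0 ==>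
    norm h < R/16 ==> norm k < R/16 ==>
    l2on (ball z (R/2)) (%x. G (x + k) - G x) \<le> C * norm k * (l2 lborel G + l2 lborel f + Kf) \<and>
    l2on (ball z (R/4)) (%x. G (x + h + k) - G (x + h) - (G (x + k) - G x)) \<le> C * norm h * norm k * (l2 lborel G + l2 lborel f + Kf)"
proof -
 obtain C1 where C1: "C1 \<ge> 0"
  "!!a w G f H K h. good_coeff z R \<Lambda> \<mu> L a ==> weakg (ball z R) w G ==> sqi lborel f ==> sqi lborel H ==>
    (!!\<psi>. rtest (ball z R) \<psi> ==> (\<integral>x. (a x *v G x - H x) \<bullet> grad \<psi> x \<partial>lborel) = (\<integral>x. f x * \<psi> x \<partial>lborel)) ==>
    norm h < (R - (3*R/4))/2 ==> l2on (cball z (3*R/4)) (%x. H (x + h) - H x) \<le> K * norm h ==> K \<ge> 0 ==>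
    l2on (ball z (R/2)) (%x. G (x + h) - G x) \<le> C1 * (norm h * (l2 lborel G + l2 lborel f + K))"
  using caccioppoli_difference[of "R/2" "3*R/4" R \<mu> \<Lambda> L z] R lam by (auto simp: field_simps)
 obtain C2 where C2: "C2 \<ge> 0"
  "!!a w G f H K h. good_coeff z (R/2) \<Lambda> \<mu> L a ==> weakg (ball z (R/2)) w G ==> sqi lborel f ==> sqi lborel H ==>
    (!!\<psi>. rtest (ball z (R/2)) \<psi> ==> (\<integral>x. (a x *v G x - H x) \<bullet> grad \<psi> x \<partial>lborel) = (\<integral>x. f x * \<psi> x \<partial>lborel)) ==>
    norm h < (R/2 - 3*R/8)/2 ==> l2on (cball z (3*R/8)) (%x. H (x + h) - H x) \<le> K * norm h ==> K \<ge> 0 ==>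
    l2on (ball z (R/4)) (%x. G (x + h) - G x) \<le> C2 * (norm h * (l2 lborel G + l2 lborel f + K))"
  using caccioppoli_difference[of "R/4" "3*R/8" "R/2" \<mu> \<Lambda> L z] R lam by (auto simp: field_simps)
 \<comment> \<open>In the bracket: \<open>C1\<close> from the first difference of the gradient, 1
   from the difference of \<open>f\<close>, and \<open>Lq + L * C1\<close> from the flux
   \<open>H'\<close>.\<close>
 define C where "C = C1 + C2 * (C1 + 1 + Lq + L * C1)"
 have CC: "C \<ge> C1" "C \<ge> C2 * (C1 + 1 + Lq + L * C1)" "C \<ge> 0" using C1 C2 lam by (auto simp: C_def)
 show ?thesis
 proof (rule that[OF CC(3)], goal_cases)
  case (1 a w G f Kf h k)
  note good = 1(1) and dda = 1(2) and w = 1(3) and f = 1(4) and eq = 1(5) and Kf = 1(6,7) and h = 1(8) and k = 1(9)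
  have sw: "sqi lborel w" and sG: "sqi lborel G" using w by (auto simp: weakg_def)
  have am[measurable]: "a \<in> borel_measurable borel" and bnd: "!!x \<xi>. norm (a x *v \<xi>) \<le> \<Lambda> * norm \<xi>"
   and ell: "!!x \<xi>. x \<in> ball z R ==> \<mu> * (norm \<xi>)\<^sup>2 \<le> (a x *v \<xi>) \<bullet> \<xi>"
   and lip: "!!x y \<xi>. x \<in> ball z R ==> y \<in> ball z R ==> norm ((a x - a y) *v \<xi>) \<le> L * norm (x - y) * norm \<xi>"
   using good by (auto simp: good_coeff_def)
  have [measurable]: "w \<in> borel_measurable borel" "G \<in> borel_measurable borel" "f \<in> borel_measurable borel"
   using sw sG f by (auto simp: sqi_def)
  define M where "M = l2 lborel G + l2 lborel f + Kf"
  have M: "l2 lborel G \<le> M" "l2 lborel f \<le> M" "Kf \<le> M" "M \<ge> 0" using Kf by (auto simp: M_def add_nonneg_nonneg)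
  have first: "l2on (ball z (R/2)) (%x. G (x + h) - G x) \<le> C1 * (norm h * M)" if "norm h < R/16" for h
  proof -
   have "l2on (ball z (R/2)) (%x. G (x + h) - G x) \<le> C1 * (norm h * (l2 lborel G + l2 lborel f + 0))"
    by (rule C1(2)[OF good w f, of "%x. 0"]) (use that R eq in \<open>auto simp: l2on_def\<close>)
   also have "\<dots> \<le> C1 * (norm h * M)" using Kf by (intro mult_left_mono C1) (auto simp: M_def)
   finally show ?thesis .
  qed
  have saG: "sqi lborel (%x. a x *v G x)"
   by (rule sqi_bound(1)[OF _ sG, of _ \<Lambda>]) (use bnd lam in auto)
  let ?B = "ball z (R/2)"
  have Bm[measurable]: "?B \<in> sets borel" by (auto intro: borel_open)
  have shB: "x + k' \<in> ball z R" if "x \<in> ?B" "norm k' < R/16" for x k'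
   using that norm_triangle_ineq4[of "z - x" k'] R by (auto simp: dist_norm algebra_simps)
  have inR: "x \<in> ball z R" if "x \<in> ?B" for x using that R by auto
  define q where "q x = (a (x + k) - a x) *v G x" for x
  have qm[measurable]: "q \<in> borel_measurable borel" unfolding q_def by measurable
  define G' where "G' = restr ?B (%x. G (x + k) - G x)"
  define f' where "f' = restr ?B (%x. f (x + k) - f x)"
  \<comment> \<open>The increment of \<open>a x *v G x\<close> is \<open>a (x + k)\<close> times the
    increment of \<open>G\<close> plus \<open>q x\<close>; the sign matches the convention that the
    flux is subtracted.\<close>
  define H' where "H' = (%x. - restr ?B q x)"
  have sG': "sqi lborel G'" unfolding G'_def by (intro sqi_restr sqi_diff sqi_shift sG) simp
  have sf': "sqi lborel f'" unfolding f'_def by (intro sqi_restr sqi_diff sqi_shift f) simp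
  have qb: "norm (restr ?B q x) \<le> (L * norm k) * norm (G x)" for x
   using lip[of "x + k" x "G x"] shB[of x k] inR[of x] lam k by (cases "x \<in> ?B") (auto simp: q_def)
  have sH': "sqi lborel H'" unfolding H'_def
   by (intro sqi_uminus sqi_bound(1)[OF _ sG, of _ "L * norm k"]) (use qb lam restr_measurable[OF Bm qm] in auto)
  have wdiff: "weakg ?B (%x. w (x + k) - w x) (%x. G (x + k) - G x)"
  proof (rule weakg_diff)
   show "weakg ?B w G" by (rule weakg_mono[OF w]) (use inR in auto)
   show "weakg ?B (%x. w (x + k)) (%x. G (x + k))"
    by (rule weakg_mono[OF weakg_shift[OF w]]) (use shB k in auto)
  qed
  have w': "weakg ?B (%x. w (x + k) - w x) G'" unfolding G'_def by (rule weakg_restr[OF wdiff]) auto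
  have good': "good_coeff z (R/2) \<Lambda> \<mu> L (%x. a (x + k))"
   unfolding good_coeff_def
  proof (intro conjI allI ballI)
   show "(%x. a (x + k)) \<in> borel_measurable borel" by measurable
   show "norm (a (x + k) *v \<xi>) \<le> \<Lambda> * norm \<xi>" for x \<xi> by (rule bnd)
   show "\<mu> * (norm \<xi>)\<^sup>2 \<le> (a (x + k) *v \<xi>) \<bullet> \<xi>" if "x \<in> ?B" for x \<xi> by (rule ell[OF shB[OF that k]])
   show "norm ((a (x + k) - a (y + k)) *v \<xi>) \<le> L * norm (x - y) * norm \<xi>" if "x \<in> ?B" "y \<in> ?B" for x y \<xi>
    using lip[OF shB[OF that(1) k] shB[OF that(2) k]] by simp
  qed
  have eq': "(\<integral>x. (a (x + k) *v G' x - H' x) \<bullet> grad \<psi> x \<partial>lborel) = (\<integral>x. f' x * \<psi> x \<partial>lborel)" if \<psi>: "rtest ?B \<psi>" for \<psi>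
  proof -
   obtain K where K: "compact K" "K \<subseteq> ?B" "!!x. x \<notin> K ==> \<psi> x = 0" using \<psi> by (auto simp: rtest_def)
   have off: "\<psi> x = 0 \<and> grad \<psi> x = 0" if "x \<notin> ?B" for x
    using K that rtest_grad_support[OF \<psi> K(1,3)] by blast
   have "(a (x + k) *v G' x - H' x) \<bullet> grad \<psi> x = (a (x + k) *v G (x + k) - a x *v G x) \<bullet> grad \<psi> x" for x
    using off[of x] by (cases "x \<in> ?B")
     (auto simp: G'_def H'_def q_def matrix_vector_mult_diff_distrib matrix_vector_mult_diff_rdistrib)
   moreover have "f' x * \<psi> x = (f (x + k) - f x) * \<psi> x" for x
    using off[of x] by (cases "x \<in> ?B") (auto simp: f'_def)
   moreover have "(\<integral>x. (a (x + k) *v G (x + k) - a x *v G x) \<bullet> grad \<psi> x \<partial>lborel) = (\<integral>x. (f (x + k) - f x) * \<psi> x \<partial>lborel)"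
    by (rule weak_equation_difference[OF saG f eq \<psi>]) (use k R in auto)
   ultimately show ?thesis by (simp only:)
  qed
  define K' where "K' = norm k * (Lq + L * C1) * M"
  have K'0: "K' \<ge> 0" using lam C1 M by (simp add: K'_def)
  have Hd: "l2on (cball z (3*R/8)) (%x. H' (x + h) - H' x) \<le> K' * norm h"
  proof -
   define s where "s x = (Lq * norm h * norm k) * norm (G (x + h)) + (L * norm k) * norm (restr ?B (%x. G (x + h) - G x) x)" for x
   have s1: "sqi lborel (%x. (Lq * norm h * norm k) * norm (G (x + h)))" "l2 lborel (%x. (Lq * norm h * norm k) * norm (G (x + h))) \<le> (Lq * norm h * norm k) * l2 lborel G"
    using sqi_bound[OF _ sqi_shift(1)[OF sG, of h], of "%x. (Lq * norm h * norm k) * norm (G (x + h))" "Lq * norm h * norm k"] sqi_shift(2)[OF sG, of h] lam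
    by (auto simp: abs_mult)
   have s0: "sqi lborel (restr ?B (%x. G (x + h) - G x))" by (intro sqi_restr sqi_diff sqi_shift sG) simp
   have s0m[measurable]: "restr ?B (%x. G (x + h) - G x) \<in> borel_measurable borel" using s0 by (simp add: sqi_def)
   have s2: "sqi lborel (%x. (L * norm k) * norm (restr ?B (%x. G (x + h) - G x) x))" "l2 lborel (%x. (L * norm k) * norm (restr ?B (%x. G (x + h) - G x) x)) \<le> (L * norm k) * l2on ?B (%x. G (x + h) - G x)"
    using sqi_bound[OF _ s0, of "%x. (L * norm k) * norm (restr ?B (%x. G (x + h) - G x) x)" "L * norm k"] lam
    by (auto simp: abs_mult l2on_def simp del: norm_scaleR)
   have ss: "sqi lborel s" unfolding s_def by (rule sqi_add[OF s1(1) s2(1)])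
   have Hm: "(%x. H' (x + h) - H' x) \<in> borel_measurable borel" using sqi_diff[OF sqi_shift(1)[OF sH', of h] sH'] by (simp add: sqi_def)
   have pt: "norm (restr (cball z (3*R/8)) (%x. H' (x + h) - H' x) x) \<le> 1 * norm (s x)" for x
   proof (cases "x \<in> cball z (3*R/8)")
    case True
    then have xB: "x \<in> ?B" using R by auto
    have xhB: "x + h \<in> ?B" using True norm_triangle_ineq4[of "z - x" h] h R by (auto simp: dist_norm algebra_simps)
    \<comment> \<open>Discrete product rule for the flux: a second difference of the coefficient
      against the gradient, plus a first difference against the first difference of the gradient,
      already bounded by \<open>first\<close>.\<close>
    have "H' (x + h) - H' x = - ((a (x + h + k) - a (x + h) - (a (x + k) - a x)) *v G (x + h) + (a (x + k) - a x) *v (G (x + h) - G x))"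
     using xB xhB by (simp add: H'_def q_def matrix_vector_mult_diff_distrib matrix_vector_mult_diff_rdistrib)
    then have "norm (H' (x + h) - H' x) \<le> norm ((a (x + h + k) - a (x + h) - (a (x + k) - a x)) *v G (x + h)) + norm ((a (x + k) - a x) *v (G (x + h) - G x))"
     by (simp only: norm_minus_cancel norm_triangle_ineq)
    also have "\<dots> \<le> Lq * norm h * norm k * norm (G (x + h)) + L * norm k * norm (G (x + h) - G x)"
     using dda[of x h k "G (x + h)"] lip[of "x + k" x "G (x + h) - G x"] inR[OF xB] inR[OF xhB] shB[OF xB k] shB[OF xhB k] by simp
    finally show ?thesis using True xB lam by (simp add: s_def)
   next
    case False then show ?thesis using lam by (simp add: s_def)
   qed
   have "l2on (cball z (3*R/8)) (%x. H' (x + h) - H' x) \<le> 1 * l2 lborel s"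
    unfolding l2on_def by (rule sqi_bound(2)[OF _ ss]) (use pt restr_measurable[OF _ Hm, of "cball z (3*R/8)"] in auto)
   also have "l2 lborel s \<le> (Lq * norm h * norm k) * l2 lborel G + (L * norm k) * l2on ?B (%x. G (x + h) - G x)"
    unfolding s_def using l2_triangle[OF s1(1) s2(1)] s1(2) s2(2) by linarith
   also have "\<dots> \<le> (Lq * norm h * norm k) * M + (L * norm k) * (C1 * (norm h * M))"
    using M first[OF h] lam by (intro add_mono mult_left_mono) auto
   also have "\<dots> = K' * norm h" by (simp add: K'_def algebra_simps)
   finally show ?thesis by simp
  qed
  have hh: "norm h < (R/2 - 3*R/8)/2" using h by simp
  have second: "l2on (ball z (R/4)) (%x. G' (x + h) - G' x) \<le> C2 * (norm h * (l2 lborel G' + l2 lborel f' + K'))"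
   by (rule C2(2)[OF good' w' sf' sH' eq' hh Hd K'0])
  have "l2 lborel G' \<le> C1 * (norm k * M)" using first[OF k] by (simp add: G'_def l2on_def)
  moreover have "l2 lborel f' \<le> norm k * M" using Kf(1) mult_right_mono[OF M(3) norm_ge_zero[of k]] by (simp add: f'_def l2on_def mult.commute)
  ultimately have "l2 lborel G' + l2 lborel f' + K' \<le> norm k * M * (C1 + 1 + Lq + L * C1)"
   by (simp add: K'_def algebra_simps)
  then have "C2 * (norm h * (l2 lborel G' + l2 lborel f' + K')) \<le> C2 * (norm h * (norm k * M * (C1 + 1 + Lq + L * C1)))"
   by (intro mult_left_mono C2) auto
  also have "\<dots> = (C2 * (C1 + 1 + Lq + L * C1)) * (norm h * norm k * M)" by (simp add: mult_ac)
  also have "\<dots> \<le> C * (norm h * norm k * M)" using CC M by (intro mult_right_mono) auto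
  finally have *: "l2on (ball z (R/4)) (%x. G' (x + h) - G' x) \<le> C * norm h * norm k * M" using second by (simp add: mult_ac)
  have "restr (ball z (R/4)) (%x. G' (x + h) - G' x) = restr (ball z (R/4)) (%x. G (x + h + k) - G (x + h) - (G (x + k) - G x))"
  proof
   fix x
   show "restr (ball z (R/4)) (%x. G' (x + h) - G' x) x = restr (ball z (R/4)) (%x. G (x + h + k) - G (x + h) - (G (x + k) - G x)) x"
   proof (cases "x \<in> ball z (R/4)")
    case True
    then have "x \<in> ?B" "x + h \<in> ?B" using norm_triangle_ineq4[of "z - x" h] h R by (auto simp: dist_norm algebra_simps)
    then show ?thesis by (simp add: G'_def)
   qed simp
  qed
  then have 2: "l2on (ball z (R/4)) (%x. G (x + h + k) - G (x + h) - (G (x + k) - G x)) \<le> C * norm h * norm k * M" using * by (simp add: l2on_def)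
  have "C1 * (norm k * M) \<le> C * (norm k * M)" using CC M by (intro mult_right_mono) auto
  then have 1: "l2on ?B (%x. G (x + k) - G x) \<le> C * norm k * M" using first[OF k] by (simp add: mult_ac)
  show ?case using 1 2 by (simp add: M_def)
 qed
qed

section \<open>Decay on small balls by dyadic summation\<close>

text \<open>The weight \<open>sqrt (2 ^ DIM('a)) ^ j\<close> compensates the volume of the shrinking
  ball, so \<open>dyadic_step\<close> becomes an additive recursion. The constants
  \<open>K j\<close> may vary with the scale; that is what makes a second pass better than the
  first.\<close>

lemma dyadic_sum:
 fixes g :: "'a::euclidean_space => 'b::euclidean_space"
 assumes g: "sqi lborel g" and t: "t > 0" and K: "!!j. K j \<ge> 0"
  and diff: "!!j h. norm h < 2 * t ==> l2on (ball z (t / 2^j)) (%x. g (x + h) - g x) \<le> K j * norm h"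
 shows "sqrt (2 ^ DIM('a)) ^ j * l2on (ball z (t / 2^j)) g
   \<le> l2on (ball z t) g + (\<Sum>i<j. sqrt (2 ^ DIM('a)) ^ i * (2 ^ DIM('a) * (2 * (t / 2^i) * K i)))"
proof (induction j)
 case (Suc j)
 let ?D = "2 ^ DIM('a) :: real"
 have "2 * (t / 2 ^ j) \<le> 2 * t" using t by (simp add: field_simps)
 then have "sqrt ?D * l2on (ball z ((t / 2^j) / 2)) g \<le> ?D * (2 * (t / 2^j) * K j) + l2on (ball z (t / 2^j)) g"
  using t by (intro dyadic_step g K diff) auto
 then have "sqrt ?D ^ j * (sqrt ?D * l2on (ball z (t / 2^Suc j)) g) \<le> sqrt ?D ^ j * (?D * (2 * (t / 2^j) * K j) + l2on (ball z (t / 2^j)) g)"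
  by (intro mult_left_mono) (auto simp: mult.commute)
 with Suc show ?case by (simp add: distrib_left mult_ac)
qed simp

text \<open>The increments form a geometric sum of ratio \<open>sqrt (2 ^ DIM('a)) / 2\<close>,
  which is 1 in dimension 2 and \<open>sqrt 2\<close> in dimension 3. Using \<open>sqrt 2\<close>
  for both avoids a logarithm in dimension 2, and the loss is harmless later. The 6 is 2 from
  \<open>dyadic_step\<close> times 3 from the geometric sum.\<close>

lemma dyadic_one_derivative:
 fixes g :: "'a::euclidean_space => 'b::euclidean_space"
 assumes d: "DIM('a) \<in> {2, 3}" and g: "sqi lborel g" and t: "t > 0" and K: "K \<ge> 0"
  and diff: "!!h. norm h < 2 * t ==> l2on (ball z t) (%x. g (x + h) - g x) \<le> K * norm h"
 shows "l2on (ball z (t / 2^j)) g \<le> (sqrt 2 / sqrt (2 ^ DIM('a))) ^ j * (l2on (ball z t) g + 6 * 2 ^ DIM('a) * t * K)"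
proof -
 let ?D = "2 ^ DIM('a) :: real"
 have D: "?D \<in> {4, 8}" using d by auto
 have sD: "sqrt ?D / 2 \<le> sqrt 2" and sD0: "sqrt ?D > 0"
 proof -
  have "sqrt ?D \<le> sqrt (2 * 4)" using D by (intro real_sqrt_le_mono) auto
  also have "\<dots> = sqrt 2 * 2" by (simp only: real_sqrt_mult real_sqrt_four)
  finally show "sqrt ?D / 2 \<le> sqrt 2" by simp
 qed simp
 have s2: "sqrt 2 - 1 \<ge> 1/3" using real_le_rsqrt[of "4/3" 2] by (simp add: power2_eq_square)
 have gm: "g \<in> borel_measurable borel" using g by (simp add: sqi_def)
 have diffj: "l2on (ball z (t / 2^i)) (%x. g (x + h) - g x) \<le> K * norm h" if "norm h < 2 * t" for i h
 proof (rule order_trans[OF l2on_mono(1) diff[OF that]])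
  show "ball z (t / 2^i) \<subseteq> ball z t" using t by (intro subset_ball) (simp add: field_simps)
  have s: "sqi lborel (%x. g (x + h) - g x)" by (intro sqi_diff sqi_shift g)
  then show "(%x. g (x + h) - g x) \<in> borel_measurable borel" by (simp add: sqi_def)
  show "sqi lborel (restr (ball z t) (%x. g (x + h) - g x))" by (rule sqi_restr[OF _ s]) simp
 qed auto
 have "sqrt ?D ^ j * l2on (ball z (t / 2^j)) g \<le> l2on (ball z t) g + (\<Sum>i<j. sqrt ?D ^ i * (?D * (2 * (t / 2^i) * K)))"
  by (rule dyadic_sum[OF g t K diffj])
 also have "(\<Sum>i<j. sqrt ?D ^ i * (?D * (2 * (t / 2^i) * K))) = (?D * 2 * t * K) * (\<Sum>i<j. (sqrt ?D / 2) ^ i)"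
  unfolding sum_distrib_left by (rule sum.cong) (auto simp: power_divide)
 also have "\<dots> \<le> (?D * 2 * t * K) * (\<Sum>i<j. sqrt 2 ^ i)"
  using t K sD sD0 by (intro mult_left_mono sum_mono power_mono) auto
 \<comment> \<open>The 3 bounds the reciprocal of \<open>sqrt 2 - 1\<close>.\<close>
 also have "(\<Sum>i<j. sqrt 2 ^ i) \<le> 3 * sqrt 2 ^ j"
 proof -
  have "(\<Sum>i<j. sqrt 2 ^ i) = (sqrt 2 ^ j - 1) / (sqrt 2 - 1)" using geometric_sum[of "sqrt 2" j] by simp
  also have "\<dots> \<le> sqrt 2 ^ j / (1/3)" using s2 by (intro frac_le) auto
  finally show ?thesis by simp
 qed
 then have "(?D * 2 * t * K) * (\<Sum>i<j. sqrt 2 ^ i) \<le> (?D * 2 * t * K) * (3 * sqrt 2 ^ j)" using t K by (intro mult_left_mono) auto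
 finally have "sqrt ?D ^ j * l2on (ball z (t / 2^j)) g \<le> l2on (ball z t) g + (6 * ?D * t * K) * sqrt 2 ^ j" by (simp add: mult_ac)
 also have "\<dots> \<le> sqrt 2 ^ j * (l2on (ball z t) g + 6 * ?D * t * K)"
  using mult_right_mono[of 1 "sqrt 2 ^ j" "l2on (ball z t) g"] by (simp add: distrib_left mult_ac)
 finally show ?thesis using sD0 by (simp add: power_divide field_simps)
qed

text \<open>Differences that decay as in \<open>dyadic_one_derivative\<close> leave the ratio
  \<open>sqrt 2 / 2\<close>, below 3/4, so the increments are summable with sum at most 4 and the
  volume rate survives. The 8 is 2 times 4.\<close>

lemma dyadic_two_derivatives:
 fixes g :: "'a::euclidean_space => 'b::euclidean_space"
 assumes g: "sqi lborel g" and t: "t > 0" and K: "K \<ge> 0"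
  and diff: "!!j h. norm h < 2 * t ==> l2on (ball z (t / 2^j)) (%x. g (x + h) - g x) \<le> (sqrt 2 / sqrt (2 ^ DIM('a))) ^ j * K * norm h"
 shows "l2on (ball z (t / 2^j)) g \<le> (1 / sqrt (2 ^ DIM('a))) ^ j * (l2on (ball z t) g + 8 * 2 ^ DIM('a) * t * K)"
proof -
 let ?D = "2 ^ DIM('a) :: real"
 have sD0: "sqrt ?D > 0" by simp
 have "sqrt 2 \<le> 3/2" by (rule real_le_lsqrt) (auto simp: power2_eq_square)
 have "sqrt ?D ^ j * l2on (ball z (t / 2^j)) g \<le> l2on (ball z t) g + (\<Sum>i<j. sqrt ?D ^ i * (?D * (2 * (t / 2^i) * ((sqrt 2 / sqrt ?D) ^ i * K))))"
  by (rule dyadic_sum[OF g t _ diff]) (use K in auto)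
 also have "(\<Sum>i<j. sqrt ?D ^ i * (?D * (2 * (t / 2^i) * ((sqrt 2 / sqrt ?D) ^ i * K)))) = (?D * 2 * t * K) * (\<Sum>i<j. (sqrt 2 / 2) ^ i)"
  unfolding sum_distrib_left by (rule sum.cong) (auto simp: power_divide)
 also have "\<dots> \<le> (?D * 2 * t * K) * 4"
 proof (rule mult_left_mono)
  have "(\<Sum>i<j. (sqrt 2 / 2) ^ i) \<le> (\<Sum>i<j. (3/4) ^ i)" using \<open>sqrt 2 \<le> 3/2\<close> by (intro sum_mono power_mono) auto
  also have "\<dots> = ((3/4) ^ j - 1) / (3/4 - 1)" by (rule geometric_sum) simp
  also have "\<dots> \<le> (4 :: real)" by (simp add: field_simps)
  finally show "(\<Sum>i<j. (sqrt 2 / 2) ^ i) \<le> 4" .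
 qed (use t K in auto)
 finally have "sqrt ?D ^ j * l2on (ball z (t / 2^j)) g \<le> l2on (ball z t) g + 8 * ?D * t * K" by (simp add: mult_ac)
 then show ?thesis using sD0 by (simp add: power_divide field_simps)
qed

text \<open>Takes the last dyadic radius that is at least \<open>t\<close>; halving it once more
  falls below \<open>t\<close>, which gives the second bound and converts powers of 2 into powers of
  \<open>t\<close>.\<close>

lemma dyadic_radius:
 fixes t0 t :: real
 assumes "0 < t" "t \<le> t0"
 obtains j where "t \<le> t0 / 2^j" "1 / 2^j < 2 * t / t0"
proof -
 obtain m where "t0 / t < 2 ^ m" using real_arch_pow[of 2 "t0 / t"] by auto
 then have ex: "\<exists>m. t0 / 2^m < t" using assms by (intro exI[of _ m]) (simp add: field_simps)
 define m0 where "m0 = (LEAST m. t0 / 2^m < t)"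
 have m0: "t0 / 2^m0 < t" unfolding m0_def using ex by (rule LeastI_ex)
 then obtain j where j: "m0 = Suc j" using assms by (cases m0) auto
 have "\<not> t0 / 2^j < t" using not_less_Least[of j "%m. t0 / 2^m < t"] j m0_def by auto
 moreover have "1 / 2^j < 2 * t / t0" using m0 j assms by (simp add: field_simps)
 ultimately show ?thesis by (intro that[of j]) auto
qed

lemma l2on_ball_mono:
 assumes "sqi lborel f" "r \<le> r'"
 shows "l2on (ball z r) f \<le> l2on (ball z r') f"
 by (rule l2on_mono(1)) (use assms sqi_restr[OF _ assms(1), of "ball z r'"] in \<open>auto simp: sqi_def\<close>)

text \<open>Sobolev-type decay: one weak derivative makes the mass in a ball of radius \<open>t\<close> vanish; two derivatives of
 the gradient give the rate of a bounded function.\<close>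

lemma weakg_decay:
 fixes z :: "'a::euclidean_space"
 assumes d: "DIM('a) \<in> {2, 3}" and R: "R > 0"
 obtains C t0 where "C \<ge> 0" "t0 > 0"
  "!!w G t. weakg (ball z R) w G ==> 0 < t ==> t \<le> t0 ==> l2on (ball z t) w \<le> C * (l2 lborel w + l2 lborel G) * sqrt t"
proof -
 let ?D = "2 ^ DIM('a) :: real"
 \<comment> \<open>A point, a shift below \<open>2 * t0\<close> and a mollification radius
   \<open>t0\<close> together stay within \<open>4 * t0\<close>, half of \<open>R\<close>.\<close>
 define t0 where "t0 = R / 8"
 define C where "C = (1 + 6 * ?D * t0) * sqrt (2 / t0)"
 have t0: "t0 > 0" using R by (simp add: t0_def)
 show ?thesis
 proof (rule that[of C t0])
  show "C \<ge> 0" "t0 > 0" using t0 by (auto simp: C_def)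
  fix w G t assume w: "weakg (ball z R) w G" and t: "0 < t" "t \<le> t0"
  have sw: "sqi lborel w" and sG: "sqi lborel G" using w by (auto simp: weakg_def)
  obtain j where j: "t \<le> t0 / 2^j" "1 / 2^j < 2 * t / t0" using dyadic_radius t by blast
  have "l2on (ball z (t0 / 2^j)) w \<le> (sqrt 2 / sqrt ?D) ^ j * (l2on (ball z t0) w + 6 * ?D * t0 * l2 lborel G)"
  proof (rule dyadic_one_derivative[OF d sw t0 l2_nonneg])
   fix h :: 'a assume h: "norm h < 2 * t0"
   have "l2on (ball z t0) (%x. w (x + h) - w x) \<le> norm h * l2 lborel G"
   proof (rule shift_estimate[OF w _ t0])
    fix x and s :: real assume x: "x \<in> ball z t0" and s: "s \<in> {0..1}"
    show "cball (x + s *\<^sub>R h) t0 \<subseteq> ball z R"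
    proof
     fix y assume "y \<in> cball (x + s *\<^sub>R h) t0"
     then have y: "norm (x + s *\<^sub>R h - y) \<le> t0" by (simp add: dist_norm)
     have "norm (s *\<^sub>R h) \<le> norm h" using s by (simp add: mult_left_le_one_le)
     moreover have "z - y = (z - x) - s *\<^sub>R h + (x + s *\<^sub>R h - y)" by simp
     ultimately have "norm (z - y) \<le> norm (z - x) + norm h + norm (x + s *\<^sub>R h - y)"
      by (smt (verit) norm_triangle_ineq norm_triangle_ineq4)
     then show "y \<in> ball z R" using x y h R by (simp add: dist_norm t0_def)
    qed
   qed simp
   then show "l2on (ball z t0) (%x. w (x + h) - w x) \<le> l2 lborel G * norm h" by (simp add: mult.commute)
  qed
  also have "\<dots> \<le> (1 / sqrt 2) ^ j * ((1 + 6 * ?D * t0) * (l2 lborel w + l2 lborel G))"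
  proof (rule mult_mono)
   \<comment> \<open>Here the dimension must be at least 2; the resulting power of
     \<open>1 / sqrt 2\<close> is the root of the radius ratio.\<close>
   have "sqrt 2 / sqrt ?D \<le> 1 / sqrt 2"
   proof -
    have "sqrt 2 * sqrt 2 \<le> sqrt ?D"
    proof -
     have "sqrt (2 ^ 2) \<le> sqrt ?D" using d by (intro real_sqrt_le_mono) auto
     then show ?thesis by simp
    qed
    then show ?thesis by (simp add: field_simps)
   qed
   then show "(sqrt 2 / sqrt ?D) ^ j \<le> (1 / sqrt 2) ^ j" by (intro power_mono) auto
   have "l2on (ball z t0) w \<le> l2 lborel w" by (rule l2on_le[OF _ sw]) simp
   moreover have "a + X * g \<le> (1 + X) * (b + g)" if "a \<le> b" "0 \<le> b" "0 \<le> g" "0 \<le> X" for a b g X :: real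
   proof -
    have "(1 + X) * (b + g) = b + g + X * b + X * g" by (simp add: algebra_simps)
    then show ?thesis using that mult_nonneg_nonneg[of X b] by linarith
   qed
   ultimately show "l2on (ball z t0) w + 6 * ?D * t0 * l2 lborel G \<le> (1 + 6 * ?D * t0) * (l2 lborel w + l2 lborel G)"
    using t0 by simp
  qed (use t0 in \<open>auto intro!: add_nonneg_nonneg\<close>)
  also have "(1 / sqrt 2) ^ j = sqrt (1 / 2 ^ j)" by (simp add: real_sqrt_divide real_sqrt_power power_divide)
  also have "sqrt (1 / 2 ^ j) * ((1 + 6 * ?D * t0) * (l2 lborel w + l2 lborel G)) \<le> sqrt (2 * t / t0) * ((1 + 6 * ?D * t0) * (l2 lborel w + l2 lborel G))"
   using j(2) t0 by (intro mult_right_mono real_sqrt_le_mono) auto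
  also have "\<dots> = C * (l2 lborel w + l2 lborel G) * sqrt t" by (simp add: C_def real_sqrt_mult real_sqrt_divide mult_ac)
  finally show "l2on (ball z t) w \<le> C * (l2 lborel w + l2 lborel G) * sqrt t"
   using l2on_ball_mono[OF sw j(1), of z] by linarith
 qed
qed

text \<open>Two dyadic passes: for each fixed shift \<open>k\<close> the difference of
  \<open>G\<close> satisfies a difference bound and decays by \<open>dyadic_one_derivative\<close>,
  with a factor \<open>norm k\<close> kept throughout; this family of bounds is the input of
  \<open>dyadic_two_derivatives\<close> for \<open>G\<close> itself.\<close>

theorem interior_gradient_decay:
 fixes z :: "real^'n"
 assumes d: "CARD('n) \<in> {2, 3}" and R: "0 < R" and lam: "\<mu> > 0" "\<Lambda> \<ge> 0" "L \<ge> 0" "Lq \<ge> 0"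
 obtains C t0 where "C \<ge> 0" "t0 > 0"
  "!!a w G f Kf t. good_coeff z R \<Lambda> \<mu> L a ==>
    (!!x h k \<xi>. {x, x + h, x + k, x + h + k} \<subseteq> ball z R ==> norm ((a (x + h + k) - a (x + h) - (a (x + k) - a x)) *v \<xi>) \<le> Lq * norm h * norm k * norm \<xi>) ==>
    weakg (ball z R) w G ==> sqi lborel f ==>
    (!!\<psi>. rtest (ball z R) \<psi> ==> (\<integral>x. (a x *v G x) \<bullet> grad \<psi> x \<partial>lborel) = (\<integral>x. f x * \<psi> x \<partial>lborel)) ==>
    (!!k. norm k < R/16 ==> l2on (ball z (R/2)) (%x. f (x + k) - f x) \<le> Kf * norm k) ==> Kf \<ge> 0 ==> 0 < t ==> t \<le> t0 ==>
    l2on (ball z t) G \<le> C * (l2 lborel G + l2 lborel f + Kf) * sqrt (t ^ CARD('n))"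
proof -
 let ?D = "2 ^ DIM(real^'n) :: real"
 have d': "DIM(real^'n) \<in> {2, 3}" using d by simp
 show thesis
 proof (rule second_difference[OF R lam, of z])
 fix C :: real
 assume C: "C \<ge> 0"
  "!!a w G f Kf h k. good_coeff z R \<Lambda> \<mu> L a ==>
    (!!x h k \<xi>. {x, x + h, x + k, x + h + k} \<subseteq> ball z R ==> norm ((a (x + h + k) - a (x + h) - (a (x + k) - a x)) *v \<xi>) \<le> Lq * norm h * norm k * norm \<xi>) ==>
    weakg (ball z R) w G ==> sqi lborel f ==>
    (!!\<psi>. rtest (ball z R) \<psi> ==> (\<integral>x. (a x *v G x) \<bullet> grad \<psi> x \<partial>lborel) = (\<integral>x. f x * \<psi> x \<partial>lborel)) ==>
    l2on (ball z (R/2)) (%x. f (x + k) - f x) \<le> Kf * norm k ==> Kf \<ge> 0 ==>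
    norm h < R/16 ==> norm k < R/16 ==>
    l2on (ball z (R/2)) (%x. G (x + k) - G x) \<le> C * norm k * (l2 lborel G + l2 lborel f + Kf) \<and>
    l2on (ball z (R/4)) (%x. G (x + h + k) - G (x + h) - (G (x + k) - G x)) \<le> C * norm h * norm k * (l2 lborel G + l2 lborel f + Kf)"
 \<comment> \<open>The dyadic lemmas use shifts up to \<open>2 * t0\<close>, which is the limit R/16
   of \<open>second_difference\<close>.\<close>
 define t0 where "t0 = R / 32"
 have t0: "t0 > 0" using R by (simp add: t0_def)
 define C1 where "C1 = C + 6 * ?D * t0 * C"
 define C' where "C' = (1 + 8 * ?D * t0 * C1) * sqrt ((2 / t0) ^ CARD('n))"
 have C10: "C1 \<ge> 0" using C(1) t0 by (simp add: C1_def)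
 show thesis
 proof (rule that[of C' t0])
  show "C' \<ge> 0" "t0 > 0" using t0 C10 by (auto simp: C'_def)
  fix a w G f Kf t assume good: "good_coeff z R \<Lambda> \<mu> L a"
   and dda: "!!x h k \<xi>. {x, x + h, x + k, x + h + k} \<subseteq> ball z R ==> norm ((a (x + h + k) - a (x + h) - (a (x + k) - a x)) *v \<xi>) \<le> Lq * norm h * norm k * norm \<xi>"
   and w: "weakg (ball z R) w G" and f: "sqi lborel f"
   and eq: "!!\<psi>. rtest (ball z R) \<psi> ==> (\<integral>x. (a x *v G x) \<bullet> grad \<psi> x \<partial>lborel) = (\<integral>x. f x * \<psi> x \<partial>lborel)"
   and fd: "!!k. norm k < R/16 ==> l2on (ball z (R/2)) (%x. f (x + k) - f x) \<le> Kf * norm k" and Kf: "Kf \<ge> 0" and t: "0 < t" "t \<le> t0"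
  have sG: "sqi lborel G" using w by (auto simp: weakg_def)
  define M where "M = l2 lborel G + l2 lborel f + Kf"
  have M: "M \<ge> 0" "l2 lborel G \<le> M" using Kf by (auto simp: M_def add_nonneg_nonneg)
  have e: "l2on (ball z (R/2)) (%x. G (x + k) - G x) \<le> C * norm k * M"
   "l2on (ball z (R/4)) (%x. G (x + h + k) - G (x + h) - (G (x + k) - G x)) \<le> C * norm h * norm k * M"
   if "norm h < R/16" "norm k < R/16" for h k
   using C(2)[OF good dda w f eq fd[OF that(2)] Kf that] unfolding M_def by auto
  have first: "l2on (ball z (t0 / 2^j)) (%x. G (x + k) - G x) \<le> (sqrt 2 / sqrt ?D) ^ j * (C1 * M) * norm k"
   if k: "norm k < 2 * t0" for j k
  proof -
   have k': "norm k < R/16" using k by (simp add: t0_def)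
   have sd: "sqi lborel (%x. G (x + k) - G x)" by (intro sqi_diff sqi_shift sG)
   have "l2on (ball z (t0 / 2^j)) (%x. G (x + k) - G x) \<le> (sqrt 2 / sqrt ?D) ^ j * (l2on (ball z t0) (%x. G (x + k) - G x) + 6 * ?D * t0 * (C * norm k * M))"
   proof (rule dyadic_one_derivative[OF d' sd t0])
    show "0 \<le> C * norm k * M" using C(1) M by simp
    fix h :: "real^'n" assume h: "norm h < 2 * t0"
    have sdd: "sqi lborel (%x. G (x + h + k) - G (x + h) - (G (x + k) - G x))"
     by (intro sqi_diff sd sqi_shift(1)[OF sd, of h] sG)
    have "l2on (ball z t0) (%x. G (x + h + k) - G (x + h) - (G (x + k) - G x)) \<le> l2on (ball z (R/4)) (%x. G (x + h + k) - G (x + h) - (G (x + k) - G x))"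
     by (rule l2on_ball_mono[OF sdd]) (use R in \<open>simp add: t0_def\<close>)
    also have "\<dots> \<le> C * norm h * norm k * M" by (rule e(2)) (use h k' in \<open>auto simp: t0_def\<close>)
    finally show "l2on (ball z t0) (%x. G (x + h + k) - G (x + h) - (G (x + k) - G x)) \<le> C * norm k * M * norm h" by (simp add: mult_ac)
   qed
   also have "l2on (ball z t0) (%x. G (x + k) - G x) \<le> C * norm k * M"
    using l2on_ball_mono[OF sd, of t0 "R/2" z] e(1)[OF k' k'] R by (simp add: t0_def)
   also have "C * norm k * M + 6 * ?D * t0 * (C * norm k * M) = C1 * M * norm k" by (simp add: C1_def algebra_simps)
   finally show ?thesis by (simp add: mult_left_mono mult.assoc)
  qed
  obtain j where j: "t \<le> t0 / 2^j" "1 / 2^j < 2 * t / t0" using dyadic_radius t by blast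
  have "l2on (ball z (t0 / 2^j)) G \<le> (1 / sqrt ?D) ^ j * (l2on (ball z t0) G + 8 * ?D * t0 * (C1 * M))"
   by (rule dyadic_two_derivatives[OF sG t0 _ first]) (use C10 M in auto)
  also have "\<dots> \<le> (1 / sqrt ?D) ^ j * ((1 + 8 * ?D * t0 * C1) * M)"
  proof (rule mult_left_mono)
   have "l2on (ball z t0) G \<le> M" using l2on_le[OF _ sG, of "ball z t0"] M(2) by simp
   then show "l2on (ball z t0) G + 8 * ?D * t0 * (C1 * M) \<le> (1 + 8 * ?D * t0 * C1) * M" by (simp add: algebra_simps)
  qed simp
  also have "(1 / sqrt ?D) ^ j = sqrt ((1 / 2 ^ j) ^ CARD('n))"
   by (simp add: real_sqrt_divide real_sqrt_power power_divide power_mult[symmetric] mult.commute)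
  also have "sqrt ((1 / 2 ^ j) ^ CARD('n)) * ((1 + 8 * ?D * t0 * C1) * M) \<le> sqrt ((2 * t / t0) ^ CARD('n)) * ((1 + 8 * ?D * t0 * C1) * M)"
   using j(2) t0 C10 M by (intro mult_right_mono real_sqrt_le_mono power_mono) auto
  also have "\<dots> = C' * M * sqrt (t ^ CARD('n))"
   by (simp add: C'_def real_sqrt_mult real_sqrt_divide power_mult_distrib power_divide mult_ac)
  finally show "l2on (ball z t) G \<le> C' * (l2 lborel G + l2 lborel f + Kf) * sqrt (t ^ CARD('n))"
   using l2on_ball_mono[OF sG j(1), of z] unfolding M_def by linarith
 qed
qed
qed

section \<open>Semi-inner product spaces, Riesz representation and indefinite symmetric
  forms\<close>

text \<open>The first-order condition at a minimiser, without derivatives: a nonzero linear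
  coefficient would make the expression negative for a suitable small \<open>t\<close>.\<close>

lemma quadratic_nonneg_linear_zero:
 fixes a N :: real
 assumes "!!t. 0 \<le> t\<^sup>2 * N + 2 * t * a"
 shows "a = 0"
proof (rule ccontr)
 assume a: "a \<noteq> 0"
 define M where "M = \<bar>N\<bar> + 1"
 have M: "M > 0" "N \<le> M" by (auto simp: M_def)
 have "0 \<le> (- a / M)\<^sup>2 * N + 2 * (- a / M) * a" by (rule assms)
 also have "\<dots> \<le> (- a / M)\<^sup>2 * M + 2 * (- a / M) * a" using mult_left_mono[OF M(2), of "(- a / M)\<^sup>2"] by simp
 also have "\<dots> = - (a\<^sup>2 / M)" using M by (simp add: power2_eq_square field_simps)
 finally show False using a M by (simp add: divide_le_0_iff)
qed

text \<open>Only semi-definite, since the elements are functions and not classes modulo null sets.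
  Carrier, scaling and product are parameters so that \<open>H1 D\<close>, \<open>X D\<close>,
  complex vectors and spaces with a changed inner product are all instances.\<close>

locale semi_inner =
 fixes V :: "'v::ab_group_add set" and scl :: "complex => 'v => 'v" and ip :: "'v => 'v => complex"
 assumes V_zero: "0 \<in> V" and V_add: "u \<in> V ==> v \<in> V ==> u + v \<in> V" and V_scl: "u \<in> V ==> scl c u \<in> V"
  and diff_scl: "u - v = u + scl (-1) v"
  and ip_add: "u \<in> V ==> v \<in> V ==> w \<in> V ==> ip (u + v) w = ip u w + ip v w"
  and ip_scl: "u \<in> V ==> w \<in> V ==> ip (scl c u) w = c * ip u w"
  and ip_herm: "u \<in> V ==> v \<in> V ==> ip v u = cnj (ip u v)"
  and ip_nonneg: "u \<in> V ==> Re (ip u u) \<ge> 0"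
begin

definition nrm :: "'v => real" where "nrm u = sqrt (Re (ip u u))"

lemma V_diff: "u \<in> V ==> v \<in> V ==> u - v \<in> V"
 unfolding diff_scl by (intro V_add V_scl)

lemma ip_add_right: "u \<in> V ==> v \<in> V ==> w \<in> V ==> ip w (u + v) = ip w u + ip w v"
 using ip_herm[of "u + v" w] ip_herm[of u w] ip_herm[of v w] ip_add V_add by simp

lemma ip_scl_right: "u \<in> V ==> w \<in> V ==> ip w (scl c u) = cnj c * ip w u"
 using ip_herm[of "scl c u" w] ip_herm[of u w] ip_scl V_scl by simp

lemma ip_diff: "u \<in> V ==> v \<in> V ==> w \<in> V ==> ip (u - v) w = ip u w - ip v w"
 unfolding diff_scl using ip_add ip_scl V_scl by simp

lemma ip_diff_right: "u \<in> V ==> v \<in> V ==> w \<in> V ==> ip w (u - v) = ip w u - ip w v"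
 unfolding diff_scl using ip_add_right ip_scl_right V_scl by simp

lemma nrm_sq: "u \<in> V ==> (nrm u)\<^sup>2 = Re (ip u u)"
 using ip_nonneg by (simp add: nrm_def)

lemma nrm_nonneg: "u \<in> V ==> nrm u \<ge> 0" using ip_nonneg by (simp add: nrm_def)

lemma nrm_scl: "u \<in> V ==> nrm (scl c u) = cmod c * nrm u"
proof -
 assume u: "u \<in> V"
 have "ip (scl c u) (scl c u) = (c * cnj c) * ip u u" using u by (simp add: ip_scl ip_scl_right V_scl)
 then have "Re (ip (scl c u) (scl c u)) = (cmod c)\<^sup>2 * Re (ip u u)" by (simp only: complex_norm_square[symmetric] Re_complex_of_real flip: of_real_power) simp
 then show ?thesis by (simp add: nrm_def real_sqrt_mult)
qed

lemma expand: "u \<in> V ==> v \<in> V ==> (nrm (u + v))\<^sup>2 = (nrm u)\<^sup>2 + 2 * Re (ip u v) + (nrm v)\<^sup>2"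
 using ip_herm[of u v] by (simp add: nrm_sq V_add ip_add ip_add_right)

lemma expand_diff: "u \<in> V ==> v \<in> V ==> (nrm (u - v))\<^sup>2 = (nrm u)\<^sup>2 - 2 * Re (ip u v) + (nrm v)\<^sup>2"
 using ip_herm[of u v] by (simp add: nrm_sq V_diff ip_diff ip_diff_right)

lemma Cauchy_Schwarz_Re:
 assumes "u \<in> V" "v \<in> V"
 shows "Re (ip u v) \<le> nrm u * nrm v"
proof (cases "nrm u * nrm v = 0")
 case False
 then have p: "nrm u > 0" "nrm v > 0" using nrm_nonneg assms by (auto simp: less_le)
 have q: "0 \<le> (nrm (scl (of_real (nrm v)) u - scl (of_real (nrm u)) v))\<^sup>2" by simp
 also have "\<dots> = 2 * (nrm u * nrm v)\<^sup>2 - 2 * (nrm u * nrm v * Re (ip u v))"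
  using assms p by (simp add: expand_diff V_scl nrm_scl ip_scl ip_scl_right power_mult_distrib mult_ac)
 finally have "(nrm u * nrm v) * Re (ip u v) \<le> (nrm u * nrm v) * (nrm u * nrm v)" by (simp add: power2_eq_square)
 then show ?thesis using p by (simp add: mult_le_cancel_left)
next
 case True
 \<comment> \<open>Degenerate vectors are orthogonal to everything: otherwise the multiple
   \<open>s\<close> of \<open>x\<close> would push the square of a norm down to -1.\<close>
 have z: "Re (ip x y) = 0" if xy: "x \<in> V" "y \<in> V" "nrm x = 0" for x y
 proof (rule ccontr)
  define r where "r = Re (ip x y)"
  assume "Re (ip x y) \<noteq> 0"
  then have r: "r \<noteq> 0" by (simp add: r_def)
  define s where "s = - ((nrm y)\<^sup>2 + 1) / (2 * r)"
  have "0 \<le> (nrm (scl (of_real s) x + y))\<^sup>2" by simp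
  also have "\<dots> = 2 * s * r + (nrm y)\<^sup>2" using xy by (simp add: expand V_scl nrm_scl ip_scl r_def)
  also have "2 * s * r = - ((nrm y)\<^sup>2 + 1)" using r by (simp add: s_def)
  finally show False by simp
 qed
 have "Re (ip u v) = 0" using True z[of u v] z[of v u] assms ip_herm[of u v] by auto
 then show ?thesis unfolding True by simp
qed

lemma Cauchy_Schwarz:
 assumes "u \<in> V" "v \<in> V"
 shows "cmod (ip u v) \<le> nrm u * nrm v"
proof (cases "ip u v = 0")
 case False
 define c where "c = cnj (ip u v) / cmod (ip u v)"
 have c: "cmod c = 1" using False by (simp add: c_def norm_divide)
 have "c * ip u v = complex_of_real (cmod (ip u v))"
  using False complex_norm_square[of "ip u v"] by (simp add: c_def power2_eq_square mult.commute nonzero_divide_eq_eq)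
 then have "cmod (ip u v) = Re (ip (scl c u) v)" using assms by (simp add: ip_scl)
 also have "\<dots> \<le> nrm (scl c u) * nrm v" by (rule Cauchy_Schwarz_Re) (use assms V_scl in auto)
 finally show ?thesis using assms c by (simp add: nrm_scl)
qed (use nrm_nonneg assms in auto)

lemma nrm_triangle:
 assumes "u \<in> V" "v \<in> V"
 shows "nrm (u + v) \<le> nrm u + nrm v"
proof (rule power2_le_imp_le)
 show "(nrm (u + v))\<^sup>2 \<le> (nrm u + nrm v)\<^sup>2"
  using Cauchy_Schwarz_Re[OF assms] by (simp add: expand assms power2_sum)
qed (use nrm_nonneg assms in auto)

lemma nrm_diff_sym: "u \<in> V ==> v \<in> V ==> nrm (u - v) = nrm (v - u)"
proof -
 assume a: "u \<in> V" "v \<in> V"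
 have "(nrm (u - v))\<^sup>2 = (nrm (v - u))\<^sup>2" using a ip_herm[of u v] by (simp add: expand_diff)
 then show ?thesis using a nrm_nonneg V_diff by (metis power2_eq_imp_eq)
qed

definition complete_space :: bool where
 "complete_space \<longleftrightarrow> (\<forall>f. (\<forall>n. f n \<in> V) --> (\<forall>e>0. \<exists>N. \<forall>m\<ge>N. \<forall>n\<ge>N. nrm (f m - f n) < e)
   --> (\<exists>l\<in>V. (%n. nrm (f n - l)) \<longlonglongrightarrow> 0))"

text \<open>Antilinear, because the functionals to be represented act on the second slot of the
  product.\<close>

definition bounded_antilinear :: "('v => complex) => bool" where
 "bounded_antilinear F \<longleftrightarrow> (\<forall>u\<in>V. \<forall>v\<in>V. F (u + v) = F u + F v) \<and> (\<forall>c. \<forall>u\<in>V. F (scl c u) = cnj c * F u)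
   \<and> (\<exists>B. \<forall>u\<in>V. cmod (F u) \<le> B * nrm u)"

text \<open>The representative minimises the energy \<open>J\<close>: completing the square bounds
  it below, the parallelogram identity makes minimising sequences Cauchy, and the first variation is
  the representation. No orthogonal complements are needed.\<close>

theorem riesz:
 assumes comp: complete_space and F: "bounded_antilinear F"
 shows "\<exists>g\<in>V. \<forall>u\<in>V. ip g u = F u"
proof -
 obtain B0 where B0: "!!u. u \<in> V ==> cmod (F u) \<le> B0 * nrm u" using F unfolding bounded_antilinear_def by blast
 define B where "B = \<bar>B0\<bar>"
 have B: "cmod (F u) \<le> B * nrm u" if "u \<in> V" for u
 proof -
  have "B0 * nrm u \<le> B * nrm u" using nrm_nonneg[OF that] by (intro mult_right_mono) (auto simp: B_def)
  then show ?thesis using B0[OF that] by linarith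
 qed
 have Fadd: "u \<in> V ==> v \<in> V ==> F (u + v) = F u + F v" and Fscl: "u \<in> V ==> F (scl c u) = cnj c * F u" for u v c
  using F by (auto simp: bounded_antilinear_def)
 define J where "J u = (nrm u)\<^sup>2 - 2 * Re (F u)" for u
 have low: "- B\<^sup>2 \<le> J u" if "u \<in> V" for u
 proof -
  have "Re (F u) \<le> B * nrm u" using B[OF that] complex_Re_le_cmod[of "F u"] by linarith
  moreover have "0 \<le> (nrm u - B)\<^sup>2" by simp
  ultimately show ?thesis by (simp add: J_def power2_diff mult.commute)
 qed
 then have bdd: "bdd_below (J ` V)" by (intro bdd_belowI2) auto
 define m where "m = Inf (J ` V)"
 have ml: "m \<le> J u" if "u \<in> V" for u unfolding m_def using bdd that by (intro cInf_lower) auto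
 have "\<exists>u\<in>V. J u < m + 1 / Suc n" for n
 proof -
  have "Inf (J ` V) < m + 1 / Suc n" by (simp add: m_def)
  then obtain y where "y \<in> J ` V" "y < m + 1 / Suc n" using cInf_lessD[of "J ` V"] V_zero by auto
  then show ?thesis by blast
 qed
 then obtain f where f: "!!n. f n \<in> V" "!!n. J (f n) < m + 1 / Suc n" by metis
 have par: "(nrm (u - v))\<^sup>2 \<le> 2 * J u + 2 * J v - 4 * m" if uv: "u \<in> V" "v \<in> V" for u v
 proof -
  have h: "scl (1/2) (u + v) \<in> V" using uv by (intro V_scl V_add)
  have "J (scl (1/2) (u + v)) = (nrm (u + v))\<^sup>2 / 4 - Re (F u) - Re (F v)"
   using uv by (simp add: J_def nrm_scl V_add Fscl Fadd power_mult_distrib power_divide algebra_simps)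
  then have "4 * m \<le> (nrm (u + v))\<^sup>2 - 4 * Re (F u) - 4 * Re (F v)" using ml[OF h] by simp
  moreover have "(nrm (u - v))\<^sup>2 + (nrm (u + v))\<^sup>2 = 2 * (nrm u)\<^sup>2 + 2 * (nrm v)\<^sup>2" using uv by (simp add: expand expand_diff)
  ultimately show ?thesis by (simp add: J_def)
 qed
 have cau: "\<exists>N. \<forall>p\<ge>N. \<forall>n\<ge>N. nrm (f p - f n) < e" if e: "e > 0" for e
 proof -
  obtain N where N: "1 / Suc N < e\<^sup>2 / 4" using reals_Archimedean[of "e\<^sup>2 / 4"] e by (auto simp: inverse_eq_divide)
  have "nrm (f p - f n) < e" if pn: "p \<ge> N" "n \<ge> N" for p n
  proof (rule power2_less_imp_less)
   have "1 / Suc p \<le> 1 / Suc N" "1 / Suc n \<le> 1 / Suc N" using pn by (auto intro!: frac_le)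
   then show "(nrm (f p - f n))\<^sup>2 < e\<^sup>2" using par[OF f(1) f(1), of p n] f(2)[of p] f(2)[of n] N by linarith
  qed (use e in simp)
  then show ?thesis by blast
 qed
 obtain g where g: "g \<in> V" "(%n. nrm (f n - g)) \<longlonglongrightarrow> 0"
  using comp[unfolded complete_space_def, rule_format, of f] f(1) cau by blast
 have Re0: "Re (ip g v - F v) = 0" if v: "v \<in> V" for v
 proof (rule quadratic_nonneg_linear_zero)
  fix t :: real
  have ipl: "(%n. ip (f n) v) \<longlonglongrightarrow> ip g v"
  proof (rule LIM_zero_cancel, rule Lim_null_comparison)
   show "\<forall>\<^sub>F n in sequentially. norm (ip (f n) v - ip g v) \<le> nrm (f n - g) * nrm v"
    using Cauchy_Schwarz[OF V_diff[OF f(1) g(1)] v] by (simp add: ip_diff f g v)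
   show "(%n. nrm (f n - g) * nrm v) \<longlonglongrightarrow> 0" using tendsto_mult_right[OF g(2), of "nrm v"] by (simp add: mult.commute)
  qed
  have "- (1 / Suc n) \<le> t\<^sup>2 * (nrm v)\<^sup>2 + 2 * t * Re (ip (f n) v - F v)" for n
  proof -
   have tv: "scl (of_real t) v \<in> V" using v by (rule V_scl)
   have "J (f n + scl (of_real t) v) = J (f n) + (t\<^sup>2 * (nrm v)\<^sup>2 + 2 * t * Re (ip (f n) v - F v))"
    using tv v f(1)[of n] by (simp add: J_def expand Fadd Fscl nrm_scl ip_scl_right power_mult_distrib algebra_simps)
   then show ?thesis using ml[OF V_add[OF f(1)[of n] tv]] f(2)[of n] by linarith
  qed
  moreover have "(%n. t\<^sup>2 * (nrm v)\<^sup>2 + 2 * t * Re (ip (f n) v - F v)) \<longlonglongrightarrow> t\<^sup>2 * (nrm v)\<^sup>2 + 2 * t * Re (ip g v - F v)"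
   by (intro tendsto_intros ipl)
  moreover have "(%n. - (1 / real (Suc n))) \<longlonglongrightarrow> - 0"
  proof (rule tendsto_minus)
   show "(%n. 1 / real (Suc n)) \<longlonglongrightarrow> 0" by (rule LIMSEQ_Suc[OF lim_1_over_n])
  qed
  ultimately show "0 \<le> t\<^sup>2 * (nrm v)\<^sup>2 + 2 * t * Re (ip g v - F v)"
   using LIMSEQ_le[of "%n. - (1 / real (Suc n))" "- 0"] by force
 qed
 have "ip g v = F v" if v: "v \<in> V" for v
 proof (rule complex_eqI)
  show "Re (ip g v) = Re (F v)" using Re0[OF v] by simp
  \<comment> \<open>Both sides are antilinear, and the real part of -i times a number is its
    imaginary part.\<close>
  show "Im (ip g v) = Im (F v)" using Re0[OF V_scl[OF v, of \<i>]] v g by (simp add: ip_scl_right Fscl)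
 qed
 then show ?thesis using g(1) by blast
qed

text \<open>A bounded symmetric form that is coercive up to a bounded substitution represents every functional:
 with \<open>L\<close> the operator of the form, apply the Riesz theorem to the inner product \<open>(L u; L v)\<close>.\<close>

theorem symmetric_form_solvable:
 fixes a :: "'v => 'v => complex"
 assumes comp: complete_space
  and a1: "!!u v w. u \<in> V ==> v \<in> V ==> w \<in> V ==> a (u + v) w = a u w + a v w"
  and a2: "!!u w c. u \<in> V ==> w \<in> V ==> a (scl c u) w = c * a u w"
  and ah: "!!u v. u \<in> V ==> v \<in> V ==> a v u = cnj (a u v)"
  and ab: "!!u v. u \<in> V ==> v \<in> V ==> cmod (a u v) \<le> C * nrm u * nrm v"
  and T: "!!u. u \<in> V ==> T u \<in> V" "!!u. u \<in> V ==> nrm (T u) \<le> K * nrm u"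
  and co: "!!u. u \<in> V ==> c * (nrm u)\<^sup>2 \<le> cmod (a u (T u))" and c: "c > 0" and C: "C \<ge> 0" and K: "K \<ge> 0"
  and F: "bounded_antilinear F"
 shows "\<exists>y\<in>V. \<forall>u\<in>V. a y u = F u"
proof -
 have a1r: "a w (u + v) = a w u + a w v" if "u \<in> V" "v \<in> V" "w \<in> V" for u v w
  using that ah[of "u + v" w] ah[of u w] ah[of v w] a1[of u v w] V_add[of u v] by simp
 have a2r: "a w (scl d u) = cnj d * a w u" if "u \<in> V" "w \<in> V" for u w d
  using that ah[of "scl d u" w] ah[of u w] a2[of u w d] V_scl[of u d] by simp
 have "\<exists>g\<in>V. \<forall>u\<in>V. ip g u = a y u" if "y \<in> V" for y
  by (rule riesz[OF comp], unfold bounded_antilinear_def, intro conjI exI[of _ "C * nrm y"] ballI allI)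
   (use that a1r a2r ab in auto)
 then obtain L where L: "!!y. y \<in> V ==> L y \<in> V" "!!y u. y \<in> V ==> u \<in> V ==> ip (L y) u = a y u" by metis
 \<comment> \<open>Positive by construction although the form is indefinite. The bounds
   \<open>up\<close> and \<open>down\<close> below show that its norm is equivalent to the given
   one, coercivity up to the substitution \<open>T\<close> supplying the lower half.\<close>
 define ip' where "ip' u v = ip (L u) (L v)" for u v
 interpret S: semi_inner V scl ip'
 proof
  show "0 \<in> V" by (rule V_zero)
  show "ip' (u + v) w = ip' u w + ip' v w" if "u \<in> V" "v \<in> V" "w \<in> V" for u v w
   using that by (simp add: ip'_def L V_add a1)
  show "ip' (scl c u) w = c * ip' u w" if "u \<in> V" "w \<in> V" for u w c
   using that by (simp add: ip'_def L V_scl a2)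
  show "ip' v u = cnj (ip' u v)" if "u \<in> V" "v \<in> V" for u v unfolding ip'_def by (rule ip_herm) (use that L in auto)
  show "0 \<le> Re (ip' u u)" if "u \<in> V" for u unfolding ip'_def by (rule ip_nonneg) (use that L in auto)
  show "u - v = u + scl (- 1) v" for u v by (rule diff_scl)
 qed (auto intro: V_add V_scl)
 have n': "S.nrm u = nrm (L u)" for u by (simp add: S.nrm_def nrm_def ip'_def)
 have up: "S.nrm u \<le> C * nrm u" if u: "u \<in> V" for u
 proof -
  have "(nrm (L u))\<^sup>2 = Re (a u (L u))" using u by (simp add: nrm_sq L)
  also have "\<dots> \<le> cmod (a u (L u))" by (rule complex_Re_le_cmod)
  also have "\<dots> \<le> C * nrm u * nrm (L u)" using u L ab by simp
  finally have "nrm (L u) * nrm (L u) \<le> (C * nrm u) * nrm (L u)" by (simp add: power2_eq_square)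
  then show ?thesis unfolding n' using nrm_nonneg[OF L(1)[OF u]] nrm_nonneg[OF u] C
   by (cases "nrm (L u) = 0") (auto simp: mult_le_cancel_right)
 qed
 have down: "nrm u \<le> K / c * S.nrm u" if u: "u \<in> V" for u
 proof (cases "nrm u = 0")
  case False
  have "c * (nrm u)\<^sup>2 \<le> cmod (ip (L u) (T u))" using co[OF u] u T L by simp
  also have "\<dots> \<le> nrm (L u) * nrm (T u)" by (rule Cauchy_Schwarz) (use u L T in auto)
  also have "\<dots> \<le> nrm (L u) * (K * nrm u)" using T(2)[OF u] nrm_nonneg[OF L(1)[OF u]] by (rule mult_left_mono)
  finally have "(c * nrm u) * nrm u \<le> (K * nrm (L u)) * nrm u" by (simp add: power2_eq_square mult_ac)
  then have "c * nrm u \<le> K * nrm (L u)" using False nrm_nonneg[OF u] by (simp add: mult_le_cancel_right)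
  then show ?thesis unfolding n' using c by (simp add: field_simps)
 next
  case True then show ?thesis unfolding n' using K c nrm_nonneg[OF L(1)[OF u]] by simp
 qed
 have Kc: "K / c \<ge> 0" using K c by simp
 \<comment> \<open>Completeness is inherited through the equivalence of norms: Cauchy by
   \<open>down\<close>, convergence by \<open>up\<close>.\<close>
 have "S.complete_space" unfolding S.complete_space_def
 proof (intro allI impI)
  fix f :: "nat => 'v" assume fV: "\<forall>n. f n \<in> V" and ca: "\<forall>e>0. \<exists>N. \<forall>m\<ge>N. \<forall>n\<ge>N. S.nrm (f m - f n) < e"
  have "\<exists>N. \<forall>m\<ge>N. \<forall>n\<ge>N. nrm (f m - f n) < e" if e: "e > 0" for e
  proof -
   have "K / c + 1 > 0" using Kc by linarith
   with e have "e / (K / c + 1) > 0" by (rule divide_pos_pos)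
   from ca[rule_format, OF this] obtain N where "\<forall>m\<ge>N. \<forall>n\<ge>N. S.nrm (f m - f n) < e / (K / c + 1)" ..
   then have N: "!!m n. m \<ge> N ==> n \<ge> N ==> S.nrm (f m - f n) < e / (K / c + 1)" by simp
   have "nrm (f m - f n) < e" if "m \<ge> N" "n \<ge> N" for m n
   proof -
    have v: "f m - f n \<in> V" using fV V_diff by blast
    have "nrm (f m - f n) \<le> (K / c + 1) * S.nrm (f m - f n)" using down[OF v] S.nrm_nonneg[OF v] by (simp add: distrib_right)
    also have "\<dots> < (K / c + 1) * (e / (K / c + 1))" by (rule mult_strict_left_mono[OF N[OF that] \<open>K / c + 1 > 0\<close>])
    also have "\<dots> = e" using \<open>K / c + 1 > 0\<close> by (intro nonzero_mult_div_cancel_left[THEN trans[OF times_divide_eq_right]]) linarith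
    finally show ?thesis .
   qed
   then show ?thesis by blast
  qed
  then obtain l where l: "l \<in> V" "(%n. nrm (f n - l)) \<longlonglongrightarrow> 0" using comp fV unfolding complete_space_def by blast
  have "(%n. S.nrm (f n - l)) \<longlonglongrightarrow> 0"
  proof (rule Lim_null_comparison)
   show "\<forall>\<^sub>F n in sequentially. norm (S.nrm (f n - l)) \<le> C * nrm (f n - l)"
    using up S.nrm_nonneg V_diff fV l(1) by simp
   show "(%n. C * nrm (f n - l)) \<longlonglongrightarrow> 0" using tendsto_mult_left[OF l(2), of C] by simp
  qed
  then show "\<exists>l\<in>V. (%n. S.nrm (f n - l)) \<longlonglongrightarrow> 0" using l(1) by blast
 qed
 obtain g where g: "g \<in> V" "!!u. u \<in> V ==> ip g u = F u" using riesz[OF comp F] by blast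
 have "S.bounded_antilinear (a g)" unfolding S.bounded_antilinear_def
 proof (intro conjI exI[of _ "C * nrm g * (K / c)"] ballI allI)
  fix u assume u: "u \<in> V"
  have "cmod (a g u) \<le> (C * nrm g) * nrm u" by (rule ab[OF g(1) u])
  also have "\<dots> \<le> (C * nrm g) * (K / c * S.nrm u)" using C nrm_nonneg[OF g(1)] by (intro mult_left_mono down[OF u]) auto
  finally show "cmod (a g u) \<le> C * nrm g * (K / c) * S.nrm u" by (simp add: mult_ac)
 qed (use a1r a2r g in auto)
 then obtain y where y: "y \<in> V" "!!u. u \<in> V ==> ip' y u = a g u" using S.riesz[OF \<open>S.complete_space\<close>] by blast
 have Ly: "L y \<in> V" using L y by blast
 \<comment> \<open>Riesz in the new product solves the equation for the square of \<open>L\<close>.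
   That \<open>y\<close> solves it for \<open>L\<close> itself follows because the residual
   \<open>e\<close> is annihilated by the form, hence has norm 0 when tested with
   \<open>T e\<close>.\<close>
 define e where "e = g - L y"
 have e: "e \<in> V" using g Ly by (simp add: e_def V_diff)
 have ez: "a u e = 0" if u: "u \<in> V" for u
 proof -
  have "a u g = cnj (a g u)" by (rule ah[OF g(1) u])
  also have "\<dots> = cnj (ip (L y) (L u))" using y(2)[OF u] by (simp add: ip'_def)
  also have "\<dots> = ip (L u) (L y)" using ip_herm[OF Ly L(1)[OF u]] by simp
  also have "\<dots> = a u (L y)" using L u Ly by simp
  finally have "a u g = a u (L y)" .
  moreover have "a u e = a u g - a u (L y)" unfolding e_def diff_scl[of g] using a1r[OF g(1) V_scl[OF Ly] u, of "-1"] a2r[OF Ly u, of "-1"] by simp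
  ultimately show ?thesis by simp
 qed
 have "a e (T e) = cnj (a (T e) e)" by (rule ah) (use T e in auto)
 then have "c * (nrm e)\<^sup>2 \<le> 0" using co[OF e] ez[OF T(1)[OF e]] by simp
 then have ne: "nrm e = 0" using c by (simp add: mult_le_0_iff)
 have "a y u = F u" if u: "u \<in> V" for u
 proof -
  have "cmod (ip e u) \<le> 0" using Cauchy_Schwarz[OF e u] ne by simp
  then have "ip g u = ip (L y) u" using g Ly u by (simp add: e_def ip_diff)
  then show ?thesis using g(2)[OF u] L(2)[OF y(1) u] by simp
 qed
 then show ?thesis using y(1) by blast
qed

end

section \<open>Completeness of L2 and the fundamental lemma of the calculus of variations\<close>

text \<open>Riesz-Fischer by a rapidly converging subsequence. Finiteness of the measure bounds L1
  norms by L2 norms, so the increments sum to a finite function almost everywhere.\<close>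

theorem sqi_complete:
 fixes f :: "nat => 'a => 'b::euclidean_space"
 assumes fin: "finite_measure M" and f: "!!n. sqi M (f n)"
  and ca: "!!e. e > 0 ==> \<exists>N. \<forall>m\<ge>N. \<forall>n\<ge>N. l2 M (%x. f m x - f n x) < e"
 obtains g where "sqi M g" "(%n. l2 M (%x. f n x - g x)) \<longlonglongrightarrow> 0"
proof -
 interpret finite_measure M by fact
 have fm[measurable]: "f n \<in> borel_measurable M" for n using f by (simp add: sqi_def)
 have "\<exists>N. \<forall>m\<ge>N. \<forall>n\<ge>N. l2 M (%x. f m x - f n x) < (1/2)^k" for k :: nat by (rule ca) simp
 then obtain N0 where N0: "!!k m n. m \<ge> N0 k ==> n \<ge> N0 k ==> l2 M (%x. f m x - f n x) < (1/2)^k" by metis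
 \<comment> \<open>Partial sums make the indices monotone while still dominating each
   \<open>N0 k\<close>.\<close>
 define r where "r k = (\<Sum>i\<le>k. N0 i)" for k
 have r: "r k \<ge> N0 k" "r (Suc k) \<ge> r k" for k by (auto simp: r_def member_le_sum)
 have rd: "l2 M (%x. f (r (Suc k)) x - f (r k) x) < (1/2)^k" for k
  by (rule N0) (use r order_trans in blast)+
 have one: "sqi M (%x. 1 :: real)" by (simp add: sqi_def)
 define C where "C = l2 M (%x. 1 :: real)"
 have l1: "(\<integral>\<^sup>+x. ennreal (norm (f (r (Suc k)) x - f (r k) x)) \<partial>M) \<le> ennreal (C * (1/2)^k)" for k
 proof -
  have s: "sqi M (%x. f (r (Suc k)) x - f (r k) x)" by (intro sqi_diff f)
  have i: "integrable M (%x. norm (f (r (Suc k)) x - f (r k) x))" using l2_prod(1)[OF one s] by simp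
  have "(\<integral>x. norm (f (r (Suc k)) x - f (r k) x) \<partial>M) \<le> C * l2 M (%x. f (r (Suc k)) x - f (r k) x)"
   using l2_prod(2)[OF one s] by (simp add: C_def)
  also have "\<dots> \<le> C * (1/2)^k" using rd[of k] by (intro mult_left_mono) (auto simp: C_def)
  finally show ?thesis using nn_integral_eq_integral[OF i] by (simp add: ennreal_leI)
 qed
 have "(\<integral>\<^sup>+x. (\<Sum>k. ennreal (norm (f (r (Suc k)) x - f (r k) x))) \<partial>M) = (\<Sum>k. \<integral>\<^sup>+x. ennreal (norm (f (r (Suc k)) x - f (r k) x)) \<partial>M)"
  by (rule nn_integral_suminf) measurable
 also have "\<dots> \<le> (\<Sum>k. ennreal (C * (1/2)^k))" by (intro suminf_le l1) auto
 also have "\<dots> = ennreal (\<Sum>k. C * (1/2)^k)" by (rule suminf_ennreal2) (auto simp: C_def intro!: summable_mult summable_geometric)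
 finally have "(\<integral>\<^sup>+x. (\<Sum>k. ennreal (norm (f (r (Suc k)) x - f (r k) x))) \<partial>M) \<noteq> \<infinity>" by (auto simp: top_unique)
 then have "AE x in M. (\<Sum>k. ennreal (norm (f (r (Suc k)) x - f (r k) x))) \<noteq> \<infinity>"
  by (intro nn_integral_PInf_AE) auto
 then have conv: "AE x in M. convergent (%k. f (r k) x)"
 proof eventually_elim
  case (elim x)
  then have "summable (%k. norm (f (r (Suc k)) x - f (r k) x))" by (intro summable_suminf_not_top) auto
  then have "summable (%k. f (r (Suc k)) x - f (r k) x)" by (rule summable_norm_cancel)
  then have "convergent (%n. \<Sum>k<n. f (r (Suc k)) x - f (r k) x)" by (simp add: summable_iff_convergent)
  then have "convergent (%n. f (r n) x - f (r 0) x)" by (simp only: sum_lessThan_telescope[of "%k. f (r k) x"])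
  then obtain l where "(%n. f (r n) x - f (r 0) x) \<longlonglongrightarrow> l" by (auto simp: convergent_def)
  from tendsto_add[OF this tendsto_const[of "f (r 0) x"]] show ?case by (auto simp: convergent_def)
 qed
 define g where "g x = lim (%k. f (r k) x)" for x
 have gm[measurable]: "g \<in> borel_measurable M" unfolding g_def by (rule borel_measurable_lim_metric) simp
 have gl: "AE x in M. (%k. f (r k) x) \<longlonglongrightarrow> g x" using conv by eventually_elim (simp add: g_def convergent_LIMSEQ_iff)
 \<comment> \<open>Fatou's lemma along the subsequence carries the Cauchy bound to the limit for all
   late \<open>n\<close>, not just for the subsequence.\<close>
 have est: "(\<integral>\<^sup>+x. ennreal ((norm (f n x - g x))\<^sup>2) \<partial>M) \<le> ennreal (((1/2)^k)\<^sup>2)" if n: "n \<ge> N0 k" for n k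
 proof -
  have "(\<integral>\<^sup>+x. ennreal ((norm (f n x - g x))\<^sup>2) \<partial>M) = (\<integral>\<^sup>+x. liminf (%j. ennreal ((norm (f n x - f (r j) x))\<^sup>2)) \<partial>M)"
  proof (rule nn_integral_cong_AE)
   show "AE x in M. ennreal ((norm (f n x - g x))\<^sup>2) = liminf (%j. ennreal ((norm (f n x - f (r j) x))\<^sup>2))"
    using gl
   proof eventually_elim
    case (elim x)
    have "(%j. ennreal ((norm (f n x - f (r j) x))\<^sup>2)) \<longlonglongrightarrow> ennreal ((norm (f n x - g x))\<^sup>2)"
     by (intro tendsto_intros tendsto_ennrealI elim)
    then show ?case using lim_imp_Liminf[of sequentially] by force
   qed
  qed
  also have "\<dots> \<le> liminf (%j. \<integral>\<^sup>+x. ennreal ((norm (f n x - f (r j) x))\<^sup>2) \<partial>M)"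
   by (rule nn_integral_liminf) measurable
  also have "\<dots> \<le> ennreal (((1/2)^k)\<^sup>2)"
  proof (rule Liminf_le)
   show "\<forall>\<^sub>F j in sequentially. (\<integral>\<^sup>+x. ennreal ((norm (f n x - f (r j) x))\<^sup>2) \<partial>M) \<le> ennreal (((1/2)^k)\<^sup>2)"
    using eventually_ge_at_top[of k]
   proof eventually_elim
    case (elim j)
    have "N0 k \<le> r j" unfolding r_def using elim by (intro member_le_sum) auto
    then have "l2 M (%x. f n x - f (r j) x) < (1/2)^k" by (intro N0 n)
    then show ?case unfolding l2_nn[OF sqi_diff[OF f f]] by (intro ennreal_leI power_mono) auto
   qed
  qed simp
  finally show ?thesis .
 qed
 have dm: "(%x. f n x - g x) \<in> borel_measurable M" for n by measurable
 have sd: "sqi M (%x. f (N0 0) x - g x)" by (rule sqi_l2_nnI(1)[OF dm est]) auto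
 have sg: "sqi M g" using sqi_diff[OF f[of "N0 0"] sd] by simp
 have "(%n. l2 M (%x. f n x - g x)) \<longlonglongrightarrow> 0"
 proof (rule LIMSEQ_I)
  fix e :: real assume "e > 0"
  then obtain k where k: "(1/2)^k < e" using real_arch_pow_inv[of e "1/2"] by auto
  have "norm (l2 M (%x. f n x - g x) - 0) < e" if "n \<ge> N0 k" for n
   using sqi_l2_nnI(2)[OF dm est[OF that]] k by simp
  then show "\<exists>no. \<forall>n\<ge>no. norm (l2 M (%x. f n x - g x) - 0) < e" by blast
 qed
 then show ?thesis using that sg by blast
qed

text \<open>At distance at least the mollification radius from the complement, the mollified
  function is an integral against a test function and vanishes; letting the radius shrink gives norm
  0 there. Countably many such sets exhaust \<open>D\<close>.\<close>

theorem du_Bois_Reymond: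
 fixes f :: "'a::euclidean_space => real"
 assumes f: "sqi lborel f" and D: "open D" "D \<noteq> UNIV"
  and z: "!!\<psi>. rtest D \<psi> ==> (\<integral>x. f x * \<psi> x \<partial>lborel) = 0"
 shows "AE x in lborel. x \<in> D --> f x = 0"
proof -
 have [measurable]: "f \<in> borel_measurable borel" using f by (simp add: sqi_def)
 \<comment> \<open>The distance to an empty set is 0 by convention, so these sets exhaust
   \<open>D\<close> only because the complement is nonempty.\<close>
 define S where "S k = {x. 1 / real (Suc k) \<le> infdist x (- D)}" for k :: nat
 have Sm[measurable]: "S k \<in> sets borel" for k unfolding S_def
  by (intro borel_closed closed_Collect_le continuous_intros)
 have sub: "cball x (1 / real (Suc (Suc k))) \<subseteq> D" if "x \<in> S k" for x k
 proof
  fix y assume "y \<in> cball x (1 / real (Suc (Suc k)))"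
  then have "dist x y \<le> 1 / real (Suc (Suc k))" by simp
  also have "\<dots> < 1 / real (Suc k)" by (simp add: frac_less2)
  also have "\<dots> \<le> infdist x (- D)" using that by (simp add: S_def)
  finally have "dist x y < infdist x (- D)" .
  then show "y \<in> D" using infdist_le[of y "- D" x] by force
 qed
 have zero: "AE x in lborel. x \<in> S k --> f x = 0" for k
 proof -
  have "l2on (S k) f \<le> 0"
  proof (rule field_le_epsilon)
   fix e :: real assume e: "e > 0"
   obtain d where d: "d > 0" "!!\<delta> \<rho>. \<delta> \<le> d ==> mollifier \<delta> \<rho> ==> l2 lborel (%x. conv \<rho> f x - f x) \<le> e"
    using mollify_l2[OF f e] by blast
   define \<delta> where "\<delta> = min d (1 / real (Suc (Suc k)))"
   have "\<delta> > 0" using d by (simp add: \<delta>_def)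
   then obtain \<rho> :: "'a => real" where \<rho>: "mollifier \<delta> \<rho>" using mollifier_exists by blast
   have s: "smooth_on UNIV \<rho>" "ckern \<delta> \<rho>" using \<rho> by (auto simp: mollifier_def)
   have z': "conv \<rho> f x = 0" if x: "x \<in> S k" for x
   proof -
    have "rtest (cball 0 \<delta>) \<rho>" unfolding rtest_def
     using s by (intro conjI exI[of _ "cball 0 \<delta>"]) (auto simp: ckern_def)
    from rtest_affine(1)[OF this, of "-1" x]
    have t: "rtest {y. x - y \<in> cball 0 \<delta>} (%y. \<rho> (x - y))" by simp
    have "{y. x - y \<in> cball 0 \<delta>} \<subseteq> D" using sub[OF x] by (auto simp: \<delta>_def dist_norm subset_iff norm_minus_commute)
    from z[OF rtest_mono[OF t this]] show ?thesis by (simp add: conv_def mult.commute)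
   qed
   note sc = mollify_sqi[OF f \<rho>]
   have e: "restr (S k) f x = restr (S k) (%x. f x - conv \<rho> f x) x" for x using z'[of x] by (cases "x \<in> S k") auto
   have "l2on (S k) f = l2on (S k) (%x. f x - conv \<rho> f x)" unfolding l2on_def using e by presburger
   also have "\<dots> \<le> l2 lborel (%x. f x - conv \<rho> f x)" by (rule l2on_le[OF Sm sqi_diff[OF f sc]])
   also have "\<dots> \<le> e" using d(2)[OF _ \<rho>] l2_diff_commute[of lborel f "conv \<rho> f"] by (simp add: \<delta>_def)
   finally show "l2on (S k) f \<le> 0 + e" by simp
  qed
  then have "l2 lborel (restr (S k) f) = 0" using l2on_nonneg[of "S k" f] unfolding l2on_def by linarith
  from l2_zero_AE[OF sqi_restr[OF _ f] this] show ?thesis by (auto simp: indicator_def elim!: eventually_mono)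
 qed
 have "AE x in lborel. \<forall>k. x \<in> S k --> f x = 0" unfolding AE_all_countable using zero by blast
 then show ?thesis
 proof eventually_elim
  case (elim x)
  show ?case
  proof
   assume x: "x \<in> D"
   show "f x = 0"
   proof -
    have "infdist x (- D) > 0" using x D in_closed_iff_infdist_zero[of "- D" x] infdist_nonneg[of x "- D"] by (auto simp: less_le)
    then obtain k where "1 / real (Suc k) < infdist x (- D)" using reals_Archimedean by (auto simp: inverse_eq_divide)
    then have "x \<in> S k" unfolding S_def by (simp only: mem_Collect_eq less_imp_le)
    then show ?thesis using elim by blast
   qed
  qed
 qed
qed

section \<open>Sobolev functions on a bounded domain\<close>

lemma borel_measurable_vec_nth:
 fixes g :: "'a => 'b::euclidean_space ^ 'n"
 shows "g \<in> borel_measurable M \<longleftrightarrow> (\<forall>i. (%x. g x $ i) \<in> borel_measurable M)"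
proof
 assume g: "g \<in> borel_measurable M"
 show "\<forall>i. (%x. g x $ i) \<in> borel_measurable M"
 proof
  fix i
  have "(%v :: 'b ^ 'n. v $ i) \<in> borel_measurable borel"
   by (intro borel_measurable_continuous_onI continuous_intros)
  from measurable_compose[OF g this] show "(%x. g x $ i) \<in> borel_measurable M" .
 qed
next
 assume c: "\<forall>i. (%x. g x $ i) \<in> borel_measurable M"
 show "g \<in> borel_measurable M"
 proof (rule borel_measurable_euclidean_space[THEN iffD2], rule ballI)
  fix b :: "'b ^ 'n" assume "b \<in> Basis"
  then obtain i u where b: "b = axis i u" by (auto simp: Basis_vec_def)
  have "(%x. g x $ i \<bullet> u) \<in> borel_measurable M" using c by (intro borel_measurable_inner) auto
  then show "(%x. g x \<bullet> b) \<in> borel_measurable M" by (simp add: b inner_axis)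
 qed
qed

lemma norm_vec_sq: "(norm (v :: 'b::euclidean_space ^ 'n))\<^sup>2 = (\<Sum>i\<in>UNIV. (norm (v $ i))\<^sup>2)"
 by (simp add: norm_vec_def L2_set_def sum_nonneg)

lemma sqi_vec: "sqi M (g :: 'a => 'b::euclidean_space ^ 'n) \<longleftrightarrow> (\<forall>i. sqi M (%x. g x $ i))"
proof
 assume g: "sqi M g"
 show "\<forall>i. sqi M (%x. g x $ i)"
 proof
  fix i show "sqi M (%x. g x $ i)"
   by (rule sqi_bound(1)[OF _ g, of _ 1]) (use g borel_measurable_vec_nth[of g M] Finite_Cartesian_Product.norm_nth_le[of "g _" i] in \<open>auto simp: sqi_def\<close>)
 qed
next
 assume "\<forall>i. sqi M (%x. g x $ i)"
 then show "sqi M g" unfolding sqi_def norm_vec_sq borel_measurable_vec_nth[of g M] by auto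
qed

lemma L2_iff_sqi: "f \<in> L2 D \<longleftrightarrow> sqi (lebesgue_on D) f"
 by (simp add: L2_def sqi_def)

lemma hdot_Re: "Re (hdot a b) = a \<bullet> b"
 by (simp add: hdot_def inner_vec_def inner_complex_def)

lemma hdot_self: "hdot a a = complex_of_real ((norm a)\<^sup>2)"
 unfolding hdot_def norm_vec_sq by (simp only: of_real_sum complex_norm_square)

text \<open>Rotating the first argument by a phase makes the value real, and the real part of
  \<open>hdot\<close> is the Euclidean inner product, to which Cauchy-Schwarz applies.\<close>

lemma hdot_bound: "cmod (hdot a b) \<le> norm a * norm b"
proof (cases "hdot a b = 0")
 case False
 define c where "c = cnj (hdot a b) / cmod (hdot a b)"
 have c: "cmod c = 1" using False by (simp add: c_def norm_divide)
 have "hdot (\<chi> i. c * a $ i) b = c * hdot a b" by (simp add: hdot_def sum_distrib_left mult.assoc)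
 also have "\<dots> = complex_of_real (cmod (hdot a b))"
  using False complex_norm_square[of "hdot a b"] by (simp add: c_def power2_eq_square mult.commute nonzero_divide_eq_eq)
 finally have "cmod (hdot a b) = (\<chi> i. c * a $ i) \<bullet> b" by (metis Re_complex_of_real hdot_Re)
 also have "\<dots> \<le> norm (\<chi> i. c * a $ i) * norm b" by (rule norm_cauchy_schwarz)
 also have "norm (\<chi> i. c * a $ i) = norm a" by (rule power2_eq_imp_eq) (auto simp: norm_vec_sq norm_mult c)
 finally show ?thesis .
qed simp

lemma borel_measurable_cnj: "f \<in> borel_measurable M ==> (%x. cnj (f x)) \<in> borel_measurable M"
 by (erule measurable_compose) (intro borel_measurable_continuous_onI continuous_intros)

lemma hdot_measurable:
 "f \<in> borel_measurable M ==> g \<in> borel_measurable M ==> (%x. hdot (f x) (g x)) \<in> borel_measurable M"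
 unfolding hdot_def borel_measurable_vec_nth[of f] borel_measurable_vec_nth[of g]
 by (intro borel_measurable_sum borel_measurable_times borel_measurable_cnj) auto

lemma rtest_test_function:
 fixes D :: "(real^'d) set"
 assumes "rtest D \<psi>"
 shows "test_function D (%x. complex_of_real (\<psi> x))"
  "frechet_derivative (%x. complex_of_real (\<psi> x)) (at x) h = complex_of_real (grad \<psi> x \<bullet> h)"
proof -
 obtain K where K: "compact K" "K \<subseteq> D" "!!x. x \<notin> K ==> \<psi> x = 0" and s: "smooth_on UNIV \<psi>" using assms by (auto simp: rtest_def)
 have "closure {x. complex_of_real (\<psi> x) \<noteq> 0} \<subseteq> K"
  by (rule closure_minimal) (use K compact_imp_closed in auto)
 moreover then have "compact (closure {x. complex_of_real (\<psi> x) \<noteq> 0})"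
  using K by (intro compact_closure[THEN iffD2] bounded_subset[OF compact_imp_bounded[OF K(1)]]) (metis closure_subset order_trans)
 moreover have "smooth_on UNIV (%x. complex_of_real (\<psi> x))"
  unfolding smooth_on_def by (rule allI, rule Ck_on_bounded_linear[OF open_UNIV bounded_linear_of_real]) (use s in \<open>simp add: smooth_on_def\<close>)
 ultimately show "test_function D (%x. complex_of_real (\<psi> x))" using K(2) unfolding test_function_def by blast
 have "((%x. complex_of_real (\<psi> x)) has_derivative (%h. complex_of_real (grad \<psi> x \<bullet> h))) (at x)"
  by (rule bounded_linear.has_derivative[OF bounded_linear_of_real has_derivative_grad[OF smooth_deriv(1)[OF s]]])
 from frechet_derivative_at[OF this]
 show "frechet_derivative (%x. complex_of_real (\<psi> x)) (at x) h = complex_of_real (grad \<psi> x \<bullet> h)" by metis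
qed

lemma test_function_rtest:
 fixes D :: "(real^'d) set"
 assumes \<phi>: "test_function D \<phi>" and p: "bounded_linear p"
 shows "rtest D (%x. p (\<phi> x) :: real)" "grad (%x. p (\<phi> x)) x \<bullet> h = p (frechet_derivative \<phi> (at x) h)"
proof -
 have s: "smooth_on UNIV \<phi>" using \<phi> by (simp add: test_function_def)
 have sm: "smooth_on UNIV (%x. p (\<phi> x))"
  unfolding smooth_on_def by (rule allI, rule Ck_on_bounded_linear[OF open_UNIV p]) (use s in \<open>simp add: smooth_on_def\<close>)
 have "p (\<phi> x) = 0" if "x \<notin> closure {x. \<phi> x \<noteq> 0}" for x
 proof -
  have "\<phi> x = 0" using that closure_subset[of "{x. \<phi> x \<noteq> 0}"] by blast
  then show ?thesis using linear_simps(3)[OF p] by simp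
 qed
 then show "rtest D (%x. p (\<phi> x))" unfolding rtest_def using \<phi> sm
  by (intro conjI exI[of _ "closure {x. \<phi> x \<noteq> 0}"]) (auto simp: test_function_def)
 have D: "((%x. p (\<phi> x)) has_derivative (%h. p (frechet_derivative \<phi> (at x) h))) (at x)"
  by (rule bounded_linear.has_derivative[OF p smooth_deriv(1)[OF s]])
 from has_derivative_unique[OF has_derivative_grad[OF D] D]
 show "grad (%x. p (\<phi> x)) x \<bullet> h = p (frechet_derivative \<phi> (at x) h)" by metis
qed

lemma integral_grad_zero:
 fixes \<psi> :: "real^'d => real"
 assumes \<psi>: "rtest UNIV \<psi>"
 shows "(\<integral>x. grad \<psi> x \<bullet> b \<partial>lborel) = 0"
proof -
 have s: "smooth_on UNIV \<psi>" using \<psi> by (simp add: rtest_def)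
 obtain r where r: "ckern r \<psi>" using rtest_ckern[OF \<psi>] by blast
 obtain r' where r': "ckern r' (grad \<psi>)" using rtest_grad_ckern[OF \<psi>] by blast
 obtain K' where K': "!!x. norm (\<psi> x) \<le> K'" using ckern_bounded[OF r] by blast
 obtain K where K: "!!x. norm (grad \<psi> x) \<le> K" using ckern_bounded[OF r'] by blast
 have [measurable]: "grad \<psi> \<in> borel_measurable borel" "\<psi> \<in> borel_measurable borel" using r r' by (auto intro: ckern_measurable)
 have ig: "integrable lborel (%x. grad \<psi> x \<bullet> b)"
 proof (rule Bochner_Integration.integrable_bound)
  show "integrable lborel (%x. indicat_real (cball 0 r') x * (K * norm b))"
   using emeasure_bounded_finite[of "cball 0 r'"] by (auto simp: integrable_indicator_iff)
  have "norm (grad \<psi> x \<bullet> b) \<le> norm (indicat_real (cball 0 r') x * (K * norm b))" for x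
  proof (cases "norm x \<le> r'")
   case True
   have "\<bar>grad \<psi> x \<bullet> b\<bar> \<le> K * norm b" using Cauchy_Schwarz_ineq2[of "grad \<psi> x" b] mult_right_mono[OF K norm_ge_zero[of b], of x] by linarith
   then show ?thesis using True by simp
  qed (use r' in \<open>simp add: ckern_def\<close>)
  then show "AE x in lborel. norm (grad \<psi> x \<bullet> b) \<le> norm (indicat_real (cball 0 r') x * (K * norm b))" by simp
 qed measurable
 define f where "f = (%x::real^'d. grad \<psi> x \<bullet> b)"
 have "(\<integral>x. f x \<partial>lborel) = 0"
 proof -
  \<comment> \<open>the quotients have integral zero by translation invariance and converge to the derivative dominatedly\<close>
  define q where "q n x = (\<psi> (x + (1 / real (Suc n)) *\<^sub>R b) - \<psi> x) * real (Suc n)" for n x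
  have q0: "(\<integral>x. q n x \<partial>lborel) = 0" for n
  proof -
   have i: "integrable lborel \<psi>"
   proof (rule Bochner_Integration.integrable_bound)
    show "integrable lborel (%x. indicat_real (cball 0 r) x * K')"
     using emeasure_bounded_finite[of "cball 0 r"] by (auto simp: integrable_indicator_iff)
    have "norm (\<psi> x) \<le> norm (indicat_real (cball 0 r) x * K')" for x
     using K'[of x] r by (cases "norm x \<le> r") (auto simp: ckern_def)
    then show "AE x in lborel. norm (\<psi> x) \<le> norm (indicat_real (cball 0 r) x * K')" by simp
   qed measurable
   have "integrable lborel (%x. \<psi> (x + (1 / real (Suc n)) *\<^sub>R b))"
   proof -
    have "integrable (distr lborel borel ((+) ((1 / real (Suc n)) *\<^sub>R b))) \<psi>" using i by (simp add: lborel_distr_plus)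
    then show ?thesis by (subst (asm) integrable_distr_eq) (auto simp: add.commute)
   qed
   then show ?thesis unfolding q_def using i integral_lborel_shift[of \<psi> "(1 / real (Suc n)) *\<^sub>R b"] by simp
  qed
  have "(%n. \<integral>x. q n x \<partial>lborel) \<longlonglongrightarrow> (\<integral>x. f x \<partial>lborel)"
  proof (rule integral_dominated_convergence[where w="%x. indicat_real (cball 0 (r + norm b)) x * (K * norm b)"])
   show "integrable lborel (%x. indicat_real (cball 0 (r + norm b)) x * (K * norm b))"
    using emeasure_bounded_finite[of "cball 0 (r + norm b)"] by (auto simp: integrable_indicator_iff)
   have "(%n. q n x) \<longlonglongrightarrow> f x" for x
   proof -
    have "((%t. \<psi> (x + t *\<^sub>R b)) has_derivative (%t. grad \<psi> x \<bullet> (t *\<^sub>R b))) (at 0)"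
     by (rule has_derivative_compose[where g=\<psi> and f="%t. x + t *\<^sub>R b"])
      (auto intro!: derivative_eq_intros has_derivative_grad[OF smooth_deriv(1)[OF s]])
    then have "((%t. \<psi> (x + t *\<^sub>R b)) has_real_derivative f x) (at 0)"
     by (simp add: has_field_derivative_def f_def mult_commute_abs)
    then have l: "((%t. (\<psi> (x + t *\<^sub>R b) - \<psi> x) / t) \<longlongrightarrow> f x) (at 0)" by (simp add: DERIV_def)
    have "filterlim (%n. 1 / real (Suc n)) (at 0) sequentially"
     unfolding filterlim_at using LIMSEQ_Suc[OF lim_1_over_n] by auto
    from filterlim_compose[OF l this] show ?thesis by (simp add: q_def)
   qed
   then show "AE x in lborel. (%n. q n x) \<longlonglongrightarrow> f x" by simp
   have "norm (q n x) \<le> indicat_real (cball 0 (r + norm b)) x * (K * norm b)" for n x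
   proof (cases "norm x \<le> r + norm b")
    case True
    have "norm (\<psi> (x + (1 / real (Suc n)) *\<^sub>R b) - \<psi> x) \<le> K * norm ((x + (1 / real (Suc n)) *\<^sub>R b) - x)"
    proof (rule differentiable_bound[of UNIV \<psi> "%y h. grad \<psi> y \<bullet> h"])
     show "(\<psi> has_derivative (%h. grad \<psi> y \<bullet> h)) (at y within UNIV)" for y
      using has_derivative_grad[OF smooth_deriv(1)[OF s]] by simp
     show "onorm (%h. grad \<psi> y \<bullet> h) \<le> K" for y
     proof (rule onorm_le)
      fix h show "norm (grad \<psi> y \<bullet> h) \<le> K * norm h"
       using Cauchy_Schwarz_ineq2[of "grad \<psi> y" h] mult_right_mono[OF K norm_ge_zero[of h], of y] unfolding real_norm_def by linarith
     qed
    qed auto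
    also have "\<dots> = (K * norm b) / real (Suc n)" by simp
    finally have "\<bar>\<psi> (x + (1 / real (Suc n)) *\<^sub>R b) - \<psi> x\<bar> * real (Suc n) \<le> K * norm b"
     by (simp add: pos_le_divide_eq del: of_nat_Suc)
    then show ?thesis using True by (simp add: q_def abs_mult del: of_nat_Suc)
   next
    case False
    have "norm ((1 / real (Suc n)) *\<^sub>R b) = norm b / real (Suc n)" by simp
    also have "\<dots> \<le> norm b / 1" by (rule divide_left_mono) auto
    finally have "norm ((1 / real (Suc n)) *\<^sub>R b) \<le> norm b" by simp
    then have "norm (x + (1 / real (Suc n)) *\<^sub>R b) > r" using False norm_triangle_ineq[of "x + (1 / real (Suc n)) *\<^sub>R b" "- ((1 / real (Suc n)) *\<^sub>R b)"] by simp
    moreover have "norm x > r" using False norm_ge_zero[of b] by linarith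
    ultimately show ?thesis using r False by (simp add: q_def ckern_def)
   qed
   then show "AE x in lborel. norm (q n x) \<le> indicat_real (cball 0 (r + norm b)) x * (K * norm b)" for n by simp
  qed (auto simp: q_def f_def)
  then have "(%n. 0) \<longlonglongrightarrow> (\<integral>x. f x \<partial>lborel)" by (simp only: q0)
  from LIMSEQ_unique[OF this tendsto_const] show ?thesis .
 qed
 then show ?thesis by (simp add: f_def)
qed

lemma sqi_Complex:
 assumes "sqi N u" "sqi N v"
 shows "sqi N (%x. Complex (u x) (v x))"
proof -
 have 1: "sqi N (%x. complex_of_real (u x))" by (rule sqi_bound(1)[OF _ assms(1), of _ 1]) (use assms in \<open>auto simp: sqi_def\<close>)
 have 2: "sqi N (%x. \<i> * complex_of_real (v x))" by (rule sqi_bound(1)[OF _ assms(2), of _ 1]) (use assms in \<open>auto simp: sqi_def norm_mult\<close>)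
 from sqi_add[OF 1 2] show ?thesis by (simp add: Complex_eq)
qed

lemma sqi_cmult: "sqi N (%x. c * w x)" "l2 N (%x. c * w x) = cmod c * l2 N w" if "sqi N w" for w :: "'a => complex"
 using that by (auto simp: sqi_def l2_def norm_mult power_mult_distrib real_sqrt_mult)

lemma cmult_integrable:
 fixes u v :: "'a => complex"
 assumes "sqi N u" "sqi N v"
 shows "integrable N (%x. u x * v x)" "cmod (\<integral>x. u x * v x \<partial>N) \<le> l2 N u * l2 N v"
proof -
 have m: "(%x. u x * v x) \<in> borel_measurable N" using assms by (auto simp: sqi_def)
 show "integrable N (%x. u x * v x)" "cmod (\<integral>x. u x * v x \<partial>N) \<le> l2 N u * l2 N v"
  using l2_bilinear[OF assms m, of 1] by (simp_all add: norm_mult)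
qed

lemma sqi_bounded_linear:
 assumes p: "bounded_linear p" and f: "sqi N f" and b: "!!z. norm (p z) \<le> norm z"
 shows "sqi N (%x. p (f x))"
proof (rule sqi_bound(1)[OF _ f, of _ 1])
 show "(%x. p (f x)) \<in> borel_measurable N"
  by (rule measurable_compose[of f N borel]) (use f p in \<open>auto simp: sqi_def intro!: borel_measurable_continuous_onI linear_continuous_on\<close>)
qed (use b in auto)

text \<open>Openness is what \<open>du_Bois_Reymond\<close> and interior balls need; boundedness
  gives finite measure, used for completeness, and a nonempty complement.\<close>

locale bdd_domain =
 fixes D :: "(real^'d) set"
 assumes D: "open D" "bounded D"
begin

abbreviation "M \<equiv> lebesgue_on D"

lemma D_borel[measurable]: "D \<in> sets borel" using D by (simp add: borel_open)
lemma D_leb: "D \<in> sets lebesgue" "D \<inter> space lebesgue \<in> sets lebesgue" using D_borel by auto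
lemma fin: "finite_measure M" by (rule finite_measure_lebesgue_on[OF lmeasurable_open]) (use D in auto)
lemma D_UNIV: "D \<noteq> UNIV" using D not_bounded_UNIV by auto

lemma AE_M: "(AE x in M. P x) \<longleftrightarrow> (AE x in lborel. x \<in> D --> P x)"
 using D_leb by (simp add: AE_restrict_space_iff AE_completion_iff)

lemma measurable_M: "f \<in> borel_measurable borel ==> f \<in> borel_measurable M"
 by (intro measurable_restrict_space1 measurable_completion) simp

lemma integral_M:
 fixes H :: "real^'d => 'b::euclidean_space"
 assumes "H \<in> borel_measurable borel"
 shows "(\<integral>x. H x \<partial>M) = (\<integral>x. restr D H x \<partial>lborel)"
 unfolding integral_restrict_space[OF D_leb(2)]
 by (rule integral_completion) (use assms in measurable)

lemma sqi_M:
 fixes f :: "real^'d => 'b::euclidean_space"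
 assumes f: "sqi lborel f"
 shows "sqi M f" "l2 M f = l2on D f"
proof -
 have m[measurable]: "f \<in> borel_measurable borel" using f by (simp add: sqi_def)
 have e: "indicat_real D x *\<^sub>R (norm (f x))\<^sup>2 = (norm (restr D f x))\<^sup>2" for x by (simp add: indicator_def)
 have "integrable lborel (%x. (norm (restr D f x))\<^sup>2)" using sqi_restr[OF _ f, of D] by (simp add: sqi_def)
 then have "integrable M (%x. (norm (f x))\<^sup>2)"
  unfolding integrable_restrict_space[OF D_leb(2)] e by (subst integrable_completion) auto
 then show "sqi M f" using measurable_M[OF m] by (simp add: sqi_def)
 have "(\<integral>x. (norm (f x))\<^sup>2 \<partial>M) = (\<integral>x. (norm (restr D f x))\<^sup>2 \<partial>lborel)"
  using integral_M[of "%x. (norm (f x))\<^sup>2"] e by simp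
 then show "l2 M f = l2on D f" by (simp add: l2_def l2on_def)
qed

text \<open>The bridge from classes on \<open>D\<close> to the theory over \<open>lborel\<close>:
  shifts and convolutions are available for Borel functions on the whole space, whereas Sobolev
  functions are only Lebesgue measurable and arbitrary outside \<open>D\<close>.\<close>

lemma borel_rep:
 fixes f :: "real^'d => 'b::euclidean_space"
 assumes f: "sqi M f"
 obtains f' where "sqi lborel f'" "!!x. x \<notin> D ==> f' x = 0" "AE x in M. f x = f' x" "l2 lborel f' = l2 M f"
proof -
 let ?f = "%x. if x \<in> D then f x else 0"
 have fm: "?f \<in> borel_measurable lebesgue" by (rule borel_measurable_if[OF D_leb(1), THEN iffD2]) (use f in \<open>simp add: sqi_def\<close>)
 \<comment> \<open>Borel versions are obtained for real functions, hence coordinate by coordinate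
   and then reassembled over the basis.\<close>
 have "\<exists>g\<in>borel_measurable lborel. AE x in lborel. ?f x \<bullet> b = g x" for b
  by (rule completion_ex_borel_measurable_real) (intro borel_measurable_inner fm borel_measurable_const)
 then have "\<forall>b. \<exists>g. g \<in> borel_measurable lborel \<and> (AE x in lborel. ?f x \<bullet> b = g x)" unfolding Bex_def by (rule allI)
 from choice[OF this] obtain g where "\<forall>b. g b \<in> borel_measurable lborel \<and> (AE x in lborel. ?f x \<bullet> b = g b x)" ..
 then have g: "g b \<in> borel_measurable lborel" "AE x in lborel. ?f x \<bullet> b = g b x" for b by (auto dest: spec[of _ b])
 have gm[measurable]: "g b \<in> borel_measurable borel" for b using g(1)[of b] by simp
 define f' where "f' = restr D (%x. \<Sum>b\<in>Basis. g b x *\<^sub>R b)"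
 have m[measurable]: "f' \<in> borel_measurable borel" unfolding f'_def by measurable
 have off: "f' x = 0" if "x \<notin> D" for x using that by (simp add: f'_def)
 have "AE x in lborel. \<forall>b\<in>Basis. ?f x \<bullet> b = g b x" using g(2) by (intro AE_ball_countable[THEN iffD2]) (auto intro: countable_finite)
 then have ae: "AE x in lborel. x \<in> D --> f x = f' x"
 proof eventually_elim
  case (elim x)
  show ?case
  proof
   assume x: "x \<in> D"
   have "f x = (\<Sum>b\<in>Basis. (f x \<bullet> b) *\<^sub>R b)" by (simp add: euclidean_representation)
   also have "\<dots> = f' x" using elim x by (simp add: f'_def)
   finally show "f x = f' x" .
  qed
 qed
 then have aeM: "AE x in M. f x = f' x" by (simp add: AE_M)
 have sf': "sqi M f'" by (rule sqi_cong_AE[OF aeM measurable_M[OF m] f])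
 have "integrable M (%x. (norm (f' x))\<^sup>2)" using sf' by (simp add: sqi_def)
 then have "integrable lborel (%x. indicator D x *\<^sub>R (norm (f' x))\<^sup>2)"
  unfolding integrable_restrict_space[OF D_leb(2)] by (subst (asm) integrable_completion) auto
 moreover have "indicat_real D x *\<^sub>R (norm (f' x))\<^sup>2 = (norm (f' x))\<^sup>2" for x using off[of x] by (cases "x \<in> D") simp_all
 ultimately have "integrable lborel (%x. (norm (f' x))\<^sup>2)" by (simp only:)
 then have s: "sqi lborel f'" by (simp add: sqi_def)
 have "restr D f' x = f' x" for x using off[of x] by (cases "x \<in> D") simp_all
 then have "restr D f' = f'" by (rule ext)
 then have "l2 lborel f' = l2 M f'" using sqi_M(2)[OF s] by (simp add: l2on_def)
 also have "\<dots> = l2 M f" by (rule l2_cong_AE[symmetric, OF aeM]) (use f sf' in \<open>auto simp: sqi_def\<close>)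
 finally show ?thesis using that s off aeM by blast
qed

lemma integral_rep:
 fixes F H :: "real^'d => 'b::euclidean_space"
 assumes "AE x in M. F x = H x" "F \<in> borel_measurable M" "H \<in> borel_measurable borel" "!!x. x \<notin> D ==> H x = 0"
 shows "(\<integral>x. F x \<partial>M) = (\<integral>x. H x \<partial>lborel)"
proof -
 have "(\<integral>x. F x \<partial>M) = (\<integral>x. H x \<partial>M)" by (rule integral_cong_AE) (use assms measurable_M in auto)
 also have "\<dots> = (\<integral>x. restr D H x \<partial>lborel)" by (rule integral_M) fact
 also have "\<dots> = (\<integral>x. H x \<partial>lborel)" by (rule Bochner_Integration.integral_cong) (use assms(4) in \<open>auto simp: indicator_def\<close>)
 finally show ?thesis .
qed

lemma test_sqi:
 assumes \<phi>: "test_function D \<phi>"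
 shows "sqi M \<phi>" "sqi M (%x. frechet_derivative \<phi> (at x) h)"
proof -
 note r = test_function_rtest[OF \<phi> bounded_linear_Re] and i = test_function_rtest[OF \<phi> bounded_linear_Im]
 have "sqi lborel (%x. Complex (Re (\<phi> x)) (Im (\<phi> x)))" by (intro sqi_Complex rtest_sqi[OF r(1)] rtest_sqi[OF i(1)])
 then show "sqi M \<phi>" using sqi_M(1) by simp
 have g: "sqi lborel (%x. g x \<bullet> h)" if "sqi lborel g" for g :: "real^'d => real^'d"
  by (rule sqi_bound(1)[OF _ that, of _ "norm h"])
   (use that Cauchy_Schwarz_ineq2[of "g _" h] in \<open>auto simp: sqi_def mult.commute[of "norm h"]\<close>)
 have "sqi lborel (%x. Complex (grad (%x. Re (\<phi> x)) x \<bullet> h) (grad (%x. Im (\<phi> x)) x \<bullet> h))"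
  by (intro sqi_Complex g rtest_grad_sqi[OF r(1)] rtest_grad_sqi[OF i(1)])
 then show "sqi M (%x. frechet_derivative \<phi> (at x) h)" using sqi_M(1) by (simp add: r(2) i(2))
qed

lemma wgD:
 "is_weak_gradient D w g ==> test_function D \<phi> ==>
  (\<integral>x. w x * frechet_derivative \<phi> (at x) (axis i 1) \<partial>M) = - (\<integral>x. g x $ i * \<phi> x \<partial>M)"
 unfolding is_weak_gradient_def by blast

lemma wg_sqi: "is_weak_gradient D w g ==> sqi M g"
 by (simp add: is_weak_gradient_def sqi_vec[of _ g] L2_iff_sqi)

lemma wg_add:
 assumes "sqi M w" "sqi M w'" "is_weak_gradient D w g" "is_weak_gradient D w' g'"
 shows "is_weak_gradient D (w + w') (%x. g x + g' x)"
 unfolding is_weak_gradient_def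
proof (intro conjI allI impI)
 have s: "sqi M (%x. g x $ i)" "sqi M (%x. g' x $ i)" for i using assms by (auto simp: is_weak_gradient_def L2_iff_sqi)
 show "(%x. (g x + g' x) $ i) \<in> L2 D" for i using sqi_add[OF s] by (simp add: L2_iff_sqi)
 fix \<phi> i assume \<phi>: "test_function D \<phi>"
 note t = test_sqi[OF \<phi>]
 show "(\<integral>x. (w + w') x * frechet_derivative \<phi> (at x) (axis i 1) \<partial>M) = - (\<integral>x. (g x + g' x) $ i * \<phi> x \<partial>M)"
  using cmult_integrable(1)[OF assms(1) t(2)] cmult_integrable(1)[OF assms(2) t(2)] cmult_integrable(1)[OF s(1) t(1)] cmult_integrable(1)[OF s(2) t(1)] assms \<phi>
  by (simp add: distrib_right is_weak_gradient_def)
qed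

lemma wg_scl:
 assumes "sqi M w" "is_weak_gradient D w g"
 shows "is_weak_gradient D (%x. c * w x) (%x. c *s g x)"
 unfolding is_weak_gradient_def
proof (intro conjI allI impI)
 have s: "sqi M (%x. g x $ i)" for i using assms by (auto simp: is_weak_gradient_def L2_iff_sqi)
 show "(%x. (c *s g x) $ i) \<in> L2 D" for i using sqi_cmult(1)[OF s] by (simp add: L2_iff_sqi)
 fix \<phi> i assume \<phi>: "test_function D \<phi>"
 show "(\<integral>x. c * w x * frechet_derivative \<phi> (at x) (axis i 1) \<partial>M) = - (\<integral>x. (c *s g x) $ i * \<phi> x \<partial>M)"
  using assms \<phi> by (simp add: is_weak_gradient_def mult.assoc)
qed

lemma L2_du_Bois:
 assumes h: "sqi M (h :: real^'d => complex)" and z: "!!\<phi>. test_function D \<phi> ==> (\<integral>x. h x * \<phi> x \<partial>M) = 0"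
 shows "AE x in M. h x = 0"
proof -
 have part: "AE x in M. p (h x) = 0" if p: "bounded_linear p" "!!z. norm (p z :: real) \<le> norm z" for p
 proof -
  have s: "sqi M (%x. p (h x))" by (rule sqi_bounded_linear[OF p(1) h p(2)])
  obtain f where f: "sqi lborel f" "!!x. x \<notin> D ==> f x = 0" "AE x in M. p (h x) = f x" using borel_rep[OF s] by blast
  have "AE x in lborel. x \<in> D --> f x = 0"
  proof (rule du_Bois_Reymond[OF f(1) D(1) D_UNIV])
   fix \<psi> assume \<psi>: "rtest D \<psi>"
   note t = rtest_test_function(1)[OF \<psi>]
   have \<psi>m: "\<psi> \<in> borel_measurable borel" using rtest_sqi[OF \<psi>] by (simp add: sqi_def)
   have hm: "(%x. p (h x)) \<in> borel_measurable M" using s by (simp add: sqi_def)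
   have "(\<integral>x. f x * \<psi> x \<partial>lborel) = (\<integral>x. p (h x) * \<psi> x \<partial>M)"
    by (rule integral_rep[symmetric])
     (use f hm \<psi>m measurable_M[OF \<psi>m] in \<open>auto simp: sqi_def elim!: eventually_mono intro!: borel_measurable_times\<close>)
   also have "\<dots> = (\<integral>x. p (h x * complex_of_real (\<psi> x)) \<partial>M)"
   proof -
    have "p (z * complex_of_real r) = p z * r" for z r using linear_simps(5)[OF p(1), of r z] by (simp add: scaleR_conv_of_real mult.commute)
    then show ?thesis by simp
   qed
   also have "\<dots> = p (\<integral>x. h x * complex_of_real (\<psi> x) \<partial>M)"
    by (rule integral_bounded_linear[OF p(1) cmult_integrable(1)[OF h test_sqi(1)[OF t]]])
   also have "\<dots> = 0" using z[OF t] linear_simps(3)[OF p(1)] by simp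
   finally show "(\<integral>x. f x * \<psi> x \<partial>lborel) = 0" .
  qed
  then have "AE x in M. f x = 0" by (simp add: AE_M)
  with f(3) show ?thesis by eventually_elim simp
 qed
 have "AE x in M. Re (h x) = 0" "AE x in M. Im (h x) = 0"
  by (rule part; simp add: bounded_linear_Re bounded_linear_Im abs_Re_le_cmod abs_Im_le_cmod)+
 then show ?thesis by eventually_elim (simp add: complex_eq_iff)
qed

text \<open>Makes the choice in \<open>wgrad\<close> harmless: every property of one weak gradient
  passes to the chosen one almost everywhere.\<close>

lemma wg_unique:
 assumes "is_weak_gradient D w g" "is_weak_gradient D w g'"
 shows "AE x in M. g x = g' x"
proof -
 have "AE x in M. g x $ i - g' x $ i = 0" for i
 proof (rule L2_du_Bois)
  have s: "sqi M (%x. g x $ i)" "sqi M (%x. g' x $ i)" using assms by (auto simp: is_weak_gradient_def L2_iff_sqi)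
  show "sqi M (%x. g x $ i - g' x $ i)" by (rule sqi_diff[OF s])
  fix \<phi> assume \<phi>: "test_function D \<phi>"
  have "(\<integral>x. g x $ i * \<phi> x \<partial>M) = (\<integral>x. g' x $ i * \<phi> x \<partial>M)" using wgD[OF assms(1) \<phi>, of i] wgD[OF assms(2) \<phi>, of i] by simp
  then show "(\<integral>x. (g x $ i - g' x $ i) * \<phi> x \<partial>M) = 0"
   using cmult_integrable(1)[OF s(1) test_sqi(1)[OF \<phi>]] cmult_integrable(1)[OF s(2) test_sqi(1)[OF \<phi>]] by (simp add: left_diff_distrib)
 qed
 then have "AE x in M. \<forall>i. g x $ i - g' x $ i = 0" by (simp add: AE_all_countable)
 then show ?thesis by eventually_elim (simp add: vec_eq_iff)
qed

lemma H1D: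
 assumes "w \<in> H1 D"
 shows "sqi M w" "is_weak_gradient D w (wgrad D w)" "sqi M (wgrad D w)"
proof -
 show "sqi M w" using assms by (simp add: H1_def L2_iff_sqi)
 show g: "is_weak_gradient D w (wgrad D w)" unfolding wgrad_def using assms by (intro someI_ex[of "is_weak_gradient D w"]) (simp add: H1_def)
 show "sqi M (wgrad D w)" by (rule wg_sqi[OF g])
qed

lemma H1I:
 assumes "sqi M w" "is_weak_gradient D w g"
 shows "w \<in> H1 D" "AE x in M. wgrad D w x = g x"
proof -
 show "w \<in> H1 D" using assms by (auto simp: H1_def L2_iff_sqi)
 from wg_unique[OF H1D(2)[OF this] assms(2)] show "AE x in M. wgrad D w x = g x" .
qed

lemma H1_add:
 assumes "w \<in> H1 D" "w' \<in> H1 D"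
 shows "w + w' \<in> H1 D" "AE x in M. wgrad D (w + w') x = wgrad D w x + wgrad D w' x"
proof -
 have s: "sqi M (w + w')" using sqi_add[OF H1D(1)[OF assms(1)] H1D(1)[OF assms(2)]] by (simp add: plus_fun_def)
 from H1I[OF s wg_add[OF H1D(1)[OF assms(1)] H1D(1)[OF assms(2)] H1D(2)[OF assms(1)] H1D(2)[OF assms(2)]]]
 show "w + w' \<in> H1 D" "AE x in M. wgrad D (w + w') x = wgrad D w x + wgrad D w' x" by auto
qed

lemma H1_scl:
 assumes "w \<in> H1 D"
 shows "(%x. c * w x) \<in> H1 D" "AE x in M. wgrad D (%x. c * w x) x = c *s wgrad D w x"
 using H1I[OF sqi_cmult(1)[OF H1D(1)[OF assms]] wg_scl[OF H1D(1)[OF assms] H1D(2)[OF assms]]] by auto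

text \<open>Integration by parts: the product of two test functions is a test function, and the
  integral of its derivative vanishes by \<open>integral_grad_zero\<close>, applied to real and
  imaginary parts.\<close>

lemma test_H1:
 assumes \<phi>: "test_function D \<phi>"
 shows "\<phi> \<in> H1 D" "AE x in M. wgrad D \<phi> x = (\<chi> i. frechet_derivative \<phi> (at x) (axis i 1))"
proof -
 have "is_weak_gradient D \<phi> (%x. \<chi> i. frechet_derivative \<phi> (at x) (axis i 1))"
  unfolding is_weak_gradient_def
 proof (intro conjI allI impI)
  show "(%x. (\<chi> i. frechet_derivative \<phi> (at x) (axis i 1)) $ i) \<in> L2 D" for i
   using test_sqi(2)[OF \<phi>] by (simp add: L2_iff_sqi)
  fix \<psi> i assume \<psi>: "test_function D \<psi>"
  let ?e = "axis i 1 :: real^'d"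
  have s\<phi>: "smooth_on UNIV \<phi>" and s\<psi>: "smooth_on UNIV \<psi>" using \<phi> \<psi> by (auto simp: test_function_def)
  let ?pr = "%x. \<phi> x * \<psi> x"
  have Dpr: "(?pr has_derivative (%h. \<phi> x * frechet_derivative \<psi> (at x) h + frechet_derivative \<phi> (at x) h * \<psi> x)) (at x)" for x
   by (rule has_derivative_mult[OF smooth_deriv(1)[OF s\<phi>] smooth_deriv(1)[OF s\<psi>]])
  have t: "test_function D ?pr"
  proof -
   have "smooth_on UNIV ?pr" unfolding smooth_on_def
    by (rule allI, rule Ck_on_bilinear[OF open_UNIV bounded_bilinear_mult]) (use s\<phi> s\<psi> in \<open>auto simp: smooth_on_def\<close>)
   moreover have sub: "closure {x. ?pr x \<noteq> 0} \<subseteq> closure {x. \<phi> x \<noteq> 0}" by (rule closure_mono) auto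
   moreover have "compact (closure {x. ?pr x \<noteq> 0})"
   proof -
    have "compact (closure {x. \<phi> x \<noteq> 0} \<inter> closure {x. ?pr x \<noteq> 0})"
     using \<phi> by (intro compact_Int_closed closed_closure) (simp add: test_function_def)
    then show ?thesis unfolding inf.absorb2[OF sub] .
   qed
   moreover have "closure {x. \<phi> x \<noteq> 0} \<subseteq> D" using \<phi> by (simp add: test_function_def)
   ultimately show ?thesis unfolding test_function_def by (intro conjI) (assumption | rule order_trans)+
  qed
  have z: "(\<integral>x. p (frechet_derivative ?pr (at x) ?e) \<partial>M) = 0" if p: "bounded_linear p" for p :: "complex => real"
  proof -
   note r = test_function_rtest[OF t p]
   obtain K where K: "compact K" "K \<subseteq> D" "!!x. x \<notin> K ==> p (?pr x) = 0" using r(1) by (auto simp: rtest_def)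
   have "grad (%x. p (?pr x)) x = 0" if "x \<notin> D" for x
    using rtest_grad_support[OF r(1) K(1,3)] K(2) that by blast
   moreover have m: "(%x. grad (%x. p (?pr x)) x \<bullet> ?e) \<in> borel_measurable borel" using rtest_grad_sqi[OF r(1)] by (auto simp: sqi_def)
   ultimately have "(\<integral>x. grad (%x. p (?pr x)) x \<bullet> ?e \<partial>M) = (\<integral>x. grad (%x. p (?pr x)) x \<bullet> ?e \<partial>lborel)"
    by (intro integral_rep measurable_M m) auto
   also have "\<dots> = 0" by (rule integral_grad_zero[OF rtest_mono[OF r(1)]]) simp
   finally show ?thesis by (simp only: r(2))
  qed
  have fi: "integrable M (%x. \<phi> x * frechet_derivative \<psi> (at x) ?e)" "integrable M (%x. frechet_derivative \<phi> (at x) ?e * \<psi> x)"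
   by (intro cmult_integrable test_sqi \<phi> \<psi>)+
  have fe: "frechet_derivative ?pr (at x) ?e = \<phi> x * frechet_derivative \<psi> (at x) ?e + frechet_derivative \<phi> (at x) ?e * \<psi> x" for x
   using frechet_derivative_at[OF Dpr[of x]] by metis
  have i: "integrable M (%x. frechet_derivative ?pr (at x) ?e)" unfolding fe using fi by simp
  have "Re (\<integral>x. frechet_derivative ?pr (at x) ?e \<partial>M) = 0" "Im (\<integral>x. frechet_derivative ?pr (at x) ?e \<partial>M) = 0"
   using z[OF bounded_linear_Re] z[OF bounded_linear_Im] integral_bounded_linear[OF bounded_linear_Re i] integral_bounded_linear[OF bounded_linear_Im i] by simp_all
  then have "(\<integral>x. frechet_derivative ?pr (at x) ?e \<partial>M) = 0" by (simp add: complex_eq_iff)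
  then have "(\<integral>x. \<phi> x * frechet_derivative \<psi> (at x) ?e \<partial>M) + (\<integral>x. frechet_derivative \<phi> (at x) ?e * \<psi> x \<partial>M) = 0"
   unfolding fe using fi by simp
  then show "(\<integral>x. \<phi> x * frechet_derivative \<psi> (at x) ?e \<partial>M) = - (\<integral>x. (\<chi> i. frechet_derivative \<phi> (at x) (axis i 1)) $ i * \<psi> x \<partial>M)"
   by (simp add: eq_neg_iff_add_eq_0)
 qed
 from H1I[OF test_sqi(1)[OF \<phi>] this] show "\<phi> \<in> H1 D" "AE x in M. wgrad D \<phi> x = (\<chi> i. frechet_derivative \<phi> (at x) (axis i 1))" by auto
qed

text \<open>Closedness of the weak gradient: both sides of its defining identity are continuous in
  L2 against a fixed test function. Completeness of \<open>H1 D\<close> rests on it.\<close>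

lemma wg_limit:
 assumes w: "!!n. sqi M (w n)" "sqi M w0" "(%n. l2 M (%x. w n x - w0 x)) \<longlonglongrightarrow> 0"
  and g: "!!n. is_weak_gradient D (w n) (g n)" "sqi M g0" "(%n. l2 M (%x. g n x - g0 x)) \<longlonglongrightarrow> 0"
 shows "is_weak_gradient D w0 g0"
 unfolding is_weak_gradient_def
proof (intro conjI allI impI)
 have s: "sqi M (%x. g n x $ i)" "sqi M (%x. g0 x $ i)" for n i using g wg_sqi[OF g(1)] sqi_vec[of M "g n"] sqi_vec[of M g0] by auto
 show "(%x. g0 x $ i) \<in> L2 D" for i using s by (simp add: L2_iff_sqi)
 fix \<phi> i assume \<phi>: "test_function D \<phi>"
 note t = test_sqi[OF \<phi>]
 have lim: "(%n. \<integral>x. u n x * v x \<partial>M) \<longlonglongrightarrow> (\<integral>x. u0 x * v x \<partial>M)"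
  if "!!n. sqi M (u n)" "sqi M u0" "sqi M v" "(%n. l2 M (%x. u n x - u0 x)) \<longlonglongrightarrow> 0"
  for u :: "nat => real^'d => complex" and u0 v
 proof (rule LIM_zero_cancel, rule Lim_null_comparison)
  have "norm ((\<integral>x. u n x * v x \<partial>M) - (\<integral>x. u0 x * v x \<partial>M)) \<le> l2 M (%x. u n x - u0 x) * l2 M v" for n
   using cmult_integrable(2)[OF sqi_diff[OF that(1) that(2)] that(3), of n] cmult_integrable(1)[OF that(1) that(3), of n] cmult_integrable(1)[OF that(2,3)]
   by (simp add: left_diff_distrib)
  then show "\<forall>\<^sub>F n in sequentially. norm ((\<integral>x. u n x * v x \<partial>M) - (\<integral>x. u0 x * v x \<partial>M)) \<le> l2 M (%x. u n x - u0 x) * l2 M v" by simp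
  show "(%n. l2 M (%x. u n x - u0 x) * l2 M v) \<longlonglongrightarrow> 0" using tendsto_mult_right[OF that(4), of "l2 M v"] by (simp add: mult.commute)
 qed
 have "(%n. l2 M (%x. g n x $ i - g0 x $ i)) \<longlonglongrightarrow> 0"
 proof (rule Lim_null_comparison[OF _ g(3)])
  have d: "sqi M (%x. g n x - g0 x)" for n by (rule sqi_diff[OF wg_sqi[OF g(1)] g(2)])
  have "l2 M (%x. (g n x - g0 x) $ i) \<le> 1 * l2 M (%x. g n x - g0 x)" for n
   by (rule sqi_bound(2)[OF _ d]) (use sqi_diff[OF s(1)[of n] s(2)] Finite_Cartesian_Product.norm_nth_le[of "g n _ - g0 _" i] in \<open>simp_all add: sqi_def\<close>)
  then show "\<forall>\<^sub>F n in sequentially. norm (l2 M (%x. g n x $ i - g0 x $ i)) \<le> l2 M (%x. g n x - g0 x)" by simp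
 qed
 note l1 = lim[OF w(1,2) t(2)[of "axis i 1"] w(3)] and l2 = lim[OF s(1) s(2) t(1) this]
 have "(\<integral>x. w n x * frechet_derivative \<phi> (at x) (axis i 1) \<partial>M) = - (\<integral>x. g n x $ i * \<phi> x \<partial>M)" for n
  using g(1) \<phi> by (simp add: is_weak_gradient_def)
 then have "(%n. - (\<integral>x. g n x $ i * \<phi> x \<partial>M)) \<longlonglongrightarrow> (\<integral>x. w0 x * frechet_derivative \<phi> (at x) (axis i 1) \<partial>M)" using l1 by simp
 from LIMSEQ_unique[OF this tendsto_minus[OF l2]]
 show "(\<integral>x. w0 x * frechet_derivative \<phi> (at x) (axis i 1) \<partial>M) = - (\<integral>x. g0 x $ i * \<phi> x \<partial>M)" .
qed

end

section \<open>Sesquilinear forms on \<open>H1 D\<close> and its completeness\<close>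

lemma hdot_add: "hdot (a + b) c = hdot a c + hdot b c" "hdot c (a + b) = hdot c a + hdot c b"
 by (simp_all add: hdot_def algebra_simps sum.distrib)

lemma hdot_scl: "hdot (c *s a) b = c * hdot a b" "hdot a (c *s b) = cnj c * hdot a b"
 by (simp_all add: hdot_def sum_distrib_left mult_ac)

lemma hdot_cmat_herm:
 assumes "transpose A = A"
 shows "hdot (cmat A *v b) a = cnj (hdot (cmat A *v a) b)"
proof -
 have sym: "A $ i $ j = A $ j $ i" for i j
 proof -
  have "transpose A $ i $ j = A $ j $ i" by (simp add: transpose_def)
  then show ?thesis using assms by simp
 qed
 have "hdot (cmat A *v b) a = (\<Sum>i\<in>UNIV. \<Sum>j\<in>UNIV. complex_of_real (A $ i $ j) * b $ j * cnj (a $ i))"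
  by (simp add: hdot_def cmat_def matrix_vector_mult_def sum_distrib_right)
 also have "\<dots> = (\<Sum>j\<in>UNIV. \<Sum>i\<in>UNIV. complex_of_real (A $ j $ i) * b $ j * cnj (a $ i))"
  by (subst sum.swap) (simp add: sym)
 also have "\<dots> = cnj (hdot (cmat A *v a) b)"
  by (simp add: hdot_def cmat_def matrix_vector_mult_def sum_distrib_left sum_distrib_right mult_ac)
 finally show ?thesis .
qed

lemma cmat_mat1: "cmat (mat 1 :: real^'n^'n) *v \<xi> = \<xi>"
proof -
 have "cmat (mat 1 :: real^'n^'n) = mat 1" by (simp add: cmat_def mat_def vec_eq_iff)
 then show ?thesis by simp
qed

lemma cmat_vec_measurable:
 fixes a :: "'a => real^'n^'n" and \<xi> :: "'a => complex^'n"
 assumes "a \<in> borel_measurable N" "\<xi> \<in> borel_measurable N"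
 shows "(%x. cmat (a x) *v \<xi> x) \<in> borel_measurable N"
 unfolding borel_measurable_vec_nth
proof
 fix i
 have 1: "(%x. a x $ i $ j) \<in> borel_measurable N" for j
  using assms(1) unfolding borel_measurable_vec_nth[of a] borel_measurable_vec_nth[of "%x. a x $ i"] by (simp add: borel_measurable_vec_nth)
 have 2: "(%x. \<xi> x $ j) \<in> borel_measurable N" for j using assms(2) by (simp add: borel_measurable_vec_nth)
 show "(%x. (cmat (a x) *v \<xi> x) $ i) \<in> borel_measurable N"
  unfolding matrix_vector_mult_def cmat_def using 1 2 by simp
qed

context bdd_domain
begin

text \<open>The bound carries the indicator of \<open>S\<close>, so the same estimates serve full
  coefficients (\<open>S\<close> everything) and differences of coefficients that live on the small
  balls only. It refers to the form rather than to matrix entries because the form is what gets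
  integrated.\<close>

definition coef :: "(real^'d => real^'d^'d) => real => (real^'d) set => bool" where
 "coef a C S \<longleftrightarrow> a \<in> borel_measurable M \<and> C \<ge> 0 \<and> S \<in> sets borel \<and>
   (\<forall>x\<in>D. \<forall>\<xi> \<eta>. cmod (hdot (cmat (a x) *v \<xi>) \<eta>) \<le> C * (indicat_real S x * norm \<xi> * norm \<eta>))"

definition bcoef :: "(real^'d => real) => real => (real^'d) set => bool" where
 "bcoef b C S \<longleftrightarrow> b \<in> borel_measurable M \<and> C \<ge> 0 \<and> S \<in> sets borel \<and> (\<forall>x\<in>D. \<bar>b x\<bar> \<le> C * indicat_real S x)"

definition IA :: "(real^'d => real^'d^'d) => (real^'d => complex) => (real^'d => complex) => complex" where
 "IA a w \<phi> = (\<integral>x. hdot (cmat (a x) *v wgrad D w x) (wgrad D \<phi> x) \<partial>M)"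

definition IB :: "(real^'d => real) => (real^'d => complex) => (real^'d => complex) => complex" where
 "IB b w \<phi> = (\<integral>x. complex_of_real (b x) * w x * cnj (\<phi> x) \<partial>M)"

lemma borel_sets_M: "S \<in> sets borel ==> restr S f \<in> borel_measurable M" if "f \<in> borel_measurable M" for f :: "real^'d => 'b::euclidean_space"
 by (intro borel_measurable_scaleR measurable_M[OF borel_measurable_indicator] that)

lemma sqi_restr_M:
 fixes f :: "real^'d => 'b::euclidean_space"
 assumes "S \<in> sets borel" "sqi M f" shows "sqi M (restr S f)" "l2 M (restr S f) \<le> l2 M f"
 using sqi_bound[OF borel_sets_M[OF _ assms(1)] assms(2), of f 1] assms(2) by (auto simp: sqi_def indicator_def)

lemma sqi_vec_eqs: "w \<in> H1 D ==> wgrad D w \<in> borel_measurable M" "w \<in> H1 D ==> w \<in> borel_measurable M"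
 using H1D[of w] by (auto simp: sqi_def)

lemma IA_bound:
 assumes a: "coef a C S" and w: "w \<in> H1 D" and \<phi>: "\<phi> \<in> H1 D"
 shows "integrable M (%x. hdot (cmat (a x) *v wgrad D w x) (wgrad D \<phi> x))"
  "cmod (IA a w \<phi>) \<le> C * (l2 M (restr S (wgrad D w)) * l2 M (wgrad D \<phi>))"
proof -
 have am: "a \<in> borel_measurable M" and C: "C \<ge> 0" and S: "S \<in> sets borel" using a by (auto simp: coef_def)
 have m: "(%x. hdot (cmat (a x) *v wgrad D w x) (wgrad D \<phi> x)) \<in> borel_measurable M"
  by (intro hdot_measurable cmat_vec_measurable am sqi_vec_eqs w \<phi>)
 have "cmod (hdot (cmat (a x) *v wgrad D w x) (wgrad D \<phi> x)) \<le> C * (norm (restr S (wgrad D w) x) * norm (wgrad D \<phi> x))" if "x \<in> D" for x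
  using a that by (simp add: coef_def)
 then have b: "AE x in M. cmod (hdot (cmat (a x) *v wgrad D w x) (wgrad D \<phi> x)) \<le> C * (norm (restr S (wgrad D w) x) * norm (wgrad D \<phi> x))"
  by (intro AE_I2) simp
 show "integrable M (%x. hdot (cmat (a x) *v wgrad D w x) (wgrad D \<phi> x))"
  "cmod (IA a w \<phi>) \<le> C * (l2 M (restr S (wgrad D w)) * l2 M (wgrad D \<phi>))"
  unfolding IA_def by (rule l2_bilinear[OF sqi_restr_M(1)[OF S H1D(3)[OF w]] H1D(3)[OF \<phi>] m b C])+
qed

lemma IB_bound:
 assumes a: "bcoef b C S" and w: "w \<in> H1 D" and \<phi>: "\<phi> \<in> H1 D"
 shows "integrable M (%x. complex_of_real (b x) * w x * cnj (\<phi> x))"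
  "cmod (IB b w \<phi>) \<le> C * (l2 M (restr S w) * l2 M \<phi>)"
proof -
 have am: "b \<in> borel_measurable M" and C: "C \<ge> 0" and S: "S \<in> sets borel" using a by (auto simp: bcoef_def)
 have bm: "(%x. complex_of_real (b x)) \<in> borel_measurable M"
  by (rule measurable_compose[OF am]) (intro borel_measurable_continuous_onI continuous_intros)
 have m: "(%x. complex_of_real (b x) * w x * cnj (\<phi> x)) \<in> borel_measurable M"
  by (intro borel_measurable_times bm borel_measurable_cnj sqi_vec_eqs w \<phi>)
 have "cmod (complex_of_real (b x) * w x * cnj (\<phi> x)) \<le> C * (norm (restr S w x) * norm (\<phi> x))" if "x \<in> D" for x
 proof -
  have "\<bar>b x\<bar> * (cmod (w x) * cmod (\<phi> x)) \<le> (C * indicat_real S x) * (cmod (w x) * cmod (\<phi> x))"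
   using a that by (intro mult_right_mono) (auto simp: bcoef_def)
  then show ?thesis by (simp add: norm_mult mult_ac)
 qed
 then have bb: "AE x in M. cmod (complex_of_real (b x) * w x * cnj (\<phi> x)) \<le> C * (norm (restr S w x) * norm (\<phi> x))"
  by (intro AE_I2) simp
 show "integrable M (%x. complex_of_real (b x) * w x * cnj (\<phi> x))"
  "cmod (IB b w \<phi>) \<le> C * (l2 M (restr S w) * l2 M \<phi>)"
  unfolding IB_def by (rule l2_bilinear[OF sqi_restr_M(1)[OF S H1D(1)[OF w]] H1D(1)[OF \<phi>] m bb C])+
qed

definition sesq :: "((real^'d => complex) => (real^'d => complex) => complex) => bool" where
 "sesq F \<longleftrightarrow> (\<forall>u\<in>H1 D. \<forall>v\<in>H1 D. \<forall>w\<in>H1 D. F (u + v) w = F u w + F v w \<and> F w (u + v) = F w u + F w v)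
   \<and> (\<forall>c. \<forall>u\<in>H1 D. \<forall>w\<in>H1 D. F (%x. c * u x) w = c * F u w \<and> F w (%x. c * u x) = cnj c * F w u)"

text \<open>\<open>wgrad\<close> is a chosen representative and therefore linear only almost
  everywhere, which is why additivity and homogeneity pass through
  \<open>integral_cong_AE\<close>.\<close>

lemma IA_sesq:
 assumes a: "coef a C S"
 shows "sesq (IA a)"
 unfolding sesq_def
proof (intro conjI ballI allI)
 have am: "a \<in> borel_measurable M" using a by (auto simp: coef_def)
 let ?h = "%w \<phi> x. hdot (cmat (a x) *v wgrad D w x) (wgrad D \<phi> x)"
 have m: "?h w \<phi> \<in> borel_measurable M" if "w \<in> H1 D" "\<phi> \<in> H1 D" for w \<phi>
  by (intro hdot_measurable cmat_vec_measurable am sqi_vec_eqs that)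
 fix u v w assume u: "u \<in> H1 D" and v: "v \<in> H1 D" and w: "w \<in> H1 D"
 note i = IA_bound(1)[OF a]
 have "IA a (u + v) w = (\<integral>x. ?h u w x + ?h v w x \<partial>M)" unfolding IA_def
  by (rule integral_cong_AE) (use H1_add(2)[OF u v] m H1_add(1) u v w in \<open>auto elim!: eventually_mono simp: matrix_vector_right_distrib hdot_add\<close>)
 then show "IA a (u + v) w = IA a u w + IA a v w" using i[OF u w] i[OF v w] by (simp add: IA_def)
 have "IA a w (u + v) = (\<integral>x. ?h w u x + ?h w v x \<partial>M)" unfolding IA_def
  by (rule integral_cong_AE) (use H1_add(2)[OF u v] m H1_add(1) u v w in \<open>auto elim!: eventually_mono simp: hdot_add\<close>)
 then show "IA a w (u + v) = IA a w u + IA a w v" using i[OF w u] i[OF w v] by (simp add: IA_def)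
next
 have am: "a \<in> borel_measurable M" using a by (auto simp: coef_def)
 let ?h = "%w \<phi> x. hdot (cmat (a x) *v wgrad D w x) (wgrad D \<phi> x)"
 have m: "?h w \<phi> \<in> borel_measurable M" if "w \<in> H1 D" "\<phi> \<in> H1 D" for w \<phi>
  by (intro hdot_measurable cmat_vec_measurable am sqi_vec_eqs that)
 fix c u w assume u: "u \<in> H1 D" and w: "w \<in> H1 D"
 have "IA a (%x. c * u x) w = (\<integral>x. c * ?h u w x \<partial>M)" unfolding IA_def
 proof (rule integral_cong_AE)
  show "AE x in M. ?h (%x. c * u x) w x = c * ?h u w x"
   using H1_scl(2)[OF u, of c] by eventually_elim (simp add: vector_scalar_commute hdot_scl)
 qed (use m H1_scl(1) u w in auto)
 then show "IA a (%x. c * u x) w = c * IA a u w" by (simp add: IA_def)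
 have "IA a w (%x. c * u x) = (\<integral>x. cnj c * ?h w u x \<partial>M)" unfolding IA_def
 proof (rule integral_cong_AE)
  show "AE x in M. ?h w (%x. c * u x) x = cnj c * ?h w u x"
   using H1_scl(2)[OF u, of c] by eventually_elim (simp add: hdot_scl)
 qed (use m H1_scl(1) u w in auto)
 then show "IA a w (%x. c * u x) = cnj c * IA a w u" by (simp add: IA_def)
qed

lemma IB_sesq:
 assumes a: "bcoef b C S"
 shows "sesq (IB b)"
 unfolding sesq_def
proof (intro conjI ballI allI)
 fix u v w assume u: "u \<in> H1 D" and v: "v \<in> H1 D" and w: "w \<in> H1 D"
 note i = IB_bound(1)[OF a]
 show "IB b (u + v) w = IB b u w + IB b v w" using i[OF u w] i[OF v w] by (simp add: IB_def algebra_simps)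
 show "IB b w (u + v) = IB b w u + IB b w v" using i[OF w u] i[OF w v] by (simp add: IB_def algebra_simps)
next
 fix c u w
 have "IB b (%x. c * u x) w = (\<integral>x. c * (complex_of_real (b x) * u x * cnj (w x)) \<partial>M)" unfolding IB_def
  by (rule Bochner_Integration.integral_cong) (auto simp: mult_ac)
 then show "IB b (%x. c * u x) w = c * IB b u w" by (simp add: IB_def)
 have "IB b w (%x. c * u x) = (\<integral>x. cnj c * (complex_of_real (b x) * w x * cnj (u x)) \<partial>M)" unfolding IB_def
  by (rule Bochner_Integration.integral_cong) (auto simp: mult_ac)
 then show "IB b w (%x. c * u x) = cnj c * IB b w u" by (simp add: IB_def)
qed

lemma IA_herm:
 assumes a: "coef a C S" and sym: "!!x. x \<in> D ==> transpose (a x) = a x" and w: "w \<in> H1 D" "\<phi> \<in> H1 D"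
 shows "IA a \<phi> w = cnj (IA a w \<phi>)"
proof -
 have "IA a \<phi> w = (\<integral>x. cnj (hdot (cmat (a x) *v wgrad D w x) (wgrad D \<phi> x)) \<partial>M)" unfolding IA_def
  by (rule Bochner_Integration.integral_cong) (use sym hdot_cmat_herm in auto)
 also have "\<dots> = cnj (IA a w \<phi>)" unfolding IA_def by (rule integral_bounded_linear[OF bounded_linear_cnj IA_bound(1)[OF a w]])
 finally show ?thesis .
qed

lemma IB_herm:
 assumes a: "bcoef b C S" and w: "w \<in> H1 D" "\<phi> \<in> H1 D"
 shows "IB b \<phi> w = cnj (IB b w \<phi>)"
proof -
 have "IB b \<phi> w = (\<integral>x. cnj (complex_of_real (b x) * w x * cnj (\<phi> x)) \<partial>M)" unfolding IB_def
  by (rule Bochner_Integration.integral_cong) (auto simp: mult_ac)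
 also have "\<dots> = cnj (IB b w \<phi>)" unfolding IB_def by (rule integral_bounded_linear[OF bounded_linear_cnj IB_bound(1)[OF a w]])
 finally show ?thesis .
qed

abbreviation "one_mat \<equiv> (%x::real^'d. mat 1 :: real^'d^'d)"
abbreviation "one_fun \<equiv> (%x::real^'d. 1 :: real)"

lemma coef_one: "coef one_mat 1 UNIV" by (simp add: coef_def cmat_mat1 hdot_bound)
lemma bcoef_one: "bcoef one_fun 1 UNIV" by (simp add: bcoef_def)

lemma IA_self: "w \<in> H1 D ==> IA one_mat w w = complex_of_real ((l2 M (wgrad D w))\<^sup>2)"
 by (simp add: IA_def cmat_mat1 hdot_self l2_sq del: of_real_power)

lemma IB_self: "IB one_fun w w = complex_of_real ((l2 M w)\<^sup>2)"
proof -
 have "IB one_fun w w = (\<integral>x. complex_of_real ((cmod (w x))\<^sup>2) \<partial>M)" unfolding IB_def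
  by (rule Bochner_Integration.integral_cong) (simp_all only: complex_norm_square of_real_1 mult_1)
 then show ?thesis by (simp add: l2_sq del: of_real_power)
qed

lemma H1_inner_eq: "w \<in> H1 D ==> \<phi> \<in> H1 D ==> H1_inner D w \<phi> = IA one_mat w \<phi> + IB one_fun w \<phi>"
 using IA_bound(1)[OF coef_one, of w \<phi>] IB_bound(1)[OF bcoef_one, of w \<phi>]
 by (simp add: H1_inner_def IA_def IB_def cmat_mat1)

lemma H1_zero: "0 \<in> H1 D"
proof -
 have "is_weak_gradient D (%x. 0) (%x. 0)" by (simp add: is_weak_gradient_def L2_iff_sqi)
 from H1I(1)[OF _ this] show ?thesis by (simp add: zero_fun_def)
qed

sublocale H1: semi_inner "H1 D" "%c w x. c * w x" "H1_inner D"
proof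
 note s = IA_sesq[OF coef_one] IB_sesq[OF bcoef_one]
 show "0 \<in> H1 D" by (rule H1_zero)
 show "u + v \<in> H1 D" if "u \<in> H1 D" "v \<in> H1 D" for u v using H1_add that by blast
 show "(%x. c * u x) \<in> H1 D" if "u \<in> H1 D" for u c using H1_scl that by blast
 show "u - v = u + (%x. - 1 * v x)" for u v :: "real^'d => complex" by (simp add: fun_eq_iff)
 show "H1_inner D (u + v) w = H1_inner D u w + H1_inner D v w" if "u \<in> H1 D" "v \<in> H1 D" "w \<in> H1 D" for u v w
  using that s H1_add(1)[of u v] by (simp add: H1_inner_eq sesq_def)
 show "H1_inner D (%x. c * u x) w = c * H1_inner D u w" if "u \<in> H1 D" "w \<in> H1 D" for u w c
  using that s H1_scl(1)[of u c] by (simp add: H1_inner_eq sesq_def distrib_left)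
 show "H1_inner D v u = cnj (H1_inner D u v)" if "u \<in> H1 D" "v \<in> H1 D" for u v
  using IA_herm[OF coef_one _ that] IB_herm[OF bcoef_one that] that by (simp add: H1_inner_eq transpose_mat)
 show "0 \<le> Re (H1_inner D u u)" if "u \<in> H1 D" for u
  using that by (simp add: H1_inner_eq IA_self IB_self del: of_real_power)
qed

lemma H1_nrm: "H1.nrm w = H1_norm D w" by (simp add: H1.nrm_def H1_norm_def)

lemma H1_norm_sq:
 assumes w: "w \<in> H1 D"
 shows "(H1_norm D w)\<^sup>2 = (l2 M (wgrad D w))\<^sup>2 + (l2 M w)\<^sup>2"
 unfolding H1_nrm[symmetric] H1.nrm_sq[OF w] H1_inner_eq[OF w w] IA_self[OF w] IB_self
 by (simp only: plus_complex.simps Re_complex_of_real)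

lemma H1_norm_nonneg: "w \<in> H1 D ==> H1_norm D w \<ge> 0"
 unfolding H1_nrm[symmetric] by (rule H1.nrm_nonneg)

lemma H1_norm_ge:
 assumes w: "w \<in> H1 D"
 shows "l2 M w \<le> H1_norm D w" "l2 M (wgrad D w) \<le> H1_norm D w"
 by (rule power2_le_imp_le[OF _ H1_norm_nonneg[OF w]], simp only: H1_norm_sq[OF w], simp)+

lemma H1_norm_le:
 assumes w: "w \<in> H1 D"
 shows "H1_norm D w \<le> l2 M (wgrad D w) + l2 M w"
 by (rule power2_le_imp_le) (simp_all add: H1_norm_sq[OF w] power2_sum)

lemma H1_diff:
 assumes "w \<in> H1 D" "w' \<in> H1 D"
 shows "w - w' \<in> H1 D" "AE x in M. wgrad D (w - w') x = wgrad D w x - wgrad D w' x"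
proof -
 show "w - w' \<in> H1 D" by (rule H1.V_diff[OF assms])
 have e: "w - w' = w + (%x. (-1) * w' x)" by (rule H1.diff_scl)
 show "AE x in M. wgrad D (w - w') x = wgrad D w x - wgrad D w' x"
  using H1_add(2)[OF assms(1) H1_scl(1)[OF assms(2), of "-1"]] H1_scl(2)[OF assms(2), of "-1"]
  unfolding e by eventually_elim (simp add: vector_sneg_minus1[symmetric])
qed

text \<open>Functions and gradients converge separately in L2, and \<open>wg_limit\<close>
  identifies the second limit as the gradient of the first.\<close>

lemma H1_complete: "H1.complete_space"
 unfolding H1.complete_space_def
proof (intro allI impI)
 fix f :: "nat => real^'d => complex" assume f: "\<forall>n. f n \<in> H1 D" and ca: "\<forall>e>0. \<exists>N. \<forall>m\<ge>N. \<forall>n\<ge>N. H1.nrm (f m - f n) < e"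
 have fn: "f n \<in> H1 D" for n using f by blast
 have b1: "l2 M (%x. f m x - f n x) \<le> H1.nrm (f m - f n)" for m n
  using H1_norm_ge(1)[OF H1_diff(1)[OF fn[of m] fn[of n]]] by (simp add: H1_nrm fun_diff_def)
 have eqg: "l2 M (wgrad D (u - v)) = l2 M (%x. wgrad D u x - wgrad D v x)" if "u \<in> H1 D" "v \<in> H1 D" for u v
  by (rule l2_cong_AE[OF H1_diff(2)[OF that]]) (use sqi_vec_eqs that H1_diff(1) in \<open>auto intro!: borel_measurable_diff\<close>)
 have b2: "l2 M (%x. wgrad D (f m) x - wgrad D (f n) x) \<le> H1.nrm (f m - f n)" for m n
  using H1_norm_ge(2)[OF H1_diff(1)[OF fn[of m] fn[of n]]] by (simp add: H1_nrm eqg fn)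
 have tr: "\<exists>N. \<forall>m\<ge>N. \<forall>n\<ge>N. d m n < e" if e: "e > 0" and le: "!!m n. d m n \<le> H1.nrm (f m - f n)" for e and d :: "nat => nat => real"
 proof -
  from ca[rule_format, OF e] obtain N where N: "\<forall>m\<ge>N. \<forall>n\<ge>N. H1.nrm (f m - f n) < e" ..
  have "d m n < e" if "m \<ge> N" "n \<ge> N" for m n using le[of m n] N that by (meson order_le_less_trans)
  then show ?thesis by blast
 qed
 obtain w0 where w0: "sqi M w0" "(%n. l2 M (%x. f n x - w0 x)) \<longlonglongrightarrow> 0"
  using sqi_complete[OF fin H1D(1)[OF fn] tr[OF _ b1]] by blast
 obtain g0 where g0: "sqi M g0" "(%n. l2 M (%x. wgrad D (f n) x - g0 x)) \<longlonglongrightarrow> 0"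
  using sqi_complete[OF fin H1D(3)[OF fn] tr[OF _ b2]] by blast
 have wg: "is_weak_gradient D w0 g0"
  by (rule wg_limit[OF _ w0 _ g0]) (use H1D[OF fn] in auto)
 note l = H1I[OF w0(1) wg]
 have "(%n. H1.nrm (f n - w0)) \<longlonglongrightarrow> 0"
 proof (rule Lim_null_comparison)
  have "norm (H1.nrm (f n - w0)) \<le> l2 M (%x. wgrad D (f n) x - g0 x) + l2 M (%x. f n x - w0 x)" for n
  proof -
   have d: "f n - w0 \<in> H1 D" by (rule H1_diff(1)[OF fn l(1)])
   have "l2 M (%x. wgrad D (f n) x - wgrad D w0 x) = l2 M (%x. wgrad D (f n) x - g0 x)"
    by (rule l2_cong_AE) (use l g0 sqi_vec_eqs fn in \<open>auto elim!: eventually_mono intro!: borel_measurable_diff simp: sqi_def\<close>)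
   then show ?thesis using H1_norm_le[OF d] H1.nrm_nonneg[OF d] eqg[OF fn l(1), of n] by (simp add: H1_nrm fun_diff_def)
  qed
  then show "\<forall>\<^sub>F n in sequentially. norm (H1.nrm (f n - w0)) \<le> l2 M (%x. wgrad D (f n) x - g0 x) + l2 M (%x. f n x - w0 x)" by simp
  show "(%n. l2 M (%x. wgrad D (f n) x - g0 x) + l2 M (%x. f n x - w0 x)) \<longlonglongrightarrow> 0"
   using tendsto_add[OF g0(2) w0(2)] by simp
 qed
 then show "\<exists>l\<in>H1 D. (%n. H1.nrm (f n - l)) \<longlonglongrightarrow> 0" using l(1) by blast
qed

end

section \<open>The spaces \<open>H10 D\<close> and \<open>X D\<close>\<close>

lemma test_functionI:
 assumes s: "smooth_on UNIV \<phi>" and K: "compact K" "K \<subseteq> D" "!!x. x \<notin> K ==> \<phi> x = 0"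
 shows "test_function D \<phi>"
proof -
 have sub: "closure {x. \<phi> x \<noteq> 0} \<subseteq> K" by (rule closure_minimal) (use K compact_imp_closed in auto)
 have "compact (K \<inter> closure {x. \<phi> x \<noteq> 0})" by (intro compact_Int_closed closed_closure K)
 then show ?thesis unfolding inf.absorb2[OF sub] test_function_def using s sub K(2) by blast
qed

lemma test_functionD:
 assumes "test_function D \<phi>"
 obtains K where "compact K" "K \<subseteq> D" "!!x. x \<notin> K ==> \<phi> x = 0"
proof (rule that[of "closure {x. \<phi> x \<noteq> 0}"])
 show "compact (closure {x. \<phi> x \<noteq> 0})" "closure {x. \<phi> x \<noteq> 0} \<subseteq> D" using assms by (auto simp: test_function_def)
 show "\<phi> x = 0" if "x \<notin> closure {x. \<phi> x \<noteq> 0}" for x using that closure_subset[of "{x. \<phi> x \<noteq> 0}"] by blast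
qed

lemma test_add:
 assumes "test_function D \<phi>" "test_function D \<psi>"
 shows "test_function D (\<phi> + \<psi>)"
proof -
 obtain K where K: "compact K" "K \<subseteq> D" "!!x. x \<notin> K ==> \<phi> x = 0" using test_functionD[OF assms(1)] by blast
 obtain L where L: "compact L" "L \<subseteq> D" "!!x. x \<notin> L ==> \<psi> x = 0" using test_functionD[OF assms(2)] by blast
 have "smooth_on UNIV (%x. \<phi> x + \<psi> x)" unfolding smooth_on_def
  by (rule allI, rule Ck_on_add) (use assms in \<open>auto simp: test_function_def smooth_on_def\<close>)
 then show ?thesis using K L by (intro test_functionI[of _ "K \<union> L"]) (auto simp: plus_fun_def compact_Un)
qed

lemma test_scl:
 assumes "test_function D \<phi>"
 shows "test_function D (%x. c * \<phi> x)"
proof -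
 obtain K where K: "compact K" "K \<subseteq> D" "!!x. x \<notin> K ==> \<phi> x = 0" using test_functionD[OF assms(1)] by blast
 have "smooth_on UNIV (%x. c * \<phi> x)" unfolding smooth_on_def
  by (rule allI, rule Ck_on_bounded_linear[OF open_UNIV bounded_linear_mult_right]) (use assms in \<open>auto simp: test_function_def smooth_on_def\<close>)
 then show ?thesis using K by (intro test_functionI[of _ K]) auto
qed

text \<open>Young's inequality for the cross term with weight \<open>s\<close>. The weight is left
  open because the two well-posedness cases balance it differently.\<close>

lemma quadratic_form_bound:
 fixes m b p q P Q E :: real
 assumes "0 < s" "E \<ge> P\<^sup>2 - 2 * (P * Q) + q\<^sup>2"
 shows "(1 - s) * P\<^sup>2 + q\<^sup>2 - Q\<^sup>2 / s \<le> E"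
proof -
 have "0 \<le> (s * P - Q)\<^sup>2 / s" using assms by simp
 also have "\<dots> = s * P\<^sup>2 - 2 * (P * Q) + Q\<^sup>2 / s" using assms by (simp add: power2_diff power2_eq_square field_simps)
 finally show ?thesis using assms(2) by (simp add: left_diff_distrib)
qed

context bdd_domain
begin

lemma nrm_zero: "H1_norm D 0 = 0"
 using H1.nrm_scl[OF H1_zero, of 0] by (simp add: H1_nrm zero_fun_def)

lemma H10_H1: "w \<in> H10 D ==> w \<in> H1 D" by (simp add: H10_def)

lemma H10_test: "test_function D \<phi> ==> \<phi> \<in> H10 D"
 unfolding H10_def using test_H1(1)[of \<phi>] nrm_zero by force

lemma H10_add:
 assumes "w \<in> H10 D" "w' \<in> H10 D"
 shows "w + w' \<in> H10 D"
 unfolding H10_def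
proof (intro CollectI conjI allI impI)
 note h = H10_H1[OF assms(1)] H10_H1[OF assms(2)]
 show "w + w' \<in> H1 D" by (rule H1.V_add[OF h])
 fix e :: real assume "e > 0"
 then have e2: "e/2 > 0" by simp
 obtain \<phi> where p: "test_function D \<phi>" "H1_norm D (w - \<phi>) < e/2" using assms(1) e2 unfolding H10_def by blast
 obtain \<psi> where q: "test_function D \<psi>" "H1_norm D (w' - \<psi>) < e/2" using assms(2) e2 unfolding H10_def by blast
 have e: "w + w' - (\<phi> + \<psi>) = (w - \<phi>) + (w' - \<psi>)" by simp
 have "H1_norm D (w + w' - (\<phi> + \<psi>)) \<le> H1_norm D (w - \<phi>) + H1_norm D (w' - \<psi>)"
  unfolding e using H1.nrm_triangle[OF H1_diff(1)[OF h(1) test_H1(1)[OF p(1)]] H1_diff(1)[OF h(2) test_H1(1)[OF q(1)]]] by (simp only: H1_nrm)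
 then have "H1_norm D (w + w' - (\<phi> + \<psi>)) < e" using p q by linarith
 then show "\<exists>\<phi>. test_function D \<phi> \<and> H1_norm D (w + w' - \<phi>) < e" using test_add[OF p(1) q(1)] by blast
qed

lemma H10_scl:
 assumes "w \<in> H10 D"
 shows "(%x. c * w x) \<in> H10 D"
 unfolding H10_def
proof (intro CollectI conjI allI impI)
 note h = H10_H1[OF assms(1)]
 show "(%x. c * w x) \<in> H1 D" by (rule H1_scl(1)[OF h])
 fix e :: real assume e: "e > 0"
 have cp: "cmod c + 1 > 0" by (simp add: add_nonneg_pos)
 then have "e / (cmod c + 1) > 0" using e by simp
 then obtain \<phi> where p: "test_function D \<phi>" "H1_norm D (w - \<phi>) < e / (cmod c + 1)" using assms(1) unfolding H10_def by blast
 note d = H1_diff(1)[OF h test_H1(1)[OF p(1)]]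
 have "(%x. c * w x) - (%x. c * \<phi> x) = (%x. c * (w - \<phi>) x)" by (simp add: fun_eq_iff right_diff_distrib)
 then have "H1_norm D ((%x. c * w x) - (%x. c * \<phi> x)) = cmod c * H1_norm D (w - \<phi>)"
  using H1.nrm_scl[OF d, of c] by (simp add: H1_nrm)
 also have "\<dots> \<le> (cmod c + 1) * H1_norm D (w - \<phi>)" using H1_norm_nonneg[OF d] by (simp add: distrib_right)
 also have "\<dots> < e" using p(2) cp by (simp add: pos_less_divide_eq mult.commute)
 finally show "\<exists>\<phi>. test_function D \<phi> \<and> H1_norm D ((%x. c * w x) - \<phi>) < e" using test_scl[OF p(1)] by blast
qed

lemma X_iff: "(w, v) \<in> X D \<longleftrightarrow> w \<in> H1 D \<and> v \<in> H1 D \<and> w - v \<in> H10 D" by (simp add: X_def)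

lemma X_H1: "u \<in> X D ==> fst u \<in> H1 D" "u \<in> X D ==> snd u \<in> H1 D" by (auto simp: X_def)

lemma X_inner_eq: "X_inner D u \<phi> = H1_inner D (fst u) (fst \<phi>) + H1_inner D (snd u) (snd \<phi>)"
 by (simp add: X_inner_def case_prod_beta)

lemma X_scale_eq: "X_scale c u = (%x. c * fst u x, %x. c * snd u x)" by (simp add: X_scale_def case_prod_beta)

lemma H10_zero: "0 \<in> H10 D"
 by (rule H10_test, rule test_functionI[of _ "{}"]) (auto simp: smooth_on_def zero_fun_def Ck_on_const)

sublocale X: semi_inner "X D" X_scale "X_inner D"
proof
 show "0 \<in> X D" by (simp add: zero_prod_def X_iff H1_zero H10_zero)
 show "u + v \<in> X D" if "u \<in> X D" "v \<in> X D" for u v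
 proof -
  obtain w w' y y' where e: "u = (w, w')" "v = (y, y')" by (cases u, cases v)
  have h: "w \<in> H1 D" "w' \<in> H1 D" "w - w' \<in> H10 D" "y \<in> H1 D" "y' \<in> H1 D" "y - y' \<in> H10 D" using that unfolding e X_iff by blast+
  have q: "(w + y) - (w' + y') = (w - w') + (y - y')" by simp
  show ?thesis unfolding e plus_prod_def fst_conv snd_conv X_iff q by (intro conjI H1.V_add H10_add h)
 qed
 show "X_scale c u \<in> X D" if "u \<in> X D" for u c
 proof -
  have "(%x. c * fst u x) - (%x. c * snd u x) = (%x. c * (fst u - snd u) x)" by (simp add: fun_eq_iff right_diff_distrib)
  then show ?thesis using that H10_scl[of "fst u - snd u" c] H1_scl(1) by (auto simp: X_scale_eq X_def)
 qed
 show "u - v = u + X_scale (- 1) v" for u v :: "'d fpair"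
  by (simp add: X_scale_eq prod_eq_iff fun_eq_iff)
 show "X_inner D (u + v) w = X_inner D u w + X_inner D v w" if "u \<in> X D" "v \<in> X D" "w \<in> X D" for u v w
  using that X_H1 by (simp add: X_inner_eq H1.ip_add)
 show "X_inner D (X_scale c u) w = c * X_inner D u w" if "u \<in> X D" "w \<in> X D" for u w c
  using that X_H1 H1.ip_scl[of "fst u" "fst w" c] H1.ip_scl[of "snd u" "snd w" c] by (simp add: X_inner_eq X_scale_eq distrib_left)
 show "X_inner D v u = cnj (X_inner D u v)" if "u \<in> X D" "v \<in> X D" for u v
  using that X_H1 H1.ip_herm[of "fst u" "fst v"] H1.ip_herm[of "snd u" "snd v"] by (simp add: X_inner_eq)
 show "0 \<le> Re (X_inner D u u)" if "u \<in> X D" for u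
  using that X_H1 H1.ip_nonneg[of "fst u"] H1.ip_nonneg[of "snd u"] by (simp add: X_inner_eq)
qed

lemma X_nrm: "X.nrm u = X_norm D u" by (simp add: X.nrm_def X_norm_def)

lemma X_norm_nonneg: "u \<in> X D ==> X_norm D u \<ge> 0" unfolding X_nrm[symmetric] by (rule X.nrm_nonneg)

lemma X_norm_sq: "u \<in> X D ==> (X_norm D u)\<^sup>2 = (H1_norm D (fst u))\<^sup>2 + (H1_norm D (snd u))\<^sup>2"
 unfolding X_nrm[symmetric] H1_nrm[symmetric] using X.nrm_sq[of u] H1.nrm_sq[OF X_H1(1)[of u]] H1.nrm_sq[OF X_H1(2)[of u]] by (simp add: X_inner_eq)

lemma X_norm_ge:
 assumes u: "u \<in> X D"
 shows "H1_norm D (fst u) \<le> X_norm D u" "H1_norm D (snd u) \<le> X_norm D u"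
 by (rule power2_le_imp_le[OF _ X_norm_nonneg[OF u]], simp only: X_norm_sq[OF u], simp)+

lemma X_norm_le:
 assumes u: "u \<in> X D"
 shows "X_norm D u \<le> H1_norm D (fst u) + H1_norm D (snd u)"
 using H1_norm_nonneg[OF X_H1(1)[OF u]] H1_norm_nonneg[OF X_H1(2)[OF u]]
 by - (rule power2_le_imp_le, simp_all add: X_norm_sq[OF u] power2_sum)

lemma X_complete: "X.complete_space"
 unfolding X.complete_space_def
proof (intro allI impI)
 fix f :: "nat => 'd fpair" assume f: "\<forall>n. f n \<in> X D" and ca: "\<forall>e>0. \<exists>N. \<forall>m\<ge>N. \<forall>n\<ge>N. X.nrm (f m - f n) < e"
 have fn: "f n \<in> X D" for n using f by blast
 have tr: "\<forall>e>0. \<exists>N. \<forall>m\<ge>N. \<forall>n\<ge>N. d m n < e" if le: "!!m n. d m n \<le> X.nrm (f m - f n)" for d :: "nat => nat => real"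
 proof (intro allI impI)
  fix e :: real assume e: "e > 0"
  from ca[rule_format, OF e] obtain N where N: "\<forall>m\<ge>N. \<forall>n\<ge>N. X.nrm (f m - f n) < e" ..
  have "d m n < e" if "m \<ge> N" "n \<ge> N" for m n using le[of m n] N that by (meson order_le_less_trans)
  then show "\<exists>N. \<forall>m\<ge>N. \<forall>n\<ge>N. d m n < e" by blast
 qed
 have dX: "f m - f n \<in> X D" for m n by (rule X.V_diff[OF fn fn])
 have "\<exists>l\<in>H1 D. (%n. H1.nrm (fst (f n) - l)) \<longlonglongrightarrow> 0"
  using H1_complete[unfolded H1.complete_space_def, rule_format, of "%n. fst (f n)"] X_H1(1)[OF fn]
   tr[of "%m n. H1.nrm (fst (f m) - fst (f n))"] X_norm_ge(1)[OF dX] by (simp add: X_nrm H1_nrm)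
 then obtain w where w: "w \<in> H1 D" "(%n. H1_norm D (fst (f n) - w)) \<longlonglongrightarrow> 0" by (auto simp: H1_nrm)
 have "\<exists>l\<in>H1 D. (%n. H1.nrm (snd (f n) - l)) \<longlonglongrightarrow> 0"
  using H1_complete[unfolded H1.complete_space_def, rule_format, of "%n. snd (f n)"] X_H1(2)[OF fn]
   tr[of "%m n. H1.nrm (snd (f m) - snd (f n))"] X_norm_ge(2)[OF dX] by (simp add: X_nrm H1_nrm)
 then obtain v where v: "v \<in> H1 D" "(%n. H1_norm D (snd (f n) - v)) \<longlonglongrightarrow> 0" by (auto simp: H1_nrm)
 \<comment> \<open>Closedness of \<open>H10 D\<close>: a test function near the difference of the
   components of a late \<open>f n\<close> is within three thirds of \<open>e\<close> of the
   limit.\<close>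
 have "w - v \<in> H10 D" unfolding H10_def
 proof (intro CollectI conjI allI impI)
  show "w - v \<in> H1 D" by (rule H1_diff(1)[OF w(1) v(1)])
  fix e :: real assume "e > 0"
  then have e3: "e/3 > 0" by simp
  have "\<forall>\<^sub>F n in sequentially. H1_norm D (fst (f n) - w) < e/3 \<and> H1_norm D (snd (f n) - v) < e/3"
   using order_tendstoD(2)[OF w(2) e3] order_tendstoD(2)[OF v(2) e3] by eventually_elim simp
  then obtain n where n: "H1_norm D (fst (f n) - w) < e/3" "H1_norm D (snd (f n) - v) < e/3" by (auto simp: eventually_sequentially)
  have "fst (f n) - snd (f n) \<in> H10 D" using fn[of n] by (auto simp: X_def)
  then obtain \<phi> where p: "test_function D \<phi>" "H1_norm D (fst (f n) - snd (f n) - \<phi>) < e/3" using e3 unfolding H10_def by blast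
  have h: "fst (f n) - w \<in> H1 D" "snd (f n) - v \<in> H1 D" "fst (f n) - snd (f n) - \<phi> \<in> H1 D" "w - fst (f n) \<in> H1 D"
   using X_H1[OF fn[of n]] w(1) v(1) test_H1(1)[OF p(1)] by (auto intro: H1_diff)
  have e: "w - v - \<phi> = (w - fst (f n)) + ((snd (f n) - v) + (fst (f n) - snd (f n) - \<phi>))" by simp
  have "H1_norm D (w - v - \<phi>) \<le> H1_norm D (w - fst (f n)) + (H1_norm D (snd (f n) - v) + H1_norm D (fst (f n) - snd (f n) - \<phi>))"
   unfolding e by (rule order_trans[OF H1.nrm_triangle[OF h(4) H1.V_add[OF h(2,3)], unfolded H1_nrm] add_left_mono[OF H1.nrm_triangle[OF h(2,3), unfolded H1_nrm]]])
  also have "H1_norm D (w - fst (f n)) = H1_norm D (fst (f n) - w)" using H1.nrm_diff_sym[OF w(1) X_H1(1)[OF fn[of n]]] by (simp add: H1_nrm)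
  finally have "H1_norm D (w - v - \<phi>) < e" using n p(2) by linarith
  then show "\<exists>\<phi>. test_function D \<phi> \<and> H1_norm D (w - v - \<phi>) < e" using p(1) by blast
 qed
 then have wv: "(w, v) \<in> X D" using w v by (simp add: X_iff)
 have "(%n. X.nrm (f n - (w, v))) \<longlonglongrightarrow> 0"
 proof (rule Lim_null_comparison)
  have "norm (X.nrm (f n - (w, v))) \<le> H1_norm D (fst (f n) - w) + H1_norm D (snd (f n) - v)" for n
   using X_norm_le[OF X.V_diff[OF fn[of n] wv]] X_norm_nonneg[OF X.V_diff[OF fn[of n] wv]] by (simp add: X_nrm)
  then show "\<forall>\<^sub>F n in sequentially. norm (X.nrm (f n - (w, v))) \<le> H1_norm D (fst (f n) - w) + H1_norm D (snd (f n) - v)" by simp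
  show "(%n. H1_norm D (fst (f n) - w) + H1_norm D (snd (f n) - v)) \<longlonglongrightarrow> 0" using tendsto_add[OF w(2) v(2)] by simp
 qed
 then show "\<exists>l\<in>X D. (%n. X.nrm (f n - l)) \<longlonglongrightarrow> 0" using wv by blast
qed

text \<open>Inverses are defined through almost everywhere equality, Riesz representatives through
  tested identities; this equivalence lets the latter replace the former everywhere. For the forward
  direction, a function vanishing almost everywhere has weak gradient 0.\<close>

lemma X_eq_iff:
 assumes g: "g \<in> X D" "g' \<in> X D"
 shows "X_eq D g g' \<longleftrightarrow> (\<forall>\<phi>\<in>X D. X_inner D g \<phi> = X_inner D g' \<phi>)"
proof
 note d = X.V_diff[OF g]
 assume e: "X_eq D g g'"
 have z: "H1_norm D h = 0" if h: "h \<in> H1 D" "AE x in M. h x = 0" for h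
 proof -
  have l: "l2 M h = 0" using l2_cong_AE[OF h(2) sqi_vec_eqs(2)[OF h(1)]] by simp
  have i: "(\<integral>x. h x * f x \<partial>M) = 0" for f
   by (rule integral_eq_zero_AE) (use h(2) in \<open>auto elim!: eventually_mono\<close>)
  have "is_weak_gradient D h (%x. 0)" using i by (simp add: is_weak_gradient_def L2_iff_sqi)
  from l2_cong_AE[OF H1I(2)[OF H1D(1)[OF h(1)] this] sqi_vec_eqs(1)[OF h(1)]] have "l2 M (wgrad D h) = 0" by simp
  then show ?thesis using H1_norm_le[OF h(1)] H1_norm_nonneg[OF h(1)] l by simp
 qed
 have "H1_norm D (fst (g - g')) = 0" by (rule z[OF X_H1(1)[OF d]]) (use e in \<open>auto simp: X_eq_def elim!: eventually_mono\<close>)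
 moreover have "H1_norm D (snd (g - g')) = 0" by (rule z[OF X_H1(2)[OF d]]) (use e in \<open>auto simp: X_eq_def elim!: eventually_mono\<close>)
 ultimately have n0: "X.nrm (g - g') = 0" using X_norm_le[OF d] X_norm_nonneg[OF d] by (simp add: X_nrm)
 show "\<forall>\<phi>\<in>X D. X_inner D g \<phi> = X_inner D g' \<phi>"
 proof
  fix \<phi> assume p: "\<phi> \<in> X D"
  have "cmod (X_inner D (g - g') \<phi>) \<le> 0" using X.Cauchy_Schwarz[OF d p] n0 by simp
  then show "X_inner D g \<phi> = X_inner D g' \<phi>" using X.ip_diff[OF g p] by simp
 qed
next
 note d = X.V_diff[OF g]
 assume "\<forall>\<phi>\<in>X D. X_inner D g \<phi> = X_inner D g' \<phi>"
 then have "X_inner D (g - g') (g - g') = 0" using X.ip_diff[OF g d] d by simp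
 then have "X_norm D (g - g') = 0" by (simp add: X_norm_def)
 then have "H1_norm D (fst (g - g')) \<le> 0" "H1_norm D (snd (g - g')) \<le> 0" using X_norm_ge[OF d] by auto
 then have "l2 M (fst (g - g')) = 0" "l2 M (snd (g - g')) = 0"
  using H1_norm_ge(1)[OF X_H1(1)[OF d]] H1_norm_ge(1)[OF X_H1(2)[OF d]] l2_nonneg[of M "fst (g - g')"] l2_nonneg[of M "snd (g - g')"] by linarith+
 from l2_zero_AE[OF H1D(1)[OF X_H1(1)[OF d]] this(1)] l2_zero_AE[OF H1D(1)[OF X_H1(2)[OF d]] this(2)]
 show "X_eq D g g'" unfolding X_eq_def by eventually_elim simp
qed

section \<open>The operators on \<open>X D\<close>, described by their forms\<close>

text \<open>Split off from \<open>form_A\<close> because, for elliptic \<open>a\<close> and positive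
  \<open>\<kappa>\<close>, it is an inner product with a norm equivalent to that of
  \<open>H1 D\<close>; \<open>wellposed_below_one\<close> uses it as such.\<close>

definition EA :: "(real^'d => real^'d^'d) => real => (real^'d => complex) => (real^'d => complex) => complex" where
 "EA a \<kappa> w \<phi> = IA a w \<phi> + complex_of_real \<kappa> * IB one_fun w \<phi>"

lemma EA_sesq: "coef a C S ==> sesq (EA a \<kappa>)"
 using IA_sesq[of a C S] IB_sesq[OF bcoef_one] unfolding sesq_def EA_def by (simp add: distrib_left)

lemma form_A_eq:
 assumes a: "coef a C S" and u: "u \<in> X D" "\<phi> \<in> X D"
 shows "form_A D a \<kappa> u \<phi> = EA a \<kappa> (fst u) (fst \<phi>) - H1_inner D (snd u) (snd \<phi>)"
proof -
 note h = X_H1[OF u(1)] X_H1[OF u(2)]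
 have "(\<integral>x. complex_of_real \<kappa> * fst u x * cnj (fst \<phi> x) \<partial>M) = complex_of_real \<kappa> * IB one_fun (fst u) (fst \<phi>)"
  by (simp add: IB_def mult.assoc)
 moreover have "integrable M (%x. complex_of_real \<kappa> * fst u x * cnj (fst \<phi> x))"
  using integrable_mult_right[OF IB_bound(1)[OF bcoef_one h(1) h(3)], of "complex_of_real \<kappa>"] by (simp add: mult.assoc)
 ultimately have "(\<integral>x. hdot (cmat (a x) *v wgrad D (fst u) x) (wgrad D (fst \<phi>) x) + complex_of_real \<kappa> * fst u x * cnj (fst \<phi> x) \<partial>M)
   = EA a \<kappa> (fst u) (fst \<phi>)"
  using IA_bound(1)[OF a h(1) h(3)] by (simp add: EA_def IA_def)
 then show ?thesis by (simp add: form_A_def case_prod_beta H1_inner_def)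
qed

lemma form_B_eq:
 assumes b: "bcoef b C S" and u: "u \<in> X D" "\<phi> \<in> X D"
 shows "form_B D b u \<phi> = IB b (fst u) (fst \<phi>) - IB one_fun (snd u) (snd \<phi>)"
 using IB_bound(1)[OF b X_H1(1)[OF u(1)] X_H1(1)[OF u(2)]] IB_bound(1)[OF bcoef_one X_H1(2)[OF u(1)] X_H1(2)[OF u(2)]]
 by (simp add: form_B_def case_prod_beta IB_def)

lemma form_C_eq_B: "form_C D \<kappa> = form_B D (%x. \<kappa>)"
 by (simp add: form_C_def form_B_def)

lemma bcoef_const: "bcoef (%x. \<kappa>) \<bar>\<kappa>\<bar> UNIV" by (simp add: bcoef_def)

lemma form_A_props:
 assumes a: "coef a C UNIV"
 shows "!!u v w. u \<in> X D ==> v \<in> X D ==> w \<in> X D ==> form_A D a \<kappa> (u + v) w = form_A D a \<kappa> u w + form_A D a \<kappa> v w"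
  "!!u w c. u \<in> X D ==> w \<in> X D ==> form_A D a \<kappa> (X_scale c u) w = c * form_A D a \<kappa> u w"
  "!!u v w. u \<in> X D ==> v \<in> X D ==> w \<in> X D ==> form_A D a \<kappa> w (u + v) = form_A D a \<kappa> w u + form_A D a \<kappa> w v"
  "!!u w c. u \<in> X D ==> w \<in> X D ==> form_A D a \<kappa> w (X_scale c u) = cnj c * form_A D a \<kappa> w u"
  "!!u v. u \<in> X D ==> v \<in> X D ==> cmod (form_A D a \<kappa> u v) \<le> (C + \<bar>\<kappa>\<bar> + 1) * X_norm D u * X_norm D v"
proof -
 note s = EA_sesq[OF a, of \<kappa>, unfolded sesq_def] and f = form_A_eq[OF a]
 show "form_A D a \<kappa> (u + v) w = form_A D a \<kappa> u w + form_A D a \<kappa> v w" if "u \<in> X D" "v \<in> X D" "w \<in> X D" for u v w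
  using s X_H1 that X.V_add[of u v] by (simp add: f H1.ip_add)
 show "form_A D a \<kappa> w (u + v) = form_A D a \<kappa> w u + form_A D a \<kappa> w v" if "u \<in> X D" "v \<in> X D" "w \<in> X D" for u v w
  using s X_H1 that X.V_add[of u v] by (simp add: f H1.ip_add_right)
 show "form_A D a \<kappa> (X_scale c u) w = c * form_A D a \<kappa> u w" if "u \<in> X D" "w \<in> X D" for u w c
  using s X_H1 that X.V_scl[of u c] H1.ip_scl[of "snd u" "snd w" c] by (simp add: f X_scale_eq right_diff_distrib)
 show "form_A D a \<kappa> w (X_scale c u) = cnj c * form_A D a \<kappa> w u" if "u \<in> X D" "w \<in> X D" for u w c
  using s X_H1 that X.V_scl[of u c] H1.ip_scl_right[of "snd u" "snd w" c] by (simp add: f X_scale_eq right_diff_distrib)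
 show "cmod (form_A D a \<kappa> u v) \<le> (C + \<bar>\<kappa>\<bar> + 1) * X_norm D u * X_norm D v" if u: "u \<in> X D" and v: "v \<in> X D" for u v
 proof -
  note h = X_H1[OF u] X_H1[OF v]
  let ?P = "X_norm D u * X_norm D v"
  have C: "C \<ge> 0" using a by (simp add: coef_def)
  have nn: "X_norm D u \<ge> 0" using X_norm_nonneg[OF u] .
  have 1: "cmod (IA a (fst u) (fst v)) \<le> C * ?P"
  proof (rule order_trans[OF IA_bound(2)[OF a h(1) h(3)]], rule mult_left_mono[OF _ C])
   show "l2 M (restr UNIV (wgrad D (fst u))) * l2 M (wgrad D (fst v)) \<le> ?P"
    using H1_norm_ge(2)[OF h(1)] H1_norm_ge(2)[OF h(3)] X_norm_ge(1)[OF u] X_norm_ge(1)[OF v] nn by (intro mult_mono) auto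
  qed
  have 2: "cmod (IB one_fun (fst u) (fst v)) \<le> 1 * ?P"
  proof (rule order_trans[OF IB_bound(2)[OF bcoef_one h(1) h(3)]], rule mult_left_mono)
   show "l2 M (restr UNIV (fst u)) * l2 M (fst v) \<le> ?P"
    using H1_norm_ge(1)[OF h(1)] H1_norm_ge(1)[OF h(3)] X_norm_ge(1)[OF u] X_norm_ge(1)[OF v] nn by (intro mult_mono) auto
  qed simp
  have 3: "cmod (H1_inner D (snd u) (snd v)) \<le> ?P"
   by (rule order_trans[OF H1.Cauchy_Schwarz[OF h(2) h(4)]], unfold H1_nrm)
    (intro mult_mono X_norm_ge u v nn H1_norm_nonneg h)
  have "cmod (form_A D a \<kappa> u v) \<le> cmod (IA a (fst u) (fst v)) + \<bar>\<kappa>\<bar> * cmod (IB one_fun (fst u) (fst v)) + cmod (H1_inner D (snd u) (snd v))"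
   unfolding f[OF u v] EA_def
   by (rule order_trans[OF norm_triangle_ineq4], rule add_right_mono, rule order_trans[OF norm_triangle_ineq]) (simp add: norm_mult)
  also have "\<dots> \<le> C * ?P + \<bar>\<kappa>\<bar> * ?P + ?P" using 1 2 3 by (intro add_mono mult_left_mono) auto
  finally show ?thesis by (simp add: algebra_simps)
 qed
qed

lemma form_B_bound:
 assumes b: "bcoef b C UNIV" and u: "u \<in> X D" and v: "v \<in> X D"
 shows "cmod (form_B D b u v) \<le> (C + 1) * X_norm D u * X_norm D v"
proof -
 note h = X_H1[OF u] X_H1[OF v]
 let ?P = "X_norm D u * X_norm D v"
 have C: "C \<ge> 0" using b by (simp add: bcoef_def)
 have nn: "X_norm D u \<ge> 0" using X_norm_nonneg[OF u] .
 have 1: "cmod (IB b (fst u) (fst v)) \<le> C * ?P"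
 proof (rule order_trans[OF IB_bound(2)[OF b h(1) h(3)]], rule mult_left_mono[OF _ C])
  show "l2 M (restr UNIV (fst u)) * l2 M (fst v) \<le> ?P"
   using H1_norm_ge(1)[OF h(1)] H1_norm_ge(1)[OF h(3)] X_norm_ge(1)[OF u] X_norm_ge(1)[OF v] nn by (intro mult_mono) auto
 qed
 have 2: "cmod (IB one_fun (snd u) (snd v)) \<le> 1 * ?P"
 proof (rule order_trans[OF IB_bound(2)[OF bcoef_one h(2) h(4)]], rule mult_left_mono)
  show "l2 M (restr UNIV (snd u)) * l2 M (snd v) \<le> ?P"
   using H1_norm_ge(1)[OF h(2)] H1_norm_ge(1)[OF h(4)] X_norm_ge(2)[OF u] X_norm_ge(2)[OF v] nn by (intro mult_mono) auto
 qed simp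
 have "cmod (form_B D b u v) \<le> C * ?P + 1 * ?P"
  unfolding form_B_eq[OF b u v] by (rule order_trans[OF norm_triangle_ineq4 add_mono[OF 1 2]])
 then show ?thesis by (simp add: algebra_simps)
qed

lemma form_B_antilinear:
 assumes b: "bcoef b C UNIV" and u: "u \<in> X D"
 shows "X.bounded_antilinear (form_B D b u)"
 unfolding X.bounded_antilinear_def X_nrm
proof (intro conjI ballI allI exI[of _ "(C + 1) * X_norm D u"])
 note f = form_B_eq[OF b u]
 note s = IB_sesq[OF b, unfolded sesq_def] IB_sesq[OF bcoef_one, unfolded sesq_def]
 show "form_B D b u (v + w) = form_B D b u v + form_B D b u w" if "v \<in> X D" "w \<in> X D" for v w
  using s X_H1 that u X.V_add[of v w] by (simp add: f)
 show "form_B D b u (X_scale c v) = cnj c * form_B D b u v" if "v \<in> X D" for c v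
  using s X_H1 that u X.V_scl[of v c] by (simp add: f X_scale_eq right_diff_distrib)
 show "cmod (form_B D b u v) \<le> (C + 1) * X_norm D u * X_norm D v" if "v \<in> X D" for v by (rule form_B_bound[OF b u that])
qed

lemma riesz_op_spec:
 assumes "X.bounded_antilinear (F u)"
 shows "riesz_op D F u \<in> X D" "!!\<phi>. \<phi> \<in> X D ==> X_inner D (riesz_op D F u) \<phi> = F u \<phi>"
proof -
 have "\<exists>g. g \<in> X D \<and> (\<forall>\<phi>\<in>X D. X_inner D g \<phi> = F u \<phi>)" using X.riesz[OF X_complete assms] by blast
 from someI_ex[OF this] show "riesz_op D F u \<in> X D" "!!\<phi>. \<phi> \<in> X D ==> X_inner D (riesz_op D F u) \<phi> = F u \<phi>"
  unfolding riesz_op_def by auto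
qed

text \<open>Well-posedness of the problem with coefficient \<open>a\<close>, with stability constant \<open>c\<close>.\<close>

definition wellposed :: "(real^'d => real^'d^'d) => real => real => bool" where
 "wellposed a \<kappa> c \<longleftrightarrow> c > 0 \<and> (\<exists>C. coef a C UNIV) \<and> (\<forall>x\<in>D. transpose (a x) = a x) \<and>
  (\<exists>T. \<forall>u\<in>X D. T u \<in> X D \<and> X_norm D (T u) \<le> 3 * X_norm D u \<and> c * (X_norm D u)\<^sup>2 \<le> cmod (form_A D a \<kappa> u (T u)))"

text \<open>Existence comes from \<open>symmetric_form_solvable\<close>, with the flip in the role
  of the bounded substitution; it legitimises the choice inside \<open>X_inv\<close>, whose result
  is then known by its tested identity.\<close>

lemma A_inv_spec:
 assumes wp: "wellposed a \<kappa> c" and g: "g \<in> X D"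
 shows "A_inv_op D a \<kappa> g \<in> X D" "!!\<phi>. \<phi> \<in> X D ==> form_A D a \<kappa> (A_inv_op D a \<kappa> g) \<phi> = X_inner D g \<phi>"
proof -
 obtain C T where a: "coef a C UNIV" and sym: "!!x. x \<in> D ==> transpose (a x) = a x" and c: "c > 0"
  and T: "!!u. u \<in> X D ==> T u \<in> X D" "!!u. u \<in> X D ==> X_norm D (T u) \<le> 3 * X_norm D u"
   "!!u. u \<in> X D ==> c * (X_norm D u)\<^sup>2 \<le> cmod (form_A D a \<kappa> u (T u))"
  using wp unfolding wellposed_def by blast
 note p = form_A_props[OF a, where \<kappa>=\<kappa>]
 have C: "C \<ge> 0" using a by (simp add: coef_def)
 have herm: "form_A D a \<kappa> v u = cnj (form_A D a \<kappa> u v)" if "u \<in> X D" "v \<in> X D" for u v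
  using IA_herm[OF a sym X_H1(1)[OF that(1)] X_H1(1)[OF that(2)]] IB_herm[OF bcoef_one X_H1(1)[OF that(1)] X_H1(1)[OF that(2)]]
   H1.ip_herm[OF X_H1(2)[OF that(1)] X_H1(2)[OF that(2)]] that by (simp add: form_A_eq[OF a] EA_def)
 have ba: "X.bounded_antilinear (form_A D a \<kappa> u)" if u: "u \<in> X D" for u
  unfolding X.bounded_antilinear_def X_nrm using p(3-5) u by blast
 have bg: "X.bounded_antilinear (X_inner D g)"
  unfolding X.bounded_antilinear_def using X.ip_add_right X.ip_scl_right X.Cauchy_Schwarz g by blast
 have "\<exists>y\<in>X D. \<forall>\<phi>\<in>X D. form_A D a \<kappa> y \<phi> = X_inner D g \<phi>"
  by (rule X.symmetric_form_solvable[OF X_complete p(1) p(2) herm _ T(1) _ _ c _ _ bg, where C="C + \<bar>\<kappa>\<bar> + 1" and K=3])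
   (use p(5) T C in \<open>auto simp: X_nrm\<close>)
 then obtain y where y: "y \<in> X D" "!!\<phi>. \<phi> \<in> X D ==> form_A D a \<kappa> y \<phi> = X_inner D g \<phi>" by blast
 note r = riesz_op_spec[where F="form_A D a \<kappa>", OF ba]
 have "X_eq D (riesz_op D (form_A D a \<kappa>) y) g" using X_eq_iff[OF r(1)[OF y(1)] g] r(2)[OF y(1)] y(2) by simp
 then have "\<exists>u. u \<in> X D \<and> X_eq D (riesz_op D (form_A D a \<kappa>) u) g" using y(1) by blast
 from someI_ex[OF this] have s: "A_inv_op D a \<kappa> g \<in> X D" "X_eq D (riesz_op D (form_A D a \<kappa>) (A_inv_op D a \<kappa> g)) g"
  unfolding A_inv_op_def X_inv_def by auto
 show "A_inv_op D a \<kappa> g \<in> X D" by (rule s(1))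
 show "form_A D a \<kappa> (A_inv_op D a \<kappa> g) \<phi> = X_inner D g \<phi>" if "\<phi> \<in> X D" for \<phi>
  using X_eq_iff[OF r(1)[OF s(1)] g] s(2) r(2)[OF s(1) that] that by simp
qed

text \<open>Removes inverses and Riesz operators: from here on a value of \<open>T_op\<close> is
  handled only through this variational identity.\<close>

lemma T_op_spec:
 assumes wp: "wellposed a \<kappa> c" and b: "bcoef b C' UNIV" and u: "u \<in> X D"
 shows "T_op D a b \<kappa> \<tau> u \<in> X D"
  "!!\<phi>. \<phi> \<in> X D ==> form_A D a \<kappa> (T_op D a b \<kappa> \<tau> u) \<phi> = form_B D b u \<phi> + (1/\<tau>) * form_C D \<kappa> u \<phi>"
proof -
 obtain C where a: "coef a C UNIV" using wp unfolding wellposed_def by blast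
 note B = riesz_op_spec[where F="form_B D b" and u=u, OF form_B_antilinear[OF b u]]
 note C = riesz_op_spec[where F="form_B D (%x. \<kappa>)" and u=u, OF form_B_antilinear[OF bcoef_const u]]
 note yB = A_inv_spec[OF wp B(1)] and yC = A_inv_spec[OF wp C(1)]
 have e: "T_op D a b \<kappa> \<tau> u = A_inv_op D a \<kappa> (riesz_op D (form_B D b) u) + X_scale (1/\<tau>) (A_inv_op D a \<kappa> (riesz_op D (form_B D (%x. \<kappa>)) u))"
  by (simp add: T_op_def form_C_eq_B)
 note s = X.V_scl[OF yC(1), of "1/\<tau>"]
 show "T_op D a b \<kappa> \<tau> u \<in> X D" unfolding e by (rule X.V_add[OF yB(1) s])
 show "form_A D a \<kappa> (T_op D a b \<kappa> \<tau> u) \<phi> = form_B D b u \<phi> + (1/\<tau>) * form_C D \<kappa> u \<phi>" if p: "\<phi> \<in> X D" for \<phi>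
  unfolding e form_A_props(1)[OF a yB(1) s p] form_A_props(2)[OF a yC(1) p] yB(2)[OF p] yC(2)[OF p] B(2)[OF p] C(2)[OF p] form_C_eq_B ..
qed

text \<open>Testing with the flip of \<open>u\<close> itself and cancelling one power of the norm;
  the 3 is the norm bound of the flip.\<close>

lemma wellposed_bound:
 assumes wp: "wellposed a \<kappa> c" and u: "u \<in> X D" and B: "!!\<phi>. \<phi> \<in> X D ==> cmod (form_A D a \<kappa> u \<phi>) \<le> B * X_norm D \<phi>" and B0: "B \<ge> 0"
 shows "X_norm D u \<le> 3 * B / c"
proof (cases "X_norm D u = 0")
 case False
 obtain T where T: "T u \<in> X D" "X_norm D (T u) \<le> 3 * X_norm D u" "c * (X_norm D u)\<^sup>2 \<le> cmod (form_A D a \<kappa> u (T u))" and c: "c > 0"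
  using wp u unfolding wellposed_def by blast
 have "c * (X_norm D u)\<^sup>2 \<le> B * X_norm D (T u)" using T(3) B[OF T(1)] by linarith
 also have "\<dots> \<le> B * (3 * X_norm D u)" by (rule mult_left_mono[OF T(2) B0])
 finally have "(c * X_norm D u) * X_norm D u \<le> (3 * B) * X_norm D u" by (simp add: power2_eq_square mult_ac)
 then have "c * X_norm D u \<le> 3 * B" using False X_norm_nonneg[OF u] by (simp add: mult_le_cancel_right)
 then show ?thesis using c by (simp add: field_simps)
qed (use wp B0 in \<open>simp add: wellposed_def\<close>)

end

section \<open>Ellipticity and well-posedness on either side of 1\<close>

text \<open>The nonnegative matrix generates a semi-inner product on complex vectors; its own
  Cauchy-Schwarz inequality extends the bound from the diagonal to all pairs without loss.\<close>

lemma hermitian_form_bound: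
 fixes A :: "real^'n^'n"
 assumes sym: "transpose A = A"
  and lo: "!!\<xi>. 0 \<le> Re (hdot (cmat A *v \<xi>) \<xi>)" and up: "!!\<xi>. Re (hdot (cmat A *v \<xi>) \<xi>) \<le> \<beta> * (norm \<xi>)\<^sup>2" and b: "\<beta> \<ge> 0"
 shows "cmod (hdot (cmat A *v \<xi>) \<eta>) \<le> \<beta> * (norm \<xi> * norm \<eta>)"
proof -
 interpret S: semi_inner "UNIV :: (complex^'n) set" "%c v. c *s v" "%\<xi> \<eta>. hdot (cmat A *v \<xi>) \<eta>"
 proof
  show "u - v = u + - 1 *s v" for u v :: "complex^'n" by (simp add: vec_eq_iff)
  show "hdot (cmat A *v v) u = cnj (hdot (cmat A *v u) v)" for u v by (rule hdot_cmat_herm[OF sym])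
 qed (use lo in \<open>simp_all add: matrix_vector_right_distrib hdot_add vector_scalar_commute hdot_scl\<close>)
 have n: "S.nrm v \<le> sqrt \<beta> * norm v" for v
  unfolding S.nrm_def using real_sqrt_le_mono[OF up[of v]] by (simp add: real_sqrt_mult)
 have "cmod (hdot (cmat A *v \<xi>) \<eta>) \<le> S.nrm \<xi> * S.nrm \<eta>" by (rule S.Cauchy_Schwarz) auto
 also have "\<dots> \<le> (sqrt \<beta> * norm \<xi>) * (sqrt \<beta> * norm \<eta>)" using n S.nrm_nonneg b by (intro mult_mono) auto
 also have "\<dots> = \<beta> * (norm \<xi> * norm \<eta>)" using b by (simp add: mult_ac)
 finally show ?thesis .
qed

lemma cmat_diff: "cmat (A - B) *v \<xi> = cmat A *v \<xi> - cmat B *v \<xi>"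
 by (simp add: cmat_def matrix_vector_mult_def vec_eq_iff sum_subtractf left_diff_distrib)

lemma hdot_diff: "hdot (a - b) c = hdot a c - hdot b c"
 by (simp add: hdot_def left_diff_distrib sum_subtractf)

context bdd_domain
begin

definition elliptic :: "(real^'d => real^'d^'d) => real => real => bool" where
 "elliptic a \<alpha> \<beta> \<longleftrightarrow> a \<in> borel_measurable M \<and> 0 < \<alpha> \<and> 0 \<le> \<beta> \<and>
   (\<forall>x\<in>D. transpose (a x) = a x \<and>
    (\<forall>\<xi>. \<alpha> * (norm \<xi>)\<^sup>2 \<le> Re (hdot (cmat (a x) *v \<xi>) \<xi>) \<and> Re (hdot (cmat (a x) *v \<xi>) \<xi>) \<le> \<beta> * (norm \<xi>)\<^sup>2))"

lemma elliptic_bound: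
 assumes "elliptic a \<alpha> \<beta>" "x \<in> D"
 shows "cmod (hdot (cmat (a x) *v \<xi>) \<eta>) \<le> \<beta> * (norm \<xi> * norm \<eta>)"
proof (rule hermitian_form_bound)
 fix \<xi> :: "complex^'d"
 have "0 \<le> \<alpha> * (norm \<xi>)\<^sup>2" using assms by (simp add: elliptic_def)
 then show "0 \<le> Re (hdot (cmat (a x) *v \<xi>) \<xi>)" using assms unfolding elliptic_def by (meson order_trans)
qed (use assms in \<open>auto simp: elliptic_def\<close>)

lemma elliptic_coef: "elliptic a \<alpha> \<beta> ==> coef a \<beta> UNIV"
 using elliptic_bound[of a \<alpha> \<beta>] by (auto simp: coef_def elliptic_def)

lemma coef_diff:
 assumes "elliptic a \<alpha> \<beta>" "elliptic a' \<alpha>' \<beta>'" "S \<in> sets borel" and eq: "!!x. x \<in> D ==> x \<notin> S ==> a x = a' x"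
 shows "coef (%x. a x - a' x) (\<beta> + \<beta>') S"
 unfolding coef_def
proof (intro conjI ballI allI)
 show "(%x. a x - a' x) \<in> borel_measurable M" using assms(1,2) by (intro borel_measurable_diff) (auto simp: elliptic_def)
 show "0 \<le> \<beta> + \<beta>'" using assms(1,2) by (auto simp: elliptic_def)
 fix x \<xi> \<eta> assume x: "x \<in> D"
 show "cmod (hdot (cmat (a x - a' x) *v \<xi>) \<eta>) \<le> (\<beta> + \<beta>') * (indicat_real S x * norm \<xi> * norm \<eta>)"
 proof (cases "x \<in> S")
  case True
  have "cmod (hdot (cmat (a x - a' x) *v \<xi>) \<eta>) \<le> cmod (hdot (cmat (a x) *v \<xi>) \<eta>) + cmod (hdot (cmat (a' x) *v \<xi>) \<eta>)"
   unfolding cmat_diff hdot_diff by (rule norm_triangle_ineq4)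
  also have "\<dots> \<le> \<beta> * (norm \<xi> * norm \<eta>) + \<beta>' * (norm \<xi> * norm \<eta>)"
   by (rule add_mono[OF elliptic_bound[OF assms(1) x] elliptic_bound[OF assms(2) x]])
  finally show ?thesis using True by (simp add: distrib_right)
 next
  case False
  have "cmat (0 :: real^'d^'d) *v \<xi> = 0" by (simp add: cmat_def matrix_vector_mult_def vec_eq_iff)
  then show ?thesis using eq[OF x False] False by (simp add: hdot_def)
 qed
qed (use assms in auto)

lemma IA_elliptic:
 assumes a: "elliptic a \<alpha> \<beta>" and w: "w \<in> H1 D"
 shows "\<alpha> * (l2 M (wgrad D w))\<^sup>2 \<le> Re (IA a w w)" "Re (IA a w w) \<le> \<beta> * (l2 M (wgrad D w))\<^sup>2"
proof -
 let ?h = "%x. hdot (cmat (a x) *v wgrad D w x) (wgrad D w x)"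
 note i = IA_bound(1)[OF elliptic_coef[OF a] w w]
 have e: "Re (IA a w w) = (\<integral>x. Re (?h x) \<partial>M)" unfolding IA_def by (rule integral_bounded_linear[OF bounded_linear_Re i, symmetric])
 have ir: "integrable M (%x. Re (?h x))" by (rule integrable_bounded_linear[OF bounded_linear_Re i])
 have ig: "integrable M (%x. (norm (wgrad D w x))\<^sup>2)" using H1D(3)[OF w] by (simp add: sqi_def)
 have "\<alpha> * (l2 M (wgrad D w))\<^sup>2 = (\<integral>x. \<alpha> * (norm (wgrad D w x))\<^sup>2 \<partial>M)" by (simp add: l2_sq)
 also have "\<dots> \<le> Re (IA a w w)" unfolding e by (rule integral_mono) (use ir ig a in \<open>auto simp: elliptic_def\<close>)
 finally show "\<alpha> * (l2 M (wgrad D w))\<^sup>2 \<le> Re (IA a w w)" .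
 have "Re (IA a w w) \<le> (\<integral>x. \<beta> * (norm (wgrad D w x))\<^sup>2 \<partial>M)" unfolding e by (rule integral_mono) (use ir ig a in \<open>auto simp: elliptic_def\<close>)
 then show "Re (IA a w w) \<le> \<beta> * (l2 M (wgrad D w))\<^sup>2" by (simp add: l2_sq)
qed

lemma EA_bounds:
 assumes a: "elliptic a \<alpha> \<beta>" and w: "w \<in> H1 D"
 shows "m \<le> \<alpha> ==> m \<le> \<kappa> ==> m * (H1_norm D w)\<^sup>2 \<le> Re (EA a \<kappa> w w)"
  "\<beta> \<le> b ==> \<kappa> \<le> b ==> Re (EA a \<kappa> w w) \<le> b * (H1_norm D w)\<^sup>2"
proof -
 have e: "Re (EA a \<kappa> w w) = Re (IA a w w) + \<kappa> * (l2 M w)\<^sup>2"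
  by (simp add: EA_def IB_self del: of_real_power)
 note i = IA_elliptic[OF a w]
 show "m * (H1_norm D w)\<^sup>2 \<le> Re (EA a \<kappa> w w)" if "m \<le> \<alpha>" "m \<le> \<kappa>"
  using i(1) mult_right_mono[OF that(1), of "(l2 M (wgrad D w))\<^sup>2"] mult_right_mono[OF that(2), of "(l2 M w)\<^sup>2"]
  unfolding e H1_norm_sq[OF w] distrib_left by simp
 show "Re (EA a \<kappa> w w) \<le> b * (H1_norm D w)\<^sup>2" if "\<beta> \<le> b" "\<kappa> \<le> b"
  using i(2) mult_right_mono[OF that(1), of "(l2 M (wgrad D w))\<^sup>2"] mult_right_mono[OF that(2), of "(l2 M w)\<^sup>2"]
  unfolding e H1_norm_sq[OF w] distrib_left by simp
qed

lemma H1_norm_reflect: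
 assumes "w \<in> H1 D" "v \<in> H1 D"
 shows "H1_norm D ((w + w) - v) \<le> 2 * H1_norm D w + H1_norm D v"
proof -
 have e: "(w + w) - v = w + (w - v)" by simp
 have "H1_norm D (w - v) \<le> H1_norm D w + H1_norm D v"
  using H1.nrm_triangle[OF assms(1) H1.V_scl[OF assms(2), of "-1"]] H1.nrm_scl[OF assms(2), of "-1"]
  unfolding H1.diff_scl[of w v] by (simp add: H1_nrm)
 then show ?thesis unfolding e using H1.nrm_triangle[OF assms(1) H1_diff(1)[OF assms]] unfolding H1_nrm by linarith
qed

text \<open>The source of the constant 3 in \<open>wellposed\<close>: from a nonnegative square,
  \<open>Z\<^sup>2\<close> is at most 6 and 3 times the two squares, so the total is at most 7 and 3
  times them, below 9 times their sum.\<close>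

lemma pair_norm_bound:
 fixes P Q Y Z :: real
 assumes "0 \<le> P" "0 \<le> Q" "0 \<le> Z" "0 \<le> Y" "Y \<le> P" "Z \<le> 2 * P + Q"
 shows "Y\<^sup>2 + Z\<^sup>2 \<le> (3 * sqrt (P\<^sup>2 + Q\<^sup>2))\<^sup>2"
proof -
 have "Z\<^sup>2 \<le> (2 * P + Q)\<^sup>2" "Y\<^sup>2 \<le> P\<^sup>2" using assms by (intro power_mono; simp)+
 moreover have "(2 * P + Q)\<^sup>2 \<le> 6 * P\<^sup>2 + 3 * Q\<^sup>2" using zero_le_power2[of "P - Q"] by (simp add: power2_eq_square algebra_simps)
 ultimately have "Z\<^sup>2 \<le> 6 * P\<^sup>2 + 3 * Q\<^sup>2" "Y\<^sup>2 \<le> P\<^sup>2" by (blast intro: order_trans)+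
 moreover have "d + a \<le> 9 * (b + c)" if "a \<le> 6 * b + 3 * c" "d \<le> b" "0 \<le> b" "0 \<le> c" for a b c d :: real
  unfolding distrib_left using that by linarith
 ultimately have "Y\<^sup>2 + Z\<^sup>2 \<le> 9 * (P\<^sup>2 + Q\<^sup>2)" by (metis zero_le_power2)
 then show ?thesis by (simp add: power_mult_distrib)
qed

lemma X_norm_eq_sqrt: "u \<in> X D ==> X_norm D u = sqrt ((H1_norm D (fst u))\<^sup>2 + (H1_norm D (snd u))\<^sup>2)"
 using X_norm_sq[of u] X_norm_nonneg[of u] by (metis real_sqrt_unique)

text \<open>With the flip \<open>(w, 2 w - v)\<close> the indefinite part turns into a square plus a
  cross term, and a lower bound \<open>m\<close> above 1 for the first form beats the cross term.
  The flip stays in \<open>X D\<close> because it only negates the difference of the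
  components.\<close>

theorem wellposed_above_one:
 assumes a: "elliptic a \<alpha> \<beta>" and m: "1 < m" "m \<le> \<alpha>" "m \<le> \<kappa>"
 shows "wellposed a \<kappa> ((m - 1) / (m + 1))"
 unfolding wellposed_def
proof (intro conjI exI[of _ \<beta>] exI[of _ "%(w, v). (w, (w + w) - v)"] ballI)
 show "0 < (m - 1) / (m + 1)" using m by simp
 show "coef a \<beta> UNIV" by (rule elliptic_coef[OF a])
 show "transpose (a x) = a x" if "x \<in> D" for x using a that by (simp add: elliptic_def)
 fix u assume u: "u \<in> X D"
 obtain w v where uv: "u = (w, v)" by (cases u)
 have XU: "X_norm D u = sqrt ((H1_norm D w)\<^sup>2 + (H1_norm D v)\<^sup>2)" using X_norm_eq_sqrt[OF u] by (simp add: uv)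
 have h: "w \<in> H1 D" "v \<in> H1 D" "w - v \<in> H10 D" using u unfolding uv X_iff by blast+
 have r: "(w + w) - v \<in> H1 D" by (rule H1_diff(1)[OF H1.V_add[OF h(1) h(1)] h(2)])
 have e: "w - ((w + w) - v) = (%x. (-1) * (w - v) x)" by (simp add: fun_eq_iff)
 have T: "(w, (w + w) - v) \<in> X D" unfolding X_iff e using h r H10_scl by blast
 then show "(case u of (w, v) => (w, (w + w) - v)) \<in> X D" by (simp add: uv)
 have "(X_norm D (w, (w + w) - v))\<^sup>2 \<le> (3 * X_norm D u)\<^sup>2"
  unfolding X_norm_sq[OF T] XU fst_conv snd_conv
  by (rule pair_norm_bound) (use H1_norm_nonneg h r H1_norm_reflect in auto)
 then have "X_norm D (w, (w + w) - v) \<le> 3 * X_norm D u" by (rule power2_le_imp_le) (use X_norm_nonneg[OF u] in simp)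
 then show "X_norm D (case u of (w, v) => (w, (w + w) - v)) \<le> 3 * X_norm D u" by (simp add: uv)
 let ?W = "H1_norm D w" and ?V = "H1_norm D v"
 have f: "form_A D a \<kappa> u (w, (w + w) - v) = EA a \<kappa> w w - (H1_inner D v w + H1_inner D v w - H1_inner D v v)"
  unfolding form_A_eq[OF elliptic_coef[OF a] u T]
  unfolding uv fst_conv snd_conv
   H1.ip_diff_right[OF H1.V_add[OF h(1) h(1)] h(2) h(2)] H1.ip_add_right[OF h(1) h(1) h(2)] ..
 have vv: "Re (H1_inner D v v) = ?V\<^sup>2" using H1.nrm_sq[OF h(2)] by (simp add: H1_nrm)
 have vw: "Re (H1_inner D v w) \<le> ?V * ?W" using H1.Cauchy_Schwarz_Re[OF h(2) h(1)] by (simp add: H1_nrm)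
 let ?E = "Re (form_A D a \<kappa> u (w, (w + w) - v))"
 have E: "?E \<ge> m * ?W\<^sup>2 - 2 * (?V * ?W) + ?V\<^sup>2" unfolding f using EA_bounds(1)[OF a h(1) m(2,3)] vw vv by simp
 \<comment> \<open>The reciprocal of the midpoint between 1 and \<open>m\<close>: the coefficient
   \<open>1 - s\<close> of the square of \<open>?V\<close> and the coefficient
   \<open>m - 1/s\<close> of the square of \<open>?W\<close> are then both positive.\<close>
 let ?s = "2 / (m + 1)"
 have "?V\<^sup>2 - 2 * (?V * ?W) + (sqrt m * ?W)\<^sup>2 \<le> ?E" using E m by (simp add: power_mult_distrib)
 then have q: "(1 - ?s) * ?V\<^sup>2 + (sqrt m * ?W)\<^sup>2 - ?W\<^sup>2 / ?s \<le> ?E" by (intro quadratic_form_bound) (use m in auto)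
 have e1: "1 - ?s = (m - 1) / (m + 1)" using m by (simp add: field_simps)
 have e2: "(sqrt m * ?W)\<^sup>2 - ?W\<^sup>2 / ?s = (m - 1) / 2 * ?W\<^sup>2" using m by (simp add: power_mult_distrib field_simps)
 have "(m - 1) / (m + 1) * ?W\<^sup>2 \<le> (m - 1) / 2 * ?W\<^sup>2" using m by (intro mult_right_mono divide_left_mono) auto
 from order_trans[OF add_left_mono[OF this] q[unfolded e1 add_diff_eq[symmetric] e2]]
 have "(m - 1) / (m + 1) * ?V\<^sup>2 + (m - 1) / (m + 1) * ?W\<^sup>2 \<le> ?E" by (simp only: add_diff_eq)
 moreover have "(m - 1) / (m + 1) * (X_norm D u)\<^sup>2 = (m - 1) / (m + 1) * ?V\<^sup>2 + (m - 1) / (m + 1) * ?W\<^sup>2"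
  unfolding X_norm_sq[OF u] unfolding uv fst_conv snd_conv by (simp only: distrib_left add.commute)
 ultimately have "(m - 1) / (m + 1) * (X_norm D u)\<^sup>2 \<le> ?E" by (simp only:)
 also have "\<dots> \<le> cmod (form_A D a \<kappa> u (w, (w + w) - v))" by (rule complex_Re_le_cmod)
 finally show "(m - 1) / (m + 1) * (X_norm D u)\<^sup>2 \<le> cmod (form_A D a \<kappa> u (case u of (w, v) => (w, (w + w) - v)))"
  by (simp add: uv)
qed

text \<open>The flip \<open>(w - 2 v, - v)\<close> shifts the cross term into the first form, where
  Cauchy-Schwarz holds for \<open>EA\<close> itself; its upper bound \<open>b\<close> below 1 is
  what absorbs the term.\<close>

theorem wellposed_below_one:
 assumes a: "elliptic a \<alpha> \<beta>" and m: "0 < m" "m \<le> \<alpha>" "m \<le> \<kappa>" and b: "\<beta> \<le> b" "\<kappa> \<le> b" "b < 1"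
 shows "wellposed a \<kappa> ((1 - b) / 2 * m)"
 unfolding wellposed_def
proof (intro conjI exI[of _ \<beta>] exI[of _ "%(w, v). (w - (v + v), - v)"] ballI)
 have mb: "m \<le> b" "m \<le> 1" using m b by linarith+
 show "0 < (1 - b) / 2 * m" using m b by simp
 show "coef a \<beta> UNIV" by (rule elliptic_coef[OF a])
 show "transpose (a x) = a x" if "x \<in> D" for x using a that by (simp add: elliptic_def)
 fix u assume u: "u \<in> X D"
 obtain w v where uv: "u = (w, v)" by (cases u)
 have XU: "X_norm D u = sqrt ((H1_norm D w)\<^sup>2 + (H1_norm D v)\<^sup>2)" using X_norm_eq_sqrt[OF u] by (simp add: uv)
 have h: "w \<in> H1 D" "v \<in> H1 D" "w - v \<in> H10 D" using u unfolding uv X_iff by blast+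
 have nv: "- v = (%x. (-1) * v x)" by (simp add: fun_eq_iff)
 have hn: "- v \<in> H1 D" unfolding nv by (rule H1_scl(1)[OF h(2)])
 have r: "w - (v + v) \<in> H1 D" by (rule H1_diff(1)[OF h(1) H1.V_add[OF h(2) h(2)]])
 have e: "w - (v + v) - (- v) = w - v" by simp
 have T: "(w - (v + v), - v) \<in> X D" unfolding X_iff e using h r hn by blast
 then show "(case u of (w, v) => (w - (v + v), - v)) \<in> X D" by (simp add: uv)
 have n1: "H1_norm D (- v) = H1_norm D v" unfolding nv using H1.nrm_scl[OF h(2), of "-1"] by (simp only: H1_nrm) simp
 have n2: "H1_norm D (w - (v + v)) \<le> 2 * H1_norm D v + H1_norm D w"
  using H1_norm_reflect[OF h(2) h(1)] H1.nrm_diff_sym[OF h(1) H1.V_add[OF h(2) h(2)]] by (simp only: H1_nrm)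
 have "(X_norm D (w - (v + v), - v))\<^sup>2 \<le> (3 * X_norm D u)\<^sup>2"
  unfolding X_norm_sq[OF T] XU fst_conv snd_conv n1
  unfolding add.commute[of "(H1_norm D (w - (v + v)))\<^sup>2"] add.commute[of "(H1_norm D w)\<^sup>2"]
  by (rule pair_norm_bound) (use H1_norm_nonneg h r n2 in auto)
 then have "X_norm D (w - (v + v), - v) \<le> 3 * X_norm D u" by (rule power2_le_imp_le) (use X_norm_nonneg[OF u] in simp)
 then show "X_norm D (case u of (w, v) => (w - (v + v), - v)) \<le> 3 * X_norm D u" by (simp add: uv)
 note cf = elliptic_coef[OF a]
 interpret E: semi_inner "H1 D" "%c w x. c * w x" "EA a \<kappa>"
 proof
  note s = EA_sesq[OF cf, of \<kappa>, unfolded sesq_def]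
  show "0 \<in> H1 D" by (rule H1_zero)
  show "u + v \<in> H1 D" if "u \<in> H1 D" "v \<in> H1 D" for u v using H1_add that by blast
  show "(%x. c * u x) \<in> H1 D" if "u \<in> H1 D" for u c using H1_scl that by blast
  show "u - v = u + (%x. - 1 * v x)" for u v :: "real^'d => complex" by (simp add: fun_eq_iff)
  show "EA a \<kappa> (u + v) w = EA a \<kappa> u w + EA a \<kappa> v w" if "u \<in> H1 D" "v \<in> H1 D" "w \<in> H1 D" for u v w
   using that s by blast
  show "EA a \<kappa> (%x. c * u x) w = c * EA a \<kappa> u w" if "u \<in> H1 D" "w \<in> H1 D" for u w c
   using that s by blast
  show "EA a \<kappa> v u = cnj (EA a \<kappa> u v)" if "u \<in> H1 D" "v \<in> H1 D" for u v
   using IA_herm[OF cf _ that] IB_herm[OF bcoef_one that] a that by (simp add: EA_def elliptic_def)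
  show "0 \<le> Re (EA a \<kappa> u u)" if "u \<in> H1 D" for u
   by (rule order_trans[OF _ EA_bounds(1)[OF a that m(2,3)]]) (use m in simp)
 qed
 let ?W = "H1_norm D w" and ?V = "H1_norm D v"
 have f: "form_A D a \<kappa> u (w - (v + v), - v) = EA a \<kappa> w w - (EA a \<kappa> w v + EA a \<kappa> w v) + H1_inner D v v"
  unfolding form_A_eq[OF cf u T]
  unfolding uv fst_conv snd_conv
   E.ip_diff_right[OF h(1) E.V_add[OF h(2) h(2)] h(1)] E.ip_add_right[OF h(2) h(2) h(1)]
  unfolding nv H1.ip_scl_right[OF h(2) h(2)] by simp
 have vv: "Re (H1_inner D v v) = ?V\<^sup>2" using H1.nrm_sq[OF h(2)] by (simp add: H1_nrm)
 have vw: "Re (EA a \<kappa> w v) \<le> E.nrm w * E.nrm v" by (rule E.Cauchy_Schwarz_Re[OF h(1) h(2)])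
 let ?E = "Re (form_A D a \<kappa> u (w - (v + v), - v))"
 have E: "?E \<ge> (E.nrm w)\<^sup>2 - 2 * (E.nrm w * E.nrm v) + ?V\<^sup>2" unfolding f using E.nrm_sq[OF h(1)] vw vv by simp
 \<comment> \<open>The midpoint between \<open>b\<close> and 1, so that \<open>1 - s\<close> and
   \<open>1 - b/s\<close> are both positive.\<close>
 let ?s = "(1 + b) / 2"
 have sp: "?s > 0" using mb m by simp
 have q: "(1 - ?s) * (E.nrm w)\<^sup>2 + ?V\<^sup>2 - (E.nrm v)\<^sup>2 / ?s \<le> ?E" by (rule quadratic_form_bound[OF sp E])
 have "(1 - b) / 2 * (m * ?W\<^sup>2) \<le> (1 - b) / 2 * (E.nrm w)\<^sup>2"
  unfolding E.nrm_sq[OF h(1)] by (rule mult_left_mono[OF EA_bounds(1)[OF a h(1) m(2,3)]]) (use b in simp)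
 moreover have "1 - ?s = (1 - b) / 2" by (simp add: field_simps)
 ultimately have q1: "(1 - b) / 2 * m * ?W\<^sup>2 \<le> (1 - ?s) * (E.nrm w)\<^sup>2" by (simp only: mult.assoc)
 have "(1 - b) / 2 * m * ?V\<^sup>2 \<le> (1 - b) / (1 + b) * ?V\<^sup>2"
 proof (rule mult_right_mono)
  have "(1 - b) / 2 * m \<le> (1 - b) / 2 * 1" by (rule mult_left_mono) (use mb b in auto)
  moreover have "(1 - b) / 2 \<le> (1 - b) / (1 + b)" by (rule divide_left_mono) (use b mb m in auto)
  ultimately show "(1 - b) / 2 * m \<le> (1 - b) / (1 + b)" by linarith
 qed simp
 also have "\<dots> = ?V\<^sup>2 - (b * ?V\<^sup>2) / ?s" using sp by (simp add: field_simps)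
 also have "\<dots> \<le> ?V\<^sup>2 - (E.nrm v)\<^sup>2 / ?s"
  unfolding E.nrm_sq[OF h(2)] by (rule diff_left_mono[OF divide_right_mono[OF EA_bounds(2)[OF a h(2) b(1,2)]]]) (use sp in simp)
 finally have q2: "(1 - b) / 2 * m * ?V\<^sup>2 \<le> ?V\<^sup>2 - (E.nrm v)\<^sup>2 / ?s" .
 from order_trans[OF add_mono[OF q1 q2] q[unfolded add_diff_eq[symmetric]]]
 have "(1 - b) / 2 * m * ?W\<^sup>2 + (1 - b) / 2 * m * ?V\<^sup>2 \<le> ?E" .
 moreover have "(1 - b) / 2 * m * (X_norm D u)\<^sup>2 = (1 - b) / 2 * m * ?W\<^sup>2 + (1 - b) / 2 * m * ?V\<^sup>2"
  unfolding X_norm_sq[OF u] unfolding uv fst_conv snd_conv by (rule distrib_left)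
 ultimately have "(1 - b) / 2 * m * (X_norm D u)\<^sup>2 \<le> ?E" by (simp only:)
 also have "\<dots> \<le> cmod (form_A D a \<kappa> u (w - (v + v), - v))" by (rule complex_Re_le_cmod)
 finally show "(1 - b) / 2 * m * (X_norm D u)\<^sup>2 \<le> cmod (form_A D a \<kappa> u (case u of (w, v) => (w - (v + v), - v)))"
  by (simp add: uv)
qed

section \<open>Difference of two solution operators\<close>

lemma IA_diff:
 assumes a: "coef a C S" and a': "coef a' C' S'" and w: "w \<in> H1 D" and \<phi>: "\<phi> \<in> H1 D"
 shows "IA a w \<phi> - IA a' w \<phi> = IA (%x. a x - a' x) w \<phi>"
 using Bochner_Integration.integral_diff[OF IA_bound(1)[OF a w \<phi>] IA_bound(1)[OF a' w \<phi>]]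
 unfolding IA_def cmat_diff hdot_diff by simp

lemma IB_diff:
 assumes b: "bcoef b C S" and b': "bcoef b' C' S'" and w: "w \<in> H1 D" and \<phi>: "\<phi> \<in> H1 D"
 shows "IB b w \<phi> - IB b' w \<phi> = IB (%x. b x - b' x) w \<phi>"
 using Bochner_Integration.integral_diff[OF IB_bound(1)[OF b w \<phi>] IB_bound(1)[OF b' w \<phi>]]
 unfolding IB_def by (simp add: left_diff_distrib)

text \<open>Subtracting the two variational identities cancels the term with \<open>\<tau>\<close>,
  which is the same on both sides. Adding and subtracting the form of \<open>a\<close> at the second
  solution puts the coefficient difference on that solution, while stability is used for
  \<open>a\<close> only; in the application the second problem is the background.\<close>

theorem T_op_difference:
 assumes wp: "wellposed a \<kappa> c" "wellposed a' \<kappa> c'" and b: "bcoef b Cb UNIV" "bcoef b' Cb' UNIV"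
  and da: "coef (%x. a' x - a x) Ca S" and db: "bcoef (%x. b x - b' x) Cd S'" and u: "u \<in> X D"
 shows "X_norm D (T_op D a b \<kappa> \<tau> u - T_op D a' b' \<kappa> \<tau> u)
  \<le> 3 * (Cd * l2 M (restr S' (fst u)) + Ca * l2 M (restr S (wgrad D (fst (T_op D a' b' \<kappa> \<tau> u))))) / c"
proof -
 define Y where "Y = T_op D a b \<kappa> \<tau> u"
 define Y' where "Y' = T_op D a' b' \<kappa> \<tau> u"
 note Y = T_op_spec[OF wp(1) b(1) u, where \<tau>=\<tau>, folded Y_def] and Y' = T_op_spec[OF wp(2) b(2) u, where \<tau>=\<tau>, folded Y'_def]
 obtain C C' where cf: "coef a C UNIV" "coef a' C' UNIV" using wp unfolding wellposed_def by blast
 note d = X.V_diff[OF Y(1) Y'(1)]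
 let ?B = "Cd * l2 M (restr S' (fst u)) + Ca * l2 M (restr S (wgrad D (fst Y')))"
 have nn: "Cd \<ge> 0" "Ca \<ge> 0" using da db by (auto simp: coef_def bcoef_def)
 have "cmod (form_A D a \<kappa> (Y - Y') \<phi>) \<le> ?B * X_norm D \<phi>" if p: "\<phi> \<in> X D" for \<phi>
 proof -
  note h = X_H1(1)[OF u] X_H1(1)[OF p] X_H1(1)[OF Y'(1)]
  have "form_A D a \<kappa> Y' \<phi> + form_A D a \<kappa> (Y - Y') \<phi> = form_A D a \<kappa> Y \<phi>"
   using form_A_props(1)[OF cf(1) Y'(1) d p, of \<kappa>] by simp
  then have "form_A D a \<kappa> (Y - Y') \<phi> = form_B D b u \<phi> - form_B D b' u \<phi> + (form_A D a' \<kappa> Y' \<phi> - form_A D a \<kappa> Y' \<phi>)"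
   using Y(2)[OF p] Y'(2)[OF p] by (simp add: algebra_simps)
  also have "\<dots> = (IB b (fst u) (fst \<phi>) - IB b' (fst u) (fst \<phi>)) + (IA a' (fst Y') (fst \<phi>) - IA a (fst Y') (fst \<phi>))"
   unfolding form_B_eq[OF b(1) u p] form_B_eq[OF b(2) u p] form_A_eq[OF cf(1) Y'(1) p] form_A_eq[OF cf(2) Y'(1) p] EA_def by simp
  also have "\<dots> = IB (%x. b x - b' x) (fst u) (fst \<phi>) + IA (%x. a' x - a x) (fst Y') (fst \<phi>)"
   unfolding IB_diff[OF b h(1,2)] IA_diff[OF cf(2,1) h(3,2)] ..
  finally have "cmod (form_A D a \<kappa> (Y - Y') \<phi>) \<le> Cd * (l2 M (restr S' (fst u)) * l2 M (fst \<phi>)) + Ca * (l2 M (restr S (wgrad D (fst Y'))) * l2 M (wgrad D (fst \<phi>)))"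
   using order_trans[OF norm_triangle_ineq add_mono[OF IB_bound(2)[OF db h(1,2)] IA_bound(2)[OF da h(3,2)]]] by simp
  also have "\<dots> \<le> Cd * (l2 M (restr S' (fst u)) * X_norm D \<phi>) + Ca * (l2 M (restr S (wgrad D (fst Y'))) * X_norm D \<phi>)"
   using order_trans[OF H1_norm_ge(1)[OF h(2)] X_norm_ge(1)[OF p]] order_trans[OF H1_norm_ge(2)[OF h(2)] X_norm_ge(1)[OF p]] nn
   by (intro add_mono mult_left_mono) auto
  finally show ?thesis by (simp add: distrib_right mult.assoc)
 qed
 from wellposed_bound[OF wp(1) d this] nn show ?thesis unfolding Y_def[symmetric] Y'_def[symmetric] by simp
qed

lemma wellposed_norm_T:
 assumes wp: "wellposed a \<kappa> c" and b: "bcoef b Cb UNIV" and u: "u \<in> X D"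
 shows "X_norm D (T_op D a b \<kappa> \<tau> u) \<le> 3 * ((Cb + 1) + cmod (1/\<tau>) * (\<bar>\<kappa>\<bar> + 1)) / c * X_norm D u"
proof -
 note Y = T_op_spec[OF wp b u, where \<tau>=\<tau>]
 have nb: "cmod (form_B D b' u \<phi>) \<le> (C + 1) * X_norm D u * X_norm D \<phi>" if b': "bcoef b' C UNIV" and p: "\<phi> \<in> X D" for b' C \<phi>
  by (rule form_B_bound[OF b' u p])
 have "Cb \<ge> 0" using b by (simp add: bcoef_def)
 then have nn: "0 \<le> ((Cb + 1) + cmod (1/\<tau>) * (\<bar>\<kappa>\<bar> + 1)) * X_norm D u" using X_norm_nonneg[OF u] by simp
 have "cmod (form_A D a \<kappa> (T_op D a b \<kappa> \<tau> u) \<phi>) \<le> ((Cb + 1) + cmod (1/\<tau>) * (\<bar>\<kappa>\<bar> + 1)) * X_norm D u * X_norm D \<phi>" if p: "\<phi> \<in> X D" for \<phi>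
 proof -
  have "cmod (form_A D a \<kappa> (T_op D a b \<kappa> \<tau> u) \<phi>) \<le> cmod (form_B D b u \<phi>) + cmod (1/\<tau>) * cmod (form_B D (%x. \<kappa>) u \<phi>)"
   unfolding Y(2)[OF p] form_C_eq_B by (rule order_trans[OF norm_triangle_ineq]) (simp only: norm_mult order_refl)
  also have "\<dots> \<le> (Cb + 1) * X_norm D u * X_norm D \<phi> + cmod (1/\<tau>) * ((\<bar>\<kappa>\<bar> + 1) * X_norm D u * X_norm D \<phi>)"
   by (intro add_mono mult_left_mono nb b bcoef_const p norm_ge_zero)
  finally show ?thesis by (simp only: distrib_right mult.assoc)
 qed
 from wellposed_bound[OF wp Y(1) this nn] show ?thesis by (simp add: mult_ac)
qed

end

section \<open>First and second differences of smooth coefficients\<close>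

text \<open>\<open>Ck_on\<close> controls derivatives along basis directions only; the dimension
  factor is the price for arbitrary directions.\<close>

lemma frechet_norm_bound:
 fixes F :: "'a::euclidean_space => 'b::real_normed_vector" and K :: real
 assumes F: "bounded_linear F" and b: "!!b. b \<in> Basis ==> norm (F b) \<le> K"
 shows "norm (F h) \<le> (DIM('a) * K) * norm h"
proof -
 have "F h = F (\<Sum>b\<in>Basis. (h \<bullet> b) *\<^sub>R b)" by (simp add: euclidean_representation)
 also have "\<dots> = (\<Sum>b\<in>Basis. (h \<bullet> b) *\<^sub>R F b)"
  by (simp add: linear_sum[OF bounded_linear.linear[OF F]] linear_scale[OF bounded_linear.linear[OF F]])
 also have "norm \<dots> \<le> (\<Sum>b\<in>(Basis::'a set). norm h * K)"
 proof (rule sum_norm_le)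
  fix b :: 'a assume B: "b \<in> Basis"
  show "norm ((h \<bullet> b) *\<^sub>R F b) \<le> norm h * K"
   unfolding norm_scaleR by (intro mult_mono b[OF B] Basis_le_norm[OF B]) auto
 qed
 finally show ?thesis by (simp add: mult_ac)
qed

lemma Ck_on_bounded_on_compact:
 fixes f :: "'a::euclidean_space => 'b::real_normed_vector"
 assumes D: "open D" and f: "Ck_on k D f" and K: "compact K" "K \<subseteq> D"
 obtains C where "C \<ge> 0" "!!x. x \<in> K ==> norm (f x) \<le> C"
proof -
 have "continuous_on K f" using Ck_on_continuous[OF D f] K(2) continuous_on_subset by blast
 then have "bounded (f ` K)" by (intro compact_imp_bounded compact_continuous_image K(1))
 then obtain C where C: "!!y. y \<in> f ` K ==> norm y \<le> C" unfolding bounded_iff by blast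
 show ?thesis by (rule that[of "max 0 C"]) (use C in \<open>auto intro: le_max_iff_disj[THEN iffD2]\<close>)
qed

lemma Ck_on_Suc_deriv: "Ck_on (Suc k) D f ==> b \<in> Basis ==> Ck_on k D (%x. frechet_derivative f (at x) b)"
 by simp

lemma Basis_common_bound:
 fixes P :: "'a::euclidean_space => real => bool"
 assumes ex: "!!b. b \<in> Basis ==> \<exists>C\<ge>0. P b C" and mono: "!!b C C'. P b C ==> C \<le> C' ==> P b C'"
 obtains C where "C \<ge> 0" "!!b. b \<in> Basis ==> P b C"
proof -
 obtain g where g: "!!b. b \<in> Basis ==> 0 \<le> g b \<and> P b (g b)" using ex by metis
 show ?thesis
 proof (rule that[of "sum g Basis"])
  show "0 \<le> sum g Basis" using g by (intro sum_nonneg) auto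
  show "P b (sum g Basis)" if b: "b \<in> Basis" for b
   by (rule mono[OF conjunct2[OF g[OF b]]], rule member_le_sum[OF b]) (use g in auto)
 qed
qed

lemma C1_lipschitz:
 fixes f :: "'a::euclidean_space => 'b::real_normed_vector"
 assumes D: "open D" and f: "Ck_on (Suc k) D f" and R: "cball z R \<subseteq> D"
 obtains L where "L \<ge> 0" "!!x y. x \<in> ball z R ==> y \<in> ball z R ==> norm (f x - f y) \<le> L * norm (x - y)"
proof -
 have ex: "\<exists>C\<ge>0. \<forall>x\<in>cball z R. norm (frechet_derivative f (at x) b) \<le> C" if B: "b \<in> Basis" for b
 proof (rule Ck_on_bounded_on_compact[OF D Ck_on_Suc_deriv[OF f B] compact_cball R])
  fix C :: real assume "C \<ge> 0" "!!x. x \<in> cball z R ==> norm (frechet_derivative f (at x) b) \<le> C"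
  then show ?thesis by (intro exI[of _ C] conjI ballI)
 qed
 have mono: "\<forall>x\<in>cball z R. norm (frechet_derivative f (at x) b) \<le> C'"
  if "\<forall>x\<in>cball z R. norm (frechet_derivative f (at x) b) \<le> C" "C \<le> C'" for b C C'
  using that by (auto intro: order_trans)
 show ?thesis
 proof (rule Basis_common_bound[OF ex mono])
  fix K :: real
  assume K: "K \<ge> 0" "!!b. b \<in> Basis ==> \<forall>x\<in>cball z R. norm (frechet_derivative f (at x) b) \<le> K"
 show ?thesis
 proof (rule that[of "DIM('a) * K"])
  fix x y assume x: "x \<in> ball z R" and y: "y \<in> ball z R"
  show "norm (f x - f y) \<le> DIM('a) * K * norm (x - y)"
  proof (rule differentiable_bound[OF convex_ball _ _ x y])
   fix u assume u: "u \<in> ball z R"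
   then have uD: "u \<in> D" using R by auto
   note d = Ck_on_SucD[OF D f uD]
   show "(f has_derivative frechet_derivative f (at u)) (at u within ball z R)" by (rule has_derivative_at_withinI[OF d])
   show "onorm (frechet_derivative f (at u)) \<le> DIM('a) * K"
   proof (rule onorm_bound)
    have bb: "norm (frechet_derivative f (at u) b) \<le> K" if "b \<in> Basis" for b
     using K(2)[OF that] u ball_subset_cball by blast
    show "norm (frechet_derivative f (at u) v) \<le> DIM('a) * K * norm v" for v
     by (rule frechet_norm_bound[OF has_derivative_bounded_linear[OF d] bb])
   qed (use K in simp)
  qed
 qed (use K in simp)
qed
qed

text \<open>A second difference is the increment of a first difference, whose derivative is small
  because the partial derivatives are Lipschitz.\<close>

lemma C2_second_difference:
 fixes f :: "'a::euclidean_space => 'b::real_normed_vector"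
 assumes D: "open D" and f: "Ck_on (Suc (Suc k)) D f" and R: "cball z R \<subseteq> D"
 obtains L where "L \<ge> 0" "!!x h k. {x, x + h, x + k, x + h + k} \<subseteq> ball z R ==>
  norm (f (x + h + k) - f (x + h) - (f (x + k) - f x)) \<le> L * norm h * norm k"
proof -
 have ex: "\<exists>C\<ge>0. \<forall>x\<in>ball z R. \<forall>y\<in>ball z R. norm (frechet_derivative f (at x) b - frechet_derivative f (at y) b) \<le> C * norm (x - y)" if B: "b \<in> Basis" for b
 proof (rule C1_lipschitz[OF D Ck_on_Suc_deriv[OF f B] R])
  fix C :: real assume "C \<ge> 0" "!!x y. x \<in> ball z R ==> y \<in> ball z R ==> norm (frechet_derivative f (at x) b - frechet_derivative f (at y) b) \<le> C * norm (x - y)"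
  then show ?thesis by (intro exI[of _ C] conjI ballI)
 qed
 have mono: "\<forall>x\<in>ball z R. \<forall>y\<in>ball z R. norm (frechet_derivative f (at x) b - frechet_derivative f (at y) b) \<le> C' * norm (x - y)"
  if "\<forall>x\<in>ball z R. \<forall>y\<in>ball z R. norm (frechet_derivative f (at x) b - frechet_derivative f (at y) b) \<le> C * norm (x - y)" "C \<le> C'" for b C C'
 proof (intro ballI)
  fix x y assume "x \<in> ball z R" "y \<in> ball z R"
  then show "norm (frechet_derivative f (at x) b - frechet_derivative f (at y) b) \<le> C' * norm (x - y)"
   using that(1) mult_right_mono[OF that(2), of "norm (x - y)"] by (meson norm_ge_zero order_trans)
 qed
 show ?thesis
 proof (rule Basis_common_bound[OF ex mono])
  fix K :: real
  assume K: "K \<ge> 0" "!!b. b \<in> Basis ==> \<forall>x\<in>ball z R. \<forall>y\<in>ball z R. norm (frechet_derivative f (at x) b - frechet_derivative f (at y) b) \<le> K * norm (x - y)"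
 show ?thesis
 proof (rule that[of "DIM('a) * K"])
  fix x h k assume s: "{x, x + h, x + k, x + h + k} \<subseteq> ball z R"
  \<comment> \<open>The points that stay in the ball under the shift by \<open>h\<close>; as an
    intersection of two balls the set is convex, as the mean value inequality requires.\<close>
  let ?S = "ball z R \<inter> ball (z - h) R" and ?g = "%y. f (y + h) - f y"
  have sh: "y \<in> ball (z - h) R \<longleftrightarrow> y + h \<in> ball z R" for y by (simp add: dist_norm algebra_simps)
  have e: "x + k + h = x + h + k" by simp
  have k1: "x + k \<in> ?S" "x \<in> ?S" unfolding Int_iff sh e using s by blast+
  have "norm (?g (x + k) - ?g x) \<le> (DIM('a) * K * norm h) * norm (x + k - x)"
  proof (rule differentiable_bound[of ?S ?g "%u v. frechet_derivative f (at (u + h)) v - frechet_derivative f (at u) v"])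
   show "convex ?S" by (intro convex_Int convex_ball)
   fix u assume "u \<in> ?S"
   then have u: "u \<in> ball z R" "u + h \<in> ball z R" unfolding Int_iff sh by blast+
   then have uD: "u \<in> D" "u + h \<in> D" using R by auto
   note d = Ck_on_SucD[OF D f uD(1)] and d2 = Ck_on_SucD[OF D f uD(2)]
   have d3: "((%y. f (y + h)) has_derivative frechet_derivative f (at (u + h))) (at u)"
   proof -
    have "((%y. y + h) has_derivative (%v. v)) (at u)" by (auto intro!: derivative_eq_intros)
    from has_derivative_compose[of "%y. y + h" "%v. v" u UNIV f "frechet_derivative f (at (u + h))", OF this d2] show ?thesis by simp
   qed
   show "(?g has_derivative (%v. frechet_derivative f (at (u + h)) v - frechet_derivative f (at u) v)) (at u within ?S)"
    by (rule has_derivative_at_withinI[OF has_derivative_diff[OF d3 d]])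
   have bl: "bounded_linear (%v. frechet_derivative f (at (u + h)) v - frechet_derivative f (at u) v)"
    by (rule bounded_linear_sub[OF has_derivative_bounded_linear[OF d2] has_derivative_bounded_linear[OF d]])
   have bb: "norm (frechet_derivative f (at (u + h)) b - frechet_derivative f (at u) b) \<le> K * norm h" if "b \<in> Basis" for b
    using K(2)[OF that, rule_format, OF u(2) u(1)] by simp
   show "onorm (%v. frechet_derivative f (at (u + h)) v - frechet_derivative f (at u) v) \<le> DIM('a) * K * norm h"
   proof (rule onorm_bound)
    show "norm (frechet_derivative f (at (u + h)) v - frechet_derivative f (at u) v) \<le> DIM('a) * K * norm h * norm v" for v
     using frechet_norm_bound[OF bl bb, of v] by (simp only: mult.assoc)
   qed (use K in simp)
  qed (use k1 in auto)
  moreover have "f (x + h + k) - f (x + h) - (f (x + k) - f x) = ?g (x + k) - ?g x" unfolding e by simp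
  ultimately show "norm (f (x + h + k) - f (x + h) - (f (x + k) - f x)) \<le> DIM('a) * K * norm h * norm k"
   by (simp only: add_diff_cancel_left')
 qed (use K in simp)
qed
qed

lemma matrix_vector_norm_le:
 fixes A :: "real^'n^'m"
 shows "norm (A *v \<xi>) \<le> CARD('m) * norm A * norm \<xi>"
proof -
 have "norm (A *v \<xi>) \<le> (\<Sum>i\<in>UNIV. \<bar>(A *v \<xi>) $ i\<bar>)" by (rule norm_le_l1_cart)
 also have "\<dots> \<le> (\<Sum>i\<in>(UNIV::'m set). norm A * norm \<xi>)"
 proof (rule sum_mono)
  fix i
  have "\<bar>(A *v \<xi>) $ i\<bar> = \<bar>A $ i \<bullet> \<xi>\<bar>" by (simp add: matrix_vector_mult_def inner_vec_def)
  also have "\<dots> \<le> norm (A $ i) * norm \<xi>" by (rule Cauchy_Schwarz_ineq2)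
  also have "\<dots> \<le> norm A * norm \<xi>" by (intro mult_right_mono Finite_Cartesian_Product.norm_nth_le norm_ge_zero)
  finally show "\<bar>(A *v \<xi>) $ i\<bar> \<le> norm A * norm \<xi>" .
 qed
 finally show ?thesis by simp
qed

section \<open>From extremal values of quadratic forms to ellipticity constants\<close>

lemma qform_homogeneous:
 "Re (hdot (cmat A *v (complex_of_real c *s \<xi>)) (complex_of_real c *s \<xi>)) = c\<^sup>2 * Re (hdot (cmat A *v \<xi>) \<xi>)"
 by (simp add: vector_scalar_commute hdot_scl power2_eq_square)

lemma norm_cscale: "norm (complex_of_real c *s \<xi>) = \<bar>c\<bar> * norm (\<xi> :: complex^'n)"
proof -
 have "complex_of_real c *s \<xi> = c *\<^sub>R \<xi>" by (simp add: vec_eq_iff scaleR_conv_of_real[where 'a=complex])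
 then show ?thesis by simp
qed

lemma qform_bounds:
 fixes A :: "real^'n^'n"
 shows "ereal \<alpha> \<le> qform_inf A ==> \<alpha> * (norm \<xi>)\<^sup>2 \<le> Re (hdot (cmat A *v \<xi>) \<xi>)"
  "qform_sup A \<le> ereal \<beta> ==> Re (hdot (cmat A *v \<xi>) \<xi>) \<le> \<beta> * (norm \<xi>)\<^sup>2"
proof -
 show "\<alpha> * (norm \<xi>)\<^sup>2 \<le> Re (hdot (cmat A *v \<xi>) \<xi>)" if l: "ereal \<alpha> \<le> qform_inf A"
 proof (cases "\<xi> = 0")
  case False
  let ?u = "complex_of_real (1 / norm \<xi>) *s \<xi>"
  have n: "norm ?u = 1" using False by (simp only: norm_cscale) simp
  have "qform_inf A \<le> ereal (Re (hdot (cmat A *v ?u) ?u))" unfolding qform_inf_def by (rule INF_lower) (use n in simp)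
  with l have "ereal \<alpha> \<le> ereal (Re (hdot (cmat A *v ?u) ?u))" by (rule order_trans)
  then have "\<alpha> \<le> (1 / norm \<xi>)\<^sup>2 * Re (hdot (cmat A *v \<xi>) \<xi>)" unfolding qform_homogeneous by simp
  then show ?thesis using False by (simp add: field_simps)
 qed (simp add: hdot_def)
 show "Re (hdot (cmat A *v \<xi>) \<xi>) \<le> \<beta> * (norm \<xi>)\<^sup>2" if l: "qform_sup A \<le> ereal \<beta>"
 proof (cases "\<xi> = 0")
  case False
  let ?u = "complex_of_real (1 / norm \<xi>) *s \<xi>"
  have n: "norm ?u = 1" using False by (simp only: norm_cscale) simp
  have "ereal (Re (hdot (cmat A *v ?u) ?u)) \<le> qform_sup A" unfolding qform_sup_def by (rule SUP_upper) (use n in simp)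
  with l have "ereal (Re (hdot (cmat A *v ?u) ?u)) \<le> ereal \<beta>" by (meson order_trans)
  then have "(1 / norm \<xi>)\<^sup>2 * Re (hdot (cmat A *v \<xi>) \<xi>) \<le> \<beta>" unfolding qform_homogeneous by simp
  then show ?thesis using False by (simp add: field_simps)
 qed (simp add: hdot_def)
qed

lemma qform_inf_le_sup: "qform_inf (A :: real^'n^'n) \<le> qform_sup A"
proof -
 obtain i :: 'n where True by simp
 let ?u = "axis i 1 :: complex^'n"
 have "norm ?u = 1" by simp
 then have "qform_inf A \<le> ereal (Re (hdot (cmat A *v ?u) ?u))" "ereal (Re (hdot (cmat A *v ?u) ?u)) \<le> qform_sup A"
  unfolding qform_inf_def qform_sup_def by (auto intro!: INF_lower SUP_upper)
 then show ?thesis by (rule order_trans)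
qed

text \<open>Over a nonempty index set the infimum lies below the supremum, so a positive infimum and
  a finite supremum are both finite, and passing to reals loses nothing. It is used for the points
  of \<open>D\<close> and for the indices of the inclusions.\<close>

lemma qform_range_real:
 assumes I: "i \<in> I" and m: "m = (INF i\<in>I. qform_inf (F i))" "m > 0" and M: "M = (SUP i\<in>I. qform_sup (F i))" "M < \<infinity>"
 shows "ereal (real_of_ereal m) = m" "ereal (real_of_ereal M) = M" "real_of_ereal m \<le> real_of_ereal M"
  "!!j \<xi>. j \<in> I ==> real_of_ereal m * (norm \<xi>)\<^sup>2 \<le> Re (hdot (cmat (F j) *v \<xi>) \<xi>)"
  "!!j \<xi>. j \<in> I ==> Re (hdot (cmat (F j) *v \<xi>) \<xi>) \<le> real_of_ereal M * (norm \<xi>)\<^sup>2"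
proof -
 have l: "m \<le> qform_inf (F j)" "qform_sup (F j) \<le> M" if "j \<in> I" for j
  unfolding m(1) M(1) using that by (auto intro: INF_lower SUP_upper)
 have mM: "m \<le> M" using l[OF I] qform_inf_le_sup[of "F i"] by (meson order_trans)
 show em: "ereal (real_of_ereal m) = m" and eM: "ereal (real_of_ereal M) = M"
  using m(2) M(2) mM by (auto intro!: ereal_real')
 show "real_of_ereal m \<le> real_of_ereal M" using mM em eM by (metis ereal_less_eq(3))
 show "real_of_ereal m * (norm \<xi>)\<^sup>2 \<le> Re (hdot (cmat (F j) *v \<xi>) \<xi>)" if "j \<in> I" for j \<xi>
  by (rule qform_bounds(1)) (use l(1)[OF that] em in simp)
 show "Re (hdot (cmat (F j) *v \<xi>) \<xi>) \<le> real_of_ereal M * (norm \<xi>)\<^sup>2" if "j \<in> I" for j \<xi>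
  by (rule qform_bounds(2)) (use l(2)[OF that] eM in simp)
qed

section \<open>Inclusions and perturbed coefficients\<close>

lemma smooth_ball_deformation_open_bounded:
 fixes B :: "'a::euclidean_space set"
 assumes "smooth_ball_deformation B"
 shows "open B" "bounded B"
proof -
 obtain r U V and \<Phi> \<Psi> :: "'a => 'a" where h: "r > 0" "open U" "open V" "cball 0 r \<subseteq> U" "homeomorphism U V \<Phi> \<Psi>" "B = \<Phi> ` ball 0 r"
  using assms unfolding smooth_ball_deformation_def by blast
 have "openin (top_of_set V) (\<Phi> ` ball 0 r)"
  by (rule homeomorphism_imp_open_map[OF h(5)]) (use h(2,4) ball_subset_cball in \<open>auto simp: openin_open_eq\<close>)
 then show "open B" using h(3,6) by (simp add: openin_open_eq)
 have "continuous_on (cball 0 r) \<Phi>" using h(4,5) unfolding homeomorphism_def by (meson continuous_on_subset)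
 then have "bounded (\<Phi> ` cball 0 r)" by (intro compact_imp_bounded compact_continuous_image compact_cball)
 then show "bounded B" unfolding h(6) by (rule bounded_subset) (auto intro!: image_mono)
qed

text \<open>One radius serves all \<open>m\<close> and all \<open>\<epsilon>\<close>: inclusions
  enter the later estimates only through the balls of radius \<open>\<epsilon> * r\<close> around
  the centres.\<close>

lemma inclusion_properties:
 assumes B: "!!m. m \<in> {1..M} ==> smooth_ball_deformation (B m)"
 obtains r where "r > 0" "!!m \<epsilon>. m \<in> {1..M} ==> \<epsilon> > 0 ==> open (inclusion z B \<epsilon> m) \<and> inclusion z B \<epsilon> m \<subseteq> ball (z m) (\<epsilon> * r)"
proof -
 have "bounded (\<Union>m\<in>{1..M}. B m)" by (intro bounded_Union) (use smooth_ball_deformation_open_bounded(2)[OF B] in auto)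
 then obtain r where r: "r > 0" "!!y. y \<in> (\<Union>m\<in>{1..M}. B m) ==> norm y < r" unfolding bounded_pos_less by blast
 show ?thesis
 proof (rule that[OF r(1)], intro conjI)
  fix m \<epsilon> assume m: "m \<in> {1..M}" and e: "\<epsilon> > (0::real)"
  show "open (inclusion z B \<epsilon> m)" unfolding inclusion_def
   by (rule open_affinity[OF smooth_ball_deformation_open_bounded(1)[OF B[OF m]]]) (use e in simp)
  have "norm y < r" if "y \<in> B m" for y using r(2) m that by blast
  then show "inclusion z B \<epsilon> m \<subseteq> ball (z m) (\<epsilon> * r)"
   unfolding inclusion_def using e by (auto simp: dist_norm)
 qed
qed

text \<open>Disjointness makes the index chosen in \<open>perturbed\<close> unique. The sum over
  indicators serves measurability, the alternative serves pointwise bounds.\<close>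

lemma perturbed_eq:
 fixes k :: "nat => 'c::real_vector"
 assumes e: "\<epsilon> > 0" and disj: "!!i j. i \<in> {1..M} ==> j \<in> {1..M} ==> i \<noteq> j ==> inclusion z B \<epsilon> i \<inter> inclusion z B \<epsilon> j = {}"
 shows "perturbed M z B k c \<epsilon> x = c x + (\<Sum>m\<in>{1..M}. indicat_real (inclusion z B \<epsilon> m) x *\<^sub>R (k m - c x))"
  "(\<exists>m\<in>{1..M}. x \<in> inclusion z B \<epsilon> m \<and> perturbed M z B k c \<epsilon> x = k m) \<or>
   (\<forall>m\<in>{1..M}. x \<notin> inclusion z B \<epsilon> m) \<and> perturbed M z B k c \<epsilon> x = c x"
proof -
 let ?I = "inclusion z B \<epsilon>"
 have both: "perturbed M z B k c \<epsilon> x = c x + (\<Sum>m\<in>{1..M}. indicat_real (?I m) x *\<^sub>R (k m - c x)) \<and>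
  ((\<exists>m\<in>{1..M}. x \<in> ?I m \<and> perturbed M z B k c \<epsilon> x = k m) \<or> (\<forall>m\<in>{1..M}. x \<notin> ?I m) \<and> perturbed M z B k c \<epsilon> x = c x)"
 proof (cases "\<exists>m\<in>{1..M}. x \<in> ?I m")
  case True
  then obtain m where m: "m \<in> {1..M}" "x \<in> ?I m" by blast
  have u: "m' = m" if "m' \<in> {1..M} \<and> x \<in> ?I m'" for m' using disj[of m' m] m that by blast
  have "(SOME m. m \<in> {1..M} \<and> x \<in> ?I m) = m" by (rule some_equality) (use m u in auto)
  then have p: "perturbed M z B k c \<epsilon> x = k m" using e True by (simp add: perturbed_def)
  have "(\<Sum>m\<in>{1..M}. indicat_real (?I m) x *\<^sub>R (k m - c x)) = (\<Sum>m'\<in>{1..M}. if m' = m then k m - c x else 0)"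
   by (rule sum.cong) (use u m in \<open>auto simp: indicator_def\<close>)
  also have "\<dots> = k m - c x" using m by simp
  finally show ?thesis using p m by auto
 next
  case False
  then have "(\<Sum>m\<in>{1..M}. indicat_real (?I m) x *\<^sub>R (k m - c x)) = 0" by (intro sum.neutral) auto
  then show ?thesis using False by (auto simp: perturbed_def)
 qed
 then show "perturbed M z B k c \<epsilon> x = c x + (\<Sum>m\<in>{1..M}. indicat_real (?I m) x *\<^sub>R (k m - c x))"
  "(\<exists>m\<in>{1..M}. x \<in> ?I m \<and> perturbed M z B k c \<epsilon> x = k m) \<or> (\<forall>m\<in>{1..M}. x \<notin> ?I m) \<and> perturbed M z B k c \<epsilon> x = c x" by blast+
qed

section \<open>Real and imaginary parts of Sobolev functions and equations\<close>

text \<open>Real coefficients commute with both projections, so each part solves a real equation of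
  the same kind; the predicate lets one argument treat both.\<close>

definition part :: "(complex => real) => bool" where "part p \<longleftrightarrow> p = Re \<or> p = Im"

lemma part_props:
 assumes "part p"
 shows "bounded_linear p" "\<bar>p z\<bar> \<le> cmod z" "p (z * complex_of_real r) = p z * r" "p (complex_of_real r * z) = r * p z"
  "p (u + v) = p u + p v" "p 0 = 0"
 using assms bounded_linear_Re bounded_linear_Im abs_Re_le_cmod abs_Im_le_cmod by (auto simp: part_def)

definition vpart :: "(complex => real) => complex^'n => real^'n" where "vpart p v = (\<chi> i. p (v $ i))"

lemma vpart_norm:
 assumes "part p" shows "norm (vpart p v) \<le> norm v"
proof (rule power2_le_imp_le)
 show "(norm (vpart p v))\<^sup>2 \<le> (norm v)\<^sup>2"
  unfolding norm_vec_sq vpart_def vec_lambda_beta real_norm_def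
  by (intro sum_mono power_mono part_props(2)[OF assms] abs_ge_zero)
qed simp

lemma vpart_bounded_linear:
 assumes "part p" shows "bounded_linear (vpart p :: complex^'n => real^'n)"
proof (rule bounded_linear_intro[where K=1])
 fix x y :: "complex^'n" and r :: real
 show "vpart p (x + y) = vpart p x + vpart p y" by (simp add: vpart_def vec_eq_iff part_props(5)[OF assms])
 show "vpart p (r *\<^sub>R x) = r *\<^sub>R vpart p x" by (simp add: vpart_def vec_eq_iff scaleR_conv_of_real[where 'a=complex] part_props(4)[OF assms])
 show "norm (vpart p x) \<le> norm x * 1" using vpart_norm[OF assms] by simp
qed

lemma norm_vpart_sum: "norm (v :: complex^'n) \<le> norm (vpart Re v) + norm (vpart Im v)"
proof (rule power2_le_imp_le)
 have "(norm v)\<^sup>2 = (norm (vpart Re v))\<^sup>2 + (norm (vpart Im v))\<^sup>2"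
  unfolding norm_vec_sq vpart_def by (simp add: cmod_power2 sum.distrib)
 then show "(norm v)\<^sup>2 \<le> (norm (vpart Re v) + norm (vpart Im v))\<^sup>2" by (simp add: power2_sum)
qed simp

lemma part_sum:
 assumes "part p" shows "p (\<Sum>i\<in>I. f i) = (\<Sum>i\<in>I. p (f i))"
 using linear_sum[OF bounded_linear.linear[OF part_props(1)[OF assms]]] .

lemma part_hdot_real:
 assumes p: "part p"
 shows "p (hdot (cmat A *v g) (\<chi> i. complex_of_real (r $ i))) = (A *v vpart p g) \<bullet> r"
 by (simp add: hdot_def cmat_def matrix_vector_mult_def inner_vec_def vpart_def part_sum[OF p] part_props[OF p])

context bdd_domain
begin

text \<open>Carries a complex weak gradient on \<open>D\<close> to a real one over
  \<open>lborel\<close>: Borel representatives vanish off \<open>D\<close>, and real test functions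
  are complex ones, so the defining identity is projected component by component.\<close>

lemma H1_real_rep:
 assumes w: "w \<in> H1 D" and p: "part p"
 obtains w' G where "weakg D w' G" "!!x. x \<notin> D ==> w' x = 0" "AE x in M. p (w x) = w' x" "AE x in M. vpart p (wgrad D w x) = G x"
  "l2 lborel w' \<le> l2 M w" "l2 lborel G \<le> l2 M (wgrad D w)"
proof -
 note bl = part_props(1)[OF p] and vbl = vpart_bounded_linear[OF p, where 'n='d]
 obtain w0 where w0: "sqi lborel w0" "!!x. x \<notin> D ==> w0 x = 0" "AE x in M. w x = w0 x" "l2 lborel w0 = l2 M w"
  by (rule borel_rep[OF H1D(1)[OF w]]) blast
 obtain g0 where g0: "sqi lborel g0" "!!x. x \<notin> D ==> g0 x = 0" "AE x in M. wgrad D w x = g0 x" "l2 lborel g0 = l2 M (wgrad D w)"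
  by (rule borel_rep[OF H1D(3)[OF w]]) blast
 define w' where "w' = (%x. p (w0 x))"
 define G where "G = (%x. vpart p (g0 x))"
 have s: "sqi lborel w'" unfolding w'_def by (rule sqi_bounded_linear[OF bl w0(1)]) (use part_props(2)[OF p] in simp)
 have sG: "sqi lborel G" unfolding G_def by (rule sqi_bounded_linear[OF vbl g0(1) vpart_norm[OF p]])
 have aw: "AE x in M. p (w x) = w' x" using w0(3) by eventually_elim (simp add: w'_def)
 have aG: "AE x in M. vpart p (wgrad D w x) = G x" using g0(3) by eventually_elim (simp add: G_def)
 have z: "w' x = 0" "G x = 0" if "x \<notin> D" for x
  using w0(2)[OF that] g0(2)[OF that] part_props(6)[OF p] by (simp_all add: w'_def G_def vpart_def vec_eq_iff)
 have "weakg D w' G" unfolding weakg_def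
 proof (intro conjI allI impI s sG)
  fix \<phi> :: "real^'d => real" assume \<phi>: "rtest D \<phi>"
  note t = rtest_test_function(1)[OF \<phi>] and ts = rtest_sqi[OF \<phi>] and tg = rtest_grad_sqi[OF \<phi>]
  note m = sqi_vec_eqs[OF w]
  have mm: "w' \<in> borel_measurable borel" "G \<in> borel_measurable borel" "\<phi> \<in> borel_measurable borel" "grad \<phi> \<in> borel_measurable borel"
   using s sG ts tg by (auto simp: sqi_def)
  have nth: "(%x. f x $ i) \<in> borel_measurable N" if "f \<in> borel_measurable N" for f :: "real^'d => 'z::euclidean_space^'d" and i N
   using that by (simp add: borel_measurable_vec_nth)
  show "(\<integral>x. w' x *\<^sub>R grad \<phi> x \<partial>lborel) = - (\<integral>x. \<phi> x *\<^sub>R G x \<partial>lborel)"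
  proof (subst vec_eq_iff, rule allI)
   fix i
   let ?e = "axis i 1 :: real^'d"
   have d: "frechet_derivative (%x. complex_of_real (\<phi> x)) (at x) ?e = complex_of_real (grad \<phi> x $ i)" for x
    using rtest_test_function(2)[OF \<phi>, of x ?e] by (simp add: inner_axis)
   note E = wgD[OF H1D(2)[OF w] t, of i, unfolded d]
   have i1: "integrable M (%x. w x * complex_of_real (grad \<phi> x $ i))"
    using cmult_integrable(1)[OF H1D(1)[OF w] test_sqi(2)[OF t, of ?e]] unfolding d .
   have i2: "integrable M (%x. wgrad D w x $ i * complex_of_real (\<phi> x))"
    using cmult_integrable(1)[OF _ test_sqi(1)[OF t]] H1D(3)[OF w] by (simp add: sqi_vec)
   have "p (\<integral>x. w x * complex_of_real (grad \<phi> x $ i) \<partial>M) = (\<integral>x. p (w x) * grad \<phi> x $ i \<partial>M)"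
    by (subst integral_bounded_linear[OF bl i1, symmetric]) (simp only: part_props(3)[OF p])
   also have "\<dots> = (\<integral>x. w' x * grad \<phi> x $ i \<partial>lborel)"
   proof (rule integral_rep)
    show "AE x in M. p (w x) * grad \<phi> x $ i = w' x * grad \<phi> x $ i" using aw by eventually_elim simp
    show "(%x. p (w x) * grad \<phi> x $ i) \<in> borel_measurable M"
     by (intro borel_measurable_times measurable_M nth mm measurable_compose[OF m(2)] borel_measurable_continuous_onI linear_continuous_on[OF bl])
    show "(%x. w' x * grad \<phi> x $ i) \<in> borel_measurable borel" by (intro borel_measurable_times nth mm)
   qed (simp add: z)
   also have "\<dots> = (\<integral>x. w' x *\<^sub>R grad \<phi> x \<partial>lborel) $ i"
    using integral_bounded_linear[OF bounded_linear_vec_nth l2_scaleR_int(1)[OF s tg], of i] by simp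
   finally have L: "(\<integral>x. w' x *\<^sub>R grad \<phi> x \<partial>lborel) $ i = p (\<integral>x. w x * complex_of_real (grad \<phi> x $ i) \<partial>M)" by simp
   have "p (\<integral>x. wgrad D w x $ i * complex_of_real (\<phi> x) \<partial>M) = (\<integral>x. p (wgrad D w x $ i) * \<phi> x \<partial>M)"
    by (subst integral_bounded_linear[OF bl i2, symmetric]) (simp only: part_props(3)[OF p])
   also have "\<dots> = (\<integral>x. G x $ i * \<phi> x \<partial>lborel)"
   proof (rule integral_rep)
    show "AE x in M. p (wgrad D w x $ i) * \<phi> x = G x $ i * \<phi> x" using aG
     by eventually_elim (metis vpart_def vec_lambda_beta)
    show "(%x. p (wgrad D w x $ i) * \<phi> x) \<in> borel_measurable M"
     by (intro borel_measurable_times measurable_M mm measurable_compose[OF nth[OF m(1)]] borel_measurable_continuous_onI linear_continuous_on[OF bl])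
    show "(%x. G x $ i * \<phi> x) \<in> borel_measurable borel" by (intro borel_measurable_times nth mm)
   qed (simp add: z)
   also have "\<dots> = (\<integral>x. \<phi> x *\<^sub>R G x \<partial>lborel) $ i"
    using integral_bounded_linear[OF bounded_linear_vec_nth l2_scaleR_int(1)[OF ts sG], of i] by (simp add: mult.commute)
   finally have "(\<integral>x. \<phi> x *\<^sub>R G x \<partial>lborel) $ i = p (\<integral>x. wgrad D w x $ i * complex_of_real (\<phi> x) \<partial>M)" by simp
   with L E show "(\<integral>x. w' x *\<^sub>R grad \<phi> x \<partial>lborel) $ i = (- (\<integral>x. \<phi> x *\<^sub>R G x \<partial>lborel)) $ i"
    by (simp add: linear_neg[OF bounded_linear.linear[OF bl]])
  qed
 qed
 moreover have "l2 lborel w' \<le> l2 M w" unfolding w0(4)[symmetric]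
  using sqi_bound(2)[of w' lborel w0 1] s w0(1) part_props(2)[OF p] by (simp add: sqi_def w'_def)
 moreover have "l2 lborel G \<le> 1 * l2 lborel g0"
  by (rule sqi_bound(2)[OF _ g0(1)]) (use sG in \<open>auto simp: sqi_def G_def intro!: AE_I2 vpart_norm[OF p]\<close>)
 then have "l2 lborel G \<le> l2 M (wgrad D w)" unfolding g0(4) by simp
 ultimately show ?thesis using \<open>l2 lborel G \<le> l2 M (wgrad D w)\<close> by (intro that[of w' G]) (simp_all add: z aw aG)
qed

lemma l2_parts:
 fixes f :: "real^'d => 'b::euclidean_space" and f1 f2 :: "real^'d => 'c::euclidean_space"
 assumes f: "sqi M f" and f1: "sqi lborel f1" and f2: "sqi lborel f2" and le: "AE x in M. norm (f x) \<le> norm (f1 x) + norm (f2 x)"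
  and S: "S \<in> sets borel"
 shows "l2 M (restr S f) \<le> l2on S f1 + l2on S f2"
proof -
 have r: "sqi lborel (restr S f1)" "sqi lborel (restr S f2)" using S by (auto intro: sqi_restr f1 f2)
 note n1 = sqi_norm[OF sqi_M(1)[OF r(1)]] and n2 = sqi_norm[OF sqi_M(1)[OF r(2)]]
 have "l2 M (restr S f) \<le> 1 * l2 M (%x. norm (restr S f1 x) + norm (restr S f2 x))"
 proof (rule sqi_bound(2)[OF _ sqi_add[OF n1 n2]])
  show "restr S f \<in> borel_measurable M" using sqi_restr_M(1)[OF S f] by (simp add: sqi_def)
  show "AE x in M. norm (restr S f x) \<le> 1 * norm (norm (restr S f1 x) + norm (restr S f2 x))"
   using le by eventually_elim (simp add: indicator_def)
 qed simp
 also have "\<dots> \<le> l2 M (restr S f1) + l2 M (restr S f2)" using l2_triangle[OF n1 n2] by (simp only: l2_norm mult_1)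
 also have "l2 M (restr S f1) \<le> l2on S f1" unfolding sqi_M(2)[OF r(1)] using l2on_le[OF _ r(1), of D] D by (simp add: l2on_def)
 also have "l2 M (restr S f2) \<le> l2on S f2" unfolding sqi_M(2)[OF r(2)] using l2on_le[OF _ r(2), of D] D by (simp add: l2on_def)
 finally show ?thesis by simp
qed

lemma H1_decay:
 assumes dim: "CARD('d) \<in> {2, 3}" and R: "R > 0" "ball z R \<subseteq> D"
 obtains C t0 where "C \<ge> 0" "t0 > 0"
  "!!w t. w \<in> H1 D ==> 0 < t ==> t \<le> t0 ==> l2 M (restr (ball z t) w) \<le> C * H1_norm D w * sqrt t"
proof -
 have dim': "DIM(real^'d) \<in> {2, 3}" using dim by simp
 show thesis
 proof (rule weakg_decay[OF dim' R(1), of z])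
  fix C t0 :: real
  assume C: "C \<ge> 0" and t0: "t0 > 0"
   and dec: "!!w G t. weakg (ball z R) w G ==> 0 < t ==> t \<le> t0 ==> l2on (ball z t) w \<le> C * (l2 lborel w + l2 lborel G) * sqrt t"
  show thesis
  \<comment> \<open>One factor 2 for adding the norms of a part and its gradient, another for adding
    the two parts.\<close>
  proof (rule that[of "4 * C" t0])
   show "4 * C \<ge> 0" "t0 > 0" using C t0 by auto
   fix w t assume w: "w \<in> H1 D" and t: "0 < t" "t \<le> t0"
   obtain u1 G1 where u1: "weakg D u1 G1" "AE x in M. Re (w x) = u1 x" "l2 lborel u1 \<le> l2 M w" "l2 lborel G1 \<le> l2 M (wgrad D w)"
    by (rule H1_real_rep[OF w, of Re]) (auto simp: part_def)
   obtain u2 G2 where u2: "weakg D u2 G2" "AE x in M. Im (w x) = u2 x" "l2 lborel u2 \<le> l2 M w" "l2 lborel G2 \<le> l2 M (wgrad D w)"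
    by (rule H1_real_rep[OF w, of Im]) (auto simp: part_def)
   have b: "l2on (ball z t) u \<le> C * (2 * H1_norm D w) * sqrt t"
    if u: "weakg D u G" "l2 lborel u \<le> l2 M w" "l2 lborel G \<le> l2 M (wgrad D w)" for u G
    by (rule order_trans[OF dec[OF weakg_mono[OF u(1) R(2)] t]], intro mult_right_mono mult_left_mono C)
     (use u H1_norm_ge[OF w] t in auto)
   have "l2 M (restr (ball z t) w) \<le> l2on (ball z t) u1 + l2on (ball z t) u2"
   proof (rule l2_parts[OF H1D(1)[OF w]])
    show "sqi lborel u1" "sqi lborel u2" using u1(1) u2(1) by (auto simp: weakg_def)
    show "AE x in M. norm (w x) \<le> norm (u1 x) + norm (u2 x)" using u1(2) u2(2)
     by eventually_elim (metis cmod_le real_norm_def)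
   qed simp
   also have "\<dots> \<le> C * (2 * H1_norm D w) * sqrt t + C * (2 * H1_norm D w) * sqrt t"
    by (intro add_mono b[OF u1(1,3,4)] b[OF u2(1,3,4)])
   finally show "l2 M (restr (ball z t) w) \<le> 4 * C * H1_norm D w * sqrt t" by (simp add: mult_ac)
  qed
 qed
qed

text \<open>Supplies the constant \<open>Kf\<close> that \<open>interior_gradient_decay\<close> asks
  of its right-hand side. By the discrete product rule the increment falls on \<open>w\<close>, on
  the Lipschitz factor \<open>b\<close> or on \<open>h\<close>, and weak gradients control the
  increments of \<open>w\<close> and \<open>h\<close>.\<close>

lemma product_shift_bound:
 fixes b w h :: "real^'d => real"
 assumes w: "weakg (ball z R) w Gw" and h: "weakg (ball z R) h Gh" and k: "norm k < R / 16"
  and b: "b \<in> borel_measurable borel" "!!x. \<bar>b x\<bar> \<le> N" "N \<ge> 0" "Lb \<ge> 0"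
   "!!x y. x \<in> ball z R ==> y \<in> ball z R ==> \<bar>b x - b y\<bar> \<le> Lb * norm (x - y)"
 shows "l2on (ball z (R/2)) (%x. (b (x + k) * w (x + k) + h (x + k)) - (b x * w x + h x))
  \<le> (N * l2 lborel Gw + Lb * l2 lborel w + l2 lborel Gh) * norm k"
proof -
 let ?S = "ball z (R/2)"
 have sw: "sqi lborel w" and sh: "sqi lborel h" using w h by (auto simp: weakg_def)
 have R: "R > 0" using k norm_ge_zero[of k] by linarith
 have sub: "cball (x + s *\<^sub>R k) (R/4) \<subseteq> ball z R" if "x \<in> ?S" "s \<in> {0..1}" for x s
 proof
  fix y assume "y \<in> cball (x + s *\<^sub>R k) (R/4)"
  moreover have "norm (s *\<^sub>R k) \<le> norm k" using that(2) by (simp add: mult_left_le_one_le)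
  moreover have "norm (y - z) \<le> norm (y - (x + s *\<^sub>R k)) + norm (x - z) + norm (s *\<^sub>R k)"
   using norm_triangle_ineq[of "y - (x + s *\<^sub>R k)" "(x - z) + s *\<^sub>R k"] norm_triangle_ineq[of "x - z" "s *\<^sub>R k"] by (simp add: algebra_simps)
  ultimately show "y \<in> ball z R" using that(1) k R by (simp add: dist_norm norm_minus_commute)
 qed
 have dw: "sqi lborel (restr ?S (%x. w (x + k) - w x))" and dh: "sqi lborel (restr ?S (%x. h (x + k) - h x))"
  by (rule sqi_restr[OF _ sqi_diff[OF sqi_shift(1)[OF sw] sw]], simp) (rule sqi_restr[OF _ sqi_diff[OF sqi_shift(1)[OF sh] sh]], simp)
 have ew: "l2on ?S (%x. w (x + k) - w x) \<le> norm k * l2 lborel Gw"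
  by (rule shift_estimate[OF w, where d="R/4"]) (use sub R in auto)
 have eh: "l2on ?S (%x. h (x + k) - h x) \<le> norm k * l2 lborel Gh"
  by (rule shift_estimate[OF h, where d="R/4"]) (use sub R in auto)
 let ?F = "%x. (b (x + k) * w (x + k) + h (x + k)) - (b x * w x + h x)"
 let ?g1 = "%x. N *\<^sub>R norm (restr ?S (%x. w (x + k) - w x) x)"
 let ?g2 = "%x. (Lb * norm k) *\<^sub>R norm (w x)"
 let ?g3 = "%x. norm (restr ?S (%x. h (x + k) - h x) x)"
 have s1: "sqi lborel ?g1" by (rule sqi_scaleR[OF sqi_norm[OF dw]])
 have s2: "sqi lborel ?g2" by (rule sqi_scaleR[OF sqi_norm[OF sw]])
 have s3: "sqi lborel ?g3" by (rule sqi_norm[OF dh])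
 have pt: "norm (restr ?S ?F x) \<le> 1 * norm ((?g1 x + ?g2 x) + ?g3 x)" for x
 proof (cases "x \<in> ?S")
  case True
  have xk: "x \<in> ball z R" "x + k \<in> ball z R" using sub[OF True, of 0] sub[OF True, of 1] R centre_in_cball[of _ "R/4"] by (auto simp del: mem_ball mem_cball)
  have eq: "?F x = b (x + k) * (w (x + k) - w x) + (b (x + k) - b x) * w x + (h (x + k) - h x)" by (simp add: algebra_simps)
  have "\<bar>?F x\<bar> \<le> \<bar>b (x + k)\<bar> * \<bar>w (x + k) - w x\<bar> + \<bar>b (x + k) - b x\<bar> * \<bar>w x\<bar> + \<bar>h (x + k) - h x\<bar>"
   unfolding eq abs_mult[symmetric] by (rule order_trans[OF abs_triangle_ineq add_right_mono[OF abs_triangle_ineq]])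
  also have "\<dots> \<le> N * \<bar>w (x + k) - w x\<bar> + (Lb * norm k) * \<bar>w x\<bar> + \<bar>h (x + k) - h x\<bar>"
   using b(2)[of "x + k"] b(5)[OF xk(2,1)] by (intro add_mono mult_right_mono) auto
  also have "\<dots> = (?g1 x + ?g2 x) + ?g3 x" using True by simp
  finally show ?thesis using True by simp
 next
  case False
  then show ?thesis by simp
 qed
 have Fm: "?F \<in> borel_measurable borel"
 proof -
  have [measurable]: "w \<in> borel_measurable borel" "h \<in> borel_measurable borel" "b \<in> borel_measurable borel" using sw sh b(1) by (auto simp: sqi_def)
  show ?thesis by measurable
 qed
 have "l2on ?S ?F \<le> 1 * l2 lborel (%x. (?g1 x + ?g2 x) + ?g3 x)" unfolding l2on_def
  by (rule sqi_bound(2)[OF _ sqi_add[OF sqi_add[OF s1 s2] s3]]) (use restr_measurable[OF _ Fm, of ?S] pt in auto)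
 also have "\<dots> \<le> (l2 lborel ?g1 + l2 lborel ?g2) + l2 lborel ?g3"
  using l2_triangle[OF sqi_add[OF s1 s2] s3] l2_triangle[OF s1 s2] by linarith
 also have "\<dots> = N * l2on ?S (%x. w (x + k) - w x) + Lb * norm k * l2 lborel w + l2on ?S (%x. h (x + k) - h x)"
  unfolding l2_scaleR l2_norm l2on_def using b(3,4) by simp
 also have "\<dots> \<le> N * (norm k * l2 lborel Gw) + Lb * norm k * l2 lborel w + norm k * l2 lborel Gh"
  by (intro add_mono mult_left_mono ew eh b order_refl)
 finally show ?thesis by (simp add: algebra_simps)
qed

text \<open>The coefficient is cut off outside the ball, which gives global measurability and
  boundedness; the jump does no harm, since differences are taken only between points of the ball.
  Compactness of the closed ball in \<open>D\<close> provides the constants.\<close>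

lemma local_good_coeff:
 assumes a: "elliptic a \<alpha> \<beta>" and C2: "Ck_on 2 D a" and R: "R > 0" "cball z R \<subseteq> D"
 obtains \<Lambda> L Lq where "\<Lambda> \<ge> 0" "L \<ge> 0" "Lq \<ge> 0" "good_coeff z R \<Lambda> \<alpha> L (restr (ball z R) a)"
  "!!x h k \<xi>. {x, x + h, x + k, x + h + k} \<subseteq> ball z R ==>
    norm ((restr (ball z R) a (x + h + k) - restr (ball z R) a (x + h) - (restr (ball z R) a (x + k) - restr (ball z R) a x)) *v \<xi>)
     \<le> Lq * norm h * norm k * norm \<xi>"
proof -
 have C2': "Ck_on (Suc (Suc 0)) D a" using C2 by (simp add: numeral_2_eq_2)
 let ?N = "real CARD('d)"
 obtain K where K: "K \<ge> 0" "!!x. x \<in> cball z R ==> norm (a x) \<le> K"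
  by (rule Ck_on_bounded_on_compact[OF D(1) C2' compact_cball R(2)]) blast
 obtain L where L: "L \<ge> 0" "!!x y. x \<in> ball z R ==> y \<in> ball z R ==> norm (a x - a y) \<le> L * norm (x - y)"
  by (rule C1_lipschitz[OF D(1) C2' R(2)]) blast
 obtain Q where Q: "Q \<ge> 0" "!!x h k. {x, x + h, x + k, x + h + k} \<subseteq> ball z R ==>
  norm (a (x + h + k) - a (x + h) - (a (x + k) - a x)) \<le> Q * norm h * norm k"
  by (rule C2_second_difference[OF D(1) C2' R(2)]) blast
 have mv: "norm (A *v \<xi>) \<le> ?N * B * norm \<xi>" if "norm A \<le> B" for A :: "real^'d^'d" and B \<xi>
  by (rule order_trans[OF matrix_vector_norm_le], intro mult_right_mono mult_left_mono that) auto
 show thesis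
 proof (rule that[of "?N * K" "?N * L" "?N * Q"])
  show "?N * K \<ge> 0" "?N * L \<ge> 0" "?N * Q \<ge> 0" using K L Q by auto
  show "good_coeff z R (?N * K) \<alpha> (?N * L) (restr (ball z R) a)" unfolding good_coeff_def
  proof (intro conjI allI ballI)
   have "continuous_on (ball z R) a" by (rule continuous_on_subset[OF Ck_on_continuous[OF D(1) C2]]) (use R ball_subset_cball in blast)
   then show "restr (ball z R) a \<in> borel_measurable borel" by (intro borel_measurable_continuous_on_indicator) auto
   show "norm (restr (ball z R) a x *v \<xi>) \<le> ?N * K * norm \<xi>" for x \<xi>
    by (rule mv) (use K in \<open>auto simp: indicator_def\<close>)
   show "norm ((restr (ball z R) a x - restr (ball z R) a y) *v \<xi>) \<le> ?N * L * norm (x - y) * norm \<xi>"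
    if "x \<in> ball z R" "y \<in> ball z R" for x y \<xi>
    using mv[OF L(2)[OF that], of \<xi>] that by (simp add: mult_ac)
   fix x and \<xi> :: "real^'d" assume x: "x \<in> ball z R"
   have xD: "x \<in> D" using x R by auto
   \<comment> \<open>Ellipticity is stated for complex vectors and is specialised to real ones
     here.\<close>
   let ?c = "\<chi> i. complex_of_real (\<xi> $ i)"
   have v: "vpart Re ?c = \<xi>" by (simp add: vpart_def vec_eq_iff)
   have n: "norm ?c = norm \<xi>" by (rule power2_eq_imp_eq) (simp_all add: norm_vec_sq)
   have "\<alpha> * (norm ?c)\<^sup>2 \<le> Re (hdot (cmat (a x) *v ?c) ?c)" using a xD by (simp add: elliptic_def)
   also have "\<dots> = (a x *v vpart Re ?c) \<bullet> \<xi>" by (rule part_hdot_real) (simp add: part_def)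
   finally show "\<alpha> * (norm \<xi>)\<^sup>2 \<le> (restr (ball z R) a x *v \<xi>) \<bullet> \<xi>" unfolding v n using x by simp
  qed
  fix x h k \<xi> assume s: "{x, x + h, x + k, x + h + k} \<subseteq> ball z R"
  have "norm ((a (x + h + k) - a (x + h) - (a (x + k) - a x)) *v \<xi>) \<le> ?N * (Q * norm h * norm k) * norm \<xi>"
   by (rule mv[OF Q(2)[OF s]])
  moreover have "restr (ball z R) a y = a y" if "y \<in> {x, x + h, x + k, x + h + k}" for y using s that by (auto simp: indicator_def)
  ultimately show "norm ((restr (ball z R) a (x + h + k) - restr (ball z R) a (x + h) - (restr (ball z R) a (x + k) - restr (ball z R) a x)) *v \<xi>)
     \<le> ?N * Q * norm h * norm k * norm \<xi>" by (simp add: mult_ac)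
 qed
qed

text \<open>A real test function makes conjugation trivial, so the projection can be pulled through
  both integrals. Its support in \<open>S\<close> allows the coefficients to be truncated to
  \<open>S\<close>.\<close>

lemma real_equation:
 assumes a: "coef a C UNIV" and b: "bcoef b Cb UNIV" and y: "y \<in> H1 D" and w: "w \<in> H1 D" and h: "h \<in> H1 D" and p: "part p"
  and eq: "!!\<phi>. test_function D \<phi> ==> IA a y \<phi> = IB b w \<phi> + IB one_fun h \<phi>"
  and S: "S \<subseteq> D" and \<psi>: "rtest S \<psi>"
  and Gy: "AE x in M. vpart p (wgrad D y x) = Gy x" "Gy \<in> borel_measurable borel"
  and w': "AE x in M. p (w x) = w' x" "w' \<in> borel_measurable borel" and h': "AE x in M. p (h x) = h' x" "h' \<in> borel_measurable borel"
  and bm: "restr S a \<in> borel_measurable borel" "restr S b \<in> borel_measurable borel"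
 shows "(\<integral>x. (restr S a x *v Gy x) \<bullet> grad \<psi> x \<partial>lborel) = (\<integral>x. (restr S b x * w' x + h' x) * \<psi> x \<partial>lborel)"
proof -
 note bl = part_props(1)[OF p]
 have \<psi>D: "rtest D \<psi>" by (rule rtest_mono[OF \<psi> S])
 note t = rtest_test_function(1)[OF \<psi>D]
 let ?\<phi> = "%x. complex_of_real (\<psi> x)"
 have tH: "?\<phi> \<in> H1 D" by (rule test_H1(1)[OF t])
 have z: "\<psi> x = 0" "grad \<psi> x = 0" if "x \<notin> S" for x
 proof -
  obtain K where K: "compact K" "K \<subseteq> S" "!!x. x \<notin> K ==> \<psi> x = 0" using \<psi> unfolding rtest_def by blast
  have "x \<notin> K" using K(2) that by blast
  then show "\<psi> x = 0" "grad \<psi> x = 0" using K(3) rtest_grad_support[OF \<psi> K(1) K(3)] by auto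
 qed
 have mm: "\<psi> \<in> borel_measurable borel" "grad \<psi> \<in> borel_measurable borel"
  using rtest_sqi[OF \<psi>] rtest_grad_sqi[OF \<psi>] by (auto simp: sqi_def)
 have g: "AE x in M. wgrad D ?\<phi> x = (\<chi> i. complex_of_real (grad \<psi> x $ i))"
  using test_H1(2)[OF t] by eventually_elim (simp add: rtest_test_function(2)[OF \<psi>D] inner_axis)
 have cont: "f \<in> borel_measurable M ==> (%x. p (f x)) \<in> borel_measurable M" for f
  by (rule measurable_compose[of f _ borel]) (auto intro: borel_measurable_continuous_onI linear_continuous_on[OF bl])
 have "p (IA a y ?\<phi>) = (\<integral>x. p (hdot (cmat (a x) *v wgrad D y x) (wgrad D ?\<phi> x)) \<partial>M)"
  unfolding IA_def by (rule integral_bounded_linear[OF bl IA_bound(1)[OF a y tH], symmetric])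
 also have "\<dots> = (\<integral>x. (restr S a x *v Gy x) \<bullet> grad \<psi> x \<partial>lborel)"
 proof (rule integral_rep)
  show "AE x in M. p (hdot (cmat (a x) *v wgrad D y x) (wgrad D ?\<phi> x)) = (restr S a x *v Gy x) \<bullet> grad \<psi> x"
   using Gy(1) g
  proof eventually_elim
   case (elim x)
   have "p (hdot (cmat (a x) *v wgrad D y x) (wgrad D ?\<phi> x)) = (a x *v Gy x) \<bullet> grad \<psi> x"
    unfolding elim(2) part_hdot_real[OF p] elim(1) ..
   then show ?case using z(2)[of x] by (cases "x \<in> S") auto
  qed
  show "(%x. p (hdot (cmat (a x) *v wgrad D y x) (wgrad D ?\<phi> x))) \<in> borel_measurable M"
   using IA_bound(1)[OF a y tH] by (intro cont) auto
  show "(%x. (restr S a x *v Gy x) \<bullet> grad \<psi> x) \<in> borel_measurable borel"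
   by (intro borel_measurable_inner matrix_vector_measurable bm mm Gy)
  show "(restr S a x *v Gy x) \<bullet> grad \<psi> x = 0" if "x \<notin> D" for x using z(2)[of x] S that by (metis inner_zero_right subsetD)
 qed
 finally have L: "(\<integral>x. (restr S a x *v Gy x) \<bullet> grad \<psi> x \<partial>lborel) = p (IA a y ?\<phi>)" by simp
 note i1 = IB_bound(1)[OF b w tH] and i2 = IB_bound(1)[OF bcoef_one h tH]
 have "p (IB b w ?\<phi> + IB one_fun h ?\<phi>) = p (\<integral>x. complex_of_real (b x) * w x * cnj (?\<phi> x) + complex_of_real 1 * h x * cnj (?\<phi> x) \<partial>M)"
  unfolding IB_def using Bochner_Integration.integral_add[OF i1 i2] by simp
 also have "\<dots> = (\<integral>x. p (complex_of_real (b x) * w x * cnj (?\<phi> x) + complex_of_real 1 * h x * cnj (?\<phi> x)) \<partial>M)"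
  by (rule integral_bounded_linear[OF bl Bochner_Integration.integrable_add[OF i1 i2], symmetric])
 also have "\<dots> = (\<integral>x. (restr S b x * w' x + h' x) * \<psi> x \<partial>lborel)"
 proof (rule integral_rep)
  show "AE x in M. p (complex_of_real (b x) * w x * cnj (?\<phi> x) + complex_of_real 1 * h x * cnj (?\<phi> x)) = (restr S b x * w' x + h' x) * \<psi> x"
   using w'(1) h'(1)
  proof eventually_elim
   case (elim x)
   have "p (complex_of_real (b x) * w x * cnj (?\<phi> x) + complex_of_real 1 * h x * cnj (?\<phi> x)) = b x * w' x * \<psi> x + h' x * \<psi> x"
    using elim by (simp add: part_props[OF p] mult.assoc)
   then show ?case using z(1)[of x] by (cases "x \<in> S") (auto simp: distrib_right)
  qed
  show "(%x. p (complex_of_real (b x) * w x * cnj (?\<phi> x) + complex_of_real 1 * h x * cnj (?\<phi> x))) \<in> borel_measurable M"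
   using Bochner_Integration.integrable_add[OF i1 i2] by (intro cont) auto
  show "(%x. (restr S b x * w' x + h' x) * \<psi> x) \<in> borel_measurable borel"
   by (intro borel_measurable_times borel_measurable_add bm mm w' h')
  show "(restr S b x * w' x + h' x) * \<psi> x = 0" if "x \<notin> D" for x using z(1)[of x] S that by auto
 qed
 finally show ?thesis using L eq[OF t] by simp
qed

text \<open>\<open>interior_gradient_decay\<close> for complex solutions: it is applied to both
  parts with right-hand side \<open>b w + h\<close>, where a \<open>C^1\<close> factor
  \<open>b\<close> and Sobolev functions \<open>w\<close>, \<open>h\<close> give the required first
  differences.\<close>

theorem gradient_decay:
 assumes dim: "CARD('d) \<in> {2, 3}" and R: "R > 0" "cball z R \<subseteq> D"
  and a: "elliptic a \<alpha> \<beta>" and C2: "Ck_on 2 D a" and b: "bcoef b Cb UNIV" "Ck_on 1 D b"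
 obtains C t0 where "C \<ge> 0" "t0 > 0"
  "!!y w h t. y \<in> H1 D ==> w \<in> H1 D ==> h \<in> H1 D ==>
    (!!\<phi>. test_function D \<phi> ==> IA a y \<phi> = IB b w \<phi> + IB one_fun h \<phi>) ==> 0 < t ==> t \<le> t0 ==>
    l2 M (restr (ball z t) (wgrad D y)) \<le> C * (H1_norm D y + H1_norm D w + H1_norm D h) * sqrt (t ^ CARD('d))"
proof -
 let ?S = "ball z R"
 have SD: "?S \<subseteq> D" using R(2) ball_subset_cball by blast
 obtain \<Lambda> L Lq where lam: "\<Lambda> \<ge> 0" "L \<ge> 0" "Lq \<ge> 0" and gc: "good_coeff z R \<Lambda> \<alpha> L (restr ?S a)"
  and sd: "!!x h k \<xi>. {x, x + h, x + k, x + h + k} \<subseteq> ?S ==>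
    norm ((restr ?S a (x + h + k) - restr ?S a (x + h) - (restr ?S a (x + k) - restr ?S a x)) *v \<xi>)
     \<le> Lq * norm h * norm k * norm \<xi>"
  by (rule local_good_coeff[OF a C2 R]) blast
 have al: "\<alpha> > 0" using a by (simp add: elliptic_def)
 have b1: "Ck_on (Suc 0) D b" using b(2) by simp
 obtain Lb where Lb: "Lb \<ge> 0" "!!x y. x \<in> ?S ==> y \<in> ?S ==> norm (b x - b y) \<le> Lb * norm (x - y)"
  by (rule C1_lipschitz[OF D(1) b1 R(2)]) blast
 have Cb: "Cb \<ge> 0" using b(1) by (simp add: bcoef_def)
 have bm: "restr ?S b \<in> borel_measurable borel"
  using continuous_on_subset[OF Ck_on_continuous[OF D(1) b1] SD] by (intro borel_measurable_continuous_on_indicator) auto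
 have bN: "\<bar>restr ?S b x\<bar> \<le> Cb" for x using b(1) SD Cb by (auto simp: bcoef_def indicator_def)
 have bL: "\<bar>restr ?S b x - restr ?S b y\<bar> \<le> Lb * norm (x - y)" if "x \<in> ?S" "y \<in> ?S" for x y
  using Lb(2)[OF that] that by simp
 show thesis
 proof (rule interior_gradient_decay[OF dim R(1) al lam, of z])
  fix C t0 :: real
  assume C: "C \<ge> 0" and t0: "t0 > 0" and dec: "!!a w G f Kf t. good_coeff z R \<Lambda> \<alpha> L a ==>
    (!!x h k \<xi>. {x, x + h, x + k, x + h + k} \<subseteq> ball z R ==> norm ((a (x + h + k) - a (x + h) - (a (x + k) - a x)) *v \<xi>) \<le> Lq * norm h * norm k * norm \<xi>) ==>
    weakg (ball z R) w G ==> sqi lborel f ==>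
    (!!\<psi>. rtest (ball z R) \<psi> ==> (\<integral>x. (a x *v G x) \<bullet> grad \<psi> x \<partial>lborel) = (\<integral>x. f x * \<psi> x \<partial>lborel)) ==>
    (!!k. norm k < R/16 ==> l2on (ball z (R/2)) (%x. f (x + k) - f x) \<le> Kf * norm k) ==> Kf \<ge> 0 ==> 0 < t ==> t \<le> t0 ==>
    l2on (ball z t) G \<le> C * (l2 lborel G + l2 lborel f + Kf) * sqrt (t ^ CARD('d))"
  \<comment> \<open>\<open>Cb\<close> is counted once for the size and once for the differences of
    the right-hand side, \<open>Lb\<close> for the variation of \<open>b\<close>; the 2 covers
    \<open>h\<close> in both roles and the gradient of \<open>y\<close>. The further factor 2 in the
    final constant adds the two parts.\<close>
  let ?K = "2 * Cb + Lb + 2"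
  show thesis
  proof (rule that[of "2 * (C * ?K)" t0])
   show "2 * (C * ?K) \<ge> 0" "t0 > 0" using C Cb Lb t0 by auto
   fix y w h t assume y: "y \<in> H1 D" and w: "w \<in> H1 D" and h: "h \<in> H1 D"
    and eq: "!!\<phi>. test_function D \<phi> ==> IA a y \<phi> = IB b w \<phi> + IB one_fun h \<phi>" and t: "0 < t" "t \<le> t0"
   let ?n = "H1_norm D y + H1_norm D w + H1_norm D h"
   have ex: "\<exists>G. sqi lborel G \<and> (AE x in M. vpart p (wgrad D y x) = G x) \<and> l2on (ball z t) G \<le> C * (?K * ?n) * sqrt (t ^ CARD('d))" if p: "part p" for p
   proof -
    obtain y' Gy where y': "weakg D y' Gy" "AE x in M. vpart p (wgrad D y x) = Gy x" "l2 lborel y' \<le> l2 M y" "l2 lborel Gy \<le> l2 M (wgrad D y)"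
     by (rule H1_real_rep[OF y p]) blast
    obtain w' Gw where w': "weakg D w' Gw" "AE x in M. p (w x) = w' x" "l2 lborel w' \<le> l2 M w" "l2 lborel Gw \<le> l2 M (wgrad D w)"
     by (rule H1_real_rep[OF w p]) blast
    obtain h' Gh where h': "weakg D h' Gh" "AE x in M. p (h x) = h' x" "l2 lborel h' \<le> l2 M h" "l2 lborel Gh \<le> l2 M (wgrad D h)"
     by (rule H1_real_rep[OF h p]) blast
    have s: "sqi lborel Gy" "sqi lborel w'" "sqi lborel h'" using y'(1) w'(1) h'(1) by (auto simp: weakg_def)
    let ?f = "%x. restr ?S b x * w' x + h' x"
    let ?Kf = "Cb * l2 lborel Gw + Lb * l2 lborel w' + l2 lborel Gh"
    have bm': "restr ?S b \<in> borel_measurable lborel" using bm by simp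
    note mb = sqi_mult_bounded[OF bm' s(2) bN, unfolded real_scaleR_def]
    have sf: "sqi lborel ?f" by (rule sqi_add[OF _ s(3)]) (use mb(1) in simp)
    have lf: "l2 lborel ?f \<le> Cb * l2 lborel w' + l2 lborel h'"
     using l2_triangle[OF _ s(3), of "%x. restr ?S b x * w' x"] mb by simp
    have e: "(\<integral>x. (restr ?S a x *v Gy x) \<bullet> grad \<psi> x \<partial>lborel) = (\<integral>x. ?f x * \<psi> x \<partial>lborel)" if "rtest ?S \<psi>" for \<psi>
     by (rule real_equation[OF elliptic_coef[OF a] b(1) y w h p eq SD that y'(2) _ w'(2) _ h'(2) _ _ bm])
      (use s gc in \<open>auto simp: sqi_def good_coeff_def\<close>)
    have sh: "l2on (ball z (R/2)) (%x. ?f (x + k) - ?f x) \<le> ?Kf * norm k" if k: "norm k < R / 16" for k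
     by (rule product_shift_bound[OF weakg_mono[OF w'(1) SD] weakg_mono[OF h'(1) SD] k bm bN Cb Lb(1) bL])
    have Kf: "?Kf \<ge> 0" using Cb Lb(1) by simp
    have "l2on (ball z t) Gy \<le> C * (l2 lborel Gy + l2 lborel ?f + ?Kf) * sqrt (t ^ CARD('d))"
     by (rule dec[OF gc sd weakg_mono[OF y'(1) SD] sf e sh Kf t])
    also have "\<dots> \<le> C * (?K * ?n) * sqrt (t ^ CARD('d))"
    proof (intro mult_right_mono mult_left_mono C)
     have n: "l2 lborel Gy \<le> H1_norm D y" "l2 lborel w' \<le> H1_norm D w" "l2 lborel Gw \<le> H1_norm D w" "l2 lborel h' \<le> H1_norm D h" "l2 lborel Gh \<le> H1_norm D h"
      using y' w' h' H1_norm_ge[OF y] H1_norm_ge[OF w] H1_norm_ge[OF h] by linarith+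
     have "l2 lborel Gy + l2 lborel ?f + ?Kf \<le> H1_norm D y + (Cb * H1_norm D w + H1_norm D h) + (Cb * H1_norm D w + Lb * H1_norm D w + H1_norm D h)"
      using lf n Cb Lb(1) mult_left_mono[OF n(2) Cb] mult_left_mono[OF n(3) Cb] mult_left_mono[OF n(2) Lb(1)] by linarith
     also have "\<dots> \<le> (2 * Cb + Lb) * H1_norm D w + 2 * ?n"
      using H1_norm_nonneg[OF y] H1_norm_nonneg[OF w] by (simp add: algebra_simps)
     also have "(2 * Cb + Lb) * H1_norm D w \<le> (2 * Cb + Lb) * ?n"
      using H1_norm_nonneg[OF y] H1_norm_nonneg[OF h] Cb Lb(1) by (intro mult_left_mono) auto
     finally show "l2 lborel Gy + l2 lborel ?f + ?Kf \<le> ?K * ?n" by (simp add: algebra_simps)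
    qed (use t in simp)
    finally show ?thesis using s(1) y'(2) by blast
   qed
   obtain G1 where G1: "sqi lborel G1" "AE x in M. vpart Re (wgrad D y x) = G1 x" "l2on (ball z t) G1 \<le> C * (?K * ?n) * sqrt (t ^ CARD('d))"
    using ex[of Re] by (auto simp: part_def)
   obtain G2 where G2: "sqi lborel G2" "AE x in M. vpart Im (wgrad D y x) = G2 x" "l2on (ball z t) G2 \<le> C * (?K * ?n) * sqrt (t ^ CARD('d))"
    using ex[of Im] by (auto simp: part_def)
   have "l2 M (restr (ball z t) (wgrad D y)) \<le> l2on (ball z t) G1 + l2on (ball z t) G2"
   proof (rule l2_parts[OF H1D(3)[OF y] G1(1) G2(1)])
    show "AE x in M. norm (wgrad D y x) \<le> norm (G1 x) + norm (G2 x)" using G1(2) G2(2)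
     by eventually_elim (metis norm_vpart_sum)
   qed simp
   also have "\<dots> \<le> C * (?K * ?n) * sqrt (t ^ CARD('d)) + C * (?K * ?n) * sqrt (t ^ CARD('d))" using G1(3) G2(3) by linarith
   also have "\<dots> = 2 * (C * ?K) * ?n * sqrt (t ^ CARD('d))" by simp
   finally show "l2 M (restr (ball z t) (wgrad D y)) \<le> 2 * (C * ?K) * ?n * sqrt (t ^ CARD('d))" .
  qed
 qed
qed

end

section \<open>Estimates uniform over all inclusions and perturbations\<close>

text \<open>The decay constants and radii depend on the centre; over finitely many centres the
  largest constant and the smallest radius serve all.\<close>

lemma finite_common_constants:
 fixes P :: "'i => real => real => bool"
 assumes "finite I" and ex: "!!i. i \<in> I ==> \<exists>C t. 0 \<le> C \<and> 0 < t \<and> P i C t"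
  and mono: "!!i C t C' t'. P i C t ==> C \<le> C' ==> t' \<le> t ==> 0 \<le> C ==> 0 < t' ==> P i C' t'"
 shows "\<exists>C t. 0 \<le> C \<and> 0 < t \<and> (\<forall>i\<in>I. P i C t)"
 using assms(1) ex
proof (induction I rule: finite_induct)
 case empty
 show ?case by (intro exI[of _ 0] exI[of _ 1]) simp
next
 case (insert j I)
 obtain C t where C: "0 \<le> C" "0 < t" "!!i. i \<in> I ==> P i C t" using insert.IH insert.prems by blast
 obtain C' t' where C': "0 \<le> C'" "0 < t'" "P j C' t'" using insert.prems by blast
 have "P i (max C C') (min t t')" if "i \<in> insert j I" for i
 proof (cases "i = j")
  case True
  then show ?thesis using mono[OF C'(3), of "max C C'" "min t t'"] C C' by simp
 next
  case False
  then show ?thesis using mono[OF C(3), of i "max C C'" "min t t'"] C C' that by simp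
 qed
 then show ?case using C C' by (intro exI[of _ "max C C'"] exI[of _ "min t t'"]) auto
qed

lemma real_of_ereal_compare:
 assumes "ereal (real_of_ereal x) = x"
 shows "ereal r < x ==> r < real_of_ereal x" "x < ereal r ==> real_of_ereal x < r"
 by (subst (asm) assms[symmetric], simp only: less_ereal.simps)+

context bdd_domain
begin

lemma l2_restr_Union:
 fixes f :: "real^'d => 'b::euclidean_space"
 assumes I: "finite I" and f: "sqi M f" and S: "!!i. i \<in> I ==> S i \<in> sets borel"
 shows "l2 M (restr (\<Union>i\<in>I. S i) f) \<le> (\<Sum>i\<in>I. l2 M (restr (S i) f))"
proof -
 let ?g = "%x. \<Sum>i\<in>I. norm (restr (S i) f x)"
 have s: "sqi M (%x. norm (restr (S i) f x))" if "i \<in> I" for i by (rule sqi_norm[OF sqi_restr_M(1)[OF S[OF that] f]])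
 have U: "(\<Union>i\<in>I. S i) \<in> sets borel" using I S by (intro sets.finite_UN) auto
 have "l2 M (restr (\<Union>i\<in>I. S i) f) \<le> 1 * l2 M ?g"
 proof (rule sqi_bound(2)[OF _ sqi_sum[OF s]])
  show "restr (\<Union>i\<in>I. S i) f \<in> borel_measurable M" using sqi_restr_M(1)[OF U f] by (simp add: sqi_def)
  have "norm (restr (\<Union>i\<in>I. S i) f x) \<le> ?g x" for x
  proof (cases "x \<in> (\<Union>i\<in>I. S i)")
   case True
   then obtain i where i: "i \<in> I" "x \<in> S i" by blast
   have "norm (restr (S i) f x) \<le> ?g x" by (rule member_le_sum[OF i(1)]) (use I in auto)
   then show ?thesis using True i by simp
  next
   case False
   then show ?thesis by (simp add: sum_nonneg)
  qed
  then show "AE x in M. norm (restr (\<Union>i\<in>I. S i) f x) \<le> 1 * norm (?g x)"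
   unfolding mult_1 real_norm_def by (intro AE_I2) (rule order_trans[OF _ abs_ge_self])
 qed auto
 also have "\<dots> \<le> (\<Sum>i\<in>I. l2 M (%x. norm (restr (S i) f x)))" using l2_sum[OF I s] by simp
 finally show ?thesis by (simp only: l2_norm)
qed

text \<open>For a test function \<open>\<phi>\<close> the pair with second component 0 lies in
  \<open>X D\<close>, which isolates the equation of the first component. Its zeroth-order terms,
  from \<open>form_A\<close> and from \<open>form_C\<close>, are gathered in the Sobolev function
  \<open>h\<close>.\<close>

lemma T_op_interior_equation:
 assumes wp: "wellposed a \<kappa> c" and b: "bcoef b C UNIV" and u: "u \<in> X D"
 obtains h where "h \<in> H1 D" "!!\<phi>. test_function D \<phi> ==> IA a (fst (T_op D a b \<kappa> \<tau> u)) \<phi> = IB b (fst u) \<phi> + IB one_fun h \<phi>"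
  "H1_norm D h \<le> cmod (complex_of_real \<kappa> / \<tau>) * H1_norm D (fst u) + \<bar>\<kappa>\<bar> * H1_norm D (fst (T_op D a b \<kappa> \<tau> u))"
proof -
 define Y where "Y = T_op D a b \<kappa> \<tau> u"
 note Y = T_op_spec[OF wp b u, where \<tau>=\<tau>, folded Y_def]
 obtain Ca where cf: "coef a Ca UNIV" using wp unfolding wellposed_def by blast
 note w = X_H1(1)[OF u] and y = X_H1(1)[OF Y(1)]
 let ?h1 = "%x. (complex_of_real \<kappa> / \<tau>) * fst u x" and ?h2 = "%x. (- complex_of_real \<kappa>) * fst Y x"
 note h1 = H1_scl(1)[OF w, of "complex_of_real \<kappa> / \<tau>"] and h2 = H1_scl(1)[OF y, of "- complex_of_real \<kappa>"]
 note s = IB_sesq[OF bcoef_one, unfolded sesq_def]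
 have z: "H1_inner D v 0 = 0" if "v \<in> H1 D" for v
  using H1.ip_scl_right[OF H1_zero that, of 0] by (simp add: zero_fun_def)
 show thesis
 proof (rule that[of "?h1 + ?h2"])
  show "?h1 + ?h2 \<in> H1 D" by (rule H1.V_add[OF h1 h2])
  show "H1_norm D (?h1 + ?h2) \<le> cmod (complex_of_real \<kappa> / \<tau>) * H1_norm D (fst u) + \<bar>\<kappa>\<bar> * H1_norm D (fst (T_op D a b \<kappa> \<tau> u))"
   using H1.nrm_triangle[OF h1 h2] H1.nrm_scl[OF w, of "complex_of_real \<kappa> / \<tau>"] H1.nrm_scl[OF y, of "- complex_of_real \<kappa>"]
   unfolding H1_nrm Y_def[symmetric] by simp
  fix \<phi> assume t: "test_function D \<phi>"
  note p = test_H1(1)[OF t]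
  have pX: "(\<phi>, 0) \<in> X D" using p H1_zero H10_test[OF t] by (simp add: X_iff)
  have k: "IB (%x. \<kappa>) (fst u) \<phi> = complex_of_real \<kappa> * IB one_fun (fst u) \<phi>" by (simp add: IB_def mult.assoc)
  have z0: "IB one_fun v 0 = 0" for v by (simp add: IB_def)
  have e0: "IA a (fst Y) \<phi> + complex_of_real \<kappa> * IB one_fun (fst Y) \<phi> = IB b (fst u) \<phi> + (1/\<tau>) * (complex_of_real \<kappa> * IB one_fun (fst u) \<phi>)"
   using Y(2)[OF pX] unfolding form_A_eq[OF cf Y(1) pX] form_C_eq_B form_B_eq[OF b u pX] form_B_eq[OF bcoef_const u pX] EA_def
    fst_conv snd_conv z[OF X_H1(2)[OF Y(1)]] z0 k by simp
  have e1: "IB one_fun (?h1 + ?h2) \<phi> = IB one_fun ?h1 \<phi> + IB one_fun ?h2 \<phi>" using s h1 h2 p by blast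
  have e2: "IB one_fun ?h1 \<phi> = complex_of_real \<kappa> / \<tau> * IB one_fun (fst u) \<phi>" using s w p by blast
  have e3: "IB one_fun ?h2 \<phi> = - complex_of_real \<kappa> * IB one_fun (fst Y) \<phi>" using s y p by blast
  show "IA a (fst (T_op D a b \<kappa> \<tau> u)) \<phi> = IB b (fst u) \<phi> + IB one_fun (?h1 + ?h2) \<phi>"
   unfolding Y_def[symmetric] e1 e2 e3 using e0 by (simp add: algebra_simps)
 qed
qed

text \<open>\<open>K\<close> and \<open>t0\<close> are fixed before the perturbed coefficients,
  hence uniform in them: they come from decay for the background problem alone. The term with
  \<open>sqrt t\<close> stems from the zeroth-order perturbation and carries its size
  \<open>Cd\<close> as a factor, so it can be switched off.\<close>

theorem perturbation_estimate:
 fixes z :: "nat => real^'d"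
 assumes dim: "CARD('d) \<in> {2, 3}" and a: "elliptic a \<alpha> \<beta>" "Ck_on 2 D a" and b: "bcoef b N UNIV" "Ck_on 1 D b"
  and wp: "wellposed a \<kappa> c" and I: "finite I" "z ` I \<subseteq> D"
 shows "\<exists>K t0. 0 \<le> K \<and> 0 < t0 \<and> (\<forall>a' \<alpha>' \<beta>' b' N' Cd c' t u. elliptic a' \<alpha>' \<beta>' --> wellposed a' \<kappa> c' --> bcoef b' N' UNIV -->
  0 < t --> t \<le> t0 --> (\<forall>x\<in>D. x \<notin> (\<Union>m\<in>I. ball (z m) t) --> a x = a' x) --> bcoef (%x. b' x - b x) Cd (\<Union>m\<in>I. ball (z m) t) -->
  u \<in> X D --> X_norm D u \<le> 1 -->
  X_norm D (T_op D a' b' \<kappa> \<tau> u - T_op D a b \<kappa> \<tau> u) \<le> 3 * (Cd * (K * sqrt t) + (\<beta> + \<beta>') * (K * sqrt (t ^ CARD('d)))) / c')"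
proof -
 define P1 where "P1 = (%m C t0. \<forall>w\<in>H1 D. \<forall>t. 0 < t --> t \<le> t0 --> l2 M (restr (ball (z m) t) w) \<le> C * H1_norm D w * sqrt t)"
 define P2 where "P2 = (%m C t0. \<forall>y\<in>H1 D. \<forall>w\<in>H1 D. \<forall>h\<in>H1 D. (\<forall>\<phi>. test_function D \<phi> --> IA a y \<phi> = IB b w \<phi> + IB one_fun h \<phi>) -->
  (\<forall>t. 0 < t --> t \<le> t0 --> l2 M (restr (ball (z m) t) (wgrad D y)) \<le> C * (H1_norm D y + H1_norm D w + H1_norm D h) * sqrt (t ^ CARD('d))))"
 have R: "\<exists>R>0. cball (z m) R \<subseteq> D" if "m \<in> I" for m
  using open_contains_cball[of D] D(1) I(2) that by (meson imageI subsetD)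
 have e1: "\<exists>C t. 0 \<le> C \<and> 0 < t \<and> P1 m C t" if m: "m \<in> I" for m
 proof -
  obtain R where R: "R > 0" "cball (z m) R \<subseteq> D" using R[OF m] by blast
  have Rb: "ball (z m) R \<subseteq> D" using R(2) ball_subset_cball by blast
  show ?thesis
  proof (rule H1_decay[OF dim R(1) Rb])
   fix C t0 :: real assume h: "0 \<le> C" "0 < t0" "!!w t. w \<in> H1 D ==> 0 < t ==> t \<le> t0 ==> l2 M (restr (ball (z m) t) w) \<le> C * H1_norm D w * sqrt t"
   have "P1 m C t0" unfolding P1_def by (intro ballI allI impI) (rule h(3))
   then show ?thesis using h(1,2) by (intro exI[of _ C] exI[of _ t0]) simp
  qed
 qed
 have e2: "\<exists>C t. 0 \<le> C \<and> 0 < t \<and> P2 m C t" if m: "m \<in> I" for m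
 proof -
  obtain R where R: "R > 0" "cball (z m) R \<subseteq> D" using R[OF m] by blast
  show ?thesis
  proof (rule gradient_decay[OF dim R a b])
   fix C t0 :: real assume h: "0 \<le> C" "0 < t0" "!!y w h t. y \<in> H1 D ==> w \<in> H1 D ==> h \<in> H1 D ==>
    (!!\<phi>. test_function D \<phi> ==> IA a y \<phi> = IB b w \<phi> + IB one_fun h \<phi>) ==> 0 < t ==> t \<le> t0 ==>
    l2 M (restr (ball (z m) t) (wgrad D y)) \<le> C * (H1_norm D y + H1_norm D w + H1_norm D h) * sqrt (t ^ CARD('d))"
   have "P2 m C t0" unfolding P2_def
   proof (intro ballI allI impI)
    fix y w h t assume i: "y \<in> H1 D" "w \<in> H1 D" "h \<in> H1 D" "\<forall>\<phi>. test_function D \<phi> --> IA a y \<phi> = IB b w \<phi> + IB one_fun h \<phi>" "0 < t" "t \<le> t0"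
    show "l2 M (restr (ball (z m) t) (wgrad D y)) \<le> C * (H1_norm D y + H1_norm D w + H1_norm D h) * sqrt (t ^ CARD('d))"
     by (rule h(3)[OF i(1-3) i(4)[rule_format] i(5,6)])
   qed
   then show ?thesis using h(1,2) by (intro exI[of _ C] exI[of _ t0]) simp
  qed
 qed
 have m1: "P1 m C' t'" if h: "P1 m C t" "C \<le> C'" "t' \<le> t" for m C t C' t'
  unfolding P1_def
 proof (intro ballI allI impI)
  fix w s assume w: "w \<in> H1 D" and s: "0 < s" "s \<le> t'"
  have "l2 M (restr (ball (z m) s) w) \<le> C * H1_norm D w * sqrt s" using h(1,3) w s unfolding P1_def by (meson order_trans)
  also have "\<dots> \<le> C' * H1_norm D w * sqrt s" using h(2) H1_norm_nonneg[OF w] s by (intro mult_right_mono) auto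
  finally show "l2 M (restr (ball (z m) s) w) \<le> C' * H1_norm D w * sqrt s" .
 qed
 have m2: "P2 m C' t'" if h: "P2 m C t" "C \<le> C'" "t' \<le> t" for m C t C' t'
  unfolding P2_def
 proof (intro ballI allI impI)
  fix y w g s assume i: "y \<in> H1 D" "w \<in> H1 D" "g \<in> H1 D" and e: "\<forall>\<phi>. test_function D \<phi> --> IA a y \<phi> = IB b w \<phi> + IB one_fun g \<phi>" and s: "0 < s" "s \<le> t'"
  have st: "s \<le> t" using s h(3) by simp
  have "l2 M (restr (ball (z m) s) (wgrad D y)) \<le> C * (H1_norm D y + H1_norm D w + H1_norm D g) * sqrt (s ^ CARD('d))"
   by (rule h(1)[unfolded P2_def, rule_format, OF i _ s(1) st]) (use e in blast)
  also have "\<dots> \<le> C' * (H1_norm D y + H1_norm D w + H1_norm D g) * sqrt (s ^ CARD('d))"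
   using h(2) H1_norm_nonneg[OF i(1)] H1_norm_nonneg[OF i(2)] H1_norm_nonneg[OF i(3)] s by (intro mult_right_mono) auto
  finally show "l2 M (restr (ball (z m) s) (wgrad D y)) \<le> C' * (H1_norm D y + H1_norm D w + H1_norm D g) * sqrt (s ^ CARD('d))" .
 qed
 have "\<exists>C t. 0 \<le> C \<and> 0 < t \<and> (\<forall>m\<in>I. P1 m C t)"
 proof (rule finite_common_constants[OF I(1)])
  show "\<exists>C t. 0 \<le> C \<and> 0 < t \<and> P1 m C t" if "m \<in> I" for m by (rule e1[OF that])
  show "P1 m C' t'" if "P1 m C t" "C \<le> C'" "t' \<le> t" for m C t C' t' by (rule m1[OF that])
 qed
 then obtain C1 t1 where C1: "0 \<le> C1" "0 < t1" and all1: "\<forall>m\<in>I. P1 m C1 t1" by (elim exE conjE) (rule that)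
 have "\<exists>C t. 0 \<le> C \<and> 0 < t \<and> (\<forall>m\<in>I. P2 m C t)"
 proof (rule finite_common_constants[OF I(1)])
  show "\<exists>C t. 0 \<le> C \<and> 0 < t \<and> P2 m C t" if "m \<in> I" for m by (rule e2[OF that])
  show "P2 m C' t'" if "P2 m C t" "C \<le> C'" "t' \<le> t" for m C t C' t' by (rule m2[OF that])
 qed
 then obtain C2 t2 where C2: "0 \<le> C2" "0 < t2" and all2: "\<forall>m\<in>I. P2 m C2 t2" by (elim exE conjE) (rule that)
 have c: "c > 0" using wp by (simp add: wellposed_def)
 have N: "N \<ge> 0" using b(1) by (simp add: bcoef_def)
 define KT where "KT = 3 * ((N + 1) + cmod (1/\<tau>) * (\<bar>\<kappa>\<bar> + 1)) / c"
 \<comment> \<open>Bounds the three norms in \<open>gradient_decay\<close> for \<open>u\<close> in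
   the unit ball: \<open>KT\<close> for the solution, 1 for \<open>u\<close>, and the bracket for
   \<open>h\<close> of \<open>T_op_interior_equation\<close>.\<close>
 define G where "G = KT + 1 + (cmod (complex_of_real \<kappa> / \<tau>) + \<bar>\<kappa>\<bar> * KT)"
 have KT: "KT \<ge> 0" unfolding KT_def using N c by simp
 have G: "G \<ge> 0" unfolding G_def using KT by simp
 define K where "K = real (card I) * C1 + real (card I) * (C2 * G)"
 have K: "real (card I) * C1 \<le> K" "real (card I) * (C2 * G) \<le> K" "0 \<le> K" unfolding K_def using C1 C2 G by auto
 show ?thesis
 proof (rule exI[of _ K], rule exI[of _ "min t1 t2"], intro conjI allI impI)
  show "0 \<le> K" "0 < min t1 t2" using K C1 C2 by auto
  fix a' \<alpha>' \<beta>' b' N' Cd c' t u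
  assume a': "elliptic a' \<alpha>' \<beta>'" and wp': "wellposed a' \<kappa> c'" and b': "bcoef b' N' UNIV" and t: "0 < t" "t \<le> min t1 t2"
   and eq: "\<forall>x\<in>D. x \<notin> (\<Union>m\<in>I. ball (z m) t) --> a x = a' x"
   and db: "bcoef (%x. b' x - b x) Cd (\<Union>m\<in>I. ball (z m) t)" and u: "u \<in> X D" "X_norm D u \<le> 1"
  let ?S = "\<Union>m\<in>I. ball (z m) t"
  have S: "?S \<in> sets borel" using I(1) by (intro sets.finite_UN) auto
  have da: "coef (%x. a x - a' x) (\<beta> + \<beta>') ?S" by (rule coef_diff[OF a(1) a' S]) (use eq in blast)
  define y where "y = fst (T_op D a b \<kappa> \<tau> u)"
  note w = X_H1(1)[OF u(1)]
  have YX: "T_op D a b \<kappa> \<tau> u \<in> X D" by (rule T_op_spec(1)[OF wp b(1) u(1)])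
  have y: "y \<in> H1 D" unfolding y_def by (rule X_H1(1)[OF YX])
  have nw: "H1_norm D (fst u) \<le> 1" using X_norm_ge(1)[OF u(1)] u(2) by simp
  have ny: "H1_norm D y \<le> KT"
  proof -
   have "H1_norm D y \<le> KT * X_norm D u" unfolding y_def KT_def
    by (rule order_trans[OF X_norm_ge(1)[OF YX] wellposed_norm_T[OF wp b(1) u(1)]])
   also have "\<dots> \<le> KT * 1" by (rule mult_left_mono[OF u(2) KT])
   finally show ?thesis by simp
  qed
  have r1: "l2 M (restr ?S (fst u)) \<le> K * sqrt t"
  proof -
   have "l2 M (restr ?S (fst u)) \<le> (\<Sum>m\<in>I. l2 M (restr (ball (z m) t) (fst u)))"
    by (rule l2_restr_Union[OF I(1) H1D(1)[OF w]]) simp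
   also have "\<dots> \<le> (\<Sum>m\<in>I. C1 * sqrt t)"
   proof (rule sum_mono)
    fix m assume m: "m \<in> I"
    have "l2 M (restr (ball (z m) t) (fst u)) \<le> C1 * H1_norm D (fst u) * sqrt t"
     by (rule all1[THEN bspec, OF m, unfolded P1_def, rule_format, OF w t(1)]) (use t in simp)
    also have "\<dots> \<le> C1 * 1 * sqrt t" by (intro mult_right_mono mult_left_mono nw C1) (use t in simp)
    finally show "l2 M (restr (ball (z m) t) (fst u)) \<le> C1 * sqrt t" by simp
   qed
   also have "\<dots> = (real (card I) * C1) * sqrt t" by simp
   also have "\<dots> \<le> K * sqrt t" by (rule mult_right_mono[OF K(1)]) (use t in simp)
   finally show ?thesis .
  qed
  have r2: "l2 M (restr ?S (wgrad D y)) \<le> K * sqrt (t ^ CARD('d))"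
  proof (rule T_op_interior_equation[OF wp b(1) u(1), where \<tau>=\<tau>, folded y_def])
   fix h assume h: "h \<in> H1 D" and he: "!!\<phi>. test_function D \<phi> ==> IA a y \<phi> = IB b (fst u) \<phi> + IB one_fun h \<phi>"
    and nh: "H1_norm D h \<le> cmod (complex_of_real \<kappa> / \<tau>) * H1_norm D (fst u) + \<bar>\<kappa>\<bar> * H1_norm D y"
   have "H1_norm D h \<le> cmod (complex_of_real \<kappa> / \<tau>) * 1 + \<bar>\<kappa>\<bar> * KT"
    by (rule order_trans[OF nh], intro add_mono mult_left_mono nw ny) auto
   then have n: "H1_norm D y + H1_norm D (fst u) + H1_norm D h \<le> G" unfolding G_def using ny nw by simp
   have "l2 M (restr ?S (wgrad D y)) \<le> (\<Sum>m\<in>I. l2 M (restr (ball (z m) t) (wgrad D y)))"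
    by (rule l2_restr_Union[OF I(1) H1D(3)[OF y]]) simp
   also have "\<dots> \<le> (\<Sum>m\<in>I. C2 * G * sqrt (t ^ CARD('d)))"
   proof (rule sum_mono)
    fix m assume m: "m \<in> I"
    have "l2 M (restr (ball (z m) t) (wgrad D y)) \<le> C2 * (H1_norm D y + H1_norm D (fst u) + H1_norm D h) * sqrt (t ^ CARD('d))"
     by (rule all2[THEN bspec, OF m, unfolded P2_def, rule_format, OF y w h _ t(1)]) (use t he in auto)
    also have "\<dots> \<le> C2 * G * sqrt (t ^ CARD('d))" by (intro mult_right_mono mult_left_mono n C2) (use t in simp)
    finally show "l2 M (restr (ball (z m) t) (wgrad D y)) \<le> C2 * G * sqrt (t ^ CARD('d))" .
   qed
   also have "\<dots> = (real (card I) * (C2 * G)) * sqrt (t ^ CARD('d))" by simp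
   also have "\<dots> \<le> K * sqrt (t ^ CARD('d))" by (rule mult_right_mono[OF K(2)]) (use t in simp)
   finally show ?thesis .
  qed
  have nn: "Cd \<ge> 0" "\<beta> + \<beta>' \<ge> 0" "c' > 0" using db da wp' by (auto simp: bcoef_def coef_def wellposed_def)
  show "X_norm D (T_op D a' b' \<kappa> \<tau> u - T_op D a b \<kappa> \<tau> u) \<le> 3 * (Cd * (K * sqrt t) + (\<beta> + \<beta>') * (K * sqrt (t ^ CARD('d)))) / c'"
   by (rule order_trans[OF T_op_difference[OF wp' wp b' b(1) da db u(1), where \<tau>=\<tau>, folded y_def]])
    (intro divide_right_mono mult_left_mono add_mono r1 r2; use nn in simp)
 qed
qed

section \<open>Operator norms and the limit of vanishing inclusions\<close>

lemma X_opnorm_diff_le: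
 assumes "!!u. u \<in> X D ==> X_norm D u \<le> 1 ==> X_norm D (F u - G u) \<le> B"
 shows "X_opnorm D (F - G) \<le> ereal B"
 unfolding X_opnorm_def by (rule SUP_least) (use assms in simp)

text \<open>The supremum is taken in the extended reals and is not nonnegative by type; evaluation
  at 0 provides the lower half of the sandwich below.\<close>

lemma X_opnorm_diff_nonneg:
 assumes "F 0 \<in> X D" "G 0 \<in> X D"
 shows "0 \<le> X_opnorm D (F - G)"
proof -
 have z: "X_norm D 0 = 0" using X.nrm_scl[OF X.V_zero, of 0] by (simp add: X_nrm X_scale_eq zero_prod_def zero_fun_def)
 have "ereal (X_norm D ((F - G) 0)) \<le> X_opnorm D (F - G)" unfolding X_opnorm_def by (rule SUP_upper) (use X.V_zero z in simp)
 moreover have "0 \<le> X_norm D ((F - G) 0)" using X_norm_nonneg[OF X.V_diff[OF assms]] by simp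
 ultimately show ?thesis by (meson ereal_less_eq(5) order_trans)
qed

lemma T_op_cong: "(!!x. x \<in> D ==> b x = b' x) ==> T_op D a b \<kappa> \<tau> = T_op D a b' \<kappa> \<tau>"
proof -
 assume e: "!!x. x \<in> D ==> b x = b' x"
 have F: "form_B D b = form_B D b'" unfolding form_B_def
  by (intro ext, clarify, rule Bochner_Integration.integral_cong) (use e in auto)
 show ?thesis by (rule ext) (simp only: T_op_def F)
qed

lemma continuous_measurable_M: "continuous_on D f ==> f \<in> borel_measurable M" for f :: "real^'d => 'b::euclidean_space"
 by (rule continuous_imp_measurable_on_sets_lebesgue) (use D in \<open>auto intro: lmeasurable_open fmeasurableD\<close>)

lemma perturbed_measurable:
 fixes k :: "nat => 'b::euclidean_space"
 assumes e: "\<epsilon> > 0" and disj: "!!i j. i \<in> {1..N} ==> j \<in> {1..N} ==> i \<noteq> j ==> inclusion z B \<epsilon> i \<inter> inclusion z B \<epsilon> j = {}"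
  and op: "!!m. m \<in> {1..N} ==> open (inclusion z B \<epsilon> m)" and c: "c \<in> borel_measurable M"
 shows "perturbed N z B k c \<epsilon> \<in> borel_measurable M"
proof -
 have eq: "perturbed N z B k c \<epsilon> = (%x. c x + (\<Sum>m\<in>{1..N}. indicat_real (inclusion z B \<epsilon> m) x *\<^sub>R (k m - c x)))"
  by (rule ext, rule perturbed_eq(1)[OF e]) (rule disj)
 show ?thesis unfolding eq
  by (intro borel_measurable_add borel_measurable_sum borel_measurable_scaleR borel_measurable_diff borel_measurable_const c measurable_M borel_measurable_indicator)
   (use op in auto)
qed

end

theorem theorem3p3:
  fixes D :: "(real^'d) set"
    and A :: "real^'d \<Rightarrow> real^'d^'d" and n :: "real^'d \<Rightarrow> real"
    and M :: nat and z :: "nat \<Rightarrow> real^'d" and B :: "nat \<Rightarrow> (real^'d) set"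
    and Am :: "nat \<Rightarrow> real^'d^'d" and nm :: "nat \<Rightarrow> real"
    and A_min A_max a_min a_max :: ereal
    and c\<^sub>0 \<kappa> :: real and U :: "complex set" and \<tau> :: complex
  defines "A_min \<equiv> INF x\<in>D. qform_inf (A x)" and "A_max \<equiv> SUP x\<in>D. qform_sup (A x)"
    and "a_min \<equiv> INF m\<in>{1..M}. qform_inf (Am m)" and "a_max \<equiv> SUP m\<in>{1..M}. qform_sup (Am m)"
  assumes dim: "CARD('d) \<in> {2, 3}"
    and D: "open D" "connected D" "D \<noteq> {}" "bounded D" "piecewise_smooth_boundary D"
    and A: "Ck_on 2 D A" "\<And>x. x \<in> D \<Longrightarrow> transpose (A x) = A x"
    and n: "Ck_on 1 D n" "bounded (n ` D)" "(INF x\<in>D. n x) > 0"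
    and M: "M \<ge> 1"
    and c\<^sub>0: "c\<^sub>0 > 0"
    and z: "\<And>m. m \<in> {1..M} \<Longrightarrow> z m \<in> D"
      "\<And>i j. i \<in> {1..M} \<Longrightarrow> j \<in> {1..M} \<Longrightarrow> i \<noteq> j \<Longrightarrow> norm (z i - z j) \<ge> c\<^sub>0"
      "\<And>m. m \<in> {1..M} \<Longrightarrow> infdist (z m) (frontier D) \<ge> c\<^sub>0"
    and B: "\<And>m. m \<in> {1..M} \<Longrightarrow> smooth_ball_deformation (B m)"
    and Am: "\<And>m. m \<in> {1..M} \<Longrightarrow> transpose (Am m) = Am m"
    and nm: "\<And>m. m \<in> {1..M} \<Longrightarrow> nm m > 0"
    and bounds: "A_min > 0" "A_max < \<infinity>" "a_min > 0" "a_max < \<infinity>"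
    and cases: "(A_min > 1 \<and> a_min > 1 \<and> \<kappa> = real_of_ereal A_min) \<or>
                (A_max < 1 \<and> a_max < 1 \<and> \<kappa> = real_of_ereal A_max)"
    and U: "bounded U" "0 \<notin> U" "\<not> 0 islimpt U" and \<tau>: "\<tau> \<in> U"
  shows "((\<lambda>\<epsilon>. X_opnorm D (T_op D (perturbed M z B Am A \<epsilon>) (perturbed M z B nm n \<epsilon>) \<kappa> \<tau>
                          - T_op D (perturbed M z B Am A 0) (perturbed M z B nm n 0) \<kappa> \<tau>))
            \<longlongrightarrow> 0) (at_right 0)
       \<and> (\<forall>n\<^sub>\<epsilon>. (\<exists>\<epsilon>\<^sub>0>0. \<forall>\<epsilon>\<in>{0..<\<epsilon>\<^sub>0}. \<forall>x\<in>D. n\<^sub>\<epsilon> \<epsilon> x = n x) \<longrightarrow>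
            (\<exists>K. \<forall>\<^sub>F \<epsilon> in at_right 0.
               X_opnorm D (T_op D (perturbed M z B Am A \<epsilon>) (n\<^sub>\<epsilon> \<epsilon>) \<kappa> \<tau>
                           - T_op D (perturbed M z B Am A 0) (n\<^sub>\<epsilon> 0) \<kappa> \<tau>)
                 \<le> ereal (K * \<epsilon> powr (real CARD('d) / 2))))"
proof -
 obtain x0 where x0: "x0 \<in> D" using D(3) by blast
 interpret bdd_domain D by unfold_locales (use D in auto)
 have one: "1 \<in> {1..M}" using M by simp
 note q = qform_range_real[OF x0 A_min_def[THEN meta_eq_to_obj_eq] bounds(1) A_max_def[THEN meta_eq_to_obj_eq] bounds(2)]
 note q' = qform_range_real[OF one a_min_def[THEN meta_eq_to_obj_eq] bounds(3) a_max_def[THEN meta_eq_to_obj_eq] bounds(4)]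
 \<comment> \<open>Ellipticity bounds common to background and inclusions, valid for every perturbed
   coefficient whatever the value of \<open>\<epsilon>\<close>.\<close>
 define \<alpha> where "\<alpha> = min (real_of_ereal A_min) (real_of_ereal a_min)"
 define \<beta> where "\<beta> = max (real_of_ereal A_max) (real_of_ereal a_max)"
 have al: "\<alpha> > 0" unfolding \<alpha>_def min_less_iff_conj using bounds(1,3)
  by (intro conjI real_of_ereal_compare(1)[OF q(1)] real_of_ereal_compare(1)[OF q'(1)]) (simp_all only: zero_ereal_def)
 have be: "\<beta> \<ge> 0" using al q(3) unfolding \<alpha>_def \<beta>_def by linarith
 have ell: "elliptic a \<alpha> \<beta>" if am: "a \<in> borel_measurable (lebesgue_on D)"
  and av: "!!x. x \<in> D ==> a x = A x \<or> (\<exists>m\<in>{1..M}. a x = Am m)" for a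
  unfolding elliptic_def
 proof (intro conjI ballI allI am al be)
  fix x assume x: "x \<in> D"
  show "transpose (a x) = a x" using av[OF x] A(2)[OF x] Am by auto
  fix \<xi> :: "complex^'d"
  have l: "\<alpha> * (norm \<xi>)\<^sup>2 \<le> real_of_ereal A_min * (norm \<xi>)\<^sup>2" "\<alpha> * (norm \<xi>)\<^sup>2 \<le> real_of_ereal a_min * (norm \<xi>)\<^sup>2"
   "real_of_ereal A_max * (norm \<xi>)\<^sup>2 \<le> \<beta> * (norm \<xi>)\<^sup>2" "real_of_ereal a_max * (norm \<xi>)\<^sup>2 \<le> \<beta> * (norm \<xi>)\<^sup>2"
   unfolding \<alpha>_def \<beta>_def by (auto intro!: mult_right_mono)
  show "\<alpha> * (norm \<xi>)\<^sup>2 \<le> Re (hdot (cmat (a x) *v \<xi>) \<xi>)"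
   using av[OF x] order_trans[OF l(1) q(4)[OF x]] order_trans[OF l(2) q'(4)] by auto
  show "Re (hdot (cmat (a x) *v \<xi>) \<xi>) \<le> \<beta> * (norm \<xi>)\<^sup>2"
   using av[OF x] order_trans[OF q(5)[OF x] l(3)] order_trans[OF q'(5) l(4)] by auto
 qed
 \<comment> \<open>The order of the quantifiers is the uniform bounded invertibility. In the first
   case \<open>\<alpha>\<close> exceeds 1 and bounds \<open>\<kappa>\<close> from below; in the
   second \<open>\<beta>\<close> is below 1 and \<open>\<kappa>\<close> lies between
   \<open>\<alpha>\<close> and \<open>\<beta>\<close>.\<close>
 have "\<exists>c>0. \<forall>a. elliptic a \<alpha> \<beta> --> wellposed a \<kappa> c"
  using cases
 proof
  assume c: "A_min > 1 \<and> a_min > 1 \<and> \<kappa> = real_of_ereal A_min"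
  then have a1: "\<alpha> > 1" unfolding \<alpha>_def min_less_iff_conj
   by (intro conjI real_of_ereal_compare(1)[OF q(1)] real_of_ereal_compare(1)[OF q'(1)]) (simp_all only: one_ereal_def)
  have ak: "\<alpha> \<le> \<kappa>" using c by (simp add: \<alpha>_def)
  have "\<forall>a. elliptic a \<alpha> \<beta> --> wellposed a \<kappa> ((\<alpha> - 1) / (\<alpha> + 1))" by (intro allI impI) (erule wellposed_above_one[OF _ a1 order_refl ak])
  moreover have "(\<alpha> - 1) / (\<alpha> + 1) > 0" using a1 by simp
  ultimately show ?thesis by blast
 next
  assume c: "A_max < 1 \<and> a_max < 1 \<and> \<kappa> = real_of_ereal A_max"
  then have b1: "\<beta> < 1" unfolding \<beta>_def max_less_iff_conj
   by (intro conjI real_of_ereal_compare(2)[OF q(2)] real_of_ereal_compare(2)[OF q'(2)]) (simp_all only: one_ereal_def)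
  have ak: "\<alpha> \<le> \<kappa>" and kb: "\<kappa> \<le> \<beta>" using c q(3) by (simp_all add: \<alpha>_def \<beta>_def)
  have "\<forall>a. elliptic a \<alpha> \<beta> --> wellposed a \<kappa> ((1 - \<beta>) / 2 * \<alpha>)" by (intro allI impI) (erule wellposed_below_one[OF _ al order_refl ak order_refl kb b1])
  moreover have "(1 - \<beta>) / 2 * \<alpha> > 0" using al b1 by simp
  ultimately show ?thesis by blast
 qed
 then obtain c where c: "c > 0" and wp: "!!a. elliptic a \<alpha> \<beta> ==> wellposed a \<kappa> c" by blast
 have nm1: "n \<in> borel_measurable (lebesgue_on D)" by (rule continuous_measurable_M[OF Ck_on_continuous[OF D(1) n(1)]])
 have Am1: "A \<in> borel_measurable (lebesgue_on D)" by (rule continuous_measurable_M[OF Ck_on_continuous[OF D(1) A(1)]])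
 obtain N0 where N0: "!!x. x \<in> D ==> \<bar>n x\<bar> \<le> N0" using n(2) unfolding bounded_iff by auto
 have N0p: "N0 \<ge> 0" using N0[OF x0] by linarith
 have bn: "bcoef n N0 UNIV" using nm1 N0 N0p by (simp add: bcoef_def)
 have eA: "elliptic A \<alpha> \<beta>" by (rule ell[OF Am1]) simp
 obtain r where r: "r > 0" and inc: "!!m \<epsilon>. m \<in> {1..M} ==> \<epsilon> > 0 ==> open (inclusion z B \<epsilon> m) \<and> inclusion z B \<epsilon> m \<subseteq> ball (z m) (\<epsilon> * r)"
  by (rule inclusion_properties[where z=z and B=B and M=M, OF B]) blast+
 have zD: "z ` {1..M} \<subseteq> D" using z(1) by blast
 obtain K t0 where K: "0 \<le> K" "0 < t0" and est0: "\<forall>a' \<alpha>' \<beta>' b' N' Cd c' t u. elliptic a' \<alpha>' \<beta>' --> wellposed a' \<kappa> c' --> bcoef b' N' UNIV -->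
  0 < t --> t \<le> t0 --> (\<forall>x\<in>D. x \<notin> (\<Union>m\<in>{1..M}. ball (z m) t) --> A x = a' x) --> bcoef (%x. b' x - n x) Cd (\<Union>m\<in>{1..M}. ball (z m) t) -->
  u \<in> X D --> X_norm D u \<le> 1 -->
  X_norm D (T_op D a' b' \<kappa> \<tau> u - T_op D A n \<kappa> \<tau> u) \<le> 3 * (Cd * (K * sqrt t) + (\<beta> + \<beta>') * (K * sqrt (t ^ CARD('d)))) / c'"
  using perturbation_estimate[OF dim eA A(1) bn n(1) wp[OF eA], of "{1..M}" z \<tau>, OF finite_atLeastAtMost zD]
  by (elim exE conjE) (rule that)
 have est: "X_norm D (T_op D a' b' \<kappa> \<tau> u - T_op D A n \<kappa> \<tau> u) \<le> 3 * (Cd * (K * sqrt t) + (\<beta> + \<beta>') * (K * sqrt (t ^ CARD('d)))) / c'"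
  if h: "elliptic a' \<alpha>' \<beta>'" "wellposed a' \<kappa> c'" "bcoef b' N' UNIV" "0 < t" "t \<le> t0" "(\<forall>x\<in>D. x \<notin> (\<Union>m\<in>{1..M}. ball (z m) t) --> A x = a' x)" "bcoef (%x. b' x - n x) Cd (\<Union>m\<in>{1..M}. ball (z m) t)" "u \<in> X D" "X_norm D u \<le> 1"
  for a' \<alpha>' \<beta>' b' N' Cd c' t u
  by (rule est0[rule_format, OF h(1-5) _ h(7-9)]) (use h(6) in blast)
 \<comment> \<open>The first bound keeps the radii \<open>\<epsilon> * r\<close> within the range of
   the decay estimates, the second makes the enclosing balls disjoint, their centres being at least
   \<open>c\<^sub>0\<close> apart.\<close>
 define \<epsilon>1 where "\<epsilon>1 = min (t0 / r) (c\<^sub>0 / (2 * r))"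
 have e1: "\<epsilon>1 > 0" unfolding \<epsilon>1_def using K r c\<^sub>0 by simp
 have small: "\<epsilon> * r \<le> t0" "\<epsilon> * r \<le> c\<^sub>0 / 2" if "\<epsilon> < \<epsilon>1" for \<epsilon>
  using that r unfolding \<epsilon>1_def by (simp_all add: field_simps)
 have disj: "inclusion z B \<epsilon> i \<inter> inclusion z B \<epsilon> j = {}" if e: "0 < \<epsilon>" "\<epsilon> < \<epsilon>1" and ij: "i \<in> {1..M}" "j \<in> {1..M}" "i \<noteq> j" for \<epsilon> i j
 proof -
  have "dist (z i) (z j) \<ge> \<epsilon> * r + \<epsilon> * r" using z(2)[OF ij] small(2)[OF e(2)] by (simp add: dist_norm)
  then have "ball (z i) (\<epsilon> * r) \<inter> ball (z j) (\<epsilon> * r) = {}" by (rule disjoint_ballI)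
  then show ?thesis using inc[OF ij(1) e(1)] inc[OF ij(2) e(1)] by blast
 qed
 let ?S = "%\<epsilon>. \<Union>m\<in>{1..M}. ball (z m) (\<epsilon> * r)"
 have pq: "(\<exists>m\<in>{1..M}. x \<in> inclusion z B \<epsilon> m \<and> perturbed M z B k c' \<epsilon> x = k m) \<or>
   (\<forall>m\<in>{1..M}. x \<notin> inclusion z B \<epsilon> m) \<and> perturbed M z B k c' \<epsilon> x = c' x"
  if e: "0 < \<epsilon>" "\<epsilon> < \<epsilon>1" for \<epsilon> x and k :: "nat => 'e::real_vector" and c'
  by (rule perturbed_eq(2)[OF e(1)]) (rule disj[OF e])
 have eP: "elliptic (perturbed M z B Am A \<epsilon>) \<alpha> \<beta>" if e: "0 < \<epsilon>" "\<epsilon> < \<epsilon>1" for \<epsilon>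
 proof (rule ell[OF perturbed_measurable[OF e(1) disj[OF e] _ Am1]])
  show "perturbed M z B Am A \<epsilon> x = A x \<or> (\<exists>m\<in>{1..M}. perturbed M z B Am A \<epsilon> x = Am m)" for x
   using pq[OF e, of x Am A] by blast
 qed (use inc e in blast)+
 have off: "\<forall>x\<in>D. x \<notin> ?S \<epsilon> --> c' x = perturbed M z B k c' \<epsilon> x" if e: "0 < \<epsilon>" "\<epsilon> < \<epsilon>1" for \<epsilon> and k :: "nat => 'c::real_vector" and c'
 proof (intro ballI impI)
  fix x assume x: "x \<notin> ?S \<epsilon>"
  have "x \<notin> inclusion z B \<epsilon> m" if "m \<in> {1..M}" for m using x inc[OF that e(1)] that by blast
  then show "c' x = perturbed M z B k c' \<epsilon> x" by (auto simp: perturbed_def)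
 qed
 \<comment> \<open>The sum stands in for a maximum.\<close>
 define Nm where "Nm = (\<Sum>m\<in>{1..M}. \<bar>nm m\<bar>)"
 have Nm: "\<bar>nm m\<bar> \<le> Nm" if "m \<in> {1..M}" for m unfolding Nm_def by (rule member_le_sum[OF that]) auto
 have Nm0: "Nm \<ge> 0" unfolding Nm_def by (simp add: sum_nonneg)
 \<comment> \<open>The difference is localised to the enclosing balls and not to the inclusions,
   because the decay estimates are about balls.\<close>
 have bP: "bcoef (perturbed M z B nm n \<epsilon>) (N0 + Nm) UNIV" "bcoef (%x. perturbed M z B nm n \<epsilon> x - n x) (N0 + Nm + N0) (?S \<epsilon>)"
  if e: "0 < \<epsilon>" "\<epsilon> < \<epsilon>1" for \<epsilon>
 proof -
  have m: "perturbed M z B nm n \<epsilon> \<in> borel_measurable (lebesgue_on D)"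
   by (rule perturbed_measurable[OF e(1) disj[OF e] _ nm1]) (use inc e in blast)+
  have p: "\<bar>perturbed M z B nm n \<epsilon> x\<bar> \<le> N0 + Nm" if "x \<in> D" for x
   using pq[OF e, of x nm n]
  proof
   assume "\<exists>m\<in>{1..M}. x \<in> inclusion z B \<epsilon> m \<and> perturbed M z B nm n \<epsilon> x = nm m"
   then obtain m where "m \<in> {1..M}" "perturbed M z B nm n \<epsilon> x = nm m" by blast
   then show ?thesis using Nm[of m] N0p by linarith
  next
   assume "(\<forall>m\<in>{1..M}. x \<notin> inclusion z B \<epsilon> m) \<and> perturbed M z B nm n \<epsilon> x = n x"
   then show ?thesis using N0[OF that] Nm0 by linarith
  qed
  show "bcoef (perturbed M z B nm n \<epsilon>) (N0 + Nm) UNIV" using m p N0p Nm0 by (simp add: bcoef_def)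
  have d: "\<bar>perturbed M z B nm n \<epsilon> x - n x\<bar> \<le> (N0 + Nm + N0) * indicat_real (?S \<epsilon>) x" if x: "x \<in> D" for x
  proof (cases "x \<in> ?S \<epsilon>")
   case True
   then show ?thesis using p[OF x] N0[OF x] abs_triangle_ineq4[of "perturbed M z B nm n \<epsilon> x" "n x"] by simp
  next
   case False
   then have "n x = perturbed M z B nm n \<epsilon> x" using off[OF e, of n nm] x by blast
   then show ?thesis using False by simp
  qed
  have "?S \<epsilon> \<in> sets borel" by (intro sets.finite_UN) auto
  then show "bcoef (%x. perturbed M z B nm n \<epsilon> x - n x) (N0 + Nm + N0) (?S \<epsilon>)"
   unfolding bcoef_def using d borel_measurable_diff[OF m nm1] N0p Nm0 by simp
 qed
 have p0: "perturbed M z B k c' 0 = c'" for k :: "nat => 'c" and c' by (simp add: perturbed_def fun_eq_iff)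
 have ev: "\<forall>\<^sub>F \<epsilon> in at_right 0. 0 < \<epsilon> \<and> \<epsilon> < \<epsilon>'" if "\<epsilon>' > 0" for \<epsilon>' :: real
  using eventually_at_right_less[of 0] eventually_at_right_real[OF that] by eventually_elim auto
 \<comment> \<open>The first term, from the jump of \<open>n\<close>, is of order
   \<open>sqrt \<epsilon>\<close>; the second, from the jump of \<open>A\<close>, is of order
   \<open>\<epsilon> powr (d/2)\<close>.\<close>
 let ?b = "%\<epsilon>. 3 * ((N0 + Nm + N0) * (K * sqrt (\<epsilon> * r)) + (\<beta> + \<beta>) * (K * sqrt ((\<epsilon> * r) ^ CARD('d)))) / c"
 have "((%\<epsilon>. X_opnorm D (T_op D (perturbed M z B Am A \<epsilon>) (perturbed M z B nm n \<epsilon>) \<kappa> \<tau> - T_op D A n \<kappa> \<tau>)) \<longlongrightarrow> 0) (at_right 0)"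
 proof (rule tendsto_sandwich)
  show "\<forall>\<^sub>F \<epsilon> in at_right 0. 0 \<le> X_opnorm D (T_op D (perturbed M z B Am A \<epsilon>) (perturbed M z B nm n \<epsilon>) \<kappa> \<tau> - T_op D A n \<kappa> \<tau>)"
   using ev[OF e1]
  proof eventually_elim
   case (elim \<epsilon>)
   then have e: "0 < \<epsilon>" "\<epsilon> < \<epsilon>1" by auto
   show ?case
    by (rule X_opnorm_diff_nonneg, rule T_op_spec(1)[OF wp[OF eP[OF e]] bP(1)[OF e] X.V_zero], rule T_op_spec(1)[OF wp[OF eA] bn X.V_zero])
  qed
  show "\<forall>\<^sub>F \<epsilon> in at_right 0. X_opnorm D (T_op D (perturbed M z B Am A \<epsilon>) (perturbed M z B nm n \<epsilon>) \<kappa> \<tau> - T_op D A n \<kappa> \<tau>) \<le> ereal (?b \<epsilon>)"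
   using ev[OF e1]
  proof eventually_elim
   case (elim \<epsilon>)
   then have e: "0 < \<epsilon>" "\<epsilon> < \<epsilon>1" by auto
   have er: "0 < \<epsilon> * r" using e r by simp
   show ?case by (rule X_opnorm_diff_le, rule est[OF eP[OF e] wp[OF eP[OF e]] bP(1)[OF e] er small(1)[OF e(2)] off[OF e] bP(2)[OF e]])
  qed
  have "(?b \<longlongrightarrow> 3 * ((N0 + Nm + N0) * (K * sqrt (0 * r)) + (\<beta> + \<beta>) * (K * sqrt ((0 * r) ^ CARD('d)))) / c) (at_right 0)"
   by (intro tendsto_intros) (use c in auto)
  moreover have "(0::real) ^ CARD('d) = 0" by (simp add: zero_power)
  ultimately have "(?b \<longlongrightarrow> 0) (at_right 0)" by (simp only: mult_zero_left mult_zero_right real_sqrt_zero add_0_left div_0)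
  then show "((%\<epsilon>. ereal (?b \<epsilon>)) \<longlongrightarrow> 0) (at_right 0)" unfolding zero_ereal_def by (rule tendsto_ereal)
 qed simp
 moreover have "\<exists>K. \<forall>\<^sub>F \<epsilon> in at_right 0. X_opnorm D (T_op D (perturbed M z B Am A \<epsilon>) (n\<^sub>\<epsilon> \<epsilon>) \<kappa> \<tau> - T_op D A (n\<^sub>\<epsilon> 0) \<kappa> \<tau>)
         \<le> ereal (K * \<epsilon> powr (real CARD('d) / 2))"
  if ne: "\<exists>\<epsilon>\<^sub>0>0. \<forall>\<epsilon>\<in>{0..<\<epsilon>\<^sub>0}. \<forall>x\<in>D. n\<^sub>\<epsilon> \<epsilon> x = n x" for n\<^sub>\<epsilon> :: "real => real^'d => real"
 proof -
  obtain \<epsilon>\<^sub>0 where e0: "\<epsilon>\<^sub>0 > 0" "\<forall>\<epsilon>\<in>{0..<\<epsilon>\<^sub>0}. \<forall>x\<in>D. n\<^sub>\<epsilon> \<epsilon> x = n x" using ne by blast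
  have T: "T_op D a (n\<^sub>\<epsilon> \<epsilon>) \<kappa> \<tau> = T_op D a n \<kappa> \<tau>" if "0 \<le> \<epsilon>" "\<epsilon> < \<epsilon>\<^sub>0" for a \<epsilon>
   by (rule T_op_cong) (use e0(2) that in auto)
  have me: "min \<epsilon>1 \<epsilon>\<^sub>0 > 0" using e1 e0 by simp
  let ?K = "3 * ((\<beta> + \<beta>) * (K * sqrt (r ^ CARD('d)))) / c"
  show ?thesis
  proof (rule exI[of _ ?K], use ev[OF me] in eventually_elim)
   case (elim \<epsilon>)
   then have e: "0 < \<epsilon>" "\<epsilon> < \<epsilon>1" "\<epsilon> < \<epsilon>\<^sub>0" by auto
   have er: "0 < \<epsilon> * r" using e r by simp
   \<comment> \<open>With an unperturbed lower-order coefficient the constant \<open>Cd\<close> is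
     0, so the term of order \<open>sqrt \<epsilon>\<close> disappears and the rate of the gradient
     term remains.\<close>
   have b0: "bcoef (%x. n x - n x) 0 (?S \<epsilon>)"
    unfolding bcoef_def using borel_measurable_diff[OF nm1 nm1] by (simp add: sets.finite_UN)
   have "(\<epsilon> ^ CARD('d)) powr (1/2) = \<epsilon> powr (real CARD('d) / 2)"
    unfolding powr_realpow[OF e(1), symmetric] powr_powr by simp
   then have s: "sqrt ((\<epsilon> * r) ^ CARD('d)) = sqrt (r ^ CARD('d)) * \<epsilon> powr (real CARD('d) / 2)"
    using e(1) by (simp add: power_mult_distrib real_sqrt_mult powr_half_sqrt)
   have "X_opnorm D (T_op D (perturbed M z B Am A \<epsilon>) n \<kappa> \<tau> - T_op D A n \<kappa> \<tau>)
    \<le> ereal (3 * (0 * (K * sqrt (\<epsilon> * r)) + (\<beta> + \<beta>) * (K * sqrt ((\<epsilon> * r) ^ CARD('d)))) / c)"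
    by (rule X_opnorm_diff_le, rule est[OF eP[OF e(1,2)] wp[OF eP[OF e(1,2)]] bn er small(1)[OF e(2)] off[OF e(1,2)] b0])
   also have "3 * (0 * (K * sqrt (\<epsilon> * r)) + (\<beta> + \<beta>) * (K * sqrt ((\<epsilon> * r) ^ CARD('d)))) / c = ?K * \<epsilon> powr (real CARD('d) / 2)"
    unfolding s by simp
   finally show ?case unfolding T[OF less_imp_le[OF e(1)] e(3)] T[OF order_refl e0(1)] .
  qed
 qed
 ultimately show ?thesis unfolding p0 by blast
qed

end
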